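(* Let $E$ be a generalized almost product structure on $M$. The following are equivalent: 1) $\pi(E)$ is a foliation (i.e. an involutive subbundle of $TM$); 2) $\Omega_M^0\subseteq\ker(\mathcal L_E(x,y))$ for all $x,y\in\Gamma(E)$; 3) $\llbracket x,y\rrbracket_{E^\perp}\in\Omega_M^1$ for all $x,y\in\Gamma(E)$; 4) $(E,\llbracket\,,\,\rrbracket_E,\langle\,,\,\rangle_E,\pi_E)$ is a Courant algebroid.
   Context: $M$ is a connected finite-dimensional smooth manifold, $\Omega_M=\Gamma(\wedge^\bullet T^*M)$ with its standard grading $\Omega_M^k$, $\mathcal E_M$ is the graded algebra of $\mathbb R$-linear endomorphisms of $\Omega_M$, $[\varphi,\psi]=\varphi\psi-(-1)^{kl}\psi\varphi$ for $\varphi,\psi$ of degrees $k,l$ (extended bilinearly), and $\mathrm{ad}_\varphi=[\varphi,\cdot]$. Forms are viewed as operators by left multiplication. Sections $X+\alpha$ of $\mathbb{T}M=TM\oplus T^*M$ are identified with the operators $\iota_X+\alpha\wedge$, so $[X+\alpha,Y+\beta]=\alpha(Y)+\beta(X)$; $\langle x,y\rangle=2[x,y]$ is the tautological pairing and $\pi:\mathbb{T}M\to TM$ the projection. A split structure of rank $2r$ is a subbundle $E\subseteq\mathbb{T}M$ of rank $2r$ on which $\langle\,,\,\rangle$ is non-degenerate of signature $(r,r)$; $E^\perp$ is its orthogonal complement, $\mathrm{pr}_E$ the orthogonal projection onto $E$, and $\langle\,,\,\rangle_E$, $\pi_E$ are the restrictions of $\langle\,,\,\rangle$, $\pi$ to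 $E$. A generalized almost product structure is a split structure $E$ of some rank $2r$ such that $\pi|_E$ has rank exactly $r$ everywhere; then $T^*M=(T^*M\cap E)\oplus(T^*M\cap E^\perp)$, which gives a bigrading $\Omega_E^{p,q}=\Gamma(\wedge^p(T^*M\cap E)\otimes\wedge^q(T^*M\cap E^\perp))$ of $\Omega_M$; $\mathcal E_E^{p,q}$ denotes operators of bidegree $(p,q)$. The de Rham operator $d$ lies in $\mathcal E_E^{1,0}\oplus\mathcal E_E^{-1,2}\oplus\mathcal E_E^{0,1}\oplus\mathcal E_E^{2,-1}$; $d_E$ is its component in $\mathcal E_E^{1,0}\oplus\mathcal E_E^{-1,2}$. The Dorfman bracket is $\llbracket x,y\rrbracket=[[x,d],y]$. For $x,y\in\Gamma(E)$, $\llbracket x,y\rrbracket_E=\mathrm{pr}_E(\llbracket x,y\rrbracket)$ and $\llbracket x,y\rrbracket_{E^\perp}=\mathrm{pr}_{E^\perp}(\llbracket x,y\rrbracket)$. The Leibnizator of an operator $\delta$ is $\mathcal L_\delta(\varphi,\psi)=[\mathbb L^\delta_\varphi,\mathbb L^\delta_\psi]-\mathbb L^\delta_{[[\varphi,\delta],\psi]}$, where $\mathbb L^\delta_\varphi=\mathrm{ad}_{[\varphi,\delta]}$ is a graded derivation of $\mathcal E_M$ (and the first bracket is the graded commutator of derivations); $\mathcal L_E=\mathcal L_{d_E}$, and $\mathcal L_E(x,y)$ is applied to functions viewed as elements of $\mathcal E_M$. A Courant algebroid is a vector bundle $E$ with a non-degenerate symmetric pairing $\langle\,,\,\rangle$,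 a bundle map $\pi:E\to TM$ and an $\mathbb R$-bilinear bracket $\llbracket\,,\,\rrbracket$ on $\Gamma(E)$ such that, for all $x,y,z\in\Gamma(E)$ and functions $f$: $\llbracket x,\llbracket y,z\rrbracket\rrbracket=\llbracket\llbracket x,y\rrbracket,z\rrbracket+\llbracket y,\llbracket x,z\rrbracket\rrbracket$; $\pi(\llbracket x,y\rrbracket)$ is the Lie bracket of $\pi(x),\pi(y)$; $\llbracket x,fy\rrbracket=f\llbracket x,y\rrbracket+(\pi(x)f)y$; $\pi(x)\langle y,z\rangle=\langle\llbracket x,y\rrbracket,z\rangle+\langle y,\llbracket x,z\rrbracket\rangle$; $\llbracket x,x\rrbracket=\frac12 D\langle x,x\rangle$, where $\langle Df,y\rangle=\pi(y)f$. *)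

theory Defs
  imports "HOL-Analysis.Analysis" "HOL-Library.Function_Algebras"
begin

text \<open>
  Tangent vectors, covectors, values of differential forms and operators on forms are all
  real-valued functions (or function-valued functions) with pointwise vector space structure.
  The following instance makes \<open>span\<close>, \<open>independent\<close> and \<open>dim\<close> available for them.
\<close>

instantiation "fun" :: (type, real_vector) real_vector
begin

definition scaleR_fun :: "real \<Rightarrow> ('a \<Rightarrow> 'b) \<Rightarrow> 'a \<Rightarrow> 'b"
  where "scaleR_fun c f = (\<lambda>x. c *\<^sub>R f x)"

instance
  by standard (simp_all add: scaleR_fun_def fun_eq_iff scaleR_add_right scaleR_add_left)

end

lemma scaleR_fun_apply [simp]: "(c *\<^sub>R f) x = c *\<^sub>R f x"
  by (simp add: scaleR_fun_def)


section \<open>Smooth manifolds\<close>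

text \<open>
  The model space is a real inner product space \<open>'e\<close> that is spanned by a finite set, i.e. a
  Euclidean space.  The class \<open>euclidean_space\<close> is not used because it excludes dimension 0.
  On a finite-dimensional space, a function is of class \<open>C\<^sup>k\<^sup>+\<^sup>1\<close> on an open set iff it is
  differentiable there and all its directional derivatives are of class \<open>C\<^sup>k\<close>.
\<close>

primrec Ck_on :: "nat \<Rightarrow> 'e::real_normed_vector set \<Rightarrow> ('e \<Rightarrow> 'f::real_normed_vector) \<Rightarrow> bool"
  where
    "Ck_on 0 S f \<longleftrightarrow> continuous_on S f"
  | "Ck_on (Suc k) S f \<longleftrightarrow>
       (\<forall>x\<in>S. f differentiable (at x)) \<and> (\<forall>v. Ck_on k S (\<lambda>x. frechet_derivative f (at x) v))"

definition smooth_on :: "'e::real_normed_vector set \<Rightarrow> ('e \<Rightarrow> 'f::real_normed_vector) \<Rightarrow> bool"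
  where "smooth_on S f \<longleftrightarrow> (\<forall>k. Ck_on k S f)"

text \<open>A chart \<open>(U, \<phi>)\<close> has domain \<open>U\<close>; the values of \<open>\<phi>\<close> outside \<open>U\<close> are irrelevant.
  The manifold is the whole type \<open>'a\<close>.  The atlas need not be maximal.\<close>

type_synonym ('a, 'e) atlas = "('a set \<times> ('a \<Rightarrow> 'e)) set"

definition smooth_manifold ::
    "('a::{t2_space, second_countable_topology}, 'e::real_inner) atlas \<Rightarrow> bool"
  where "smooth_manifold A \<longleftrightarrow>
    (\<exists>B::'e set. finite B \<and> span B = UNIV) \<and>
    (\<forall>(U, \<phi>)\<in>A. open U \<and> open (\<phi> ` U) \<and> homeomorphism U (\<phi> ` U) \<phi> (inv_into U \<phi>)) \<and>
    (\<Union>(U, \<phi>)\<in>A. U) = UNIV \<and>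
    (\<forall>(U, \<phi>)\<in>A. \<forall>(V, \<psi>)\<in>A. smooth_on (\<phi> ` (U \<inter> V)) (\<psi> \<circ> inv_into U \<phi>))"

definition mdim :: "('a, 'e::real_inner) atlas \<Rightarrow> nat"
  where "mdim A = dim (UNIV :: 'e set)"

definition smooth_fun_on :: "('a, 'e::real_inner) atlas \<Rightarrow> 'a set \<Rightarrow> ('a \<Rightarrow> real) \<Rightarrow> bool"
  where "smooth_fun_on A U f \<longleftrightarrow> (\<forall>(V, \<phi>)\<in>A. smooth_on (\<phi> ` (U \<inter> V)) (f \<circ> inv_into V \<phi>))"

definition smooth_funs :: "('a, 'e::real_inner) atlas \<Rightarrow> ('a \<Rightarrow> real) set"
  where "smooth_funs A = {f. smooth_fun_on A UNIV f}"


section \<open>Tangent and cotangent spaces, vector bundles\<close>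

text \<open>
  Tangent vectors at \<open>p\<close> are derivations at \<open>p\<close> of the algebra of smooth functions, normalised to
  vanish on non-smooth functions.  Covectors are normalised to vanish outside the tangent space.
\<close>

type_synonym 'a tvec = "('a \<Rightarrow> real) \<Rightarrow> real"
type_synonym 'a covec = "'a tvec \<Rightarrow> real"
type_synonym 'a ttvec = "'a tvec \<times> 'a covec"

definition tangent :: "('a, 'e::real_inner) atlas \<Rightarrow> 'a \<Rightarrow> 'a tvec set"
  where "tangent A p = {v.
    (\<forall>f\<in>smooth_funs A. \<forall>g\<in>smooth_funs A. \<forall>a b.
       v (\<lambda>q. a * f q + b * g q) = a * v f + b * v g \<and>
       v (\<lambda>q. f q * g q) = f p * v g + g p * v f) \<and>
    (\<forall>f. f \<notin> smooth_funs A \<longrightarrow> v f = 0)}"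

definition cotangent :: "('a, 'e::real_inner) atlas \<Rightarrow> 'a \<Rightarrow> 'a covec set"
  where "cotangent A p = {\<alpha>.
    (\<forall>v\<in>tangent A p. \<forall>w\<in>tangent A p. \<forall>a b. \<alpha> (a *\<^sub>R v + b *\<^sub>R w) = a * \<alpha> v + b * \<alpha> w) \<and>
    (\<forall>v. v \<notin> tangent A p \<longrightarrow> \<alpha> v = 0)}"

text \<open>Smooth sections of \<open>TM\<close> and of \<open>TM \<oplus> T\<^sup>*M\<close> over an open set \<open>U\<close>.\<close>

definition tm_section ::
    "('a, 'e::real_inner) atlas \<Rightarrow> 'a set \<Rightarrow> ('a \<Rightarrow> 'a tvec) \<Rightarrow> bool"
  where "tm_section A U X \<longleftrightarrow>
    (\<forall>p\<in>U. X p \<in> tangent A p) \<and> (\<forall>f\<in>smooth_funs A. smooth_fun_on A U (\<lambda>p. X p f))"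

definition vector_fields :: "('a, 'e::real_inner) atlas \<Rightarrow> ('a \<Rightarrow> 'a tvec) set"
  where "vector_fields A = {X. tm_section A UNIV X}"

definition ttm_section ::
    "('a, 'e::real_inner) atlas \<Rightarrow> 'a set \<Rightarrow> ('a \<Rightarrow> 'a ttvec) \<Rightarrow> bool"
  where "ttm_section A U x \<longleftrightarrow>
    tm_section A U (\<lambda>p. fst (x p)) \<and>
    (\<forall>p\<in>U. snd (x p) \<in> cotangent A p) \<and>
    (\<forall>X\<in>vector_fields A. smooth_fun_on A U (\<lambda>p. snd (x p) (X p)))"

definition ttm_sections :: "('a, 'e::real_inner) atlas \<Rightarrow> ('a \<Rightarrow> 'a ttvec) set"
  where "ttm_sections A = {x. ttm_section A UNIV x}"

definition lie :: "('a \<Rightarrow> 'a tvec) \<Rightarrow> ('a \<Rightarrow> 'a tvec) \<Rightarrow> 'a \<Rightarrow> 'a tvec"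
  where "lie X Y = (\<lambda>p f. X p (\<lambda>q. Y q f) - Y p (\<lambda>q. X q f))"

definition frame_on ::
    "'a set \<Rightarrow> nat \<Rightarrow> (nat \<Rightarrow> 'a \<Rightarrow> 'v::real_vector) \<Rightarrow> ('a \<Rightarrow> 'v set) \<Rightarrow> bool"
  where "frame_on U k e E \<longleftrightarrow> (\<forall>q\<in>U.
    inj_on (\<lambda>i. e i q) {..<k} \<and> independent ((\<lambda>i. e i q) ` {..<k}) \<and>
    span ((\<lambda>i. e i q) ` {..<k}) = E q)"

text \<open>Subbundles of rank \<open>k\<close> of \<open>TM\<close> (for \<open>sec = tm_section A\<close>) or of \<open>TM \<oplus> T\<^sup>*M\<close>
  (for \<open>sec = ttm_section A\<close>).\<close>

definition subbundle ::
    "('a::topological_space set \<Rightarrow> ('a \<Rightarrow> 'v::real_vector) \<Rightarrow> bool) \<Rightarrow> nat \<Rightarrow> ('a \<Rightarrow> 'v set) \<Rightarrow> bool"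
  where "subbundle sec k E \<longleftrightarrow>
    (\<forall>p. \<exists>U e. open U \<and> p \<in> U \<and> (\<forall>i<k. sec U (e i)) \<and> frame_on U k e E)"

definition involutive_subbundle ::
    "('a::topological_space, 'e::real_inner) atlas \<Rightarrow> ('a \<Rightarrow> 'a tvec set) \<Rightarrow> bool"
  where "involutive_subbundle A F \<longleftrightarrow>
    (\<exists>k. subbundle (tm_section A) k F) \<and>
    (\<forall>X\<in>vector_fields A. \<forall>Y\<in>vector_fields A.
       (\<forall>p. X p \<in> F p) \<and> (\<forall>p. Y p \<in> F p) \<longrightarrow> (\<forall>p. lie X Y p \<in> F p))"

text \<open>
  Abstract vector bundles: a family of vector spaces with a smooth structure given by a
  collection \<open>\<F>\<close> of local frames with smooth transition functions.  \<open>\<Gamma>\<close> is the set of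
  smooth sections, i.e. of those sections with smooth coefficients in all frames of \<open>\<F>\<close>.
\<close>

definition smooth_combination ::
    "('a, 'e::real_inner) atlas \<Rightarrow> 'a set \<Rightarrow> nat \<Rightarrow> (nat \<Rightarrow> 'a \<Rightarrow> 'v::real_vector) \<Rightarrow> ('a \<Rightarrow> 'v) \<Rightarrow> bool"
  where "smooth_combination A U k e s \<longleftrightarrow>
    (\<exists>c. (\<forall>i<k. smooth_fun_on A U (c i)) \<and> (\<forall>q\<in>U. s q = (\<Sum>i<k. c i q *\<^sub>R e i q)))"

definition vector_bundle ::
    "('a::topological_space, 'e::real_inner) atlas \<Rightarrow> ('a \<Rightarrow> 'v::real_vector set)
      \<Rightarrow> ('a \<Rightarrow> 'v) set \<Rightarrow> bool"
  where "vector_bundle A E \<Gamma> \<longleftrightarrow> (\<exists>k \<F>.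
    (\<Union>(U, e)\<in>\<F>. U) = UNIV \<and>
    (\<forall>(U, e)\<in>\<F>. open U \<and> frame_on U k e E) \<and>
    (\<forall>(U, e)\<in>\<F>. \<forall>(V, f)\<in>\<F>. \<forall>i<k. smooth_combination A (U \<inter> V) k e (f i)) \<and>
    \<Gamma> = {s. (\<forall>p. s p \<in> E p) \<and> (\<forall>(U, e)\<in>\<F>. smooth_combination A U k e s)})"


section \<open>Differential forms\<close>

text \<open>
  The value at \<open>p\<close> of an inhomogeneous form is a function on lists of tangent vectors; its
  restriction to lists of length \<open>k\<close> is the component of degree \<open>k\<close>.  It is normalised to vanish
  if some entry is not a tangent vector at \<open>p\<close>.  Components of degree above the dimension
  vanish automatically.
\<close>

type_synonym 'a form = "'a \<Rightarrow> 'a tvec list \<Rightarrow> real"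

definition forms :: "('a, 'e::real_inner) atlas \<Rightarrow> 'a form set"
  where "forms A = {\<omega>.
    (\<forall>p vs. \<not> set vs \<subseteq> tangent A p \<longrightarrow> \<omega> p vs = 0) \<and>
    (\<forall>p us ws. \<forall>v\<in>tangent A p. \<forall>w\<in>tangent A p. \<forall>a b.
       \<omega> p (us @ (a *\<^sub>R v + b *\<^sub>R w) # ws) = a * \<omega> p (us @ v # ws) + b * \<omega> p (us @ w # ws)) \<and>
    (\<forall>p vs. \<not> distinct vs \<longrightarrow> \<omega> p vs = 0) \<and>
    (\<forall>Xs. set Xs \<subseteq> vector_fields A \<longrightarrow> (\<lambda>p. \<omega> p (map (\<lambda>X. X p) Xs)) \<in> smooth_funs A)}"

definition deg_part :: "int \<Rightarrow> 'a form \<Rightarrow> 'a form"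
  where "deg_part k \<omega> = (\<lambda>p vs. if int (length vs) = k then \<omega> p vs else 0)"

text \<open>Left exterior multiplication by a covector, on values of forms at a point, with the
  convention \<open>(\<alpha> \<and> \<beta>)(v, w) = \<alpha>(v) \<beta>(w) - \<alpha>(w) \<beta>(v)\<close>.\<close>

definition wedge_left :: "'a covec \<Rightarrow> ('a tvec list \<Rightarrow> real) \<Rightarrow> 'a tvec list \<Rightarrow> real"
  where "wedge_left \<alpha> \<eta> = (\<lambda>vs. \<Sum>i<length vs. (-1) ^ i * \<alpha> (vs ! i) * \<eta> (nths vs (- {i})))"

definition wedge_list :: "'a covec list \<Rightarrow> 'a tvec list \<Rightarrow> real"
  where "wedge_list \<alpha>s = foldr wedge_left \<alpha>s (\<lambda>vs. if vs = [] then 1 else 0)"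

text \<open>The de Rham differential, characterised by the Koszul (Palais) formula.\<close>

definition koszul :: "'a form \<Rightarrow> ('a \<Rightarrow> 'a tvec) list \<Rightarrow> 'a \<Rightarrow> real"
  where "koszul \<omega> Xs p =
    (\<Sum>i<length Xs. (-1) ^ i * (Xs ! i) p (\<lambda>q. \<omega> q (map (\<lambda>X. X q) (nths Xs (- {i}))))) +
    (\<Sum>j<length Xs. \<Sum>i<j. (-1) ^ (i + j) *
       \<omega> p (map (\<lambda>X. X p) (lie (Xs ! i) (Xs ! j) # nths Xs (- {i, j}))))"

definition de_rham :: "('a, 'e::real_inner) atlas \<Rightarrow> 'a form \<Rightarrow> 'a form"
  where "de_rham A \<omega> = (THE \<eta>. \<eta> \<in> forms A \<and>
    (\<forall>Xs. set Xs \<subseteq> vector_fields A \<longrightarrow> (\<forall>p. \<eta> p (map (\<lambda>X. X p) Xs) = koszul \<omega> Xs p)))"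


section \<open>Operators on forms and graded commutators\<close>

text \<open>
  Let \<open>V\<close> be graded with degrees in \<open>{-N..N}\<close> and let \<open>P k\<close> be the projection of \<open>V\<close> onto its
  component of degree \<open>k\<close>.  Then \<open>hom_comp P N k F\<close> is the component of degree \<open>k\<close> of the
  endomorphism \<open>F\<close>, and degrees of endomorphisms lie in \<open>{-2N..2N}\<close>.
\<close>

definition hom_comp ::
    "(int \<Rightarrow> 'v \<Rightarrow> 'v) \<Rightarrow> nat \<Rightarrow> int \<Rightarrow> ('v \<Rightarrow> 'v) \<Rightarrow> 'v \<Rightarrow> 'v::real_vector"
  where "hom_comp P N k F = (\<lambda>v. \<Sum>j = - int N..int N. P (j + k) (F (P j v)))"

definition graded_comm ::
    "(int \<Rightarrow> 'v \<Rightarrow> 'v) \<Rightarrow> nat \<Rightarrow> ('v \<Rightarrow> 'v) \<Rightarrow> ('v \<Rightarrow> 'v) \<Rightarrow> 'v \<Rightarrow> 'v::real_vector"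
  where "graded_comm P N F G = (\<lambda>v. \<Sum>k = - 2 * int N..2 * int N. \<Sum>l = - 2 * int N..2 * int N.
    hom_comp P N k F (hom_comp P N l G v) -
      ((-1) powi (k * l)) *\<^sub>R hom_comp P N l G (hom_comp P N k F v))"

type_synonym 'a form_op = "'a form \<Rightarrow> 'a form"

text \<open>The graded commutator of operators on forms, and the graded commutator of
  endomorphisms (such as derivations) of the graded algebra of operators on forms.\<close>

definition op_comm ::
    "('a, 'e::real_inner) atlas \<Rightarrow> 'a form_op \<Rightarrow> 'a form_op \<Rightarrow> 'a form_op"
  where "op_comm A = graded_comm deg_part (mdim A)"

definition der_comm ::
    "('a, 'e::real_inner) atlas \<Rightarrow> ('a form_op \<Rightarrow> 'a form_op) \<Rightarrow> ('a form_op \<Rightarrow> 'a form_op)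
      \<Rightarrow> 'a form_op \<Rightarrow> 'a form_op"
  where "der_comm A = graded_comm (hom_comp deg_part (mdim A)) (mdim A)"

definition fun_op :: "('a \<Rightarrow> real) \<Rightarrow> 'a form_op"
  where "fun_op f = (\<lambda>\<omega> p vs. f p * \<omega> p vs)"

definition sec_op :: "('a \<Rightarrow> 'a ttvec) \<Rightarrow> 'a form_op"
  where "sec_op x = (\<lambda>\<omega> p vs. \<omega> p (fst (x p) # vs) + wedge_left (snd (x p)) (\<omega> p) vs)"

definition L_op ::
    "('a, 'e::real_inner) atlas \<Rightarrow> 'a form_op \<Rightarrow> 'a form_op \<Rightarrow> 'a form_op \<Rightarrow> 'a form_op"
  where "L_op A \<delta> \<phi> = op_comm A (op_comm A \<phi> \<delta>)"

definition leibnizator ::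
    "('a, 'e::real_inner) atlas \<Rightarrow> 'a form_op \<Rightarrow> 'a form_op \<Rightarrow> 'a form_op \<Rightarrow> 'a form_op \<Rightarrow> 'a form_op"
  where "leibnizator A \<delta> \<phi> \<psi> =
    der_comm A (L_op A \<delta> \<phi>) (L_op A \<delta> \<psi>) - L_op A \<delta> (op_comm A (op_comm A \<phi> \<delta>) \<psi>)"

text \<open>The Dorfman bracket \<open>[[x, d], y]\<close>, as the section that induces this operator.\<close>

definition dorfman ::
    "('a, 'e::real_inner) atlas \<Rightarrow> ('a \<Rightarrow> 'a ttvec) \<Rightarrow> ('a \<Rightarrow> 'a ttvec) \<Rightarrow> 'a \<Rightarrow> 'a ttvec"
  where "dorfman A x y = (THE z. z \<in> ttm_sections A \<and>
    (\<forall>\<omega>\<in>forms A. sec_op z \<omega> = op_comm A (op_comm A (sec_op x) (de_rham A)) (sec_op y) \<omega>))"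


section \<open>Split structures\<close>

definition pairing :: "'a ttvec \<Rightarrow> 'a ttvec \<Rightarrow> real"
  where "pairing x y = 2 * (snd x (fst y) + snd y (fst x))"

definition nondegenerate_on :: "('v::real_vector \<Rightarrow> 'v \<Rightarrow> real) \<Rightarrow> 'v set \<Rightarrow> bool"
  where "nondegenerate_on b V \<longleftrightarrow> (\<forall>x\<in>V. (\<forall>y\<in>V. b x y = 0) \<longrightarrow> x = 0)"

definition has_signature :: "('v::real_vector \<Rightarrow> 'v \<Rightarrow> real) \<Rightarrow> 'v set \<Rightarrow> nat \<Rightarrow> nat \<Rightarrow> bool"
  where "has_signature b V r s \<longleftrightarrow> (\<exists>B C.
    finite B \<and> finite C \<and> B \<inter> C = {} \<and> card B = r \<and> card C = s \<and>
    independent (B \<union> C) \<and> span (B \<union> C) = V \<and>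
    (\<forall>x\<in>B. b x x = 1) \<and> (\<forall>x\<in>C. b x x = -1) \<and>
    (\<forall>x\<in>B \<union> C. \<forall>y\<in>B \<union> C. x \<noteq> y \<longrightarrow> b x y = 0))"

definition split_structure ::
    "('a::topological_space, 'e::real_inner) atlas \<Rightarrow> nat \<Rightarrow> ('a \<Rightarrow> 'a ttvec set) \<Rightarrow> bool"
  where "split_structure A r E \<longleftrightarrow> subbundle (ttm_section A) (2 * r) E \<and>
    (\<forall>p. nondegenerate_on pairing (E p) \<and> has_signature pairing (E p) r r)"

definition generalized_almost_product ::
    "('a::topological_space, 'e::real_inner) atlas \<Rightarrow> ('a \<Rightarrow> 'a ttvec set) \<Rightarrow> bool"
  where "generalized_almost_product A E \<longleftrightarrow>
    (\<exists>r. split_structure A r E \<and> (\<forall>p. dim (fst ` E p) = r))"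

definition sections :: "('a, 'e::real_inner) atlas \<Rightarrow> ('a \<Rightarrow> 'a ttvec set) \<Rightarrow> ('a \<Rightarrow> 'a ttvec) set"
  where "sections A E = {x \<in> ttm_sections A. \<forall>p. x p \<in> E p}"

definition orth ::
    "('a, 'e::real_inner) atlas \<Rightarrow> ('a \<Rightarrow> 'a ttvec set) \<Rightarrow> 'a \<Rightarrow> 'a ttvec set"
  where "orth A E p =
    {y \<in> tangent A p \<times> cotangent A p. \<forall>x\<in>E p. pairing x y = 0}"

definition proj ::
    "('a, 'e::real_inner) atlas \<Rightarrow> ('a \<Rightarrow> 'a ttvec set) \<Rightarrow> ('a \<Rightarrow> 'a ttvec) \<Rightarrow> 'a \<Rightarrow> 'a ttvec"
  where "proj A E z = (\<lambda>p. THE x. x \<in> E p \<and> z p - x \<in> orth A E p)"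

text \<open>One-forms, as sections of \<open>TM \<oplus> T\<^sup>*M\<close>.\<close>

definition one_forms :: "('a, 'e::real_inner) atlas \<Rightarrow> ('a \<Rightarrow> 'a ttvec) set"
  where "one_forms A = {z \<in> ttm_sections A. \<forall>p. fst (z p) = 0}"


section \<open>The bigrading and the component of the de Rham differential\<close>

text \<open>\<open>a\<close> counts the factors from \<open>T\<^sup>*M \<inter> E\<close>, \<open>b\<close> those from its counterpart for the orthogonal complement of \<open>E\<close>.
  The bidegrees are integers so that shifts need no case distinction; the spaces
  with a negative index are zero.\<close>

definition bigraded_forms ::
    "('a, 'e::real_inner) atlas \<Rightarrow> ('a \<Rightarrow> 'a ttvec set) \<Rightarrow> int \<Rightarrow> int \<Rightarrow> 'a form set"
  where "bigraded_forms A E a b = {\<omega> \<in> forms A. \<forall>p. \<omega> p \<in> span {wedge_list (\<alpha>s @ \<beta>s) | \<alpha>s \<beta>s.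
    int (length \<alpha>s) = a \<and> (\<forall>\<alpha>\<in>set \<alpha>s. \<alpha> \<in> cotangent A p \<and> (0, \<alpha>) \<in> E p) \<and>
    int (length \<beta>s) = b \<and> (\<forall>\<beta>\<in>set \<beta>s. \<beta> \<in> cotangent A p \<and> (0, \<beta>) \<in> orth A E p)}}"

definition form_bicomp ::
    "('a, 'e::real_inner) atlas \<Rightarrow> ('a \<Rightarrow> 'a ttvec set) \<Rightarrow> int \<Rightarrow> int \<Rightarrow> 'a form \<Rightarrow> 'a form"
  where "form_bicomp A E a b \<omega> = (THE \<eta>. \<exists>c.
    (\<forall>i j. c i j \<in> bigraded_forms A E i j) \<and>
    \<omega> = (\<Sum>i = 0..int (mdim A). \<Sum>j = 0..int (mdim A). c i j) \<and> \<eta> = c a b)"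

definition op_bicomp ::
    "('a, 'e::real_inner) atlas \<Rightarrow> ('a \<Rightarrow> 'a ttvec set) \<Rightarrow> int \<Rightarrow> int \<Rightarrow> 'a form_op \<Rightarrow> 'a form_op"
  where "op_bicomp A E a b \<phi> = (\<lambda>\<omega>. \<Sum>i = 0..int (mdim A). \<Sum>j = 0..int (mdim A).
    form_bicomp A E (i + a) (j + b) (\<phi> (form_bicomp A E i j \<omega>)))"

definition d_split :: "('a, 'e::real_inner) atlas \<Rightarrow> ('a \<Rightarrow> 'a ttvec set) \<Rightarrow> 'a form_op"
  where "d_split A E = op_bicomp A E 1 0 (de_rham A) + op_bicomp A E (-1) 2 (de_rham A)"


section \<open>Courant algebroids\<close>

definition courant_D ::
    "('a \<Rightarrow> 'v) set \<Rightarrow> ('a \<Rightarrow> 'v \<Rightarrow> 'v \<Rightarrow> real) \<Rightarrow> ('a \<Rightarrow> 'v \<Rightarrow> 'a tvec) \<Rightarrow> ('a \<Rightarrow> real) \<Rightarrow> 'a \<Rightarrow> 'v"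
  where "courant_D \<Gamma> pair anchor f =
    (THE z. z \<in> \<Gamma> \<and> (\<forall>y\<in>\<Gamma>. \<forall>p. pair p (z p) (y p) = anchor p (y p) f))"

text \<open>Fibres \<open>E\<close>, smooth sections \<open>\<Gamma>\<close>, bracket \<open>br\<close> on sections, fibrewise pairing and anchor.\<close>

definition courant_algebroid ::
    "('a::topological_space, 'e::real_inner) atlas \<Rightarrow> ('a \<Rightarrow> 'v::real_vector set) \<Rightarrow> ('a \<Rightarrow> 'v) set
      \<Rightarrow> (('a \<Rightarrow> 'v) \<Rightarrow> ('a \<Rightarrow> 'v) \<Rightarrow> 'a \<Rightarrow> 'v) \<Rightarrow> ('a \<Rightarrow> 'v \<Rightarrow> 'v \<Rightarrow> real) \<Rightarrow> ('a \<Rightarrow> 'v \<Rightarrow> 'a tvec) \<Rightarrow> bool"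
  where "courant_algebroid A E \<Gamma> br pair anchor \<longleftrightarrow>
    vector_bundle A E \<Gamma> \<and>
    (\<forall>p. nondegenerate_on (pair p) (E p) \<and>
      (\<forall>x\<in>E p. \<forall>y\<in>E p. pair p x y = pair p y x) \<and>
      (\<forall>x\<in>E p. \<forall>y\<in>E p. \<forall>z\<in>E p. \<forall>a b.
         pair p (a *\<^sub>R x + b *\<^sub>R y) z = a * pair p x z + b * pair p y z)) \<and>
    (\<forall>x\<in>\<Gamma>. \<forall>y\<in>\<Gamma>. (\<lambda>p. pair p (x p) (y p)) \<in> smooth_funs A) \<and>
    (\<forall>p. \<forall>x\<in>E p. \<forall>y\<in>E p. \<forall>a b.
       anchor p (a *\<^sub>R x + b *\<^sub>R y) = a *\<^sub>R anchor p x + b *\<^sub>R anchor p y) \<and>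
    (\<forall>x\<in>\<Gamma>. (\<lambda>p. anchor p (x p)) \<in> vector_fields A) \<and>
    (\<forall>x\<in>\<Gamma>. \<forall>y\<in>\<Gamma>. br x y \<in> \<Gamma>) \<and>
    (\<forall>x\<in>\<Gamma>. \<forall>y\<in>\<Gamma>. \<forall>z\<in>\<Gamma>. \<forall>a b.
       br (a *\<^sub>R x + b *\<^sub>R y) z = a *\<^sub>R br x z + b *\<^sub>R br y z \<and>
       br z (a *\<^sub>R x + b *\<^sub>R y) = a *\<^sub>R br z x + b *\<^sub>R br z y) \<and>
    (\<forall>x\<in>\<Gamma>. \<forall>y\<in>\<Gamma>. \<forall>z\<in>\<Gamma>. br x (br y z) = br (br x y) z + br y (br x z)) \<and>
    (\<forall>x\<in>\<Gamma>. \<forall>y\<in>\<Gamma>.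
       (\<lambda>p. anchor p (br x y p)) = lie (\<lambda>p. anchor p (x p)) (\<lambda>p. anchor p (y p))) \<and>
    (\<forall>x\<in>\<Gamma>. \<forall>y\<in>\<Gamma>. \<forall>f\<in>smooth_funs A.
       br x (\<lambda>p. f p *\<^sub>R y p) = (\<lambda>p. f p *\<^sub>R br x y p + anchor p (x p) f *\<^sub>R y p)) \<and>
    (\<forall>x\<in>\<Gamma>. \<forall>y\<in>\<Gamma>. \<forall>z\<in>\<Gamma>. \<forall>p.
       anchor p (x p) (\<lambda>q. pair q (y q) (z q)) =
         pair p (br x y p) (z p) + pair p (y p) (br x z p)) \<and>
    (\<forall>x\<in>\<Gamma>. br x x = (1 / 2) *\<^sub>R courant_D \<Gamma> pair anchor (\<lambda>q. pair q (x q) (x q)))"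

end

theory Submission
  imports Defs
begin

text \<open>
  Write \<open>F = \<pi>(E)\<close> and let \<open>P\<close> be the projection \<open>v \<mapsto> \<pi> (pr\<^sub>E v)\<close> of \<open>TM\<close> onto \<open>F\<close>.  The kernel
  \<open>T\<^sup>*M \<inter> E\<close> of \<open>\<pi>\<close> on \<open>E\<close> is Lagrangian, so it is dual to \<open>F\<close>, and \<open>TM\<close> is the sum of \<open>F\<close> and the
  kernel of \<open>P\<close>.  Each of the four conditions says that \<open>P[X,Y] = [X,Y]\<close> for the anchors \<open>X\<close>, \<open>Y\<close>
  of sections of \<open>E\<close>.

  For the Leibnizator, let \<open>\<epsilon>\<close> be the pullback of forms along the reflection \<open>1 - 2P\<close>; it is
  \<open>(-1)\<^sup>a\<close> on bidegree \<open>(a,b)\<close>.  Since \<open>d\<close> has only the bidegrees \<open>(1,0)\<close>, \<open>(-1,2)\<close>, \<open>(0,1)\<close>, \<open>(2,-1)\<close>, the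
  component \<open>d\<^sub>E\<close>, which changes the first degree by an odd number, is \<open>1/2 (d - \<epsilon> d \<epsilon>)\<close>.
  Cartan calculus gives \<open>[\<iota>\<^sub>X, d\<^sub>E] = 1/2 (L\<^sub>X + \<epsilon> L\<^sub>X \<epsilon>)\<close> for \<open>X\<close> in \<open>F\<close>, so that \<open>[[x, d\<^sub>E], y]\<close> has anchor \<open>P[X,Y]\<close> and the
  Leibnizator sends \<open>f\<close> to \<open>([X,Y] - P[X,Y]) f\<close>.  The other conditions are read off the Dorfman
  bracket \<open>([X,Y], L\<^sub>X \<beta> - \<iota>\<^sub>Y d\<alpha>)\<close>.
\<close>

section \<open>Smooth functions on the model space\<close>

text \<open>The obstacle is that d, the bigrading and the graded commutators are given indirectly,
  by definite descriptions or by sums over homogeneous components. A calculus of contractions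
  replaces them. A form is determined by its function part and its contractions, so two operators
  agree once they have the same commutation rule with every contraction and the same function part.
  The list of bidegrees of d comes out of the same recursion: contraction with a field of F lowers
  the first degree by one, contraction with a field in the kernel of P leaves it alone, and a Lie
  derivative changes it by at most one. The signs of the graded commutators are handled by a parity
  involution: an operator that commutes or anticommutes with it has only even or only odd
  components, so the sign is constant on the surviving terms. In the Jacobi identity of the
  projected bracket, the discarded part of an inner bracket is, under involutivity, a one-form that
  vanishes on F; its brackets with sections of E stay orthogonal to E.\<close>

lemma Ck_on_cong:
  assumes "open S" "\<And>x. x \<in> S \<Longrightarrow> f x = g x" "Ck_on k S f"
  shows "Ck_on k S g"
  using assms(2,3)
proof (induction k arbitrary: f g)
  case 0
  then show ?case by (auto intro: continuous_on_eq)
next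
  case (Suc k)
  have d: "(g has_derivative frechet_derivative f (at x)) (at x)" if "x \<in> S" for x
  proof (rule has_derivative_transform_within_open[OF _ assms(1) that])
    show "(f has_derivative frechet_derivative f (at x)) (at x)"
      using Suc.prems that by (simp add: frechet_derivative_works)
  qed (use Suc.prems in auto)
  have eq: "frechet_derivative f (at x) = frechet_derivative g (at x)" if "x \<in> S" for x
    using frechet_derivative_at[OF d[OF that]] .
  have "Ck_on k S (\<lambda>x. frechet_derivative g (at x) v)" for v
  proof (rule Suc.IH[rotated])
    show "Ck_on k S (\<lambda>x. frechet_derivative f (at x) v)" using Suc.prems(2) by simp
    show "frechet_derivative f (at x) v = frechet_derivative g (at x) v" if "x \<in> S" for x
      by (simp only: eq[OF that])
  qed
  then show ?case using d unfolding Ck_on.simps differentiable_def by blast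
qed

text \<open>\<open>Ck_on\<close> is phrased through the chosen \<open>frechet_derivative\<close>.
  Uniqueness of derivatives lets any explicit candidate \<open>f'\<close> stand in for it on an open
  set, so the closure rules can use the usual derivative formulas.\<close>

lemma Ck_on_SucI:
  assumes "open S" "\<And>x. x \<in> S \<Longrightarrow> (f has_derivative f' x) (at x)"
    and "\<And>v. Ck_on k S (\<lambda>x. f' x v)"
  shows "Ck_on (Suc k) S f"
proof -
  have "Ck_on k S (\<lambda>x. frechet_derivative f (at x) v)" for v
    by (rule Ck_on_cong[OF assms(1) _ assms(3)[of v]]) (use frechet_derivative_at[OF assms(2)] in simp)
  then show ?thesis using assms(2) unfolding Ck_on.simps differentiable_def by blast
qed

lemma Ck_on_Suc_has_derivative:
  "Ck_on (Suc k) S f \<Longrightarrow> x \<in> S \<Longrightarrow> (f has_derivative frechet_derivative f (at x)) (at x)"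
  by (simp add: frechet_derivative_works)

lemma Ck_on_imp_continuous_on: "Ck_on k S f \<Longrightarrow> continuous_on S f"
  by (cases k) (auto intro!: continuous_at_imp_continuous_on differentiable_imp_continuous_within)

lemma Ck_on_Suc_imp: "Ck_on (Suc k) S f \<Longrightarrow> Ck_on k S f"
proof (induction k arbitrary: f)
  case 0
  then show ?case using Ck_on_imp_continuous_on by fastforce
next
  case (Suc k)
  have "\<forall>x\<in>S. f differentiable (at x)" "\<And>v. Ck_on (Suc k) S (\<lambda>x. frechet_derivative f (at x) v)"
    using Suc.prems unfolding Ck_on.simps(2)[of "Suc k"] by blast+
  then show ?case using Suc.IH by (intro Ck_on.simps(2)[THEN iffD2]) blast
qed

lemma Ck_on_subset: "Ck_on k S f \<Longrightarrow> T \<subseteq> S \<Longrightarrow> Ck_on k T f"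
  by (induction k arbitrary: f) (auto intro: continuous_on_subset)

lemma Ck_on_const: "open S \<Longrightarrow> Ck_on k S (\<lambda>x. c)"
proof (induction k arbitrary: c)
  case (Suc k)
  then show ?case by (intro Ck_on_SucI[where f' = "\<lambda>x v. 0"]) auto
qed auto

lemma Ck_on_bounded_linear: "open S \<Longrightarrow> bounded_linear L \<Longrightarrow> Ck_on k S L"
proof (cases k)
  case 0
  assume "bounded_linear L"
  then show ?thesis using 0 by (simp add: linear_continuous_on)
next
  case (Suc l)
  assume "open S" "bounded_linear L"
  then show ?thesis unfolding Suc
    by (intro Ck_on_SucI[where f' = "\<lambda>x. L"] bounded_linear_imp_has_derivative Ck_on_const)
qed

lemma Ck_on_add: "open S \<Longrightarrow> Ck_on k S f \<Longrightarrow> Ck_on k S g \<Longrightarrow> Ck_on k S (\<lambda>x. f x + g x)"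
proof (induction k arbitrary: f g)
  case (Suc k)
  show ?case
  proof (rule Ck_on_SucI[OF Suc.prems(1)])
    show "((\<lambda>x. f x + g x) has_derivative
        (\<lambda>v. frechet_derivative f (at x) v + frechet_derivative g (at x) v)) (at x)" if "x \<in> S" for x
      using Suc.prems that by (intro has_derivative_add Ck_on_Suc_has_derivative)
  qed (use Suc in auto)
qed (auto intro: continuous_on_add)

lemma Ck_on_mult:
  fixes f g :: "'e::real_normed_vector \<Rightarrow> real"
  shows "open S \<Longrightarrow> Ck_on k S f \<Longrightarrow> Ck_on k S g \<Longrightarrow> Ck_on k S (\<lambda>x. f x * g x)"
proof (induction k arbitrary: f g)
  case (Suc k)
  show ?case
  proof (rule Ck_on_SucI[OF Suc.prems(1)])
    show "((\<lambda>x. f x * g x) has_derivative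
        (\<lambda>v. f x * frechet_derivative g (at x) v + frechet_derivative f (at x) v * g x)) (at x)"
      if "x \<in> S" for x
      using Suc.prems that by (intro has_derivative_mult Ck_on_Suc_has_derivative)
    show "Ck_on k S (\<lambda>x. f x * frechet_derivative g (at x) v + frechet_derivative f (at x) v * g x)" for v
      using Suc.prems Suc.prems(2,3)[THEN Ck_on_Suc_imp] by (intro Ck_on_add Suc.IH) simp_all
  qed
qed (auto intro: continuous_on_mult)

lemma Ck_on_sum:
  assumes "open S" "\<And>i. i \<in> I \<Longrightarrow> Ck_on k S (f i)"
  shows "Ck_on k S (\<lambda>x. \<Sum>i\<in>I. f i x)"
  using assms(2)
  by (induction I rule: infinite_finite_induct) (auto intro: Ck_on_add Ck_on_const assms(1))

lemma Ck_on_inner_left: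
  "open S \<Longrightarrow> Ck_on k S g \<Longrightarrow> Ck_on k S (\<lambda>x. g x \<bullet> b)"
proof (induction k arbitrary: g)
  case (Suc k)
  show ?case
  proof (rule Ck_on_SucI[OF Suc.prems(1)])
    show "((\<lambda>x. g x \<bullet> b) has_derivative (\<lambda>v. frechet_derivative g (at x) v \<bullet> b)) (at x)"
      if "x \<in> S" for x
      using Suc.prems that by (intro has_derivative_inner_left Ck_on_Suc_has_derivative)
  qed (use Suc in auto)
qed (auto intro: continuous_intros)

lemma Ck_on_inverse:
  fixes f :: "'e::real_normed_vector \<Rightarrow> real"
  shows "open S \<Longrightarrow> Ck_on k S f \<Longrightarrow> (\<And>x. x \<in> S \<Longrightarrow> f x \<noteq> 0) \<Longrightarrow> Ck_on k S (\<lambda>x. inverse (f x))"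
proof (induction k)
  case 0
  then show ?case by (auto intro: continuous_intros)
next
  case (Suc k)
  show ?case
  proof (rule Ck_on_SucI[OF Suc.prems(1)])
    show "((\<lambda>x. inverse (f x)) has_derivative
        (\<lambda>v. (-1) * ((inverse (f x) * frechet_derivative f (at x) v) * inverse (f x)))) (at x)"
      if "x \<in> S" for x
      using Deriv.has_derivative_inverse[OF Suc.prems(3)[OF that] Ck_on_Suc_has_derivative[OF Suc.prems(2) that]]
      by simp
    show "Ck_on k S (\<lambda>x. (-1) * ((inverse (f x) * frechet_derivative f (at x) v) * inverse (f x)))" for v
      using Suc.prems Suc.IH Ck_on_Suc_imp[OF Suc.prems(2)] by (intro Ck_on_mult Ck_on_const) simp_all
  qed
qed

lemma Ck_on_local:
  assumes "open S" "\<And>x. x \<in> S \<Longrightarrow> \<exists>T. open T \<and> x \<in> T \<and> Ck_on k (S \<inter> T) f"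
  shows "Ck_on k S f"
  using assms(2)
proof (induction k arbitrary: f)
  case 0
  have "isCont f x" if x: "x \<in> S" for x
  proof -
    obtain T where "open T" "x \<in> T" "continuous_on (S \<inter> T) f" using 0[OF x] by auto
    then show ?thesis using assms(1) x by (simp add: continuous_on_eq_continuous_at open_Int)
  qed
  then show ?case by (simp add: continuous_at_imp_continuous_on)
next
  case (Suc k)
  have "Ck_on k S (\<lambda>x. frechet_derivative f (at x) v)" for v
  proof (rule Suc.IH)
    fix x assume "x \<in> S"
    from Suc.prems[OF this] obtain T where "open T" "x \<in> T" "Ck_on (Suc k) (S \<inter> T) f" by blast
    then show "\<exists>T. open T \<and> x \<in> T \<and> Ck_on k (S \<inter> T) (\<lambda>x. frechet_derivative f (at x) v)"
      by (intro exI[of _ T]) simp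
  qed
  moreover have "f differentiable (at x)" if "x \<in> S" for x
    using Suc.prems[OF that] that by auto
  ultimately show ?case by auto
qed

text \<open>The model space is only an inner product space with a finite spanning set, so an
  orthonormal basis is produced and carried along as a set. In dimension 0 it is empty.\<close>

definition onb :: "'e::real_inner set \<Rightarrow> bool"
  where "onb B \<longleftrightarrow> finite B \<and> (\<forall>b\<in>B. \<forall>c\<in>B. b \<bullet> c = (if b = c then 1 else 0)) \<and> span B = UNIV"

lemma onb_exists:
  assumes "finite (C :: 'e::real_inner set)" "span C = UNIV"
  shows "\<exists>B :: 'e set. onb B"
proof -
  obtain D :: "'e set" where D: "finite D" "span D = UNIV" "pairwise orthogonal D"
    using basis_orthogonal[OF assms(1)] assms(2) by auto
  define B where "B = (\<lambda>x. x /\<^sub>R norm x) ` (D - {0})"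
  have "finite B" using D by (simp add: B_def)
  moreover have "b \<bullet> c = (if b = c then 1 else 0)" if "b \<in> B" "c \<in> B" for b c
  proof -
    obtain x y where xy: "x \<in> D" "y \<in> D" "x \<noteq> 0" "y \<noteq> 0" "b = x /\<^sub>R norm x" "c = y /\<^sub>R norm y"
      using \<open>b \<in> B\<close> \<open>c \<in> B\<close> unfolding B_def by blast
    show ?thesis
    proof (cases "x = y")
      case True
      then show ?thesis using xy by (simp add: dot_square_norm power2_eq_square)
    next
      case False
      then have "x \<bullet> y = 0" using D(3) xy by (auto simp: pairwise_def orthogonal_def)
      then have "b \<bullet> c = 0" using xy by simp
      moreover have "b \<bullet> b = 1" using xy by (simp add: dot_square_norm power2_eq_square)
      ultimately show ?thesis by auto
    qed
  qed
  moreover have "D \<subseteq> span B"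
  proof
    fix x assume "x \<in> D"
    show "x \<in> span B"
    proof (cases "x = 0")
      case False
      then have "x = norm x *\<^sub>R (x /\<^sub>R norm x)" by simp
      moreover have "x /\<^sub>R norm x \<in> span B" using False \<open>x \<in> D\<close> by (auto simp: B_def intro: span_base)
      ultimately show ?thesis using span_scale by metis
    qed (simp add: span_zero)
  qed
  then have "span B = UNIV" using D(2) by (metis span_minimal subspace_span top.extremum_uniqueI)
  ultimately show ?thesis unfolding onb_def by blast
qed

lemma onb_expand:
  assumes "onb B"
  shows "(\<Sum>b\<in>B. (x \<bullet> b) *\<^sub>R b) = x"
proof -
  have B: "finite B" "\<And>b c. b \<in> B \<Longrightarrow> c \<in> B \<Longrightarrow> b \<bullet> c = (if b = c then 1 else 0)" "span B = UNIV"
    using assms by (auto simp: onb_def)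
  have "x \<in> span B" using B by simp
  then obtain u where u: "x = (\<Sum>b\<in>B. u b *\<^sub>R b)" using B(1) by (auto simp: span_finite)
  have "x \<bullet> b = u b" if "b \<in> B" for b
  proof -
    have "x \<bullet> b = (\<Sum>c\<in>B. if c = b then u c else 0)"
      unfolding u inner_sum_left using B(2)[OF _ that] by (intro sum.cong) auto
    then show ?thesis using B(1) that by simp
  qed
  then show ?thesis using u by simp
qed

lemma onb_linear_expand:
  assumes "onb B" "linear L"
  shows "L x = (\<Sum>b\<in>B. (x \<bullet> b) *\<^sub>R L b)"
  by (subst onb_expand[OF assms(1), of x, symmetric])
    (simp add: linear_sum[OF assms(2)] linear_scale[OF assms(2)])

lemma onb_card:
  fixes B :: "'e::real_inner set"
  assumes B: "onb B"
  shows "card B = dim (UNIV :: 'e set)"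
proof -
  have "independent B"
  proof (rule pairwise_orthogonal_independent)
    show "pairwise orthogonal B" using B by (auto simp: onb_def pairwise_def orthogonal_def)
    show "0 \<notin> B" using B unfolding onb_def by (metis inner_zero_left zero_neq_one)
  qed
  then show ?thesis using B by (metis dim_eq_card onb_def span_UNIV)
qed

lemma onb_real: "onb {1::real}"
proof -
  have "x \<in> span {1::real}" for x
    using span_scale[OF span_base, of 1 "{1::real}" x] by simp
  then show ?thesis by (auto simp: onb_def)
qed

lemma Ck_on_compose:
  fixes f :: "'e2::real_inner \<Rightarrow> real"
  assumes B: "onb (B :: 'e2 set)" and S: "open S" and T: "open T" and sub: "g ` S \<subseteq> T"
    and f: "Ck_on k T f" and g: "Ck_on k S g"
  shows "Ck_on k S (\<lambda>x. f (g x))"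
  using f g
proof (induction k arbitrary: f)
  case 0
  then show ?case using sub by (auto intro: continuous_on_compose2)
next
  case (Suc k)
  let ?Df = "\<lambda>y. frechet_derivative f (at y)" and ?Dg = "\<lambda>x. frechet_derivative g (at x)"
  show ?case
  proof (rule Ck_on_SucI[OF S])
    fix x assume x: "x \<in> S"
    have f': "(f has_derivative ?Df (g x)) (at (g x))"
      using Suc.prems sub x by (intro Ck_on_Suc_has_derivative) auto
    have "((\<lambda>x. f (g x)) has_derivative (\<lambda>v. ?Df (g x) (?Dg x v))) (at x)"
      using diff_chain_at[OF Ck_on_Suc_has_derivative[OF Suc.prems(2) x] f'] by (simp add: o_def)
    \<comment> \<open>The direction \<open>?Dg x v\<close> varies with \<open>x\<close>, while
      \<open>Ck_on\<close> controls derivatives in fixed directions. Expansion in the basis leaves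
      fixed directions \<open>b\<close> and coefficient functions.\<close>
    moreover have "?Df (g x) (?Dg x v) = (\<Sum>b\<in>B. (?Dg x v \<bullet> b) * ?Df (g x) b)" for v
      using onb_linear_expand[OF B, of "?Df (g x)" "?Dg x v"] has_derivative_linear[OF f'] by simp
    ultimately show "((\<lambda>x. f (g x)) has_derivative (\<lambda>v. \<Sum>b\<in>B. (?Dg x v \<bullet> b) * ?Df (g x) b)) (at x)"
      by simp
  next
    fix v
    show "Ck_on k S (\<lambda>x. \<Sum>b\<in>B. (?Dg x v \<bullet> b) * ?Df (g x) b)"
    proof (intro Ck_on_sum Ck_on_mult Ck_on_inner_left S)
      fix b
      show "Ck_on k S (\<lambda>x. ?Dg x v)" using Suc.prems by simp
      show "Ck_on k S (\<lambda>x. ?Df (g x) b)"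
        using Suc.prems by (intro Suc.IH[of "\<lambda>y. ?Df y b"] Ck_on_Suc_imp[of k S g]) auto
    qed
  qed
qed

section \<open>Closure rules for smooth maps\<close>

lemma smooth_on_has_derivative:
  "smooth_on S f \<Longrightarrow> x \<in> S \<Longrightarrow> (f has_derivative frechet_derivative f (at x)) (at x)"
  unfolding smooth_on_def using Ck_on_Suc_has_derivative by blast

lemma smooth_on_frechet: "smooth_on S f \<Longrightarrow> smooth_on S (\<lambda>x. frechet_derivative f (at x) v)"
  unfolding smooth_on_def using Ck_on.simps(2) by blast

lemma smooth_on_continuous: "smooth_on S f \<Longrightarrow> continuous_on S f"
  unfolding smooth_on_def using Ck_on_imp_continuous_on by blast

lemma smooth_on_subset: "smooth_on S f \<Longrightarrow> T \<subseteq> S \<Longrightarrow> smooth_on T f"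
  unfolding smooth_on_def using Ck_on_subset by blast

lemma smooth_on_cong: "open S \<Longrightarrow> (\<And>x. x \<in> S \<Longrightarrow> f x = g x) \<Longrightarrow> smooth_on S f \<Longrightarrow> smooth_on S g"
  unfolding smooth_on_def using Ck_on_cong by blast

lemma smooth_on_const: "open S \<Longrightarrow> smooth_on S (\<lambda>x. c)"
  by (simp add: smooth_on_def Ck_on_const)

lemma smooth_on_bounded_linear: "open S \<Longrightarrow> bounded_linear L \<Longrightarrow> smooth_on S L"
  by (simp add: smooth_on_def Ck_on_bounded_linear)

lemma smooth_on_add: "open S \<Longrightarrow> smooth_on S f \<Longrightarrow> smooth_on S g \<Longrightarrow> smooth_on S (\<lambda>x. f x + g x)"
  by (simp add: smooth_on_def Ck_on_add)

lemma smooth_on_mult: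
  fixes f g :: "'e::real_normed_vector \<Rightarrow> real"
  shows "open S \<Longrightarrow> smooth_on S f \<Longrightarrow> smooth_on S g \<Longrightarrow> smooth_on S (\<lambda>x. f x * g x)"
  by (simp add: smooth_on_def Ck_on_mult)

lemma smooth_on_inverse:
  fixes f :: "'e::real_normed_vector \<Rightarrow> real"
  shows "open S \<Longrightarrow> smooth_on S f \<Longrightarrow> (\<And>x. x \<in> S \<Longrightarrow> f x \<noteq> 0) \<Longrightarrow> smooth_on S (\<lambda>x. inverse (f x))"
  by (simp add: smooth_on_def Ck_on_inverse)

lemma smooth_on_compose:
  fixes f :: "'e2::real_inner \<Rightarrow> real"
  assumes "onb (B :: 'e2 set)" "open S" "open T" "g ` S \<subseteq> T" "smooth_on T f" "smooth_on S g"
  shows "smooth_on S (\<lambda>x. f (g x))"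
  using assms Ck_on_compose[OF assms(1-4)] by (simp add: smooth_on_def)

lemma smooth_on_local:
  assumes "open S" "\<And>x. x \<in> S \<Longrightarrow> \<exists>T. open T \<and> x \<in> T \<and> smooth_on (S \<inter> T) f"
  shows "smooth_on S f"
  unfolding smooth_on_def
proof
  fix k
  show "Ck_on k S f"
    using assms(2) unfolding smooth_on_def by (intro Ck_on_local[OF assms(1)]) blast
qed

subsection \<open>Hadamard's lemma\<close>

text \<open>Differentiation in \<open>x\<close> pulls out one factor \<open>t\<close>, so the weight
  \<open>t ^ m\<close> makes the family closed under differentiation. The case \<open>m = 0\<close>
  gives the coefficients in Hadamard's lemma.\<close>

definition ray_integral :: "'e::real_inner \<Rightarrow> nat \<Rightarrow> ('e \<Rightarrow> real) \<Rightarrow> 'e \<Rightarrow> real"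
  where "ray_integral x0 m h x = integral {0..1} (\<lambda>t. t ^ m * h (x0 + t *\<^sub>R (x - x0)))"

lemma ray_in_ball:
  fixes x0 :: "'e::real_normed_vector"
  assumes "x \<in> ball x0 r" "t \<in> {0..1::real}"
  shows "x0 + t *\<^sub>R (x - x0) \<in> ball x0 r"
proof -
  have "norm (t *\<^sub>R (x - x0)) \<le> 1 * norm (x - x0)"
    unfolding norm_scaleR using assms by (intro mult_right_mono) auto
  then show ?thesis using assms by (simp add: dist_norm norm_minus_commute)
qed

lemma ray_integrand_continuous:
  fixes h :: "'e::real_inner \<Rightarrow> real"
  assumes "continuous_on (ball x0 r) h"
  shows "continuous_on (ball x0 r \<times> {0..1}) (\<lambda>(x, t). t ^ m * h (x0 + t *\<^sub>R (x - x0)))"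
proof -
  have "continuous_on (ball x0 r \<times> {0..1}) (\<lambda>z. h (x0 + snd z *\<^sub>R (fst z - x0)))"
    by (intro continuous_on_compose2[OF assms] continuous_intros)
      (use ray_in_ball in \<open>fastforce simp del: mem_ball\<close>)
  then show ?thesis
    by (auto intro!: continuous_intros simp: case_prod_unfold)
qed

lemma ray_integrand_integrable:
  fixes h :: "'e::real_inner \<Rightarrow> real"
  assumes "continuous_on (ball x0 r) h" "x \<in> ball x0 r"
  shows "(\<lambda>t. t ^ m * h (x0 + t *\<^sub>R (x - x0))) integrable_on {0..1}"
proof (rule integrable_continuous_real)
  have "continuous_on {0..1} (\<lambda>t. h (x0 + t *\<^sub>R (x - x0)))"
    using ray_in_ball[OF assms(2)] by (intro continuous_on_compose2[OF assms(1)] continuous_intros) auto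
  then show "continuous_on {0..1} (\<lambda>t. t ^ m * h (x0 + t *\<^sub>R (x - x0)))"
    by (intro continuous_intros)
qed

lemma onb_inner_le_norm: "onb B \<Longrightarrow> b \<in> B \<Longrightarrow> \<bar>v \<bullet> b\<bar> \<le> norm v"
  using Cauchy_Schwarz_ineq2[of v b] by (simp add: onb_def norm_eq_sqrt_inner)

text \<open>Differentiation under the integral sign. By compactness of the unit interval the
  derivative of the integrand near \<open>x\<close> is close to the one at \<open>x\<close>
  uniformly in \<open>t\<close>; the mean value inequality turns this into a linearization error
  that is uniform in \<open>t\<close> and can be integrated.\<close>

lemma ray_integral_has_derivative:
  fixes h :: "'e::real_inner \<Rightarrow> real"
  assumes B: "onb (B :: 'e set)" and h: "smooth_on (ball x0 r) h" and x: "x \<in> ball x0 r"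
  shows "(ray_integral x0 m h has_derivative
     (\<lambda>v. \<Sum>b\<in>B. (v \<bullet> b) * ray_integral x0 (Suc m) (\<lambda>y. frechet_derivative h (at y) b) x)) (at x)"
proof -
  let ?D = "\<lambda>b y. frechet_derivative h (at y) b"
  let ?ray = "\<lambda>y t. x0 + t *\<^sub>R (y - x0)"
  define L where "L v = (\<Sum>b\<in>B. (v \<bullet> b) * ray_integral x0 (Suc m) (?D b) x)" for v
  define l where "l y t v = (\<Sum>b\<in>B. (v \<bullet> b) * (t ^ Suc m * ?D b (?ray y t)))" for y t v
  have cD: "continuous_on (ball x0 r) (?D b)" for b
    by (rule smooth_on_continuous[OF smooth_on_frechet[OF h]])
  have ch: "continuous_on (ball x0 r) h" by (rule smooth_on_continuous[OF h])
  have finB: "finite B" using B by (simp add: onb_def)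
  have blL: "bounded_linear L"
    unfolding L_def by (intro bounded_linear_sum bounded_linear_mult_left[THEN bounded_linear_compose, of "\<lambda>v. v \<bullet> _"] bounded_linear_inner_left) 
  have der: "((\<lambda>y. t ^ m * h (?ray y t)) has_derivative l y t) (at y)"
    if y: "y \<in> ball x0 r" and t: "t \<in> {0..1}" for y t
  proof -
    have hd: "(h has_derivative frechet_derivative h (at (?ray y t))) (at (?ray y t))"
      by (rule smooth_on_has_derivative[OF h ray_in_ball[OF y t]])
    have lin: "linear (frechet_derivative h (at (?ray y t)))" by (rule has_derivative_linear[OF hd])
    have "((\<lambda>y. ?ray y t) has_derivative (\<lambda>v. t *\<^sub>R v)) (at y)"
      by (auto intro!: derivative_eq_intros)
    from diff_chain_at[OF this hd]
    have "((\<lambda>y. h (?ray y t)) has_derivative (\<lambda>v. frechet_derivative h (at (?ray y t)) (t *\<^sub>R v))) (at y)"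
      by (simp add: o_def)
    then have "((\<lambda>y. t ^ m * h (?ray y t)) has_derivative
        (\<lambda>v. t ^ m * frechet_derivative h (at (?ray y t)) (t *\<^sub>R v))) (at y)"
      by (rule has_derivative_mult_right)
    moreover have "t ^ m * frechet_derivative h (at (?ray y t)) (t *\<^sub>R v) = l y t v" for v
    proof -
      have "frechet_derivative h (at (?ray y t)) (t *\<^sub>R v) = t * (\<Sum>b\<in>B. (v \<bullet> b) * ?D b (?ray y t))"
        using onb_linear_expand[OF B lin, of v] by (simp add: linear_scale[OF lin])
      then show ?thesis by (simp add: l_def sum_distrib_left mult_ac)
    qed
    ultimately show ?thesis by (simp add: fun_eq_iff[symmetric])
  qed
  have l_integral: "((\<lambda>t. l x t v) has_integral L v) {0..1}" for v
    unfolding l_def L_def ray_integral_def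
    by (intro has_integral_sum[OF finB] has_integral_mult_right integrable_integral
        ray_integrand_integrable[OF cD x])
  have est: "\<exists>d>0. \<forall>y. norm (y - x) < d \<longrightarrow>
      norm (ray_integral x0 m h y - ray_integral x0 m h x - L (y - x)) \<le> e * norm (y - x)"
    if e: "e > 0" for e
  proof -
    \<comment> \<open>Each of the \<open>card B\<close> coordinate directions contributes an error
      \<open>e'\<close>; the summand 1 keeps the denominator positive when \<open>B\<close> is
      empty.\<close>
    define e' where "e' = e / (real (card B) + 1)"
    have e': "e' > 0" using e by (simp add: e'_def)
    have "\<forall>b. \<exists>X0. x \<in> X0 \<and> open X0 \<and> (\<forall>y\<in>X0 \<inter> ball x0 r. \<forall>t\<in>{0..1}.
        dist (t ^ Suc m * ?D b (?ray y t)) (t ^ Suc m * ?D b (?ray x t)) \<le> e')"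
    proof
      fix b
      obtain X0 where "x \<in> X0" "open X0" "\<forall>y\<in>X0 \<inter> ball x0 r. \<forall>t\<in>{0..1}.
        dist (case (y, t) of (y, t) \<Rightarrow> t ^ Suc m * ?D b (?ray y t))
          (case (x, t) of (y, t) \<Rightarrow> t ^ Suc m * ?D b (?ray y t)) \<le> e'"
        by (rule continuous_on_prod_compactE[OF ray_integrand_continuous[OF cD[of b], of "Suc m"] compact_Icc x e'])
      then show "\<exists>X0. x \<in> X0 \<and> open X0 \<and> (\<forall>y\<in>X0 \<inter> ball x0 r. \<forall>t\<in>{0..1}.
        dist (t ^ Suc m * ?D b (?ray y t)) (t ^ Suc m * ?D b (?ray x t)) \<le> e')"
        unfolding case_prod_conv by (intro exI[of _ X0] conjI)
    qed
    then have "\<exists>X0. \<forall>b. x \<in> X0 b \<and> open (X0 b) \<and> (\<forall>y\<in>X0 b \<inter> ball x0 r. \<forall>t\<in>{0..1}.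
        dist (t ^ Suc m * ?D b (?ray y t)) (t ^ Suc m * ?D b (?ray x t)) \<le> e')"
      by (rule choice)
    then obtain X0 where X0: "\<And>b. x \<in> X0 b" "\<And>b. open (X0 b)"
      "\<And>b y t. y \<in> X0 b \<Longrightarrow> y \<in> ball x0 r \<Longrightarrow> t \<in> {0..1} \<Longrightarrow>
        dist (t ^ Suc m * ?D b (?ray y t)) (t ^ Suc m * ?D b (?ray x t)) \<le> e'"
      by blast
    have "open (ball x0 r \<inter> (\<Inter>b\<in>B. X0 b))" using finB X0 by (intro open_Int open_INT) auto
    moreover have "x \<in> ball x0 r \<inter> (\<Inter>b\<in>B. X0 b)" using x X0(1) by blast
    ultimately obtain d where d: "d > 0" "ball x d \<subseteq> ball x0 r \<inter> (\<Inter>b\<in>B. X0 b)"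
      using openE by blast
    have "norm (ray_integral x0 m h y - ray_integral x0 m h x - L (y - x)) \<le> e * norm (y - x)"
      if y: "norm (y - x) < d" for y
    proof -
      have yb: "y \<in> ball x d" using y by (simp add: dist_norm norm_minus_commute)
      have onb_bd: "onorm (l z t - l x t) \<le> real (card B) * e'" if z: "z \<in> ball x d" and t: "t \<in> {0..1}" for z t
      proof (rule onorm_bound)
        show "0 \<le> real (card B) * e'" using e' by simp
        fix v
        have "norm ((l z t - l x t) v) = \<bar>\<Sum>b\<in>B. (v \<bullet> b) * (t ^ Suc m * ?D b (?ray z t) - t ^ Suc m * ?D b (?ray x t))\<bar>"
          by (simp add: l_def sum_subtractf right_diff_distrib)
        also have "\<dots> \<le> (\<Sum>b\<in>B. \<bar>v \<bullet> b\<bar> * \<bar>t ^ Suc m * ?D b (?ray z t) - t ^ Suc m * ?D b (?ray x t)\<bar>)"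
          by (rule order_trans[OF sum_abs]) (simp add: abs_mult)
        also have "\<dots> \<le> (\<Sum>b\<in>B. norm v * e')"
        proof (intro sum_mono mult_mono)
          fix b assume b: "b \<in> B"
          show "\<bar>v \<bullet> b\<bar> \<le> norm v" by (rule onb_inner_le_norm[OF B b])
          show "\<bar>t ^ Suc m * ?D b (?ray z t) - t ^ Suc m * ?D b (?ray x t)\<bar> \<le> e'"
          proof -
            have "z \<in> X0 b" "z \<in> ball x0 r" using z d(2) b by blast+
            from X0(3)[OF this t] show ?thesis by (simp only: dist_real_def)
          qed
        qed auto
        finally show "norm ((l z t - l x t) v) \<le> real (card B) * e' * norm v" by (simp add: mult_ac)
      qed
      have pt: "norm (t ^ m * h (?ray y t) - t ^ m * h (?ray x t) - l x t (y - x)) \<le> norm (y - x) * (real (card B) * e')"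
        if t: "t \<in> {0..1}" for t
      proof (rule differentiable_bound_linearization[where S = "ball x d"])
        show "x + s *\<^sub>R (y - x) \<in> ball x d" if "s \<in> {0..1}" for s by (rule ray_in_ball[OF yb that])
        show "((\<lambda>y. t ^ m * h (?ray y t)) has_derivative l z t) (at z within ball x d)"
          if "z \<in> ball x d" for z
          by (rule has_derivative_at_withinI[OF der[OF _ t]]) (use d(2) that in blast)
        show "onorm (l z t - l x t) \<le> real (card B) * e'" if "z \<in> ball x d" for z
          by (rule onb_bd[OF that t])
        show "x \<in> ball x d" using d by simp
      qed
      have y0: "y \<in> ball x0 r" using d(2) yb by blast
      have "((\<lambda>t. t ^ m * h (?ray y t) - t ^ m * h (?ray x t) - l x t (y - x)) has_integral
          (ray_integral x0 m h y - ray_integral x0 m h x - L (y - x))) {0..1}"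
        unfolding ray_integral_def
        by (intro has_integral_diff l_integral integrable_integral ray_integrand_integrable[OF ch y0]
            ray_integrand_integrable[OF ch x])
      from has_integral_bound_real[OF _ finite.emptyI this] pt
      have "norm (ray_integral x0 m h y - ray_integral x0 m h x - L (y - x)) \<le> norm (y - x) * (real (card B) * e')"
        using e' by auto
      also have "\<dots> \<le> e * norm (y - x)"
      proof -
        have "real (card B) * e' \<le> e"
          using e by (simp add: e'_def field_simps)
        then show ?thesis by (metis mult.commute mult_right_mono norm_ge_zero)
      qed
      finally show ?thesis .
    qed
    then show ?thesis using d(1) by blast
  qed
  have "(ray_integral x0 m h has_derivative L) (at x)"
    unfolding has_derivative_at_alt using blL est by blast
  then show ?thesis unfolding L_def .
qed

lemma ray_integral_smooth:
  fixes h :: "'e::real_inner \<Rightarrow> real"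
  assumes B: "onb (B :: 'e set)" and h: "smooth_on (ball x0 r) h"
  shows "smooth_on (ball x0 r) (ray_integral x0 m h)"
proof -
  have "Ck_on k (ball x0 r) (ray_integral x0 m h)" for k
    using h
  proof (induction k arbitrary: m h)
    case 0
    have "continuous_on (ball x0 r) (\<lambda>x. integral (cbox 0 1) (\<lambda>t. t ^ m * h (x0 + t *\<^sub>R (x - x0))))"
      using ray_integrand_continuous[OF smooth_on_continuous[OF 0], of m]
      by (intro integral_continuous_on_param) simp
    then show ?case by (simp add: ray_integral_def[abs_def])
  next
    case (Suc k)
    show ?case
      by (rule Ck_on_SucI[OF open_ball ray_integral_has_derivative[OF B Suc.prems]])
        (auto intro!: Ck_on_sum Ck_on_mult Ck_on_const Suc.IH smooth_on_frechet[OF Suc.prems])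
  qed
  then show ?thesis by (simp add: smooth_on_def)
qed

text \<open>The fundamental theorem of calculus along the segment from \<open>x0\<close> to
  \<open>x\<close>, with the derivative expanded in the basis. It will let a derivation at a point
  be computed from its values on coordinate functions.\<close>

lemma Hadamard:
  fixes F :: "'e::real_inner \<Rightarrow> real"
  assumes B: "onb (B :: 'e set)" and F: "smooth_on (ball x0 r) F"
  shows "\<exists>g. (\<forall>b. smooth_on (ball x0 r) (g b)) \<and>
    (\<forall>x\<in>ball x0 r. F x = F x0 + (\<Sum>b\<in>B. ((x - x0) \<bullet> b) * g b x)) \<and>
    (\<forall>b. g b x0 = frechet_derivative F (at x0) b)"
proof (intro exI conjI allI ballI)
  let ?D = "\<lambda>b y. frechet_derivative F (at y) b"
  let ?g = "\<lambda>b. ray_integral x0 0 (?D b)"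
  show "smooth_on (ball x0 r) (?g b)" for b
    by (rule ray_integral_smooth[OF B smooth_on_frechet[OF F]])
  show "?g b x0 = ?D b x0" for b by (simp add: ray_integral_def)
  fix x assume x: "x \<in> ball x0 r"
  have finB: "finite B" using B by (simp add: onb_def)
  let ?ray = "\<lambda>t. x0 + t *\<^sub>R (x - x0)"
  have "((\<lambda>t. frechet_derivative F (at (?ray t)) (x - x0)) has_integral (F (?ray 1) - F (?ray 0))) {0..1}"
  proof (rule fundamental_theorem_of_calculus)
    fix t :: real assume t: "t \<in> {0..1}"
    have hd: "(F has_derivative frechet_derivative F (at (?ray t))) (at (?ray t))"
      by (rule smooth_on_has_derivative[OF F ray_in_ball[OF x t]])
    have "((\<lambda>t. ?ray t) has_derivative (\<lambda>s. s *\<^sub>R (x - x0))) (at t)"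
      by (auto intro!: derivative_eq_intros)
    from diff_chain_at[OF this hd]
    have "((\<lambda>t. F (?ray t)) has_derivative (\<lambda>s. frechet_derivative F (at (?ray t)) (s *\<^sub>R (x - x0)))) (at t)"
      by (simp add: o_def)
    then have "((\<lambda>t. F (?ray t)) has_vector_derivative frechet_derivative F (at (?ray t)) (x - x0)) (at t)"
      by (simp add: has_vector_derivative_def linear_scale[OF has_derivative_linear[OF hd]])
    then show "((\<lambda>t. F (?ray t)) has_vector_derivative frechet_derivative F (at (?ray t)) (x - x0)) (at t within {0..1})"
      by (rule has_vector_derivative_at_within)
  qed simp
  moreover have "((\<lambda>t. \<Sum>b\<in>B. ((x - x0) \<bullet> b) * (t ^ 0 * ?D b (?ray t))) has_integral
      (\<Sum>b\<in>B. ((x - x0) \<bullet> b) * ?g b x)) {0..1}"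
    unfolding ray_integral_def
    by (intro has_integral_sum[OF finB] has_integral_mult_right integrable_integral
        ray_integrand_integrable[OF smooth_on_continuous[OF smooth_on_frechet[OF F]] x])
  moreover have "frechet_derivative F (at (?ray t)) (x - x0) = (\<Sum>b\<in>B. ((x - x0) \<bullet> b) * (t ^ 0 * ?D b (?ray t)))"
    if "t \<in> {0..1}" for t
    using onb_linear_expand[OF B has_derivative_linear[OF smooth_on_has_derivative[OF F ray_in_ball[OF x that]]], of "x - x0"]
    by simp
  ultimately have "F (?ray 1) - F (?ray 0) = (\<Sum>b\<in>B. ((x - x0) \<bullet> b) * ?g b x)"
    by (metis (no_types, lifting) has_integral_cong has_integral_unique)
  then show "F x = F x0 + (\<Sum>b\<in>B. ((x - x0) \<bullet> b) * ?g b x)" by simp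
qed

subsection \<open>Bump functions\<close>

text \<open>All derivatives of exp(-1/s), extended by 0, are linear combinations of these functions,
  so a single induction proves the whole family smooth.\<close>

definition flat :: "nat \<Rightarrow> real \<Rightarrow> real"
  where "flat m s = (if s > 0 then exp (- 1 / s) / s ^ m else 0)"

lemma power_le_fact_exp: "0 \<le> x \<Longrightarrow> x ^ n \<le> fact n * exp (x::real)"
proof -
  assume x: "0 \<le> x"
  obtain t where t: "exp x = (\<Sum>m<Suc n. x ^ m / fact m) + exp t / fact (Suc n) * x ^ Suc n"
    using Maclaurin_exp_le[of x "Suc n"] by blast
  have "0 \<le> exp t / fact (Suc n) * x ^ Suc n" using x by auto
  moreover have "x ^ n / fact n \<le> (\<Sum>m<Suc n. x ^ m / fact m)"
    using x by (auto intro: sum_nonneg)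
  ultimately have "x ^ n / fact n \<le> exp x" using t by linarith
  then show ?thesis by (simp add: field_simps)
qed

text \<open>The inequality x^n / n! \<le> exp x at x = 1/s and n = m + j: the exponential beats the
  pole to any order \<open>j\<close>.\<close>

lemma flat_bound: "\<bar>flat m s\<bar> \<le> fact (m + j) * \<bar>s\<bar> ^ j"
proof (cases "s > 0")
  case True
  have "(1 / s) ^ (m + j) \<le> fact (m + j) * exp (1 / s)" using True by (intro power_le_fact_exp) simp
  then have "exp (- 1 / s) * (1 / s) ^ (m + j) \<le> exp (- 1 / s) * (fact (m + j) * exp (1 / s))"
    by (intro mult_left_mono) auto
  also have "\<dots> = fact (m + j)" by (simp add: exp_minus field_simps)
  finally show ?thesis using True by (simp add: flat_def power_add field_simps)
qed (simp add: flat_def)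

lemma flat_has_derivative:
  "(flat m has_real_derivative flat (m + 2) s - real m * flat (m + 1) s) (at s)"
proof -
  consider "s > 0" | "s < 0" | "s = 0" by linarith
  then show ?thesis
  proof cases
    case 1
    have "((\<lambda>s. exp (- 1 / s) / s ^ m) has_real_derivative flat (m + 2) s - real m * flat (m + 1) s) (at s)"
    proof -
      have "((\<lambda>s. exp (- 1 / s) * inverse (s ^ m)) has_real_derivative
          exp (- 1 / s) * (1 / s\<^sup>2) * inverse (s ^ m) + - (inverse (s ^ m) * (real m * s ^ (m - 1)) * inverse (s ^ m)) * exp (- 1 / s)) (at s)"
        using 1 by (auto intro!: derivative_eq_intros simp: power2_eq_square)
      moreover have "inverse (s ^ m) * (real m * s ^ (m - 1)) * inverse (s ^ m) = real m / s ^ (m + 1)"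
        using 1 by (cases m) (auto simp: field_simps)
      ultimately have "((\<lambda>s. exp (- 1 / s) * inverse (s ^ m)) has_real_derivative
          exp (- 1 / s) * (1 / s\<^sup>2) * inverse (s ^ m) + - (real m / s ^ (m + 1)) * exp (- 1 / s)) (at s)"
        by simp
      moreover have "exp (- 1 / s) * (1 / s\<^sup>2) * inverse (s ^ m) + - (real m / s ^ (m + 1)) * exp (- 1 / s)
          = flat (m + 2) s - real m * flat (m + 1) s"
        using 1 by (simp add: flat_def power2_eq_square field_simps)
      ultimately show ?thesis by (simp add: divide_inverse)
    qed
    then show ?thesis
      by (rule has_field_derivative_transform_within_open[of _ _ _ "{0<..}"]) (use 1 in \<open>auto simp: flat_def\<close>)
  next
    case 2
    have "((\<lambda>s. 0) has_real_derivative flat (m + 2) s - real m * flat (m + 1) s) (at s)"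
      using 2 by (simp add: flat_def)
    then show ?thesis
      by (rule has_field_derivative_transform_within_open[of _ _ _ "{..<0}"]) (use 2 in \<open>auto simp: flat_def\<close>)
  next
    case 3
    have "((\<lambda>h. flat m h / h) \<longlongrightarrow> 0) (at 0)"
    proof (rule tendsto_rabs_zero_cancel, rule tendsto_sandwich[of "\<lambda>_. 0"])
      show "\<forall>\<^sub>F h in at 0. \<bar>flat m h / h\<bar> \<le> fact (m + 2) * \<bar>h\<bar>"
        unfolding eventually_at_topological
      proof (intro exI conjI impI ballI)
        fix h :: real assume "h \<in> UNIV" "h \<noteq> 0"
        then show "\<bar>flat m h / h\<bar> \<le> fact (m + 2) * \<bar>h\<bar>"
          \<comment> \<open>Decay of order 2 still leaves a factor \<open>\<bar>h\<bar>\<close>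
            after division by \<open>h\<close>, so the difference quotient at 0 tends to 0.\<close>
          using flat_bound[of m h 2]
          by (simp add: pos_divide_le_eq power2_eq_square abs_mult mult.assoc del: fact_Suc)
      qed auto
      show "((\<lambda>h. fact (m + 2) * \<bar>h\<bar>) \<longlongrightarrow> 0) (at (0::real))"
        by (auto intro!: tendsto_eq_intros)
    qed auto
    then show ?thesis using 3 by (simp add: DERIV_def flat_def)
  qed
qed

lemma flat_smooth: "smooth_on UNIV (flat m)"
proof -
  have "Ck_on k UNIV (flat m)" for k
  proof (induction k arbitrary: m)
    case 0
    show ?case
      using flat_has_derivative[THEN DERIV_isCont] by (auto simp: continuous_at_imp_continuous_on)
  next
    case (Suc k)
    show ?case
    proof (rule Ck_on_SucI[OF open_UNIV])
      show "(flat m has_derivative (\<lambda>v. v * (flat (m + 2) s + (- real m) * flat (m + 1) s))) (at s)" for s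
        using flat_has_derivative[of m s] by (simp add: has_field_derivative_def mult.commute[of _ "_ - _"])
      show "Ck_on k UNIV (\<lambda>s. v * (flat (m + 2) s + (- real m) * flat (m + 1) s))" for v :: real
        by (intro Ck_on_mult Ck_on_add Ck_on_const Suc.IH open_UNIV)
    qed
  qed
  then show ?thesis by (simp add: smooth_on_def)
qed

lemma flat_0_pos: "s > 0 \<Longrightarrow> flat 0 s > 0" and flat_0_nonneg: "flat 0 s \<ge> 0"
  and flat_nonpos: "s \<le> 0 \<Longrightarrow> flat m s = 0"
  by (auto simp: flat_def)

lemma bump_exists:
  fixes x0 :: "'e::real_inner"
  assumes B: "onb (B :: 'e set)" and r: "0 < r" "r < R"
  shows "\<exists>h. smooth_on UNIV h \<and> (\<forall>x\<in>ball x0 r. h x = (1::real)) \<and> (\<forall>x. x \<notin> cball x0 R \<longrightarrow> h x = 0)"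
proof -
  \<comment> \<open>The squared distance to \<open>x0\<close>, spelled as a polynomial in the
    coordinates so that the closure rules give its smoothness.\<close>
  let ?q = "\<lambda>x. (\<Sum>b\<in>B. ((x \<bullet> b) + (- x0 \<bullet> b)) * ((x \<bullet> b) + (- x0 \<bullet> b)))"
  have q: "?q x = (dist x x0)\<^sup>2" for x
  proof -
    have "(dist x x0)\<^sup>2 = (x - x0) \<bullet> (\<Sum>b\<in>B. ((x - x0) \<bullet> b) *\<^sub>R b)"
      by (simp add: onb_expand[OF B] dist_norm power2_norm_eq_inner)
    then show ?thesis by (simp add: inner_sum_right inner_diff_left)
  qed
  have lin: "smooth_on UNIV (\<lambda>x. x \<bullet> b)" for b :: 'e
    by (intro smooth_on_bounded_linear bounded_linear_inner_left open_UNIV)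
  have q_smooth: "smooth_on UNIV ?q"
    unfolding smooth_on_def using lin
    by (auto intro!: Ck_on_sum Ck_on_mult Ck_on_add Ck_on_const simp: smooth_on_def simp del: inner_minus_left)
  let ?a = "\<lambda>x. flat 0 (R\<^sup>2 + (-1) * ?q x)" and ?b = "\<lambda>x. flat 0 (?q x + - r\<^sup>2)"
  have as: "smooth_on UNIV ?a"
    by (rule smooth_on_compose[OF onb_real open_UNIV open_UNIV _ flat_smooth])
      (intro smooth_on_add smooth_on_mult smooth_on_const q_smooth open_UNIV subset_UNIV)+
  have bs: "smooth_on UNIV ?b"
    by (rule smooth_on_compose[OF onb_real open_UNIV open_UNIV _ flat_smooth])
      (intro smooth_on_add smooth_on_const q_smooth open_UNIV subset_UNIV)+
  \<comment> \<open>The two arguments of \<open>flat 0\<close> cannot both be nonpositive because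
    \<open>r < R\<close>, so the denominator of \<open>?h\<close> never vanishes.\<close>
  have pos: "?a x + ?b x > 0" for x
  proof (cases "?q x < R\<^sup>2")
    case True
    then have "?a x > 0" using flat_0_pos[of "R\<^sup>2 + (-1) * ?q x"] by simp
    then show ?thesis using flat_0_nonneg[of "?q x + - r\<^sup>2"] by linarith
  next
    case False
    moreover have "r\<^sup>2 < R\<^sup>2" using r by (simp add: power_strict_mono)
    ultimately have "?b x > 0" by (intro flat_0_pos) linarith
    then show ?thesis using flat_0_nonneg[of "R\<^sup>2 + (-1) * ?q x"] by linarith
  qed
  let ?h = "\<lambda>x. ?a x * inverse (?a x + ?b x)"
  have "smooth_on UNIV ?h"
    by (intro smooth_on_mult smooth_on_inverse smooth_on_add as bs open_UNIV) (rule less_imp_neq[OF pos, symmetric])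
  moreover have "?h x = 1" if "x \<in> ball x0 r" for x
  proof -
    have "?q x < r\<^sup>2" unfolding q using that r by (auto simp: dist_commute intro: power_strict_mono)
    then have "?b x = 0" by (intro flat_nonpos) linarith
    then show ?thesis using pos[of x] by simp
  qed
  moreover have "?h x = 0" if "x \<notin> cball x0 R" for x
  proof -
    have "R\<^sup>2 \<le> ?q x" unfolding q using that r by (auto simp: dist_commute intro: power_mono)
    then have "?a x = 0" by (intro flat_nonpos) linarith
    then show ?thesis by simp
  qed
  ultimately show ?thesis by blast
qed

text \<open>The ball is a closed subset of a box of coordinates, and the box is compact by induction
  on the basis. This serves the supports of cutoff functions.\<close>

lemma compact_cball_onb:
  fixes x0 :: "'e::real_inner"
  assumes B: "onb (B :: 'e set)"
  shows "compact (cball x0 R)"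
proof -
  have box: "compact {\<Sum>b\<in>C. c b *\<^sub>R b | c. \<forall>b\<in>C. \<bar>c b\<bar> \<le> M}" if "finite C" for C :: "'e set" and M
    using that
  proof (induction C)
    case empty
    then show ?case by simp
  next
    case (insert a C)
    let ?K = "\<lambda>C. {\<Sum>b\<in>C. c b *\<^sub>R b | c. \<forall>b\<in>C. \<bar>c b\<bar> \<le> M}"
    have *: "?K (insert a C) = (\<lambda>(x, s). x + s *\<^sub>R a) ` (?K C \<times> {-M..M})"
    proof safe
      fix c assume c: "\<forall>b\<in>insert a C. \<bar>c b\<bar> \<le> M"
      have "((\<Sum>b\<in>C. c b *\<^sub>R b), c a) \<in> ?K C \<times> {-M..M}" using c by auto
      moreover have "(\<Sum>b\<in>insert a C. c b *\<^sub>R b) = (\<lambda>(x, s). x + s *\<^sub>R a) ((\<Sum>b\<in>C. c b *\<^sub>R b), c a)"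
        using insert by (simp add: add.commute)
      ultimately show "(\<Sum>b\<in>insert a C. c b *\<^sub>R b) \<in> (\<lambda>(x, s). x + s *\<^sub>R a) ` (?K C \<times> {-M..M})" by (rule rev_image_eqI)
    next
      fix s c assume s: "s \<in> {-M..M}" and c: "\<forall>b\<in>C. \<bar>c b\<bar> \<le> M"
      have "(\<Sum>b\<in>C. c b *\<^sub>R b) + s *\<^sub>R a = (\<Sum>b\<in>insert a C. (c(a := s)) b *\<^sub>R b)"
        using insert by (simp add: add.commute) (rule sum.cong, auto)
      moreover have "\<forall>b\<in>insert a C. \<bar>(c(a := s)) b\<bar> \<le> M" using c s by auto
      ultimately show "\<exists>c'. (\<Sum>b\<in>C. c b *\<^sub>R b) + s *\<^sub>R a = (\<Sum>b\<in>insert a C. c' b *\<^sub>R b) \<and> (\<forall>b\<in>insert a C. \<bar>c' b\<bar> \<le> M)"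
        by blast
    qed
    have "continuous_on (?K C \<times> {-M..M}) (\<lambda>(x, s). x + s *\<^sub>R a)"
      unfolding case_prod_unfold by (intro continuous_intros)
    from compact_continuous_image[OF this compact_Times[OF insert.IH compact_Icc]]
    show ?case unfolding * .
  qed
  have finB: "finite B" using B by (simp add: onb_def)
  let ?K = "{\<Sum>b\<in>B. c b *\<^sub>R b | c. \<forall>b\<in>B. \<bar>c b\<bar> \<le> norm x0 + R}"
  have "cball x0 R \<subseteq> ?K"
  proof
    fix x assume "x \<in> cball x0 R"
    then have nx: "norm x \<le> norm x0 + R"
      using norm_triangle_ineq2[of x x0] by (simp add: dist_norm norm_minus_commute)
    have "\<bar>x \<bullet> b\<bar> \<le> norm x0 + R" if "b \<in> B" for b
      using onb_inner_le_norm[OF B that, of x] nx by linarith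
    then show "x \<in> ?K" using onb_expand[OF B, of x] by (intro CollectI exI[of _ "\<lambda>b. x \<bullet> b"]) auto
  qed
  then have "?K \<inter> cball x0 R = cball x0 R" by blast
  then show ?thesis using compact_Int_closed[OF box[OF finB] closed_cball, of "norm x0 + R" x0 R] by (simp only:)
qed

section \<open>Smooth functions and tangent vectors on a manifold\<close>

lemma sum_apply: "(\<Sum>i\<in>I. F i) x = (\<Sum>i\<in>I. F i x)"
  by (induction I rule: infinite_finite_induct) auto

definition model_basis :: "'e::real_inner set"
  where "model_basis = (SOME B. onb B)"

section \<open>Charts, smooth functions and cutoffs\<close>

locale smooth_mfd =
  fixes A :: "('a::{t2_space, second_countable_topology}, 'e::real_inner) atlas"
  assumes smooth_manifold: "smooth_manifold A"
begin

abbreviation "C \<equiv> smooth_funs A"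
abbreviation "T \<equiv> tangent A"
abbreviation "VF \<equiv> vector_fields A"
abbreviation "\<B> \<equiv> model_basis :: 'e set"

lemma onb_\<B>: "onb \<B>"
proof -
  have "\<exists>B::'e set. onb B" using smooth_manifold onb_exists unfolding smooth_manifold_def by blast
  then show ?thesis unfolding model_basis_def by (rule someI_ex)
qed

lemma finite_\<B> [simp]: "finite \<B>" using onb_\<B> by (simp add: onb_def)

lemma card_\<B>: "card \<B> = mdim A" using onb_card[OF onb_\<B>] by (simp add: mdim_def)

lemma chart:
  assumes "(V, \<phi>) \<in> A"
  shows chart_open: "open V" and chart_open_range: "open (\<phi> ` V)"
    and chart_inv [simp]: "\<And>q. q \<in> V \<Longrightarrow> inv_into V \<phi> (\<phi> q) = q"
    and chart_cont: "continuous_on V \<phi>" and chart_inv_cont: "continuous_on (\<phi> ` V) (inv_into V \<phi>)"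
    and chart_inj: "inj_on \<phi> V"
proof -
  have "open V \<and> open (\<phi> ` V) \<and> homeomorphism V (\<phi> ` V) \<phi> (inv_into V \<phi>)"
    using smooth_manifold assms unfolding smooth_manifold_def by blast
  then show "open V" "open (\<phi> ` V)" "\<And>q. q \<in> V \<Longrightarrow> inv_into V \<phi> (\<phi> q) = q"
    "continuous_on V \<phi>" "continuous_on (\<phi> ` V) (inv_into V \<phi>)"
    by (auto simp: homeomorphism_def)
  then show "inj_on \<phi> V" by (metis inj_on_inverseI)
qed

lemma chart_transition:
  "(V, \<phi>) \<in> A \<Longrightarrow> (V', \<phi>') \<in> A \<Longrightarrow> smooth_on (\<phi> ` (V \<inter> V')) (\<lambda>y. \<phi>' (inv_into V \<phi> y))"
  using smooth_manifold unfolding smooth_manifold_def o_def by blast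

lemma chart_exists: "\<exists>V \<phi>. (V, \<phi>) \<in> A \<and> p \<in> V"
proof -
  have "p \<in> (\<Union>(U, \<phi>)\<in>A. U)" using smooth_manifold unfolding smooth_manifold_def by blast
  then show ?thesis by auto
qed

lemma chart_image_open:
  assumes c: "(V, \<phi>) \<in> A" and "open W"
  shows "open (\<phi> ` (W \<inter> V))"
proof -
  have "\<phi> ` (W \<inter> V) = \<phi> ` V \<inter> inv_into V \<phi> -` W"
    using chart_inv[OF c] by (auto simp: image_iff) 
  then show ?thesis
    using continuous_open_preimage[OF chart_inv_cont[OF c] chart_open_range[OF c] assms(2)] by simp
qed

lemma chart_preimage_open:
  assumes c: "(V, \<phi>) \<in> A" and "open Q"
  shows "open (V \<inter> \<phi> -` Q)"
  by (rule continuous_open_preimage[OF chart_cont[OF c] chart_open[OF c] assms(2)])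

lemma sfo_iff: "smooth_fun_on A U f \<longleftrightarrow>
    (\<forall>(V, \<phi>)\<in>A. smooth_on (\<phi> ` (U \<inter> V)) (\<lambda>y. f (inv_into V \<phi> y)))"
  by (simp add: smooth_fun_on_def o_def)

lemma sfo_charts:
  "(\<And>V \<phi>. (V, \<phi>) \<in> A \<Longrightarrow> smooth_on (\<phi> ` (U \<inter> V)) (\<lambda>y. f (inv_into V \<phi> y))) \<Longrightarrow> smooth_fun_on A U f"
  unfolding sfo_iff by auto

lemma sfoD: "smooth_fun_on A U f \<Longrightarrow> (V, \<phi>) \<in> A \<Longrightarrow> smooth_on (\<phi> ` (U \<inter> V)) (\<lambda>y. f (inv_into V \<phi> y))"
  unfolding sfo_iff by auto

lemma sfo_const: "open U \<Longrightarrow> smooth_fun_on A U (\<lambda>q. c)"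
  by (intro sfo_charts smooth_on_const chart_image_open)

lemma sfo_add: "open U \<Longrightarrow> smooth_fun_on A U f \<Longrightarrow> smooth_fun_on A U g \<Longrightarrow> smooth_fun_on A U (\<lambda>q. f q + g q)"
  by (rule sfo_charts) (rule smooth_on_add[OF chart_image_open sfoD sfoD])

lemma sfo_mult: "open U \<Longrightarrow> smooth_fun_on A U f \<Longrightarrow> smooth_fun_on A U g \<Longrightarrow> smooth_fun_on A U (\<lambda>q. f q * g q)"
  by (rule sfo_charts) (rule smooth_on_mult[OF chart_image_open sfoD sfoD])

lemma sfo_inverse:
  assumes "open U" "smooth_fun_on A U f" "\<And>q. q \<in> U \<Longrightarrow> f q \<noteq> 0"
  shows "smooth_fun_on A U (\<lambda>q. inverse (f q))"
proof (rule sfo_charts)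
  fix V \<phi> assume c: "(V, \<phi>) \<in> A"
  show "smooth_on (\<phi> ` (U \<inter> V)) (\<lambda>y. inverse (f (inv_into V \<phi> y)))"
  proof (rule smooth_on_inverse[OF chart_image_open[OF c assms(1)]])
    show "smooth_on (\<phi> ` (U \<inter> V)) (\<lambda>y. f (inv_into V \<phi> y))" using assms(2) c by (rule sfoD)
  qed (use chart_inv[OF c] assms(3) in auto)
qed

lemma sfo_mono: "smooth_fun_on A U f \<Longrightarrow> W \<subseteq> U \<Longrightarrow> smooth_fun_on A W f"
  by (rule sfo_charts) (rule smooth_on_subset[OF sfoD], auto)

lemma sfo_cong:
  assumes "open U" "smooth_fun_on A U f" "\<And>q. q \<in> U \<Longrightarrow> f q = g q"
  shows "smooth_fun_on A U g"
proof (rule sfo_charts)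
  fix V \<phi> assume c: "(V, \<phi>) \<in> A"
  show "smooth_on (\<phi> ` (U \<inter> V)) (\<lambda>y. g (inv_into V \<phi> y))"
  proof (rule smooth_on_cong[OF chart_image_open[OF c assms(1)]])
    show "smooth_on (\<phi> ` (U \<inter> V)) (\<lambda>y. f (inv_into V \<phi> y))" using assms(2) c by (rule sfoD)
  qed (use chart_inv[OF c] assms(3) in auto)
qed

lemma sfo_local:
  assumes "open U" "\<And>p. p \<in> U \<Longrightarrow> \<exists>W. open W \<and> p \<in> W \<and> smooth_fun_on A (U \<inter> W) f"
  shows "smooth_fun_on A U f"
proof (rule sfo_charts)
  fix V \<phi> assume c: "(V, \<phi>) \<in> A"
  show "smooth_on (\<phi> ` (U \<inter> V)) (\<lambda>y. f (inv_into V \<phi> y))"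
  proof (rule smooth_on_local[OF chart_image_open[OF c assms(1)]])
    fix y assume "y \<in> \<phi> ` (U \<inter> V)"
    then obtain p where p: "p \<in> U" "p \<in> V" "y = \<phi> p" by blast
    obtain W where W: "open W" "p \<in> W" "smooth_fun_on A (U \<inter> W) f" using assms(2)[OF p(1)] by blast
    have "\<phi> ` (U \<inter> V) \<inter> \<phi> ` (W \<inter> V) = \<phi> ` (U \<inter> W \<inter> V)"
      using inj_on_image_Int[OF chart_inj[OF c], of "U \<inter> V" "W \<inter> V"] by (simp add: Int_ac)
    moreover have "smooth_on (\<phi> ` (U \<inter> W \<inter> V)) (\<lambda>y. f (inv_into V \<phi> y))"
      using W(3) c by (rule sfoD)
    ultimately show "\<exists>S. open S \<and> y \<in> S \<and> smooth_on (\<phi> ` (U \<inter> V) \<inter> S) (\<lambda>y. f (inv_into V \<phi> y))"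
      using chart_image_open[OF c W(1)] p W(2) by (intro exI[of _ "\<phi> ` (W \<inter> V)"]) auto
  qed
qed

text \<open>Smoothness seen in one chart passes to all the others through the transition
  maps.\<close>

lemma sfo_chart:
  assumes c: "(V, \<phi>) \<in> A" and Q: "open Q" "Q \<subseteq> \<phi> ` V" "smooth_on Q h"
  shows "smooth_fun_on A (V \<inter> \<phi> -` Q) (\<lambda>q. h (\<phi> q))"
proof (rule sfo_charts)
  fix V' \<phi>' assume c': "(V', \<phi>') \<in> A"
  have "smooth_on (\<phi>' ` (V' \<inter> V)) (\<lambda>y. \<phi> (inv_into V' \<phi>' y))" by (rule chart_transition[OF c' c])
  then have "smooth_on (\<phi>' ` (V \<inter> \<phi> -` Q \<inter> V')) (\<lambda>y. \<phi> (inv_into V' \<phi>' y))"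
    by (rule smooth_on_subset) auto
  moreover have "(\<lambda>y. \<phi> (inv_into V' \<phi>' y)) ` \<phi>' ` (V \<inter> \<phi> -` Q \<inter> V') \<subseteq> Q"
    using chart_inv[OF c'] by auto
  ultimately show "smooth_on (\<phi>' ` (V \<inter> \<phi> -` Q \<inter> V')) (\<lambda>y. h (\<phi> (inv_into V' \<phi>' y)))"
    by (intro smooth_on_compose[OF onb_\<B> chart_image_open[OF c' chart_preimage_open[OF c Q(1)]] Q(1) _ Q(3)])
qed

lemma sfo_chart_all:
  assumes c: "(V, \<phi>) \<in> A" and "smooth_on (\<phi> ` V) h"
  shows "smooth_fun_on A V (\<lambda>q. h (\<phi> q))"
  using sfo_chart[OF c chart_open_range[OF c] order_refl assms(2)]
  by (rule sfo_mono) auto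

lemma sfo_continuous:
  assumes U: "open U" and f: "smooth_fun_on A U f"
  shows "continuous_on U f"
proof (rule continuous_at_imp_continuous_on, rule ballI)
  fix p assume p: "p \<in> U"
  obtain V \<phi> where c: "(V, \<phi>) \<in> A" "p \<in> V" using chart_exists by blast
  have "continuous_on (\<phi> ` (U \<inter> V)) (\<lambda>y. f (inv_into V \<phi> y))"
    by (rule smooth_on_continuous[OF sfoD[OF f c(1)]])
  then have "continuous_on (U \<inter> V) (\<lambda>q. f (inv_into V \<phi> (\<phi> q)))"
    by (rule continuous_on_compose2) (auto intro: continuous_on_subset[OF chart_cont[OF c(1)]])
  then have "continuous_on (U \<inter> V) f"
    by (rule continuous_on_eq) (use chart_inv[OF c(1)] in auto)
  then show "isCont f p"
    using c p U chart_open[OF c(1)] by (simp add: continuous_on_eq_continuous_at open_Int)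
qed

lemma C_iff: "f \<in> C \<longleftrightarrow> smooth_fun_on A UNIV f" by (simp add: smooth_funs_def)

lemma C_const [simp, intro]: "(\<lambda>q. c) \<in> C" by (simp add: C_iff sfo_const)
lemma C_add [simp, intro]: "f \<in> C \<Longrightarrow> g \<in> C \<Longrightarrow> (\<lambda>q. f q + g q) \<in> C" by (simp add: C_iff sfo_add)
lemma C_mult [simp, intro]: "f \<in> C \<Longrightarrow> g \<in> C \<Longrightarrow> (\<lambda>q. f q * g q) \<in> C" by (simp add: C_iff sfo_mult)
lemma C_minus [simp, intro]: "f \<in> C \<Longrightarrow> (\<lambda>q. - f q) \<in> C" using C_mult[of "\<lambda>q. -1" f] by simp
lemma C_diff [simp, intro]: "f \<in> C \<Longrightarrow> g \<in> C \<Longrightarrow> (\<lambda>q. f q - g q) \<in> C"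
  using C_add[of f "\<lambda>q. - g q"] by simp
lemma C_sum [intro]: "(\<And>i. i \<in> I \<Longrightarrow> f i \<in> C) \<Longrightarrow> (\<lambda>q. \<Sum>i\<in>I. f i q) \<in> C"
  by (induction I rule: infinite_finite_induct) auto

text \<open>The open sets \<open>U\<close> and the complement of \<open>K\<close> cover the
  manifold. On the first the product is smooth, on the second it is 0. This is how local data become
  global functions.\<close>

lemma cutoff_smooth:
  assumes "ch \<in> C" "open U" "closed K" "K \<subseteq> U" "\<And>q. q \<notin> K \<Longrightarrow> ch q = 0" "smooth_fun_on A U f"
  shows "(\<lambda>q. ch q * f q) \<in> C"
  unfolding C_iff
proof (rule sfo_local[OF open_UNIV])
  fix p
  show "\<exists>W. open W \<and> p \<in> W \<and> smooth_fun_on A (UNIV \<inter> W) (\<lambda>q. ch q * f q)"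
  proof (cases "p \<in> U")
    case True
    then show ?thesis
      using assms sfo_mult[OF assms(2) sfo_mono[of UNIV ch] assms(6)] by (intro exI[of _ U]) (auto simp: C_iff)
  next
    case False
    have "smooth_fun_on A (- K) (\<lambda>q. ch q * f q)"
      by (rule sfo_cong[OF _ sfo_const[of "-K" 0]]) (use assms in auto)
    then show ?thesis using False assms by (intro exI[of _ "- K"]) auto
  qed
qed

lemma bump:
  assumes U: "open U" "p \<in> U"
  obtains ch W K where "ch \<in> C" "open W" "p \<in> W" "W \<subseteq> U" "\<And>q. q \<in> W \<Longrightarrow> ch q = 1"
    "closed K" "K \<subseteq> U" "\<And>q. q \<notin> K \<Longrightarrow> ch q = 0"
proof -
  obtain V \<phi> where c: "(V, \<phi>) \<in> A" "p \<in> V" using chart_exists by blast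
  have "open (\<phi> ` (U \<inter> V))" by (rule chart_image_open[OF c(1) U(1)])
  moreover have "\<phi> p \<in> \<phi> ` (U \<inter> V)" using c U by blast
  ultimately obtain R where R: "R > 0" "cball (\<phi> p) R \<subseteq> \<phi> ` (U \<inter> V)"
    using open_contains_cball by blast
  obtain h where h: "smooth_on UNIV h" "\<And>x. x \<in> ball (\<phi> p) (R / 2) \<Longrightarrow> h x = (1::real)"
    "\<And>x. x \<notin> cball (\<phi> p) R \<Longrightarrow> h x = 0"
    using bump_exists[OF onb_\<B>, of "R / 2" R "\<phi> p"] R(1) by auto
  define ch where "ch q = (if q \<in> V then h (\<phi> q) else 0)" for q
  define K where "K = inv_into V \<phi> ` cball (\<phi> p) R"
  have sub: "cball (\<phi> p) R \<subseteq> \<phi> ` V" using R(2) by blast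
  have "compact K" unfolding K_def
    by (rule compact_continuous_image[OF continuous_on_subset[OF chart_inv_cont[OF c(1)] sub] compact_cball_onb[OF onb_\<B>]])
  \<comment> \<open>The Hausdorff property enters here: the compact set is closed in the whole
    manifold, so extension by 0 stays smooth outside the chart.\<close>
  then have K: "closed K" by (rule compact_imp_closed)
  have KU: "K \<subseteq> U \<inter> V"
  proof
    fix q assume "q \<in> K"
    then obtain y where y: "y \<in> cball (\<phi> p) R" "q = inv_into V \<phi> y" by (auto simp: K_def)
    then obtain q' where "q' \<in> U \<inter> V" "y = \<phi> q'" using R(2) by blast
    then show "q \<in> U \<inter> V" using y chart_inv[OF c(1)] by auto
  qed
  have off: "ch q = 0" if "q \<notin> K" for q
  proof (cases "q \<in> V")
    case True
    have "\<phi> q \<notin> cball (\<phi> p) R"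
    proof
      assume "\<phi> q \<in> cball (\<phi> p) R"
      then have "inv_into V \<phi> (\<phi> q) \<in> K" unfolding K_def by (rule imageI)
      then show False using that chart_inv[OF c(1) True] by simp
    qed
    then show ?thesis using h(3) True by (simp add: ch_def)
  qed (simp add: ch_def)
  have "ch \<in> C"
    unfolding C_iff
  proof (rule sfo_local[OF open_UNIV])
    fix q
    show "\<exists>W. open W \<and> q \<in> W \<and> smooth_fun_on A (UNIV \<inter> W) ch"
    proof (cases "q \<in> V")
      case True
      have "smooth_fun_on A V ch"
        by (rule sfo_cong[OF chart_open[OF c(1)] sfo_chart_all[OF c(1) smooth_on_subset[OF h(1)]]])
          (auto simp: ch_def)
      then show ?thesis using True chart_open[OF c(1)] by (intro exI[of _ V]) auto
    next
      case False
      have "smooth_fun_on A (- K) ch"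
        by (rule sfo_cong[OF _ sfo_const[of "-K" 0]]) (use K off in auto)
      then show ?thesis using False K KU by (intro exI[of _ "- K"]) auto
    qed
  qed
  moreover define W where "W = V \<inter> \<phi> -` ball (\<phi> p) (R / 2)"
  moreover have "open W" unfolding W_def by (rule chart_preimage_open[OF c(1) open_ball])
  moreover have "p \<in> W" using c R by (simp add: W_def)
  moreover have "W \<subseteq> U"
  proof
    fix q assume q: "q \<in> W"
    then have "\<phi> q \<in> cball (\<phi> p) R" using R(1) by (auto simp: W_def)
    then obtain q' where q': "q' \<in> U \<inter> V" "\<phi> q = \<phi> q'" using R(2) by blast
    then have "q = q'" using inj_onD[OF chart_inj[OF c(1)] q'(2)] q by (simp add: W_def)
    then show "q \<in> U" using q' by simp
  qed
  moreover have "ch q = 1" if "q \<in> W" for q using that h(2) by (simp add: W_def ch_def)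
  ultimately show ?thesis using that[of ch W K] K KU off by blast
qed

lemma sfo_extend:
  assumes "open U" "p \<in> U" "smooth_fun_on A U f"
  obtains g W where "g \<in> C" "open W" "p \<in> W" "W \<subseteq> U" "\<And>q. q \<in> W \<Longrightarrow> f q = g q"
proof -
  obtain ch W K where "ch \<in> C" "open W" "p \<in> W" "W \<subseteq> U" "\<And>q. q \<in> W \<Longrightarrow> ch q = 1"
    "closed K" "K \<subseteq> U" "\<And>q. q \<notin> K \<Longrightarrow> ch q = 0"
    by (rule bump[OF assms(1,2)]) blast
  then show ?thesis
    using that[of "\<lambda>q. ch q * f q" W] cutoff_smooth[of ch U K f] assms by auto
qed

lemma sfoI:
  assumes "open U" "\<And>p. p \<in> U \<Longrightarrow> \<exists>W g. open W \<and> p \<in> W \<and> g \<in> C \<and> (\<forall>q\<in>W. f q = g q)"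
  shows "smooth_fun_on A U f"
proof (rule sfo_local[OF assms(1)])
  fix p assume "p \<in> U"
  then obtain W g where W: "open W" "p \<in> W" "g \<in> C" "\<forall>q\<in>W. f q = g q" using assms(2) by blast
  have "smooth_fun_on A (U \<inter> W) f"
    by (rule sfo_cong[OF _ sfo_mono[of UNIV g]]) (use W assms(1) in \<open>auto simp: C_iff\<close>)
  then show "\<exists>W. open W \<and> p \<in> W \<and> smooth_fun_on A (U \<inter> W) f" using W by blast
qed

subsection \<open>Tangent vectors\<close>

lemma T_lin: "v \<in> T p \<Longrightarrow> f \<in> C \<Longrightarrow> g \<in> C \<Longrightarrow> v (\<lambda>q. a * f q + b * g q) = a * v f + b * v g"
  and T_mult: "v \<in> T p \<Longrightarrow> f \<in> C \<Longrightarrow> g \<in> C \<Longrightarrow> v (\<lambda>q. f q * g q) = f p * v g + g p * v f"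
  and T_junk: "v \<in> T p \<Longrightarrow> f \<notin> C \<Longrightarrow> v f = 0"
  by (auto simp: tangent_def)

lemma T_add: "v \<in> T p \<Longrightarrow> f \<in> C \<Longrightarrow> g \<in> C \<Longrightarrow> v (\<lambda>q. f q + g q) = v f + v g"
  using T_lin[of v p f g 1 1] by simp

lemma T_diff: "v \<in> T p \<Longrightarrow> f \<in> C \<Longrightarrow> g \<in> C \<Longrightarrow> v (\<lambda>q. f q - g q) = v f - v g"
  using T_lin[of v p f g 1 "-1"] by simp

lemma T_const: "v \<in> T p \<Longrightarrow> v (\<lambda>q. c) = 0"
proof -
  assume v: "v \<in> T p"
  have "v (\<lambda>q. 1 * 1) = 1 * v (\<lambda>q. 1) + 1 * v (\<lambda>q. 1)" using T_mult[OF v C_const C_const] .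
  then have "v (\<lambda>q. 1) = 0" by simp
  then show ?thesis using T_lin[OF v C_const C_const, of c 1 0 1] by simp
qed

lemma T_cmult: "v \<in> T p \<Longrightarrow> f \<in> C \<Longrightarrow> v (\<lambda>q. c * f q) = c * v f"
  using T_lin[of v p f f c 0] by simp

lemma T_sum:
  assumes v: "v \<in> T p" and I: "finite I" "\<And>i. i \<in> I \<Longrightarrow> f i \<in> C"
  shows "v (\<lambda>q. \<Sum>i\<in>I. f i q) = (\<Sum>i\<in>I. v (f i))"
  using I by (induction I rule: finite_induct) (auto simp: T_const[OF v] T_add[OF v] C_sum)

lemma subspace_T: "subspace (T p)"
  unfolding subspace_def
proof (intro conjI ballI allI)
  show "0 \<in> T p" by (simp add: tangent_def zero_fun_def)
  fix v w assume "v \<in> T p" "w \<in> T p"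
  then show "v + w \<in> T p" by (auto simp: tangent_def plus_fun_def algebra_simps)
next
  fix c v assume "v \<in> T p"
  then show "c *\<^sub>R v \<in> T p" by (auto simp: tangent_def algebra_simps)
qed

lemma T_0 [simp]: "0 \<in> T p" and T_plus [simp, intro]: "v \<in> T p \<Longrightarrow> w \<in> T p \<Longrightarrow> v + w \<in> T p"
  and T_scale [simp, intro]: "v \<in> T p \<Longrightarrow> c *\<^sub>R v \<in> T p"
  and T_minus_vec [simp, intro]: "v \<in> T p \<Longrightarrow> w \<in> T p \<Longrightarrow> v - w \<in> T p"
  and T_neg [simp, intro]: "v \<in> T p \<Longrightarrow> - v \<in> T p"
  using subspace_T[of p] by (auto simp: subspace_0 subspace_add subspace_scale subspace_diff subspace_neg)

lemma T_sum_vec: "(\<And>i. i \<in> I \<Longrightarrow> v i \<in> T p) \<Longrightarrow> (\<Sum>i\<in>I. v i) \<in> T p"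
  by (rule subspace_sum[OF subspace_T])

lemma T_eqI: "v \<in> T p \<Longrightarrow> w \<in> T p \<Longrightarrow> (\<And>f. f \<in> C \<Longrightarrow> v f = w f) \<Longrightarrow> v = w"
  by (rule ext) (metis T_junk)

text \<open>Tangent vectors act on global functions, so coordinate fields and coordinate functions
  are multiplied by a cutoff. Near \<open>p\<close> the cutoff is 1 and they are dual to each other;
  that they span is Hadamard's lemma.\<close>

lemma frame_exists:
  obtains W E \<xi> where "open W" "p \<in> W" "\<And>b. E b \<in> VF" "\<And>b. \<xi> b \<in> C"
    "\<And>q b c. q \<in> W \<Longrightarrow> b \<in> \<B> \<Longrightarrow> c \<in> \<B> \<Longrightarrow> E b q (\<xi> c) = (if b = c then 1 else 0)"
    "\<And>q v. q \<in> W \<Longrightarrow> v \<in> T q \<Longrightarrow> v = (\<Sum>b\<in>\<B>. v (\<xi> b) *\<^sub>R E b q)"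
proof -
  obtain V \<phi> where c: "(V, \<phi>) \<in> A" "p \<in> V" using chart_exists by blast
  have V: "open V" by (rule chart_open[OF c(1)])
  obtain ch W K where ch: "ch \<in> C" "open W" "p \<in> W" "W \<subseteq> V" "\<And>q. q \<in> W \<Longrightarrow> ch q = 1"
    "closed K" "K \<subseteq> V" "\<And>q. q \<notin> K \<Longrightarrow> ch q = 0"
    by (rule bump[OF V c(2)]) blast
  let ?inv = "inv_into V \<phi>"
  let ?D = "\<lambda>f y. frechet_derivative (\<lambda>y. f (?inv y)) (at y)"
  define E where "E b q f = (if f \<in> C then ch q * ?D f (\<phi> q) b else 0)" for b q f
  define \<xi> where "\<xi> b q = ch q * (\<phi> q \<bullet> b)" for b q
  have fV: "smooth_on (\<phi> ` V) (\<lambda>y. f (?inv y))" if "f \<in> C" for f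
  proof -
    have "smooth_on (\<phi> ` (UNIV \<inter> V)) (\<lambda>y. f (?inv y))" using that c(1) unfolding C_iff by (rule sfoD)
    then show ?thesis by simp
  qed
  have fd: "((\<lambda>y. f (?inv y)) has_derivative ?D f (\<phi> q)) (at (\<phi> q))" if "f \<in> C" "q \<in> V" for f q
    by (rule smooth_on_has_derivative[OF fV[OF that(1)] imageI[OF that(2)]])
  have E_T: "E b q \<in> T q" for b q
  proof (cases "q \<in> V")
    case False
    then have "ch q = 0" using ch by blast
    then show ?thesis by (simp add: E_def tangent_def)
  next
    case True
    show ?thesis
      unfolding tangent_def
    proof (intro CollectI conjI ballI allI impI)
      fix f g assume f: "f \<in> C" "g \<in> C"
      fix s t :: real
      have "((\<lambda>y. s * f (?inv y) + t * g (?inv y)) has_derivative (\<lambda>v. s * ?D f (\<phi> q) v + t * ?D g (\<phi> q) v)) (at (\<phi> q))"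
        by (intro has_derivative_add has_derivative_mult_right fd f True)
      from frechet_derivative_at[OF this, symmetric] show "E b q (\<lambda>q. s * f q + t * g q) = s * E b q f + t * E b q g"
        using f by (simp add: E_def algebra_simps)
      have "((\<lambda>y. f (?inv y) * g (?inv y)) has_derivative
          (\<lambda>v. f (?inv (\<phi> q)) * ?D g (\<phi> q) v + ?D f (\<phi> q) v * g (?inv (\<phi> q)))) (at (\<phi> q))"
        by (intro has_derivative_mult fd f True)
      from frechet_derivative_at[OF this, symmetric] show "E b q (\<lambda>q. f q * g q) = f q * E b q g + g q * E b q f"
        using f True chart_inv[OF c(1) True] by (simp add: E_def algebra_simps)
    next
      fix f assume "f \<notin> C"
      then show "E b q f = 0" by (simp add: E_def)
    qed
  qed
  have E_VF: "E b \<in> VF" for b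
    unfolding vector_fields_def tm_section_def
  proof (intro CollectI conjI ballI E_T)
    fix f assume f: "f \<in> C"
    have "(\<lambda>q. ch q * ?D f (\<phi> q) b) \<in> C"
      by (rule cutoff_smooth[OF ch(1) V ch(6,7,8) sfo_chart_all[OF c(1) smooth_on_frechet[OF fV[OF f]]]])
    then show "smooth_fun_on A UNIV (\<lambda>q. E b q f)" using f by (simp add: E_def C_iff)
  qed
  have \<xi>_C: "\<xi> b \<in> C" for b
    unfolding \<xi>_def
    by (rule cutoff_smooth[OF ch(1) V ch(6,7,8) sfo_chart_all[OF c(1)
          smooth_on_bounded_linear[OF chart_open_range[OF c(1)] bounded_linear_inner_left]]])
  have delta: "E b q (\<xi> c') = (if b = c' then 1 else 0)" if q: "q \<in> W" and b: "b \<in> \<B>" "c' \<in> \<B>" for q b c'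
  proof -
    have "((\<lambda>y. \<xi> c' (?inv y)) has_derivative (\<lambda>v. v \<bullet> c')) (at (\<phi> q))"
    proof (rule has_derivative_transform_within_open)
      show "((\<lambda>y. y \<bullet> c') has_derivative (\<lambda>v. v \<bullet> c')) (at (\<phi> q))"
        by (rule bounded_linear_imp_has_derivative[OF bounded_linear_inner_left])
      show "open (\<phi> ` (W \<inter> V))" by (rule chart_image_open[OF c(1) ch(2)])
      show "\<phi> q \<in> \<phi> ` (W \<inter> V)" using q ch(4) by blast
      show "y \<bullet> c' = \<xi> c' (?inv y)" if "y \<in> \<phi> ` (W \<inter> V)" for y
        using that chart_inv[OF c(1)] ch(5) by (auto simp: \<xi>_def)
    qed
    from frechet_derivative_at[OF this] have "?D (\<xi> c') (\<phi> q) b = b \<bullet> c'" by metis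
    then show ?thesis using \<xi>_C ch(5)[OF q] b onb_\<B> by (simp add: E_def onb_def)
  qed
  have expand: "v = (\<Sum>b\<in>\<B>. v (\<xi> b) *\<^sub>R E b q)" if q: "q \<in> W" and v: "v \<in> T q" for q v
  proof (rule T_eqI[OF v])
    show "(\<Sum>b\<in>\<B>. v (\<xi> b) *\<^sub>R E b q) \<in> T q" by (intro T_sum_vec T_scale E_T)
    fix f assume f: "f \<in> C"
    have qV: "q \<in> V" using q ch(4) by blast
    have "open (\<phi> ` (W \<inter> V))" by (rule chart_image_open[OF c(1) ch(2)])
    moreover have "\<phi> q \<in> \<phi> ` (W \<inter> V)" using q ch(4) by blast
    ultimately obtain \<rho> where \<rho>: "\<rho> > 0" "ball (\<phi> q) \<rho> \<subseteq> \<phi> ` (W \<inter> V)"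
      by (meson open_contains_ball)
    have ballV: "ball (\<phi> q) \<rho> \<subseteq> \<phi> ` V" using \<rho>(2) by blast
    obtain g where g: "\<And>b. smooth_on (ball (\<phi> q) \<rho>) (g b)"
      "\<And>x. x \<in> ball (\<phi> q) \<rho> \<Longrightarrow> f (?inv x) = f (?inv (\<phi> q)) + (\<Sum>b\<in>\<B>. ((x - \<phi> q) \<bullet> b) * g b x)"
      "\<And>b. g b (\<phi> q) = ?D f (\<phi> q) b"
      using Hadamard[OF onb_\<B> smooth_on_subset[OF fV[OF f] ballV]] by blast
    define U where "U = V \<inter> \<phi> -` ball (\<phi> q) \<rho>"
    have U: "open U" "q \<in> U" unfolding U_def using chart_preimage_open[OF c(1) open_ball] qV \<rho>(1) by auto
    have UW: "U \<subseteq> W"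
    proof
      fix q' assume q': "q' \<in> U"
      then obtain q'' where q'': "q'' \<in> W \<inter> V" "\<phi> q' = \<phi> q''" using \<rho>(2) unfolding U_def by blast
      then have "q' = q''" using inj_onD[OF chart_inj[OF c(1)] q''(2)] q' by (simp add: U_def)
      then show "q' \<in> W" using q'' by simp
    qed
    obtain ch' W' K' where ch': "ch' \<in> C" "open W'" "q \<in> W'" "W' \<subseteq> U" "\<And>q. q \<in> W' \<Longrightarrow> ch' q = 1"
      "closed K'" "K' \<subseteq> U" "\<And>q. q \<notin> K' \<Longrightarrow> ch' q = 0"
      by (rule bump[OF U]) blast
    define G where "G b q' = ch' q' * g b (\<phi> q')" for b q'
    have G: "G b \<in> C" for b
      unfolding G_def
      by (rule cutoff_smooth[OF ch'(1) U(1) ch'(6,7,8) sfo_chart[OF c(1) open_ball ballV g(1), folded U_def]])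
    have ch'q: "ch' q = 1" using ch' by blast
    \<comment> \<open>Hadamard's expansion made global by the second cutoff \<open>ch'\<close>. The
      first summand is a product of two functions vanishing at \<open>q\<close>, so every derivation
      at \<open>q\<close> kills it.\<close>
    have eq: "f = (\<lambda>q'. (1 - ch' q') * (f q' - f q) + (f q + (\<Sum>b\<in>\<B>. (\<xi> b q' - \<xi> b q) * G b q')))"
    proof
      fix q'
      show "f q' = (1 - ch' q') * (f q' - f q) + (f q + (\<Sum>b\<in>\<B>. (\<xi> b q' - \<xi> b q) * G b q'))"
      proof (cases "q' \<in> U")
        case False
        then have "ch' q' = 0" using ch' by blast
        then show ?thesis by (simp add: G_def)
      next
        case True
        then have "\<phi> q' \<in> ball (\<phi> q) \<rho>" "q' \<in> V" "q' \<in> W" using UW by (auto simp: U_def)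
        then have "f q' - f q = (\<Sum>b\<in>\<B>. (\<xi> b q' - \<xi> b q) * g b (\<phi> q'))"
          using g(2)[of "\<phi> q'"] chart_inv[OF c(1)] qV q ch(5) by (simp add: \<xi>_def inner_diff_left)
        then have "ch' q' * (f q' - f q) = (\<Sum>b\<in>\<B>. (\<xi> b q' - \<xi> b q) * G b q')"
          by (simp add: G_def sum_distrib_left mult_ac)
        then show ?thesis by (simp add: algebra_simps)
      qed
    qed
    have 1: "v (\<lambda>q'. (1 - ch' q') * (f q' - f q)) = 0"
      by (subst T_mult[OF v]) (use f ch' ch'q in auto)
    have 2: "v (\<lambda>q'. (\<xi> b q' - \<xi> b q) * G b q') = v (\<xi> b) * E b q f" for b
    proof -
      have "v (\<lambda>q'. (\<xi> b q' - \<xi> b q) * G b q') = G b q * v (\<xi> b)"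
        by (subst T_mult[OF v]) (use \<xi>_C G T_diff[OF v \<xi>_C C_const] T_const[OF v] in auto)
      also have "G b q = E b q f" using f ch(5)[OF q] g(3) by (simp add: G_def E_def ch'q)
      finally show ?thesis by simp
    qed
    have "v f = v (\<lambda>q'. (1 - ch' q') * (f q' - f q) + (f q + (\<Sum>b\<in>\<B>. (\<xi> b q' - \<xi> b q) * G b q')))"
      by (rule arg_cong[OF eq])
    also have "\<dots> = (\<Sum>b\<in>\<B>. v (\<xi> b) * E b q f)"
      using 1 2 f ch'(1) \<xi>_C G
      by (simp add: T_add[OF v] T_const[OF v] T_sum[OF v] C_sum)
    finally show "v f = (\<Sum>b\<in>\<B>. v (\<xi> b) *\<^sub>R E b q) f"
      by (simp add: sum_apply)
  qed
  show ?thesis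
    by (rule that[OF ch(2,3) E_VF \<xi>_C delta expand])
qed

end

section \<open>Vector fields and tensoriality\<close>

lemma nths_Cons_zero: "nths (v # vs) (- {0}) = vs"
  by (simp add: nths_Cons nths_all)

lemma nths_Cons_Suc: "nths (v # vs) (- {Suc i}) = v # nths vs (- {i})"
  by (simp add: nths_Cons Compl_eq)

lemma wedge_left_Nil [simp]: "wedge_left \<alpha> \<eta> [] = 0"
  by (simp add: wedge_left_def)

lemma wedge_left_Cons:
  "wedge_left \<alpha> \<eta> (v # vs) = \<alpha> v * \<eta> vs - wedge_left \<alpha> (\<lambda>ws. \<eta> (v # ws)) vs"
  unfolding wedge_left_def length_Cons sum.lessThan_Suc_shift
  by (simp add: nths_Cons_zero nths_Cons_Suc sum_negf)

lemma wedge_left_lin: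
  "wedge_left \<alpha> (\<lambda>ws. a * \<eta> ws + b * \<eta>' ws) vs = a * wedge_left \<alpha> \<eta> vs + b * wedge_left \<alpha> \<eta>' vs"
  unfolding wedge_left_def by (simp add: sum_distrib_left sum.distrib distrib_left mult_ac)

context smooth_mfd
begin

lemma VF_T [simp]: "X \<in> VF \<Longrightarrow> X p \<in> T p"
  and VF_C [simp]: "X \<in> VF \<Longrightarrow> f \<in> C \<Longrightarrow> (\<lambda>p. X p f) \<in> C"
  unfolding vector_fields_def tm_section_def smooth_funs_def by blast+

lemma VFI: "(\<And>p. X p \<in> T p) \<Longrightarrow> (\<And>f. f \<in> C \<Longrightarrow> (\<lambda>p. X p f) \<in> C) \<Longrightarrow> X \<in> VF"
  unfolding vector_fields_def tm_section_def smooth_funs_def by blast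

lemma VF_add [simp]: "X \<in> VF \<Longrightarrow> Y \<in> VF \<Longrightarrow> (\<lambda>p. X p + Y p) \<in> VF"
  by (rule VFI) auto

lemma VF_fmult [simp]: "f \<in> C \<Longrightarrow> X \<in> VF \<Longrightarrow> (\<lambda>p. f p *\<^sub>R X p) \<in> VF"
  by (rule VFI) auto

lemma VF_0 [simp]: "(\<lambda>p. 0) \<in> VF"
  by (rule VFI) auto

lemma VF_scale [simp]: "X \<in> VF \<Longrightarrow> (\<lambda>p. c *\<^sub>R X p) \<in> VF"
  using VF_fmult[of "\<lambda>_. c" X] by simp

lemma VF_minus [simp]: "X \<in> VF \<Longrightarrow> (\<lambda>p. - X p) \<in> VF"
  using VF_scale[of X "-1"] by simp

lemma VF_diff [simp]: "X \<in> VF \<Longrightarrow> Y \<in> VF \<Longrightarrow> (\<lambda>p. X p - Y p) \<in> VF"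
  using VF_add[of X "\<lambda>p. - Y p"] by simp

lemma VF_sum: "(\<And>i. i \<in> I \<Longrightarrow> X i \<in> VF) \<Longrightarrow> (\<lambda>p. \<Sum>i\<in>I. X i p) \<in> VF"
  by (induction I rule: infinite_finite_induct) auto

lemma VF_lie [simp]:
  assumes X: "X \<in> VF" and Y: "Y \<in> VF"
  shows "lie X Y \<in> VF"
proof (rule VFI)
  fix p
  show "lie X Y p \<in> T p"
    unfolding tangent_def
  proof (intro CollectI conjI ballI allI impI)
    fix f g :: "'a \<Rightarrow> real" and a b :: real assume f: "f \<in> C" "g \<in> C"
    have 1: "(\<lambda>q. Z q (\<lambda>q. a * f q + b * g q)) = (\<lambda>q. a * Z q f + b * Z q g)" if "Z \<in> VF" for Z
      using T_lin[OF VF_T[OF that] f] by simp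
    show "lie X Y p (\<lambda>q. a * f q + b * g q) = a * lie X Y p f + b * lie X Y p g"
      unfolding lie_def 1[OF X] 1[OF Y] using X Y f by (simp add: T_lin[OF VF_T[OF X]] T_lin[OF VF_T[OF Y]] algebra_simps)
    have 2: "(\<lambda>q. Z q (\<lambda>q. f q * g q)) = (\<lambda>q. f q * Z q g + g q * Z q f)" if "Z \<in> VF" for Z
      using T_mult[OF VF_T[OF that] f] by simp
    show "lie X Y p (\<lambda>q. f q * g q) = f p * lie X Y p g + g p * lie X Y p f"
      unfolding lie_def 2[OF X] 2[OF Y] using X Y f
      by (simp add: T_add[OF VF_T[OF X]] T_add[OF VF_T[OF Y]] T_mult[OF VF_T[OF X]] T_mult[OF VF_T[OF Y]] algebra_simps)
  next
    fix f assume "f \<notin> C"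
    then show "lie X Y p f = 0"
      using T_junk[OF VF_T[OF X]] T_junk[OF VF_T[OF Y]] T_const[OF VF_T[OF X]] T_const[OF VF_T[OF Y]]
      by (simp add: lie_def)
  qed
  fix f assume "f \<in> C"
  then show "(\<lambda>p. lie X Y p f) \<in> C" using X Y by (simp add: lie_def)
qed

lemma lie_anti: "lie X Y p = - lie Y X p"
  by (simp add: lie_def fun_eq_iff)

lemma lie_add_right:
  assumes X: "X \<in> VF" and Y: "Y \<in> VF" and Z: "Z \<in> VF"
  shows "lie X (\<lambda>q. Y q + Z q) p = lie X Y p + lie X Z p"
proof (rule T_eqI[of _ p])
  fix f assume "f \<in> C"
  then show "lie X (\<lambda>q. Y q + Z q) p f = (lie X Y p + lie X Z p) f"
    using assms by (simp add: lie_def T_add[OF VF_T[OF X]])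
qed (use assms in \<open>auto intro!: VF_T VF_lie T_plus VF_add\<close>)

lemma lie_fmult_right:
  assumes "X \<in> VF" "Y \<in> VF" "f \<in> C"
  shows "lie X (\<lambda>q. f q *\<^sub>R Y q) p = f p *\<^sub>R lie X Y p + X p f *\<^sub>R Y p"
proof (rule T_eqI[of _ p])
  fix g assume "g \<in> C"
  then show "lie X (\<lambda>q. f q *\<^sub>R Y q) p g = (f p *\<^sub>R lie X Y p + X p f *\<^sub>R Y p) g"
    using assms by (simp add: lie_def T_mult[OF VF_T[OF assms(1)]] algebra_simps)
qed (use assms in \<open>auto intro!: VF_T VF_lie T_plus T_scale VF_fmult\<close>)

lemma lie_add_left:
  "X \<in> VF \<Longrightarrow> Y \<in> VF \<Longrightarrow> Z \<in> VF \<Longrightarrow> lie (\<lambda>q. Y q + Z q) X p = lie Y X p + lie Z X p"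
  by (subst (1 2 3) lie_anti) (simp add: lie_add_right)

lemma lie_fmult_left:
  "X \<in> VF \<Longrightarrow> Y \<in> VF \<Longrightarrow> f \<in> C \<Longrightarrow> lie (\<lambda>q. f q *\<^sub>R Y q) X p = f p *\<^sub>R lie Y X p - X p f *\<^sub>R Y p"
  by (subst (1 2) lie_anti) (simp add: lie_fmult_right)

lemma lie_scale_left: "X \<in> VF \<Longrightarrow> Y \<in> VF \<Longrightarrow> lie (\<lambda>q. c *\<^sub>R Y q) X p = c *\<^sub>R lie Y X p"
  using lie_fmult_left[of X Y "\<lambda>_. c" p] T_const[OF VF_T] by simp

lemma lie_apply: "f \<in> C \<Longrightarrow> lie X Y p f = X p (\<lambda>q. Y q f) - Y p (\<lambda>q. X q f)"
  by (simp add: lie_def)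

lemma lie_jacobi:
  assumes X: "X \<in> VF" and Y: "Y \<in> VF" and Z: "Z \<in> VF"
  shows "lie X (lie Y Z) p = lie (lie X Y) Z p + lie Y (lie X Z) p"
proof (rule T_eqI[of _ p])
  fix f assume f: "f \<in> C"
  show "lie X (lie Y Z) p f = (lie (lie X Y) Z p + lie Y (lie X Z) p) f"
    unfolding lie_def using X Y Z f by (simp add: T_diff[OF VF_T[OF X]] T_diff[OF VF_T[OF Y]] T_diff[OF VF_T[OF Z]])
qed (use assms in auto)

lemma vf_ext:
  assumes v: "v \<in> T p"
  obtains X where "X \<in> VF" "X p = v"
proof -
  obtain W E \<xi> where W: "open W" "p \<in> W" "\<And>b. E b \<in> VF" "\<And>b. \<xi> b \<in> C"
    "\<And>q b c. q \<in> W \<Longrightarrow> b \<in> \<B> \<Longrightarrow> c \<in> \<B> \<Longrightarrow> E b q (\<xi> c) = (if b = c then 1 else 0)"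
    "\<And>q v. q \<in> W \<Longrightarrow> v \<in> T q \<Longrightarrow> v = (\<Sum>b\<in>\<B>. v (\<xi> b) *\<^sub>R E b q)"
    by (rule frame_exists[of p]) blast
  show ?thesis
    by (rule that[of "\<lambda>q. \<Sum>b\<in>\<B>. v (\<xi> b) *\<^sub>R E b q"]) (use W v in \<open>auto intro: VF_sum VF_scale\<close>)
qed

lemma vfs_ext:
  assumes "set vs \<subseteq> T p"
  obtains Xs where "set Xs \<subseteq> VF" "map (\<lambda>X. X p) Xs = vs"
  using assms
proof (induction vs arbitrary: thesis)
  case Nil
  show ?case by (rule Nil(1)[of "[]"]) auto
next
  case (Cons v vs)
  obtain Xs where Xs: "set Xs \<subseteq> VF" "map (\<lambda>X. X p) Xs = vs"
    using Cons.IH Cons.prems(2) by auto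
  obtain X where X: "X \<in> VF" "X p = v" using vf_ext[of v p] Cons.prems(2) by auto
  show ?case by (rule Cons.prems(1)[of "X # Xs"]) (use Xs X in auto)
qed

text \<open>A field that vanishes at \<open>p\<close> is a sum of frame fields with coefficients
  vanishing at \<open>p\<close>, up to a term with the factor \<open>1 - ch\<close>, which vanishes
  there too. A map that is linear over functions kills every such summand.\<close>

lemma tensorial:
  fixes F :: "('a \<Rightarrow> 'a tvec) \<Rightarrow> real"
  assumes add: "\<And>X Y. X \<in> VF \<Longrightarrow> Y \<in> VF \<Longrightarrow> F (\<lambda>q. X q + Y q) = F X + F Y"
    and mult: "\<And>f X. f \<in> C \<Longrightarrow> X \<in> VF \<Longrightarrow> F (\<lambda>q. f q *\<^sub>R X q) = f p * F X"
    and XY: "X \<in> VF" "Y \<in> VF" "X p = Y p"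
  shows "F X = F Y"
proof -
  \<comment> \<open>The sign is written as a constant function times \<open>Y\<close>, so that
    \<open>mult\<close> covers it.\<close>
  define Z where "Z = (\<lambda>q. X q + (-1) *\<^sub>R Y q)"
  have Z: "Z \<in> VF" "Z p = 0" using XY VF_add[of X "\<lambda>q. (-1) *\<^sub>R Y q"] VF_scale[of Y "-1"] by (auto simp: Z_def)
  obtain W E \<xi> where W: "open W" "p \<in> W" "\<And>b. E b \<in> VF" "\<And>b. \<xi> b \<in> C"
    "\<And>q b c. q \<in> W \<Longrightarrow> b \<in> \<B> \<Longrightarrow> c \<in> \<B> \<Longrightarrow> E b q (\<xi> c) = (if b = c then 1 else 0)"
    "\<And>q v. q \<in> W \<Longrightarrow> v \<in> T q \<Longrightarrow> v = (\<Sum>b\<in>\<B>. v (\<xi> b) *\<^sub>R E b q)"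
    by (rule frame_exists[of p]) blast
  obtain ch W' K where ch: "ch \<in> C" "open W'" "p \<in> W'" "W' \<subseteq> W" "\<And>q. q \<in> W' \<Longrightarrow> ch q = 1"
    "closed K" "K \<subseteq> W" "\<And>q. q \<notin> K \<Longrightarrow> ch q = 0"
    by (rule bump[OF W(1,2)]) blast
  have F0: "F (\<lambda>q. 0) = 0" using mult[of "\<lambda>_. 0" "\<lambda>_. 0"] by simp
  have Fs: "F (\<lambda>q. \<Sum>i\<in>I. g i q *\<^sub>R E i q) = (\<Sum>i\<in>I. g i p * F (E i))" if "finite I" "\<And>i. g i \<in> C" for I g
    using that
  proof (induction I)
    case (insert i I)
    then have "F (\<lambda>q. g i q *\<^sub>R E i q + (\<Sum>i\<in>I. g i q *\<^sub>R E i q)) = F (\<lambda>q. g i q *\<^sub>R E i q) + F (\<lambda>q. \<Sum>i\<in>I. g i q *\<^sub>R E i q)"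
      using W(3) by (intro add VF_fmult VF_sum) auto
    moreover have "F (\<lambda>q. g i q *\<^sub>R E i q) = g i p * F (E i)" using insert W(3) by (intro mult) auto
    moreover have "F (\<lambda>q. \<Sum>i\<in>I. g i q *\<^sub>R E i q) = (\<Sum>i\<in>I. g i p * F (E i))"
      by (rule insert.IH) (rule insert.prems)
    ultimately show ?case by (simp only: sum.insert[OF insert.hyps])
  qed (simp add: F0)
  have eq: "Z = (\<lambda>q. (1 - ch q) *\<^sub>R Z q + (\<Sum>b\<in>\<B>. (ch q * Z q (\<xi> b)) *\<^sub>R E b q))"
  proof
    fix q
    show "Z q = (1 - ch q) *\<^sub>R Z q + (\<Sum>b\<in>\<B>. (ch q * Z q (\<xi> b)) *\<^sub>R E b q)"
    proof (cases "q \<in> W")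
      case True
      have "(\<Sum>b\<in>\<B>. (ch q * Z q (\<xi> b)) *\<^sub>R E b q) = ch q *\<^sub>R (\<Sum>b\<in>\<B>. Z q (\<xi> b) *\<^sub>R E b q)"
        by (simp add: scaleR_right.sum)
      also have "\<dots> = ch q *\<^sub>R Z q" using W(6)[OF True VF_T[OF Z(1)]] by simp
      finally show ?thesis by (simp add: scaleR_left_diff_distrib)
    next
      case False
      then show ?thesis using ch(7,8) by (metis (no_types, lifting) diff_zero add.right_neutral
          mult_zero_left scaleR_one scaleR_zero_left subsetD sum.neutral)
    qed
  qed
  have "F Z = F (\<lambda>q. (1 - ch q) *\<^sub>R Z q + (\<Sum>b\<in>\<B>. (ch q * Z q (\<xi> b)) *\<^sub>R E b q))"
    by (rule arg_cong[OF eq])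
  also have "\<dots> = F (\<lambda>q. (1 - ch q) *\<^sub>R Z q) + F (\<lambda>q. \<Sum>b\<in>\<B>. (ch q * Z q (\<xi> b)) *\<^sub>R E b q)"
    using Z W ch(1) by (intro add VF_fmult VF_sum) auto
  also have "\<dots> = (1 - ch p) * F Z + (\<Sum>b\<in>\<B>. (ch p * Z p (\<xi> b)) * F (E b))"
    using Z W(4) ch(1) Fs[of \<B> "\<lambda>b q. ch q * Z q (\<xi> b)"] mult[of "\<lambda>q. 1 - ch q" Z] by simp
  also have "\<dots> = 0" using ch(3,5) Z(2) by simp
  finally have "F Z = 0" .
  moreover have "F Z = F X + (-1) * F Y"
    unfolding Z_def using XY add[of X "\<lambda>q. (-1) *\<^sub>R Y q"] mult[of "\<lambda>_. -1" Y] VF_scale[of Y "-1"] by simp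
  ultimately show ?thesis by simp
qed

section \<open>Differential forms\<close>

abbreviation "\<Omega> \<equiv> forms A"

definition ev :: "('a \<Rightarrow> 'a tvec) list \<Rightarrow> 'a \<Rightarrow> 'a tvec list"
  where "ev Xs p = map (\<lambda>X. X p) Xs"

lemma ev_simps [simp]: "ev [] p = []" "ev (X # Xs) p = X p # ev Xs p" "ev (Xs @ Ys) p = ev Xs p @ ev Ys p"
  "length (ev Xs p) = length Xs"
  by (simp_all add: ev_def)

lemma set_ev: "set Xs \<subseteq> VF \<Longrightarrow> set (ev Xs p) \<subseteq> T p"
  by (induction Xs) auto

lemma form_outside: "\<omega> \<in> \<Omega> \<Longrightarrow> \<not> set vs \<subseteq> T p \<Longrightarrow> \<omega> p vs = 0"
  by (simp add: forms_def)

lemma form_slot: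
  "\<omega> \<in> \<Omega> \<Longrightarrow> v \<in> T p \<Longrightarrow> w \<in> T p \<Longrightarrow>
    \<omega> p (us @ (a *\<^sub>R v + b *\<^sub>R w) # ws) = a * \<omega> p (us @ v # ws) + b * \<omega> p (us @ w # ws)"
  by (simp add: forms_def)

lemma form_distinct: "\<omega> \<in> \<Omega> \<Longrightarrow> \<not> distinct vs \<Longrightarrow> \<omega> p vs = 0"
  by (simp add: forms_def)

lemma form_C: "\<omega> \<in> \<Omega> \<Longrightarrow> set Xs \<subseteq> VF \<Longrightarrow> (\<lambda>p. \<omega> p (ev Xs p)) \<in> C"
  by (simp add: forms_def ev_def)

lemma form_C_Nil [simp]: "\<omega> \<in> \<Omega> \<Longrightarrow> (\<lambda>p. \<omega> p []) \<in> C"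
  using form_C[of \<omega> "[]"] by simp

lemma form_head:
  "\<omega> \<in> \<Omega> \<Longrightarrow> v \<in> T p \<Longrightarrow> w \<in> T p \<Longrightarrow> \<omega> p ((a *\<^sub>R v + b *\<^sub>R w) # ws) = a * \<omega> p (v # ws) + b * \<omega> p (w # ws)"
  using form_slot[of \<omega> v p w "[]"] by simp

lemma form_add: "\<omega> \<in> \<Omega> \<Longrightarrow> v \<in> T p \<Longrightarrow> w \<in> T p \<Longrightarrow> \<omega> p ((v + w) # ws) = \<omega> p (v # ws) + \<omega> p (w # ws)"
  using form_head[of \<omega> v p w 1 1] by simp

lemma form_scale: "\<omega> \<in> \<Omega> \<Longrightarrow> v \<in> T p \<Longrightarrow> \<omega> p (c *\<^sub>R v # ws) = c * \<omega> p (v # ws)"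
  using form_head[of \<omega> v p v c 0] by simp

lemma form_0 [simp]: "\<omega> \<in> \<Omega> \<Longrightarrow> \<omega> p (0 # ws) = 0"
  using form_scale[of \<omega> 0 p 0] by simp

lemma form_neg: "\<omega> \<in> \<Omega> \<Longrightarrow> v \<in> T p \<Longrightarrow> \<omega> p (- v # ws) = - \<omega> p (v # ws)"
  using form_scale[of \<omega> v p "-1"] by simp

lemma form_diff: "\<omega> \<in> \<Omega> \<Longrightarrow> v \<in> T p \<Longrightarrow> w \<in> T p \<Longrightarrow> \<omega> p ((v - w) # ws) = \<omega> p (v # ws) - \<omega> p (w # ws)"
  using form_head[of \<omega> v p w 1 "-1"] by simp

text \<open>Polarisation: \<open>v + w\<close> is put into both slots, where the form vanishes
  because an entry is repeated.\<close>

lemma form_swap: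
  assumes w: "\<omega> \<in> \<Omega>"
  shows "\<omega> p (us @ v # w # ws) = - \<omega> p (us @ w # v # ws)"
proof (cases "v \<in> T p \<and> w \<in> T p")
  case False
  then have "\<not> set (us @ v # w # ws) \<subseteq> T p" "\<not> set (us @ w # v # ws) \<subseteq> T p" by auto
  then show ?thesis using form_outside[OF w] by simp
next
  case True
  have s: "\<omega> p (us @ (1 *\<^sub>R v + 1 *\<^sub>R w) # ws') = 1 * \<omega> p (us @ v # ws') + 1 * \<omega> p (us @ w # ws')" for us ws'
    using True by (intro form_slot w) auto
  have "0 = \<omega> p (us @ (v + w) # (v + w) # ws)" by (rule form_distinct[OF w, symmetric]) simp
  also have "\<dots> = \<omega> p (us @ v # (v + w) # ws) + \<omega> p (us @ w # (v + w) # ws)" using s by simp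
  also have "\<dots> = \<omega> p (us @ v # v # ws) + \<omega> p (us @ v # w # ws) + (\<omega> p (us @ w # v # ws) + \<omega> p (us @ w # w # ws))"
    using s[of "us @ [v]" ws] s[of "us @ [w]" ws] by simp
  also have "\<dots> = \<omega> p (us @ v # w # ws) + \<omega> p (us @ w # v # ws)"
    using form_distinct[OF w, of "us @ v # v # ws" p] form_distinct[OF w, of "us @ w # w # ws" p] by simp
  finally show ?thesis by simp
qed

lemma form_swap_head: "\<omega> \<in> \<Omega> \<Longrightarrow> \<omega> p (v # w # ws) = - \<omega> p (w # v # ws)"
  using form_swap[of \<omega> p "[]" v w ws] by (simp only: append_Nil)

text \<open>The carrier \<open>S\<close> is kept general because the rule serves both tangent
  vectors at a point and lists of vector fields.\<close>

lemma alternating_move: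
  assumes swap: "\<And>us v w ws. set (us @ v # w # ws) \<subseteq> S \<Longrightarrow> \<eta> (us @ v # w # ws) = - (\<eta> (us @ w # v # ws) :: real)"
    and "set (pre @ us @ v # ws) \<subseteq> S"
  shows "\<eta> (pre @ us @ v # ws) = (-1) ^ length us * \<eta> (pre @ v # us @ ws)"
  using assms(2)
proof (induction us arbitrary: ws rule: rev_induct)
  case (snoc u us)
  have "\<eta> (pre @ (us @ [u]) @ v # ws) = - \<eta> (pre @ us @ v # u # ws)"
    using swap[of "pre @ us" u v ws] snoc.prems by simp
  also have "\<eta> (pre @ us @ v # u # ws) = (-1) ^ length us * \<eta> (pre @ v # us @ u # ws)"
    using snoc.prems by (intro snoc.IH) auto
  finally show ?case by simp
qed simp

text \<open>Skewness in neighbouring slots transports linearity from the first slot to any other. It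
  also brings equal entries next to each other, where the value equals its own negative.\<close>

lemma formI:
  assumes out: "\<And>p vs. \<not> set vs \<subseteq> T p \<Longrightarrow> \<omega> p vs = 0"
    and head: "\<And>p v w ws a b. v \<in> T p \<Longrightarrow> w \<in> T p \<Longrightarrow> set ws \<subseteq> T p \<Longrightarrow>
      \<omega> p ((a *\<^sub>R v + b *\<^sub>R w) # ws) = a * \<omega> p (v # ws) + b * \<omega> p (w # ws)"
    and swap: "\<And>p us v w ws. set (us @ v # w # ws) \<subseteq> T p \<Longrightarrow> \<omega> p (us @ v # w # ws) = - \<omega> p (us @ w # v # ws)"
    and smooth: "\<And>Xs. set Xs \<subseteq> VF \<Longrightarrow> (\<lambda>p. \<omega> p (ev Xs p)) \<in> C"
  shows "\<omega> \<in> \<Omega>"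
proof -
  have move: "\<omega> p (pre @ us @ v # ws) = (-1) ^ length us * \<omega> p (pre @ v # us @ ws)"
    if "set (pre @ us @ v # ws) \<subseteq> T p" for p pre us v ws
    by (rule alternating_move[where S = "T p" and \<eta> = "\<omega> p", OF swap that])
  have "\<omega> p (us @ (a *\<^sub>R v + b *\<^sub>R w) # ws) = a * \<omega> p (us @ v # ws) + b * \<omega> p (us @ w # ws)"
    if vw: "v \<in> T p" "w \<in> T p" for p us v w ws a b
  proof (cases "set (us @ ws) \<subseteq> T p")
    case True
    have "\<omega> p (us @ u # ws) = (-1) ^ length us * \<omega> p (u # us @ ws)" if "u \<in> T p" for u
      using move[of "[]" us u ws p] True that by simp
    then show ?thesis using vw True head[of v p w "us @ ws" a b] by (simp add: algebra_simps)
  next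
    case False
    then show ?thesis using out[of _ p] by auto
  qed
  moreover have "\<omega> p vs = 0" if nd: "\<not> distinct vs" for p vs
  proof (cases "set vs \<subseteq> T p")
    case True
    obtain xs ys zs y where vs: "vs = xs @ [y] @ ys @ [y] @ zs" using not_distinct_decomp[OF nd] by blast
    have "\<omega> p vs = (-1) ^ length ys * \<omega> p (xs @ y # y # ys @ zs)"
      using move[of "xs @ [y]" ys y zs p] True vs by simp
    moreover have "\<omega> p (xs @ y # y # ys @ zs) = - \<omega> p (xs @ y # y # ys @ zs)"
      using True vs by (intro swap) auto
    ultimately show ?thesis by simp
  qed (rule out)
  ultimately show ?thesis using out smooth unfolding forms_def ev_def by blast
qed

lemma form_eqI:
  assumes "\<omega> \<in> \<Omega>" "\<eta> \<in> \<Omega>" "\<And>Xs p. set Xs \<subseteq> VF \<Longrightarrow> \<omega> p (ev Xs p) = \<eta> p (ev Xs p)"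
  shows "\<omega> = \<eta>"
proof (intro ext)
  fix p vs
  show "\<omega> p vs = \<eta> p vs"
  proof (cases "set vs \<subseteq> T p")
    case True
    then obtain Xs where "set Xs \<subseteq> VF" "ev Xs p = vs" using vfs_ext unfolding ev_def by metis
    then show ?thesis using assms(3) by blast
  next
    case False
    then show ?thesis using form_outside assms(1,2) by metis
  qed
qed

lemma forms_0 [simp]: "0 \<in> \<Omega>"
  by (rule formI) auto

lemma forms_add [simp]: "\<omega> \<in> \<Omega> \<Longrightarrow> \<eta> \<in> \<Omega> \<Longrightarrow> \<omega> + \<eta> \<in> \<Omega>"
proof (rule formI)
  assume w: "\<omega> \<in> \<Omega>" "\<eta> \<in> \<Omega>"
  fix p us v w' ws
  show "(\<omega> + \<eta>) p (us @ v # w' # ws) = - (\<omega> + \<eta>) p (us @ w' # v # ws)"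
    using form_swap[OF w(1), of p us v w' ws] form_swap[OF w(2), of p us v w' ws] by simp
qed (auto simp: form_outside form_head algebra_simps form_C)

lemma fun_op_apply [simp]: "fun_op f \<omega> p vs = f p * \<omega> p vs"
  by (simp add: fun_op_def)

lemma forms_fun_op [simp]: "f \<in> C \<Longrightarrow> \<omega> \<in> \<Omega> \<Longrightarrow> fun_op f \<omega> \<in> \<Omega>"
proof (rule formI)
  assume w: "\<omega> \<in> \<Omega>"
  fix p us v w' ws
  show "fun_op f \<omega> p (us @ v # w' # ws) = - fun_op f \<omega> p (us @ w' # v # ws)"
    using form_swap[OF w(1), of p us v w' ws] by simp
qed (auto simp: form_outside form_head algebra_simps form_C)

lemma forms_scaleR [simp]: "\<omega> \<in> \<Omega> \<Longrightarrow> c *\<^sub>R \<omega> \<in> \<Omega>"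
proof -
  assume "\<omega> \<in> \<Omega>"
  moreover have "c *\<^sub>R \<omega> = fun_op (\<lambda>_. c) \<omega>" by (simp add: fun_eq_iff)
  ultimately show ?thesis using forms_fun_op[OF C_const] by metis
qed

lemma forms_uminus [simp]: "\<omega> \<in> \<Omega> \<Longrightarrow> - \<omega> \<in> \<Omega>"
  using forms_scaleR[of \<omega> "-1"] by simp

lemma forms_diff [simp]: "\<omega> \<in> \<Omega> \<Longrightarrow> \<eta> \<in> \<Omega> \<Longrightarrow> \<omega> - \<eta> \<in> \<Omega>"
  using forms_add[of \<omega> "- \<eta>"] by simp

lemma forms_sum: "(\<And>i. i \<in> I \<Longrightarrow> \<omega> i \<in> \<Omega>) \<Longrightarrow> (\<Sum>i\<in>I. \<omega> i) \<in> \<Omega>"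
  by (induction I rule: infinite_finite_induct) auto

text \<open>The unit of the exterior algebra, i.e. the constant function 1 as a form of degree 0.
  Then \<open>wd \<alpha> one_form0\<close> is the covector field \<open>\<alpha>\<close> regarded
  as a one-form.\<close>

definition one_form0 :: "'a form"
  where "one_form0 = (\<lambda>p vs. if vs = [] then 1 else 0)"

lemma one_form0 [simp]: "one_form0 \<in> \<Omega>"
proof (rule formI)
  fix Xs :: "('a \<Rightarrow> 'a tvec) list"
  show "(\<lambda>p. one_form0 p (ev Xs p)) \<in> C" by (cases Xs) (auto simp: one_form0_def)
qed (auto simp: one_form0_def)

definition ins :: "('a \<Rightarrow> 'a tvec) \<Rightarrow> 'a form \<Rightarrow> 'a form"
  where "ins X \<omega> = (\<lambda>p vs. \<omega> p (X p # vs))"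

lemma ins_apply: "ins X \<omega> p vs = \<omega> p (X p # vs)" by (simp add: ins_def)

lemma forms_ins [simp]: "X \<in> VF \<Longrightarrow> \<omega> \<in> \<Omega> \<Longrightarrow> ins X \<omega> \<in> \<Omega>"
proof (rule formI)
  assume X: "X \<in> VF" and w: "\<omega> \<in> \<Omega>"
  fix p us v w' ws
  show "ins X \<omega> p (us @ v # w' # ws) = - ins X \<omega> p (us @ w' # v # ws)"
    using form_swap[OF w, of p "X p # us" v w' ws] by (simp add: ins_def)
  fix a b
  show "v \<in> T p \<Longrightarrow> w' \<in> T p \<Longrightarrow> ins X \<omega> p ((a *\<^sub>R v + b *\<^sub>R w') # ws) = a * ins X \<omega> p (v # ws) + b * ins X \<omega> p (w' # ws)"
    using form_slot[OF w, of v p w' "[X p]"] by (simp add: ins_def)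
  fix Xs assume "set Xs \<subseteq> VF"
  then show "(\<lambda>p. ins X \<omega> p (ev Xs p)) \<in> C" using form_C[OF w, of "X # Xs"] X by (simp add: ins_def)
qed (auto simp: form_outside ins_def)

lemma ins_add [simp]: "ins X (\<omega> + \<eta>) = ins X \<omega> + ins X \<eta>"
  and ins_fun_op [simp]: "ins X (fun_op f \<omega>) = fun_op f (ins X \<omega>)"
  and ins_diff [simp]: "ins X (\<omega> - \<eta>) = ins X \<omega> - ins X \<eta>"
  and ins_uminus [simp]: "ins X (- \<omega>) = - ins X \<omega>"
  and ins_scaleR [simp]: "ins X (c *\<^sub>R \<omega>) = c *\<^sub>R ins X \<omega>"
  and ins_0 [simp]: "ins X 0 = 0"
  by (auto simp: ins_def fun_eq_iff)

lemma fun_op_add [simp]: "fun_op f (\<omega> + \<eta>) = fun_op f \<omega> + fun_op f \<eta>"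
  and fun_op_diff [simp]: "fun_op f (\<omega> - \<eta>) = fun_op f \<omega> - fun_op f \<eta>"
  and fun_op_uminus [simp]: "fun_op f (- \<omega>) = - fun_op f \<omega>"
  and fun_op_scaleR [simp]: "fun_op f (c *\<^sub>R \<omega>) = c *\<^sub>R fun_op f \<omega>"
  and fun_op_0 [simp]: "fun_op f 0 = 0"
  by (auto simp: fun_eq_iff algebra_simps)

lemma ins_add_left: "\<omega> \<in> \<Omega> \<Longrightarrow> X \<in> VF \<Longrightarrow> Y \<in> VF \<Longrightarrow> ins (\<lambda>p. X p + Y p) \<omega> = ins X \<omega> + ins Y \<omega>"
  and ins_fmult_left: "\<omega> \<in> \<Omega> \<Longrightarrow> X \<in> VF \<Longrightarrow> ins (\<lambda>p. f p *\<^sub>R X p) \<omega> = fun_op f (ins X \<omega>)"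
  and ins_diff_left: "\<omega> \<in> \<Omega> \<Longrightarrow> X \<in> VF \<Longrightarrow> Y \<in> VF \<Longrightarrow> ins (\<lambda>p. X p - Y p) \<omega> = ins X \<omega> - ins Y \<omega>"
  and ins_minus_left: "\<omega> \<in> \<Omega> \<Longrightarrow> X \<in> VF \<Longrightarrow> ins (\<lambda>p. - X p) \<omega> = - ins X \<omega>"
  by (auto simp: ins_def fun_eq_iff form_add form_scale form_diff form_neg)

lemma ins_anti: "\<omega> \<in> \<Omega> \<Longrightarrow> ins X (ins Y \<omega>) = - ins Y (ins X \<omega>)"
  by (auto simp: ins_def fun_eq_iff intro: form_swap_head)

section \<open>Covector fields and exterior multiplication\<close>

definition CF :: "('a \<Rightarrow> 'a covec) set"
  where "CF = {\<alpha>. (\<forall>p. \<alpha> p \<in> cotangent A p) \<and> (\<forall>X\<in>VF. (\<lambda>p. \<alpha> p (X p)) \<in> C)}"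

abbreviation "T' \<equiv> cotangent A"

lemma T'_lin: "\<alpha> \<in> T' p \<Longrightarrow> v \<in> T p \<Longrightarrow> w \<in> T p \<Longrightarrow> \<alpha> (a *\<^sub>R v + b *\<^sub>R w) = a * \<alpha> v + b * \<alpha> w"
  and T'_outside: "\<alpha> \<in> T' p \<Longrightarrow> v \<notin> T p \<Longrightarrow> \<alpha> v = 0"
  by (auto simp: cotangent_def)

lemma T'_add: "\<alpha> \<in> T' p \<Longrightarrow> v \<in> T p \<Longrightarrow> w \<in> T p \<Longrightarrow> \<alpha> (v + w) = \<alpha> v + \<alpha> w"
  using T'_lin[of \<alpha> p v w 1 1] by simp
lemma T'_scale: "\<alpha> \<in> T' p \<Longrightarrow> v \<in> T p \<Longrightarrow> \<alpha> (c *\<^sub>R v) = c * \<alpha> v"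
  using T'_lin[of \<alpha> p v v c 0] by simp
lemma T'_0: "\<alpha> \<in> T' p \<Longrightarrow> \<alpha> 0 = 0"
  using T'_scale[of \<alpha> p 0 0] by simp
lemma T'_diff: "\<alpha> \<in> T' p \<Longrightarrow> v \<in> T p \<Longrightarrow> w \<in> T p \<Longrightarrow> \<alpha> (v - w) = \<alpha> v - \<alpha> w"
  using T'_lin[of \<alpha> p v w 1 "-1"] by simp
lemma T'_neg: "\<alpha> \<in> T' p \<Longrightarrow> v \<in> T p \<Longrightarrow> \<alpha> (- v) = - \<alpha> v"
  using T'_scale[of \<alpha> p v "-1"] by simp
lemma T'_sum: "\<alpha> \<in> T' p \<Longrightarrow> (\<And>i. i \<in> I \<Longrightarrow> v i \<in> T p) \<Longrightarrow> \<alpha> (\<Sum>i\<in>I. v i) = (\<Sum>i\<in>I. \<alpha> (v i))"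
  by (induction I rule: infinite_finite_induct) (auto simp: T'_0 T'_add T_sum_vec)

lemma T'I: "(\<And>v w a b. v \<in> T p \<Longrightarrow> w \<in> T p \<Longrightarrow> \<alpha> (a *\<^sub>R v + b *\<^sub>R w) = a * \<alpha> v + b * \<alpha> w) \<Longrightarrow>
    (\<And>v. v \<notin> T p \<Longrightarrow> \<alpha> v = 0) \<Longrightarrow> \<alpha> \<in> T' p"
  by (auto simp: cotangent_def)

lemma T'_eqI: "\<alpha> \<in> T' p \<Longrightarrow> \<beta> \<in> T' p \<Longrightarrow> (\<And>v. v \<in> T p \<Longrightarrow> \<alpha> v = \<beta> v) \<Longrightarrow> \<alpha> = \<beta>"
  by (rule ext) (metis T'_outside)

lemma subspace_T': "subspace (T' p)"
  unfolding subspace_def by (auto intro!: T'I simp: T'_lin T'_outside algebra_simps)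

lemma T'_plus [simp]: "\<alpha> \<in> T' p \<Longrightarrow> \<beta> \<in> T' p \<Longrightarrow> \<alpha> + \<beta> \<in> T' p"
  and T'_scaleR [simp]: "\<alpha> \<in> T' p \<Longrightarrow> c *\<^sub>R \<alpha> \<in> T' p"
  and T'_minus [simp]: "\<alpha> \<in> T' p \<Longrightarrow> \<beta> \<in> T' p \<Longrightarrow> \<alpha> - \<beta> \<in> T' p"
  and T'_uminus [simp]: "\<alpha> \<in> T' p \<Longrightarrow> - \<alpha> \<in> T' p"
  and T'_zero [simp]: "0 \<in> T' p"
  using subspace_T'[of p] by (auto simp: subspace_0 subspace_add subspace_scale subspace_diff subspace_neg)

lemma CF_T' [simp]: "\<alpha> \<in> CF \<Longrightarrow> \<alpha> p \<in> T' p" and CF_C [simp]: "\<alpha> \<in> CF \<Longrightarrow> X \<in> VF \<Longrightarrow> (\<lambda>p. \<alpha> p (X p)) \<in> C"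
  unfolding CF_def by blast+

lemma CFI: "(\<And>p. \<alpha> p \<in> T' p) \<Longrightarrow> (\<And>X. X \<in> VF \<Longrightarrow> (\<lambda>p. \<alpha> p (X p)) \<in> C) \<Longrightarrow> \<alpha> \<in> CF"
  unfolding CF_def by blast

lemma CF_add [simp]: "\<alpha> \<in> CF \<Longrightarrow> \<beta> \<in> CF \<Longrightarrow> (\<lambda>p. \<alpha> p + \<beta> p) \<in> CF"
  and CF_fmult [simp]: "f \<in> C \<Longrightarrow> \<alpha> \<in> CF \<Longrightarrow> (\<lambda>p. f p *\<^sub>R \<alpha> p) \<in> CF"
  and CF_minus [simp]: "\<alpha> \<in> CF \<Longrightarrow> \<beta> \<in> CF \<Longrightarrow> (\<lambda>p. \<alpha> p - \<beta> p) \<in> CF"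
  and CF_uminus [simp]: "\<alpha> \<in> CF \<Longrightarrow> (\<lambda>p. - \<alpha> p) \<in> CF"
  and CF_0 [simp]: "(\<lambda>p. 0) \<in> CF"
  by (auto intro!: CFI)

lemma CF_eqI:
  assumes "\<alpha> \<in> CF" "\<beta> \<in> CF" "\<And>X p. X \<in> VF \<Longrightarrow> \<alpha> p (X p) = \<beta> p (X p)"
  shows "\<alpha> = \<beta>"
proof
  fix p
  show "\<alpha> p = \<beta> p"
  proof (rule T'_eqI)
    fix v assume "v \<in> T p"
    then obtain X where "X \<in> VF" "X p = v" by (rule vf_ext)
    then show "\<alpha> p v = \<beta> p v" using assms(3) by auto
  qed (use assms in auto)
qed

definition wd :: "('a \<Rightarrow> 'a covec) \<Rightarrow> 'a form \<Rightarrow> 'a form"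
  where "wd \<alpha> \<omega> = (\<lambda>p. wedge_left (\<alpha> p) (\<omega> p))"

lemma wd_Nil [simp]: "wd \<alpha> \<omega> p [] = 0" by (simp add: wd_def)
lemma wd_Cons: "wd \<alpha> \<omega> p (X p # vs) = \<alpha> p (X p) * \<omega> p vs - wd \<alpha> (ins X \<omega>) p vs"
  by (simp add: wd_def wedge_left_Cons ins_def)

lemma forms_wd [simp]:
  assumes \<alpha>: "\<alpha> \<in> CF" and w: "\<omega> \<in> \<Omega>"
  shows "wd \<alpha> \<omega> \<in> \<Omega>"
proof (rule formI)
  fix p :: 'a and vs us ws :: "'a tvec list" and v w a b
  show "wd \<alpha> \<omega> p vs = 0" if "\<not> set vs \<subseteq> T p"
  proof -
    have "wedge_left (\<alpha> p) \<eta> vs = 0" if "\<And>vs. \<not> set vs \<subseteq> T p \<Longrightarrow> \<eta> vs = 0" "\<not> set vs \<subseteq> T p" for \<eta>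
      using that
    proof (induction vs arbitrary: \<eta>)
      case (Cons u vs)
      show ?case
      proof (cases "u \<in> T p")
        case True
        then show ?thesis using Cons.prems Cons.IH[of "\<lambda>ws. \<eta> (u # ws)"] by (simp add: wedge_left_Cons)
      next
        case False
        have "wedge_left (\<alpha> p) (\<lambda>ws. \<eta> (u # ws)) vs = 0"
          using Cons.prems(1) False by (simp add: wedge_left_def)
        then show ?thesis using False T'_outside[OF CF_T'[OF \<alpha>]] by (simp add: wedge_left_Cons)
      qed
    qed simp
    then show ?thesis using that form_outside[OF w] by (simp add: wd_def)
  qed
  show "wd \<alpha> \<omega> p ((a *\<^sub>R v + b *\<^sub>R w) # ws) = a * wd \<alpha> \<omega> p (v # ws) + b * wd \<alpha> \<omega> p (w # ws)"
    if "v \<in> T p" "w \<in> T p"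
    using that assms by (simp add: wd_def wedge_left_Cons form_head wedge_left_lin T'_lin[OF CF_T'] algebra_simps)
  show "wd \<alpha> \<omega> p (us @ v # w # ws) = - wd \<alpha> \<omega> p (us @ w # v # ws)"
  proof -
    have "wedge_left (\<alpha> p) \<eta> (us @ v # w # ws) = - wedge_left (\<alpha> p) \<eta> (us @ w # v # ws)"
      if "\<And>us v w ws. \<eta> (us @ v # w # ws) = - \<eta> (us @ w # v # ws)" for \<eta>
      using that
    proof (induction us arbitrary: \<eta>)
      case Nil
      have "(\<lambda>ws. \<eta> (v # w # ws)) = (\<lambda>ws. (-1) * \<eta> (w # v # ws) + 0 * \<eta> ws)"
        using Nil[of "[]" v w] by (simp only: append_Nil fun_eq_iff) simp
      then show ?case by (simp only: append_Nil wedge_left_Cons wedge_left_lin)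
    next
      case (Cons u us)
      have "\<eta> (us @ v # w # ws) = - \<eta> (us @ w # v # ws)" by (rule Cons.prems)
      moreover have "wedge_left (\<alpha> p) (\<lambda>ws. \<eta> (u # ws)) (us @ v # w # ws) = - wedge_left (\<alpha> p) (\<lambda>ws. \<eta> (u # ws)) (us @ w # v # ws)"
      proof (rule Cons.IH)
        show "\<eta> (u # us' @ v # w # ws) = - \<eta> (u # us' @ w # v # ws)" for us' v w ws
          using Cons.prems[of "u # us'" v w ws] by (simp only: append_Cons)
      qed
      ultimately show ?case by (simp only: append_Cons wedge_left_Cons)
    qed
    from this[of "\<omega> p", OF form_swap[OF w]] show ?thesis unfolding wd_def .
  qed
  fix Xs assume "set Xs \<subseteq> VF"
  then show "(\<lambda>p. wd \<alpha> \<omega> p (ev Xs p)) \<in> C"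
    using w
  proof (induction Xs arbitrary: \<omega>)
    case (Cons X Xs)
    then show ?case using \<alpha> by (auto simp: wd_Cons form_C)
  qed simp
qed

lemma wedge_left_add: "wedge_left \<alpha> (\<lambda>ws. \<eta> ws + \<eta>' ws) vs = wedge_left \<alpha> \<eta> vs + wedge_left \<alpha> \<eta>' vs"
  using wedge_left_lin[of \<alpha> 1 \<eta> 1 \<eta>' vs] by simp

lemma wedge_left_scale: "wedge_left \<alpha> (\<lambda>ws. c * \<eta> ws) vs = c * wedge_left \<alpha> \<eta> vs"
  using wedge_left_lin[of \<alpha> c \<eta> 0 \<eta> vs] by simp

lemma wd_add [simp]: "wd \<alpha> (\<omega> + \<eta>) = wd \<alpha> \<omega> + wd \<alpha> \<eta>"
  and wd_fun_op [simp]: "wd \<alpha> (fun_op f \<omega>) = fun_op f (wd \<alpha> \<omega>)"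
  using wedge_left_add wedge_left_scale by (auto simp: wd_def fun_eq_iff plus_fun_def fun_op_def)

lemma fun_op_const: "fun_op (\<lambda>_. c) \<omega> = c *\<^sub>R \<omega>" by (simp add: fun_eq_iff)

lemma wd_scaleR [simp]: "wd \<alpha> (c *\<^sub>R \<omega>) = c *\<^sub>R wd \<alpha> \<omega>"
  using wd_fun_op[of \<alpha> "\<lambda>_. c" \<omega>] by (simp add: fun_op_const)
lemma wd_uminus [simp]: "wd \<alpha> (- \<omega>) = - wd \<alpha> \<omega>" using wd_scaleR[of \<alpha> "-1" \<omega>] by simp
lemma wd_diff [simp]: "wd \<alpha> (\<omega> - \<eta>) = wd \<alpha> \<omega> - wd \<alpha> \<eta>"
  using wd_add[of \<alpha> \<omega> "- \<eta>"] by simp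

lemma wd_add_left: "wd (\<lambda>p. \<alpha> p + \<beta> p) \<omega> = wd \<alpha> \<omega> + wd \<beta> \<omega>"
  and wd_fmult_left: "wd (\<lambda>p. f p *\<^sub>R \<alpha> p) \<omega> = fun_op f (wd \<alpha> \<omega>)"
  and wd_diff_left: "wd (\<lambda>p. \<alpha> p - \<beta> p) \<omega> = wd \<alpha> \<omega> - wd \<beta> \<omega>"
  and wd_minus_left: "wd (\<lambda>p. - \<alpha> p) \<omega> = - wd \<alpha> \<omega>"
  by (auto simp: wd_def fun_eq_iff wedge_left_def sum.distrib sum_distrib_left sum_subtractf sum_negf algebra_simps)

lemma ins_wd: "ins X (wd \<alpha> \<omega>) = fun_op (\<lambda>p. \<alpha> p (X p)) \<omega> - wd \<alpha> (ins X \<omega>)"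
  by (auto simp: fun_eq_iff ins_apply wd_Cons)

text \<open>A form is determined by its function part and its contractions. An invariant that forces
  the function part to vanish and survives contraction therefore contains only 0. Two summands are
  allowed because fields are later split into two parts.\<close>

lemma ins_coinduct:
  assumes step: "\<And>\<eta>. P \<eta> \<Longrightarrow> \<eta> \<in> \<Omega> \<and> (\<forall>p. \<eta> p [] = 0) \<and>
      (\<forall>Y\<in>VF. \<exists>\<eta>1 \<eta>2. P \<eta>1 \<and> P \<eta>2 \<and> ins Y \<eta> = \<eta>1 + \<eta>2)"
    and "P \<eta>"
  shows "\<eta> = 0"
proof -
  have "\<eta> p (ev Xs p) = 0" if "P \<eta>" "set Xs \<subseteq> VF" for p Xs
    using that
  proof (induction Xs arbitrary: \<eta>)
    case Nil
    then show ?case using step by simp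
  next
    case (Cons X Xs)
    obtain \<eta>1 \<eta>2 where e: "P \<eta>1" "P \<eta>2" "ins X \<eta> = \<eta>1 + \<eta>2"
      using step[OF Cons.prems(1)] Cons.prems(2) by auto
    have "\<eta> p (ev (X # Xs) p) = ins X \<eta> p (ev Xs p)" by (simp add: ins_apply)
    also have "\<dots> = \<eta>1 p (ev Xs p) + \<eta>2 p (ev Xs p)" using e(3) by simp
    also have "\<dots> = 0" using Cons.IH[OF e(1)] Cons.IH[OF e(2)] Cons.prems(2) by simp
    finally show ?case .
  qed
  then show ?thesis using assms by (intro form_eqI) auto
qed

text \<open>The standard way to prove operator identities below: \<open>S\<close> is the difference
  of the two sides, and \<open>c\<close> is the sign in its commutation with contractions.\<close>

lemma operator_zero:
  assumes S: "\<And>\<omega>. \<omega> \<in> \<Omega> \<Longrightarrow> S \<omega> \<in> \<Omega>" and nil: "\<And>\<omega> p. \<omega> \<in> \<Omega> \<Longrightarrow> S \<omega> p [] = 0"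
    and ins: "\<And>Y \<omega>. Y \<in> VF \<Longrightarrow> \<omega> \<in> \<Omega> \<Longrightarrow> ins Y (S \<omega>) = c *\<^sub>R S (ins Y \<omega>)"
    and w: "\<omega> \<in> \<Omega>"
  shows "S \<omega> = 0"
proof (rule ins_coinduct[where P = "\<lambda>\<eta>. \<exists>\<omega>\<in>\<Omega>. \<exists>k. \<eta> = k *\<^sub>R S \<omega>"])
  fix \<eta> assume "\<exists>\<omega>\<in>\<Omega>. \<exists>k. \<eta> = k *\<^sub>R S \<omega>"
  then obtain \<omega> k where e: "\<omega> \<in> \<Omega>" "\<eta> = k *\<^sub>R S \<omega>" by blast
  show "\<eta> \<in> \<Omega> \<and> (\<forall>p. \<eta> p [] = 0) \<and>
      (\<forall>Y\<in>VF. \<exists>\<eta>1 \<eta>2. (\<exists>\<omega>\<in>\<Omega>. \<exists>k. \<eta>1 = k *\<^sub>R S \<omega>) \<and> (\<exists>\<omega>\<in>\<Omega>. \<exists>k. \<eta>2 = k *\<^sub>R S \<omega>) \<and> ins Y \<eta> = \<eta>1 + \<eta>2)"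
  proof (intro conjI ballI allI)
    fix Y assume Y: "Y \<in> VF"
    have "ins Y \<eta> = (k * c) *\<^sub>R S (ins Y \<omega>) + 0 *\<^sub>R S (ins Y \<omega>)" using e ins[OF Y e(1)] by simp
    moreover have "ins Y \<omega> \<in> \<Omega>" using Y e by simp
    ultimately show "\<exists>\<eta>1 \<eta>2. (\<exists>\<omega>\<in>\<Omega>. \<exists>k. \<eta>1 = k *\<^sub>R S \<omega>) \<and> (\<exists>\<omega>\<in>\<Omega>. \<exists>k. \<eta>2 = k *\<^sub>R S \<omega>) \<and> ins Y \<eta> = \<eta>1 + \<eta>2"
      by blast
  qed (use e S nil in auto)
qed (use w in \<open>metis scaleR_one\<close>)

lemma wd_anti: "\<alpha> \<in> CF \<Longrightarrow> \<beta> \<in> CF \<Longrightarrow> \<omega> \<in> \<Omega> \<Longrightarrow> wd \<alpha> (wd \<beta> \<omega>) = - wd \<beta> (wd \<alpha> \<omega>)"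
proof -
  assume a: "\<alpha> \<in> CF" "\<beta> \<in> CF" "\<omega> \<in> \<Omega>"
  have "wd \<alpha> (wd \<beta> \<omega>) + wd \<beta> (wd \<alpha> \<omega>) = 0"
    by (rule operator_zero[where S = "\<lambda>\<omega>. wd \<alpha> (wd \<beta> \<omega>) + wd \<beta> (wd \<alpha> \<omega>)" and c = 1])
      (use a in \<open>auto simp: ins_wd\<close>)
  then show ?thesis by (simp add: eq_neg_iff_add_eq_0)
qed

end

section \<open>Cartan calculus\<close>

context smooth_mfd
begin

definition ext_field :: "'a \<Rightarrow> 'a tvec \<Rightarrow> 'a \<Rightarrow> 'a tvec"
  where "ext_field p v = (SOME X. X \<in> VF \<and> X p = v)"

lemma ext_field: "v \<in> T p \<Longrightarrow> ext_field p v \<in> VF \<and> ext_field p v p = v"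
  unfolding ext_field_def by (rule someI_ex[of "\<lambda>X. X \<in> VF \<and> X p = v"]) (erule vf_ext, blast)

text \<open>Tangent vectors are extended to fields, to which \<open>F\<close> can be applied. The
  choice of extension is harmless once \<open>F\<close> is tensorial; this is the content of
  \<open>mkform_ev\<close>.\<close>

definition mkform :: "(('a \<Rightarrow> 'a tvec) list \<Rightarrow> 'a \<Rightarrow> real) \<Rightarrow> 'a form"
  where "mkform F = (\<lambda>p vs. if set vs \<subseteq> T p then F (map (ext_field p) vs) p else 0)"

lemma map_ext_field:
  "set vs \<subseteq> T p \<Longrightarrow> set (map (ext_field p) vs) \<subseteq> VF \<and> ev (map (ext_field p) vs) p = vs"
  by (induction vs) (auto simp: ext_field)

lemma mkform:
  assumes smooth: "\<And>Xs. set Xs \<subseteq> VF \<Longrightarrow> F Xs \<in> C"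
    and add: "\<And>X Y Xs p. X \<in> VF \<Longrightarrow> Y \<in> VF \<Longrightarrow> set Xs \<subseteq> VF \<Longrightarrow> F ((\<lambda>q. X q + Y q) # Xs) p = F (X # Xs) p + F (Y # Xs) p"
    and mult: "\<And>f X Xs p. f \<in> C \<Longrightarrow> X \<in> VF \<Longrightarrow> set Xs \<subseteq> VF \<Longrightarrow> F ((\<lambda>q. f q *\<^sub>R X q) # Xs) p = f p * F (X # Xs) p"
    and swap: "\<And>us X Y ws p. set (us @ X # Y # ws) \<subseteq> VF \<Longrightarrow> F (us @ X # Y # ws) p = - F (us @ Y # X # ws) p"
  shows mkform_form: "mkform F \<in> \<Omega>"
    and mkform_ev: "\<And>Xs p. set Xs \<subseteq> VF \<Longrightarrow> mkform F p (ev Xs p) = F Xs p"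
proof -
  have head: "F (X # Xs) p = F (Y # Xs) p" if "X \<in> VF" "Y \<in> VF" "set Xs \<subseteq> VF" "X p = Y p" for X Y Xs p
    by (rule tensorial[where F = "\<lambda>X. F (X # Xs) p" and p = p]) (use that add mult in auto)
  have move: "F (us @ X # ws) p = (-1) ^ length us * F (X # us @ ws) p" if "set (us @ X # ws) \<subseteq> VF" for us X ws p
    using alternating_move[where S = VF and \<eta> = "\<lambda>Xs. F Xs p" and pre = "[]", OF swap] that by simp
  \<comment> \<open>Fields are exchanged one at a time: each is moved to the front, replaced there
    by \<open>head\<close> and moved back. The list \<open>us\<close> collects those already
    replaced.\<close>
  have local': "F (us @ Xs) p = F (us @ Ys) p"
    if "length Xs = length Ys" "set us \<subseteq> VF" "set Xs \<subseteq> VF" "set Ys \<subseteq> VF" "ev Xs p = ev Ys p" for us Xs Ys p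
    using that
  proof (induction Xs Ys arbitrary: us rule: list_induct2)
    case (Cons X Xs Y Ys)
    have "F (us @ X # Xs) p = (-1) ^ length us * F (X # us @ Xs) p" using Cons.prems by (intro move) auto
    also have "F (X # us @ Xs) p = F (Y # us @ Xs) p" using Cons.prems by (intro head) auto
    also have "(-1) ^ length us * F (Y # us @ Xs) p = F (us @ Y # Xs) p" using Cons.prems by (intro move[symmetric]) auto
    also have "\<dots> = F ((us @ [Y]) @ Ys) p" using Cons.IH[of "us @ [Y]"] Cons.prems by simp
    finally show ?case by simp
  qed simp
  have loc: "F Xs p = F Ys p" if "set Xs \<subseteq> VF" "set Ys \<subseteq> VF" "ev Xs p = ev Ys p" for Xs Ys p
    using local'[of Xs Ys "[]" p] that map_eq_imp_length_eq[of "\<lambda>X. X p" Xs "\<lambda>X. X p" Ys] by (simp add: ev_def)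
  show eval: "mkform F p (ev Xs p) = F Xs p" if "set Xs \<subseteq> VF" for Xs p
  proof -
    have "set (ev Xs p) \<subseteq> T p" by (rule set_ev[OF that])
    then have "mkform F p (ev Xs p) = F (map (ext_field p) (ev Xs p)) p" by (simp add: mkform_def)
    also have "\<dots> = F Xs p" using map_ext_field[OF \<open>set (ev Xs p) \<subseteq> T p\<close>] that by (intro loc) auto
    finally show ?thesis .
  qed
  have eval': "mkform F p vs = F Xs p" if "set Xs \<subseteq> VF" "ev Xs p = vs" for Xs p vs
    using eval that by blast
  show "mkform F \<in> \<Omega>"
  proof (rule formI)
    fix p vs assume "\<not> set vs \<subseteq> T p"
    then show "mkform F p vs = 0" by (simp add: mkform_def)
  next
    fix p v w ws a b assume vw: "v \<in> T p" "w \<in> T p" "set ws \<subseteq> T p"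
    obtain X where X: "X \<in> VF" "X p = v" by (rule vf_ext[OF vw(1)])
    obtain Y where Y: "Y \<in> VF" "Y p = w" by (rule vf_ext[OF vw(2)])
    obtain Xs where Xs: "set Xs \<subseteq> VF" "ev Xs p = ws" using vfs_ext[OF vw(3)] unfolding ev_def by blast
    have "mkform F p ((a *\<^sub>R v + b *\<^sub>R w) # ws) = F ((\<lambda>q. a *\<^sub>R X q + b *\<^sub>R Y q) # Xs) p"
      using X Y Xs by (intro eval') auto
    also have "\<dots> = a * F (X # Xs) p + b * F (Y # Xs) p"
      using X Y Xs add[of "\<lambda>q. a *\<^sub>R X q" "\<lambda>q. b *\<^sub>R Y q" Xs p] mult[of "\<lambda>_. a" X Xs p] mult[of "\<lambda>_. b" Y Xs p] by simp
    also have "F (X # Xs) p = mkform F p (v # ws)" using X Xs by (intro eval'[symmetric]) auto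
    also have "F (Y # Xs) p = mkform F p (w # ws)" using Y Xs by (intro eval'[symmetric]) auto
    finally show "mkform F p ((a *\<^sub>R v + b *\<^sub>R w) # ws) = a * mkform F p (v # ws) + b * mkform F p (w # ws)" .
  next
    fix p us v w ws assume s: "set (us @ v # w # ws) \<subseteq> T p"
    let ?e = "ext_field p"
    have "mkform F p (us @ v # w # ws) = F (map ?e us @ ?e v # ?e w # map ?e ws) p"
      using s by (simp add: mkform_def)
    also have "\<dots> = - F (map ?e us @ ?e w # ?e v # map ?e ws) p"
      by (rule swap) (use map_ext_field[OF s] in simp)
    also have "F (map ?e us @ ?e w # ?e v # map ?e ws) p = mkform F p (us @ w # v # ws)"
      using s by (simp add: mkform_def)
    finally show "mkform F p (us @ v # w # ws) = - mkform F p (us @ w # v # ws)" .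
  next
    fix Xs assume Xs: "set Xs \<subseteq> VF"
    then show "(\<lambda>p. mkform F p (ev Xs p)) \<in> C" using eval[OF Xs] smooth[OF Xs] by simp
  qed
qed

text \<open>Both the Lie derivative and the exterior derivative are evaluated by peeling off the
  first vector field, according to \<open>\<iota>\<^sub>Y L\<^sub>X = L\<^sub>X \<iota>\<^sub>Y - \<iota>\<^bsub>[X,Y]\<^esub>\<close> and \<open>\<iota>\<^sub>X d = L\<^sub>X - d \<iota>\<^sub>X\<close>.\<close>

primrec LV :: "('a \<Rightarrow> 'a tvec) \<Rightarrow> ('a \<Rightarrow> 'a tvec) list \<Rightarrow> 'a form \<Rightarrow> 'a \<Rightarrow> real"
  where
    "LV X [] \<omega> p = X p (\<lambda>q. \<omega> q [])"
  | "LV X (Y # Ys) \<omega> p = LV X Ys (ins Y \<omega>) p - \<omega> p (lie X Y p # ev Ys p)"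

primrec dv :: "('a \<Rightarrow> 'a tvec) list \<Rightarrow> 'a form \<Rightarrow> 'a \<Rightarrow> real"
  where
    "dv [] \<omega> p = 0"
  | "dv (X # Xs) \<omega> p = LV X Xs \<omega> p - dv Xs (ins X \<omega>) p"

lemma LV_C: "X \<in> VF \<Longrightarrow> \<omega> \<in> \<Omega> \<Longrightarrow> set Ys \<subseteq> VF \<Longrightarrow> LV X Ys \<omega> \<in> C"
proof (induction Ys arbitrary: \<omega>)
  case Nil
  then have "(\<lambda>p. X p (\<lambda>q. \<omega> q [])) \<in> C" by simp
  then show ?case by (simp add: LV.simps(1)[abs_def])
next
  case (Cons Y Ys)
  have "LV X Ys (ins Y \<omega>) \<in> C" by (rule Cons.IH) (use Cons.prems in auto)
  moreover have "(\<lambda>p. \<omega> p (ev (lie X Y # Ys) p)) \<in> C" by (rule form_C) (use Cons.prems in auto)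
  ultimately have "(\<lambda>p. LV X Ys (ins Y \<omega>) p - \<omega> p (ev (lie X Y # Ys) p)) \<in> C" by (rule C_diff)
  then show ?case by (simp add: LV.simps(2)[abs_def])
qed

lemma LV_add: "X \<in> VF \<Longrightarrow> \<omega> \<in> \<Omega> \<Longrightarrow> \<eta> \<in> \<Omega> \<Longrightarrow> set Ys \<subseteq> VF \<Longrightarrow>
    LV X Ys (\<omega> + \<eta>) p = LV X Ys \<omega> p + LV X Ys \<eta> p"
proof (induction Ys arbitrary: \<omega> \<eta>)
  case Nil
  then show ?case using T_add[OF VF_T[OF Nil.prems(1)] form_C_Nil form_C_Nil] by simp
qed simp

lemma LV_fun: "X \<in> VF \<Longrightarrow> \<omega> \<in> \<Omega> \<Longrightarrow> f \<in> C \<Longrightarrow> set Ys \<subseteq> VF \<Longrightarrow>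
    LV X Ys (fun_op f \<omega>) p = X p f * \<omega> p (ev Ys p) + f p * LV X Ys \<omega> p"
proof (induction Ys arbitrary: \<omega>)
  case Nil
  then show ?case using T_mult[OF VF_T[OF Nil.prems(1)] Nil.prems(3) form_C_Nil] by simp
next
  case (Cons Y Ys)
  have "LV X Ys (fun_op f (ins Y \<omega>)) p = X p f * ins Y \<omega> p (ev Ys p) + f p * LV X Ys (ins Y \<omega>) p"
    by (rule Cons.IH) (use Cons.prems in auto)
  then show "LV X (Y # Ys) (fun_op f \<omega>) p = X p f * \<omega> p (ev (Y # Ys) p) + f p * LV X (Y # Ys) \<omega> p"
    by (simp add: ins_apply algebra_simps)
qed

lemma LV_scaleR: "X \<in> VF \<Longrightarrow> \<omega> \<in> \<Omega> \<Longrightarrow> set Ys \<subseteq> VF \<Longrightarrow> LV X Ys (c *\<^sub>R \<omega>) p = c * LV X Ys \<omega> p"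
  using LV_fun[of X \<omega> "\<lambda>_. c" Ys p] T_const[OF VF_T] by (simp add: fun_op_const)

lemma LV_uminus: "X \<in> VF \<Longrightarrow> \<omega> \<in> \<Omega> \<Longrightarrow> set Ys \<subseteq> VF \<Longrightarrow> LV X Ys (- \<omega>) p = - LV X Ys \<omega> p"
  using LV_scaleR[of X \<omega> Ys "-1" p] by simp

lemma LV_swap: "X \<in> VF \<Longrightarrow> \<omega> \<in> \<Omega> \<Longrightarrow> set (us @ Y # Z # Ys) \<subseteq> VF \<Longrightarrow>
    LV X (us @ Y # Z # Ys) \<omega> p = - LV X (us @ Z # Y # Ys) \<omega> p"
proof (induction us arbitrary: \<omega>)
  case Nil
  have 1: "LV X Ys (ins Z (ins Y \<omega>)) p = - LV X Ys (ins Y (ins Z \<omega>)) p"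
    using Nil ins_anti[of \<omega> Z Y] LV_uminus[of X "ins Y (ins Z \<omega>)" Ys p] by simp
  have 2: "\<omega> p (Y p # lie X Z p # ev Ys p) = - \<omega> p (lie X Z p # Y p # ev Ys p)"
    "\<omega> p (Z p # lie X Y p # ev Ys p) = - \<omega> p (lie X Y p # Z p # ev Ys p)"
    by (rule form_swap_head[OF Nil.prems(2)])+
  show ?case by (simp only: append_Nil LV.simps ins_apply ev_simps 1 2)
next
  case (Cons u us)
  have "LV X (us @ Y # Z # Ys) (ins u \<omega>) p = - LV X (us @ Z # Y # Ys) (ins u \<omega>) p"
    using Cons by (intro Cons.IH) auto
  moreover have "\<omega> p ((lie X u p # ev us p) @ Y p # Z p # ev Ys p) = - \<omega> p ((lie X u p # ev us p) @ Z p # Y p # ev Ys p)"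
    by (rule form_swap[OF Cons.prems(2)])
  ultimately show ?case by simp
qed

lemma LV_head_add: "X \<in> VF \<Longrightarrow> \<omega> \<in> \<Omega> \<Longrightarrow> Y \<in> VF \<Longrightarrow> Z \<in> VF \<Longrightarrow> set Ys \<subseteq> VF \<Longrightarrow>
    LV X ((\<lambda>q. Y q + Z q) # Ys) \<omega> p = LV X (Y # Ys) \<omega> p + LV X (Z # Ys) \<omega> p"
  by (simp add: ins_add_left LV_add lie_add_right form_add)

lemma LV_head_mult: "X \<in> VF \<Longrightarrow> \<omega> \<in> \<Omega> \<Longrightarrow> Y \<in> VF \<Longrightarrow> f \<in> C \<Longrightarrow> set Ys \<subseteq> VF \<Longrightarrow>
    LV X ((\<lambda>q. f q *\<^sub>R Y q) # Ys) \<omega> p = f p * LV X (Y # Ys) \<omega> p"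
  by (simp add: ins_fmult_left LV_fun lie_fmult_right form_add form_scale ins_apply algebra_simps)

definition Lie :: "('a \<Rightarrow> 'a tvec) \<Rightarrow> 'a form \<Rightarrow> 'a form"
  where "Lie X \<omega> = mkform (\<lambda>Ys. LV X Ys \<omega>)"

lemma Lie_form [simp]: "X \<in> VF \<Longrightarrow> \<omega> \<in> \<Omega> \<Longrightarrow> Lie X \<omega> \<in> \<Omega>"
  unfolding Lie_def by (rule mkform_form) (auto simp only: LV_C LV_head_add LV_head_mult LV_swap)

lemma Lie_ev: "X \<in> VF \<Longrightarrow> \<omega> \<in> \<Omega> \<Longrightarrow> set Ys \<subseteq> VF \<Longrightarrow> Lie X \<omega> p (ev Ys p) = LV X Ys \<omega> p"
  unfolding Lie_def by (rule mkform_ev) (auto simp only: LV_C LV_head_add LV_head_mult LV_swap)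

lemma dv_C: "\<omega> \<in> \<Omega> \<Longrightarrow> set Xs \<subseteq> VF \<Longrightarrow> dv Xs \<omega> \<in> C"
proof (induction Xs arbitrary: \<omega>)
  case Nil
  then show ?case by (simp add: dv.simps(1)[abs_def])
next
  case (Cons X Xs)
  then have "(\<lambda>p. LV X Xs \<omega> p - dv Xs (ins X \<omega>) p) \<in> C" by (intro C_diff LV_C Cons.IH) auto
  then show ?case by (simp add: dv.simps(2)[abs_def])
qed

lemma dv_add: "\<omega> \<in> \<Omega> \<Longrightarrow> \<eta> \<in> \<Omega> \<Longrightarrow> set Xs \<subseteq> VF \<Longrightarrow> dv Xs (\<omega> + \<eta>) p = dv Xs \<omega> p + dv Xs \<eta> p"
  by (induction Xs arbitrary: \<omega> \<eta>) (auto simp: LV_add)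

definition dfun :: "('a \<Rightarrow> real) \<Rightarrow> 'a \<Rightarrow> 'a covec"
  where "dfun f = (\<lambda>p v. if v \<in> T p then v f else 0)"

lemma dfun_CF [simp]: "f \<in> C \<Longrightarrow> dfun f \<in> CF"
  by (rule CFI) (auto intro!: T'I simp: dfun_def)

lemma dfun_apply [simp]: "X \<in> VF \<Longrightarrow> dfun f p (X p) = X p f"
  and dfun_T: "v \<in> T p \<Longrightarrow> dfun f p v = v f"
  by (auto simp: dfun_def)

lemma dv_fun: "\<omega> \<in> \<Omega> \<Longrightarrow> f \<in> C \<Longrightarrow> set Xs \<subseteq> VF \<Longrightarrow>
    dv Xs (fun_op f \<omega>) p = f p * dv Xs \<omega> p + wd (dfun f) \<omega> p (ev Xs p)"
proof (induction Xs arbitrary: \<omega>)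
  case (Cons X Xs)
  have "dv Xs (fun_op f (ins X \<omega>)) p = f p * dv Xs (ins X \<omega>) p + wd (dfun f) (ins X \<omega>) p (ev Xs p)"
    by (rule Cons.IH) (use Cons.prems in auto)
  then show "dv (X # Xs) (fun_op f \<omega>) p = f p * dv (X # Xs) \<omega> p + wd (dfun f) \<omega> p (ev (X # Xs) p)"
    using Cons.prems by (simp add: LV_fun wd_Cons algebra_simps)
qed simp

lemma dv_scaleR: "\<omega> \<in> \<Omega> \<Longrightarrow> set Xs \<subseteq> VF \<Longrightarrow> dv Xs (c *\<^sub>R \<omega>) p = c * dv Xs \<omega> p"
  by (induction Xs arbitrary: \<omega>) (auto simp: LV_scaleR algebra_simps)

lemma dv_uminus: "\<omega> \<in> \<Omega> \<Longrightarrow> set Xs \<subseteq> VF \<Longrightarrow> dv Xs (- \<omega>) p = - dv Xs \<omega> p"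
  using dv_scaleR[of \<omega> Xs "-1" p] by simp

lemma LV_left_add: "X \<in> VF \<Longrightarrow> X' \<in> VF \<Longrightarrow> \<omega> \<in> \<Omega> \<Longrightarrow> set Ys \<subseteq> VF \<Longrightarrow>
    LV (\<lambda>q. X q + X' q) Ys \<omega> p = LV X Ys \<omega> p + LV X' Ys \<omega> p"
  by (induction Ys arbitrary: \<omega>) (auto simp: lie_add_left form_add)

text \<open>The rule for the Lie derivative along fX. Its extra term df \<and> \<iota>_X is what
  keeps \<open>dv\<close> linear over functions in the first field.\<close>

lemma LV_left_mult: "X \<in> VF \<Longrightarrow> \<omega> \<in> \<Omega> \<Longrightarrow> f \<in> C \<Longrightarrow> set Ys \<subseteq> VF \<Longrightarrow>
    LV (\<lambda>q. f q *\<^sub>R X q) Ys \<omega> p = f p * LV X Ys \<omega> p + wd (dfun f) (ins X \<omega>) p (ev Ys p)"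
proof (induction Ys arbitrary: \<omega>)
  case (Cons Y Ys)
  have "wd (dfun f) (ins Y (ins X \<omega>)) p (ev Ys p) = - wd (dfun f) (ins X (ins Y \<omega>)) p (ev Ys p)"
    using Cons.prems ins_anti[of \<omega> Y X] wd_uminus[of "dfun f" "ins X (ins Y \<omega>)"] by simp
  moreover have "LV (\<lambda>q. f q *\<^sub>R X q) Ys (ins Y \<omega>) p = f p * LV X Ys (ins Y \<omega>) p + wd (dfun f) (ins X (ins Y \<omega>)) p (ev Ys p)"
    by (rule Cons.IH) (use Cons.prems in auto)
  ultimately show "LV (\<lambda>q. f q *\<^sub>R X q) (Y # Ys) \<omega> p = f p * LV X (Y # Ys) \<omega> p + wd (dfun f) (ins X \<omega>) p (ev (Y # Ys) p)"
    using Cons.prems by (simp add: lie_fmult_left form_diff form_scale wd_Cons algebra_simps) (simp add: ins_apply)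
qed simp

lemma dv_head_add: "\<omega> \<in> \<Omega> \<Longrightarrow> X \<in> VF \<Longrightarrow> Y \<in> VF \<Longrightarrow> set Xs \<subseteq> VF \<Longrightarrow>
    dv ((\<lambda>q. X q + Y q) # Xs) \<omega> p = dv (X # Xs) \<omega> p + dv (Y # Xs) \<omega> p"
  by (simp add: LV_left_add ins_add_left dv_add)

text \<open>The term with \<open>dfun f\<close> from \<open>LV_left_mult\<close> cancels the one
  from \<open>dv_fun\<close>. So the recursion for \<open>dv\<close> is tensorial although the Lie
  derivative in it is not tensorial in the field along which it is taken.\<close>

lemma dv_head_mult: "\<omega> \<in> \<Omega> \<Longrightarrow> X \<in> VF \<Longrightarrow> f \<in> C \<Longrightarrow> set Xs \<subseteq> VF \<Longrightarrow>
    dv ((\<lambda>q. f q *\<^sub>R X q) # Xs) \<omega> p = f p * dv (X # Xs) \<omega> p"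
  by (simp add: LV_left_mult ins_fmult_left dv_fun algebra_simps)

lemma LV_lie_anti: "X \<in> VF \<Longrightarrow> Y \<in> VF \<Longrightarrow> \<omega> \<in> \<Omega> \<Longrightarrow> \<omega> p (lie X Y p # vs) = - \<omega> p (lie Y X p # vs)"
  by (subst lie_anti) (simp add: form_neg)

lemma dv_swap: "\<omega> \<in> \<Omega> \<Longrightarrow> set (us @ X # Y # Xs) \<subseteq> VF \<Longrightarrow>
    dv (us @ X # Y # Xs) \<omega> p = - dv (us @ Y # X # Xs) \<omega> p"
proof (induction us arbitrary: \<omega>)
  case Nil
  have 1: "dv Xs (ins Y (ins X \<omega>)) p = - dv Xs (ins X (ins Y \<omega>)) p"
    using Nil ins_anti[of \<omega> Y X] dv_uminus[of "ins X (ins Y \<omega>)" Xs p] by simp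
  have 2: "\<omega> p (lie X Y p # ev Xs p) = - \<omega> p (lie Y X p # ev Xs p)"
    using Nil by (intro LV_lie_anti) auto
  show ?case by (simp only: append_Nil dv.simps LV.simps 1 2)
next
  case (Cons u us)
  then show ?case using LV_swap[of u \<omega> us X Y Xs p] by simp
qed

definition dd :: "'a form \<Rightarrow> 'a form"
  where "dd \<omega> = mkform (\<lambda>Xs. dv Xs \<omega>)"

lemma dd_form [simp]: "\<omega> \<in> \<Omega> \<Longrightarrow> dd \<omega> \<in> \<Omega>"
  unfolding dd_def by (rule mkform_form) (auto simp only: dv_C dv_head_add dv_head_mult dv_swap)

lemma dd_ev: "\<omega> \<in> \<Omega> \<Longrightarrow> set Ys \<subseteq> VF \<Longrightarrow> dd \<omega> p (ev Ys p) = dv Ys \<omega> p"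
  unfolding dd_def by (rule mkform_ev) (auto simp only: dv_C dv_head_add dv_head_mult dv_swap)

text \<open>The alternating signs arise when the bracket is moved past the fields in front of it.
  This closed form links the recursion to the Palais formula.\<close>

lemma LV_explicit:
  assumes "X \<in> VF" "\<omega> \<in> \<Omega>" "set Xs \<subseteq> VF"
  shows "LV X Xs \<omega> p = X p (\<lambda>q. \<omega> q (ev Xs q)) -
    (\<Sum>j<length Xs. (-1) ^ j * \<omega> p (lie X (Xs ! j) p # ev (nths Xs (- {j})) p))"
  using assms
proof (induction Xs arbitrary: \<omega>)
  case (Cons Y Ys)
  have "\<omega> p (lie X (Ys ! j) p # Y p # ev (nths Ys (- {j})) p) = - ins Y \<omega> p (lie X (Ys ! j) p # ev (nths Ys (- {j})) p)" for j
    unfolding ins_apply by (rule form_swap_head[OF Cons.prems(2)])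
  moreover have "LV X Ys (ins Y \<omega>) p = X p (\<lambda>q. ins Y \<omega> q (ev Ys q)) -
    (\<Sum>j<length Ys. (-1) ^ j * ins Y \<omega> p (lie X (Ys ! j) p # ev (nths Ys (- {j})) p))"
    by (rule Cons.IH) (use Cons.prems in auto)
  ultimately show "LV X (Y # Ys) \<omega> p = X p (\<lambda>q. \<omega> q (ev (Y # Ys) q)) -
    (\<Sum>j<length (Y # Ys). (-1) ^ j * \<omega> p (lie X ((Y # Ys) ! j) p # ev (nths (Y # Ys) (- {j})) p))"
    by (simp add: sum.lessThan_Suc_shift nths_Cons_zero nths_Cons_Suc sum_negf del: sum.lessThan_Suc)
      (simp add: ins_apply)
qed simp

lemma nths_Cons_zero_Suc: "nths (v # vs) (- {0, Suc j}) = nths vs (- {j})"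
  and nths_Cons_Suc_Suc: "nths (v # vs) (- {Suc i, Suc j}) = v # nths vs (- {i, j})"
proof -
  have "{k. Suc k \<in> - {0, Suc j}} = - {j}" "{k. Suc k \<in> - {Suc i, Suc j}} = - {i, j}" by auto
  then show "nths (v # vs) (- {0, Suc j}) = nths vs (- {j})" "nths (v # vs) (- {Suc i, Suc j}) = v # nths vs (- {i, j})"
    by (simp_all add: nths_Cons)
qed

text \<open>The terms in which the first field differentiates or is bracketed add up to a Lie
  derivative along it; the others are the formula for the contracted form with reversed sign. This
  is the recursion of \<open>dv\<close>.\<close>

lemma koszul_dv:
  assumes "\<omega> \<in> \<Omega>" "set Xs \<subseteq> VF"
  shows "koszul \<omega> Xs p = dv Xs \<omega> p"
  using assms
proof (induction Xs arbitrary: \<omega>)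
  case Nil
  then show ?case by (simp add: koszul_def)
next
  case (Cons X Xs)
  let ?n = "length Xs"
  have X: "X \<in> VF" "set Xs \<subseteq> VF" using Cons.prems by auto
  have k: "koszul \<omega> Xs p = (\<Sum>i<length Xs. (-1) ^ i * (Xs ! i) p (\<lambda>q. \<omega> q (ev (nths Xs (- {i})) q))) +
    (\<Sum>j<length Xs. \<Sum>i<j. (-1) ^ (i + j) * \<omega> p (lie (Xs ! i) (Xs ! j) p # ev (nths Xs (- {i, j})) p))" for \<omega> Xs
    by (simp add: koszul_def ev_def)
  have 1: "(\<Sum>i<length (X # Xs). (-1) ^ i * ((X # Xs) ! i) p (\<lambda>q. \<omega> q (ev (nths (X # Xs) (- {i})) q))) =
      X p (\<lambda>q. \<omega> q (ev Xs q)) - (\<Sum>i<?n. (-1) ^ i * (Xs ! i) p (\<lambda>q. ins X \<omega> q (ev (nths Xs (- {i})) q)))"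
    by (simp add: sum.lessThan_Suc_shift nths_Cons_zero nths_Cons_Suc sum_negf ins_apply del: sum.lessThan_Suc)
  have s: "\<omega> p (lie (Xs ! i) (Xs ! j) p # X p # ev (nths Xs (- {i, j})) p) =
      - ins X \<omega> p (lie (Xs ! i) (Xs ! j) p # ev (nths Xs (- {i, j})) p)" for i j
    unfolding ins_apply by (rule form_swap_head[OF Cons.prems(1)])
  have 2: "(\<Sum>j<length (X # Xs). \<Sum>i<j. (-1) ^ (i + j) * \<omega> p (lie ((X # Xs) ! i) ((X # Xs) ! j) p # ev (nths (X # Xs) (- {i, j})) p)) =
     - (\<Sum>j<?n. (-1) ^ j * \<omega> p (lie X (Xs ! j) p # ev (nths Xs (- {j})) p)) -
     (\<Sum>j<?n. \<Sum>i<j. (-1) ^ (i + j) * ins X \<omega> p (lie (Xs ! i) (Xs ! j) p # ev (nths Xs (- {i, j})) p))"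
    by (simp add: sum.lessThan_Suc_shift nths_Cons_zero_Suc nths_Cons_Suc_Suc s sum_negf sum.distrib sum_subtractf
        del: sum.lessThan_Suc)
  have "koszul \<omega> (X # Xs) p = LV X Xs \<omega> p - koszul (ins X \<omega>) Xs p"
    unfolding k 1 2 LV_explicit[OF X(1) Cons.prems(1) X(2)] by simp
  moreover have "koszul (ins X \<omega>) Xs p = dv Xs (ins X \<omega>) p" by (rule Cons.IH) (use Cons.prems in auto)
  ultimately show "koszul \<omega> (X # Xs) p = dv (X # Xs) \<omega> p" by simp
qed

text \<open>Existence is provided by \<open>dd\<close>, and uniqueness holds because vector fields
  through every list of tangent vectors exist. From here on the definite description is replaced by
  the recursion.\<close>

lemma de_rham_dd: "\<omega> \<in> \<Omega> \<Longrightarrow> de_rham A \<omega> = dd \<omega>"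
  unfolding de_rham_def
proof (rule the_equality)
  assume w: "\<omega> \<in> \<Omega>"
  show 1: "dd \<omega> \<in> \<Omega> \<and> (\<forall>Xs. set Xs \<subseteq> VF \<longrightarrow> (\<forall>p. dd \<omega> p (map (\<lambda>X. X p) Xs) = koszul \<omega> Xs p))"
    using w dd_ev[OF w] by (simp add: koszul_dv ev_def)
  fix \<eta> assume e: "\<eta> \<in> \<Omega> \<and> (\<forall>Xs. set Xs \<subseteq> VF \<longrightarrow> (\<forall>p. \<eta> p (map (\<lambda>X. X p) Xs) = koszul \<omega> Xs p))"
  show "\<eta> = dd \<omega>"
    by (rule form_eqI) (use 1 e in \<open>auto simp: ev_def\<close>)
qed

section \<open>Algebraic rules for the exterior and the Lie derivative\<close>

lemma dd_Nil [simp]: "\<omega> \<in> \<Omega> \<Longrightarrow> dd \<omega> p [] = 0"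
  using dd_ev[of \<omega> "[]" p] by simp

lemma Lie_Nil [simp]: "X \<in> VF \<Longrightarrow> \<omega> \<in> \<Omega> \<Longrightarrow> Lie X \<omega> p [] = X p (\<lambda>q. \<omega> q [])"
  using Lie_ev[of X \<omega> "[]" p] by simp

lemma dd_add [simp]: "\<omega> \<in> \<Omega> \<Longrightarrow> \<eta> \<in> \<Omega> \<Longrightarrow> dd (\<omega> + \<eta>) = dd \<omega> + dd \<eta>"
  by (rule form_eqI) (auto simp: dd_ev dv_add)

lemma dd_scaleR [simp]: "\<omega> \<in> \<Omega> \<Longrightarrow> dd (c *\<^sub>R \<omega>) = c *\<^sub>R dd \<omega>"
  by (rule form_eqI) (auto simp: dd_ev dv_scaleR)

lemma dd_uminus [simp]: "\<omega> \<in> \<Omega> \<Longrightarrow> dd (- \<omega>) = - dd \<omega>"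
  using dd_scaleR[of \<omega> "-1"] by simp

lemma dd_diff [simp]: "\<omega> \<in> \<Omega> \<Longrightarrow> \<eta> \<in> \<Omega> \<Longrightarrow> dd (\<omega> - \<eta>) = dd \<omega> - dd \<eta>"
  using dd_add[of \<omega> "- \<eta>"] by simp

lemma dd_0 [simp]: "dd 0 = 0"
  using dd_scaleR[of 0 0] by simp

lemma Lie_add [simp]: "X \<in> VF \<Longrightarrow> \<omega> \<in> \<Omega> \<Longrightarrow> \<eta> \<in> \<Omega> \<Longrightarrow> Lie X (\<omega> + \<eta>) = Lie X \<omega> + Lie X \<eta>"
  by (rule form_eqI) (auto simp: Lie_ev LV_add)

lemma Lie_scaleR [simp]: "X \<in> VF \<Longrightarrow> \<omega> \<in> \<Omega> \<Longrightarrow> Lie X (c *\<^sub>R \<omega>) = c *\<^sub>R Lie X \<omega>"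
  by (rule form_eqI) (auto simp: Lie_ev LV_scaleR)

lemma Lie_uminus [simp]: "X \<in> VF \<Longrightarrow> \<omega> \<in> \<Omega> \<Longrightarrow> Lie X (- \<omega>) = - Lie X \<omega>"
  using Lie_scaleR[of X \<omega> "-1"] by simp

lemma Lie_diff [simp]: "X \<in> VF \<Longrightarrow> \<omega> \<in> \<Omega> \<Longrightarrow> \<eta> \<in> \<Omega> \<Longrightarrow> Lie X (\<omega> - \<eta>) = Lie X \<omega> - Lie X \<eta>"
  using Lie_add[of X \<omega> "- \<eta>"] by simp

lemma Lie_fun: "X \<in> VF \<Longrightarrow> \<omega> \<in> \<Omega> \<Longrightarrow> f \<in> C \<Longrightarrow> Lie X (fun_op f \<omega>) = fun_op (\<lambda>p. X p f) \<omega> + fun_op f (Lie X \<omega>)"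
  by (rule form_eqI) (auto simp: Lie_ev LV_fun)

lemma dd_fun: "\<omega> \<in> \<Omega> \<Longrightarrow> f \<in> C \<Longrightarrow> dd (fun_op f \<omega>) = fun_op f (dd \<omega>) + wd (dfun f) \<omega>"
  by (rule form_eqI) (auto simp: dd_ev dv_fun)

lemma ins_dd: "X \<in> VF \<Longrightarrow> \<omega> \<in> \<Omega> \<Longrightarrow> ins X (dd \<omega>) = Lie X \<omega> - dd (ins X \<omega>)"
proof (rule form_eqI)
  fix Xs p assume X: "X \<in> VF" "\<omega> \<in> \<Omega>" "set Xs \<subseteq> VF"
  show "ins X (dd \<omega>) p (ev Xs p) = (Lie X \<omega> - dd (ins X \<omega>)) p (ev Xs p)"
    using X dd_ev[of \<omega> "X # Xs" p] by (simp add: ins_apply Lie_ev dd_ev)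
qed auto

lemma ins_Lie: "X \<in> VF \<Longrightarrow> Y \<in> VF \<Longrightarrow> \<omega> \<in> \<Omega> \<Longrightarrow> ins Y (Lie X \<omega>) = Lie X (ins Y \<omega>) - ins (lie X Y) \<omega>"
proof (rule form_eqI)
  fix Xs p assume X: "X \<in> VF" "Y \<in> VF" "\<omega> \<in> \<Omega>" "set Xs \<subseteq> VF"
  show "ins Y (Lie X \<omega>) p (ev Xs p) = (Lie X (ins Y \<omega>) - ins (lie X Y) \<omega>) p (ev Xs p)"
    using X Lie_ev[of X \<omega> "Y # Xs" p] by (simp add: ins_apply Lie_ev)
qed auto

subsection \<open>One-forms\<close>

definition cov :: "'a form \<Rightarrow> 'a \<Rightarrow> 'a covec"
  where "cov \<omega> = (\<lambda>p v. \<omega> p [v])"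

lemma cov_CF [simp]: "\<omega> \<in> \<Omega> \<Longrightarrow> cov \<omega> \<in> CF"
proof (rule CFI)
  assume w: "\<omega> \<in> \<Omega>"
  show "cov \<omega> p \<in> T' p" for p
    by (rule T'I) (use w in \<open>auto simp: cov_def form_head form_outside\<close>)
  show "(\<lambda>p. cov \<omega> p (X p)) \<in> C" if "X \<in> VF" for X
    using form_C[OF w, of "[X]"] that by (simp add: cov_def)
qed

definition LieC :: "('a \<Rightarrow> 'a tvec) \<Rightarrow> ('a \<Rightarrow> 'a covec) \<Rightarrow> 'a \<Rightarrow> 'a covec"
  where "LieC X \<alpha> = cov (Lie X (wd \<alpha> one_form0))"

text \<open>The one-form \<iota>_Y d\<alpha>, the subtracted term in the covector part of the
  Dorfman bracket.\<close>

definition dC :: "('a \<Rightarrow> 'a tvec) \<Rightarrow> ('a \<Rightarrow> 'a covec) \<Rightarrow> 'a \<Rightarrow> 'a covec"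
  where "dC Y \<alpha> = cov (ins Y (dd (wd \<alpha> one_form0)))"

lemma LieC_CF [simp]: "X \<in> VF \<Longrightarrow> \<alpha> \<in> CF \<Longrightarrow> LieC X \<alpha> \<in> CF"
  and dC_CF [simp]: "X \<in> VF \<Longrightarrow> \<alpha> \<in> CF \<Longrightarrow> dC X \<alpha> \<in> CF"
  by (simp_all add: LieC_def dC_def)

lemma wd_one_form0 [simp]: "wd \<alpha> one_form0 p [v] = \<alpha> p v"
  by (simp add: wd_def wedge_left_def one_form0_def)

lemma LieC_apply: "X \<in> VF \<Longrightarrow> \<alpha> \<in> CF \<Longrightarrow> Y \<in> VF \<Longrightarrow>
    LieC X \<alpha> p (Y p) = X p (\<lambda>q. \<alpha> q (Y q)) - \<alpha> p (lie X Y p)"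
  using Lie_ev[of X "wd \<alpha> one_form0" "[Y]" p] by (simp add: LieC_def cov_def ins_apply)

lemma dC_apply: "X \<in> VF \<Longrightarrow> \<alpha> \<in> CF \<Longrightarrow> Y \<in> VF \<Longrightarrow>
    dC X \<alpha> p (Y p) = X p (\<lambda>q. \<alpha> q (Y q)) - Y p (\<lambda>q. \<alpha> q (X q)) - \<alpha> p (lie X Y p)"
  using dd_ev[of "wd \<alpha> one_form0" "[X, Y]" p] by (simp add: dC_def cov_def ins_apply)

lemma dC_LieC: "X \<in> VF \<Longrightarrow> \<alpha> \<in> CF \<Longrightarrow> dC X \<alpha> = (\<lambda>p. LieC X \<alpha> p - dfun (\<lambda>q. \<alpha> q (X q)) p)"
  by (rule CF_eqI) (auto simp: LieC_apply dC_apply)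

lemma Lie_wd:
  assumes X: "X \<in> VF" and a: "\<alpha> \<in> CF" and w: "\<omega> \<in> \<Omega>"
  shows "Lie X (wd \<alpha> \<omega>) = wd (LieC X \<alpha>) \<omega> + wd \<alpha> (Lie X \<omega>)"
proof -
  let ?S = "\<lambda>\<omega>. Lie X (wd \<alpha> \<omega>) - wd (LieC X \<alpha>) \<omega> - wd \<alpha> (Lie X \<omega>)"
  have "?S \<omega> = 0"
  proof (rule operator_zero[where S = ?S and c = "-1"])
    fix Y \<omega> assume Y: "Y \<in> VF" and w: "\<omega> \<in> \<Omega>"
    let ?f = "\<lambda>p. \<alpha> p (Y p)"
    have 1: "ins Y (Lie X (wd \<alpha> \<omega>)) = Lie X (fun_op ?f \<omega> - wd \<alpha> (ins Y \<omega>)) - ins (lie X Y) (wd \<alpha> \<omega>)"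
      using X Y a w by (simp add: ins_Lie ins_wd)
    have 2: "Lie X (fun_op ?f \<omega> - wd \<alpha> (ins Y \<omega>)) = fun_op (\<lambda>p. X p ?f) \<omega> + fun_op ?f (Lie X \<omega>) - Lie X (wd \<alpha> (ins Y \<omega>))"
      using X Y a w by (simp add: Lie_fun)
    have 3: "ins Y (wd (LieC X \<alpha>) \<omega>) = fun_op (\<lambda>p. X p ?f) \<omega> - fun_op (\<lambda>p. \<alpha> p (lie X Y p)) \<omega> - wd (LieC X \<alpha>) (ins Y \<omega>)"
      using X Y a w by (auto simp: ins_wd LieC_apply fun_eq_iff algebra_simps)
    have 4: "ins Y (wd \<alpha> (Lie X \<omega>)) = fun_op ?f (Lie X \<omega>) - wd \<alpha> (Lie X (ins Y \<omega>)) + wd \<alpha> (ins (lie X Y) \<omega>)"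
      using X Y a w by (simp add: ins_wd ins_Lie)
    show "ins Y (?S \<omega>) = (-1) *\<^sub>R ?S (ins Y \<omega>)"
      unfolding ins_diff 1 2 3 4 by (simp add: ins_wd)
  qed (use assms T_const[OF VF_T[OF X]] in auto)
  then show ?thesis by (simp add: algebra_simps)
qed

text \<open>The operator \<open>[\<alpha>, d]\<close>, i.e. multiplication by the two-form \<open>d\<alpha>\<close>.\<close>

definition dmul :: "('a \<Rightarrow> 'a covec) \<Rightarrow> 'a form \<Rightarrow> 'a form"
  where "dmul \<alpha> \<omega> = dd (wd \<alpha> \<omega>) + wd \<alpha> (dd \<omega>)"

lemma dmul_form [simp]: "\<alpha> \<in> CF \<Longrightarrow> \<omega> \<in> \<Omega> \<Longrightarrow> dmul \<alpha> \<omega> \<in> \<Omega>"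
  by (simp add: dmul_def)

lemma dmul_add [simp]: "\<alpha> \<in> CF \<Longrightarrow> \<omega> \<in> \<Omega> \<Longrightarrow> \<eta> \<in> \<Omega> \<Longrightarrow> dmul \<alpha> (\<omega> + \<eta>) = dmul \<alpha> \<omega> + dmul \<alpha> \<eta>"
  by (simp add: dmul_def)

lemma dmul_scaleR [simp]: "\<alpha> \<in> CF \<Longrightarrow> \<omega> \<in> \<Omega> \<Longrightarrow> dmul \<alpha> (c *\<^sub>R \<omega>) = c *\<^sub>R dmul \<alpha> \<omega>"
  by (simp add: dmul_def scaleR_add_right)

lemma dmul_diff [simp]: "\<alpha> \<in> CF \<Longrightarrow> \<omega> \<in> \<Omega> \<Longrightarrow> \<eta> \<in> \<Omega> \<Longrightarrow> dmul \<alpha> (\<omega> - \<eta>) = dmul \<alpha> \<omega> - dmul \<alpha> \<eta>"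
  by (simp add: dmul_def)

lemma dmul_fun: "\<alpha> \<in> CF \<Longrightarrow> \<omega> \<in> \<Omega> \<Longrightarrow> f \<in> C \<Longrightarrow> dmul \<alpha> (fun_op f \<omega>) = fun_op f (dmul \<alpha> \<omega>)"
  using wd_anti[of \<alpha> "dfun f" \<omega>] by (simp add: dmul_def dd_fun)

lemma ins_dmul:
  assumes Y: "Y \<in> VF" and a: "\<alpha> \<in> CF" and w: "\<omega> \<in> \<Omega>"
  shows "ins Y (dmul \<alpha> \<omega>) = dmul \<alpha> (ins Y \<omega>) + wd (dC Y \<alpha>) \<omega>"
  using assms
  by (simp add: dmul_def ins_dd ins_wd Lie_wd dd_fun dC_LieC wd_diff_left)

text \<open>A two-form commutes with a one-form. Under contraction the extra terms are products of
  \<open>\<beta>\<close> with \<iota>_Y d\<alpha> in both orders, and \<open>wd_anti\<close> removes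
  them.\<close>

lemma dmul_wd:
  assumes a: "\<alpha> \<in> CF" and b: "\<beta> \<in> CF" and w: "\<omega> \<in> \<Omega>"
  shows "dmul \<alpha> (wd \<beta> \<omega>) = wd \<beta> (dmul \<alpha> \<omega>)"
proof -
  let ?S = "\<lambda>\<omega>. dmul \<alpha> (wd \<beta> \<omega>) - wd \<beta> (dmul \<alpha> \<omega>)"
  have "?S \<omega> = 0"
  proof (rule operator_zero[where S = ?S and c = "-1"])
    fix Y \<omega> assume Y: "Y \<in> VF" and w: "\<omega> \<in> \<Omega>"
    then show "ins Y (?S \<omega>) = (-1) *\<^sub>R ?S (ins Y \<omega>)"
      using a b wd_anti[of \<beta> "dC Y \<alpha>" \<omega>]
      by (simp add: ins_dmul ins_wd dmul_fun)
  qed (use assms in \<open>auto simp: dmul_def\<close>)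
  then show ?thesis by simp
qed

end

section \<open>Graded commutators on forms and the Dorfman bracket\<close>

lemmas fapply = plus_fun_apply zero_fun_apply minus_apply uminus_apply scaleR_fun_apply

(* Unification produces eta-expanded terms, which these rules would unfold below operators. *)
declare fapply [simp del] and smooth_mfd.fun_op_apply [simp del]

lemma deg_part_apply: "deg_part k \<omega> p vs = (if int (length vs) = k then \<omega> p vs else 0)"
  by (simp add: deg_part_def)

lemma minus_one_powi: "(-1) powi k = (if even k then 1 else (-1) :: real)"
  by (auto simp: power_int_def even_nat_iff)

context smooth_mfd
begin

lemma form_slot_sum:
  assumes w: "\<omega> \<in> \<Omega>" and "finite I" "\<And>i. i \<in> I \<Longrightarrow> v i \<in> T p"
  shows "\<omega> p (us @ (\<Sum>i\<in>I. c i *\<^sub>R v i) # ws) = (\<Sum>i\<in>I. c i * \<omega> p (us @ v i # ws))"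
  using assms(2,3)
proof (induction I)
  case empty
  show ?case using form_slot[OF w, of 0 p 0 us 0 0 ws] by simp
next
  case (insert i I)
  have "\<omega> p (us @ (c i *\<^sub>R v i + 1 *\<^sub>R (\<Sum>i\<in>I. c i *\<^sub>R v i)) # ws) =
      c i * \<omega> p (us @ v i # ws) + 1 * \<omega> p (us @ (\<Sum>i\<in>I. c i *\<^sub>R v i) # ws)"
    using insert by (intro form_slot w T_sum_vec) auto
  then show ?case using insert by simp
qed

text \<open>Expanding every entry in a frame of \<open>mdim A\<close> fields leaves only lists with
  a repeated entry. This is why the finite ranges of degrees in the graded commutators lose
  nothing.\<close>

lemma form_top:
  assumes w: "\<omega> \<in> \<Omega>" and len: "length vs > mdim A"
  shows "\<omega> p vs = 0"
proof (cases "set vs \<subseteq> T p")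
  case True
  obtain W E \<xi> where W: "open W" "p \<in> W" "\<And>b. E b \<in> VF" "\<And>b. \<xi> b \<in> C"
    "\<And>q b c. q \<in> W \<Longrightarrow> b \<in> \<B> \<Longrightarrow> c \<in> \<B> \<Longrightarrow> E b q (\<xi> c) = (if b = c then 1 else 0)"
    "\<And>q v. q \<in> W \<Longrightarrow> v \<in> T q \<Longrightarrow> v = (\<Sum>b\<in>\<B>. v (\<xi> b) *\<^sub>R E b q)"
    by (rule frame_exists[of p]) blast
  let ?B = "(\<lambda>b. E b p) ` \<B>"
  have "\<omega> p (us @ vs) = 0" if "set us \<subseteq> ?B" "set vs \<subseteq> T p" "length us + length vs > mdim A" for us vs
    using that
  proof (induction vs arbitrary: us)
    case Nil
    have "card ?B \<le> mdim A" using card_image_le[of \<B> "\<lambda>b. E b p"] by (simp add: card_\<B>)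
    have "\<not> distinct us"
    proof
      assume "distinct us"
      then have "length us \<le> card ?B"
        using Nil(1) card_mono[of ?B "set us"] by (simp add: distinct_card)
      then show False using Nil(3) \<open>card ?B \<le> mdim A\<close> by simp
    qed
    then show ?case by (simp add: form_distinct[OF w])
  next
    case (Cons v vs)
    have "v = (\<Sum>b\<in>\<B>. v (\<xi> b) *\<^sub>R E b p)" using W(2,6) Cons.prems by simp
    then have "\<omega> p (us @ v # vs) = (\<Sum>b\<in>\<B>. v (\<xi> b) * \<omega> p (us @ E b p # vs))"
      using form_slot_sum[OF w finite_\<B>, of "\<lambda>b. E b p" p us "\<lambda>b. v (\<xi> b)" vs] W(3) by simp
    also have "\<dots> = 0"
    proof (rule sum.neutral, rule ballI)
      fix b assume "b \<in> \<B>"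
      then have "\<omega> p ((us @ [E b p]) @ vs) = 0" using Cons.prems by (intro Cons.IH) auto
      then show "v (\<xi> b) * \<omega> p (us @ E b p # vs) = 0" by simp
    qed
    finally show ?case .
  qed
  from this[of "[]" vs] show ?thesis using True len by simp
qed (rule form_outside[OF w])

lemma deg_part_form [simp]: "\<omega> \<in> \<Omega> \<Longrightarrow> deg_part k \<omega> \<in> \<Omega>"
proof (rule formI)
  assume w: "\<omega> \<in> \<Omega>"
  fix p us v w' ws
  show "deg_part k \<omega> p (us @ v # w' # ws) = - deg_part k \<omega> p (us @ w' # v # ws)"
    using form_swap[OF w, of p us v w' ws] by (simp add: deg_part_apply)
  fix Xs assume Xs: "set Xs \<subseteq> VF"
  show "(\<lambda>p. deg_part k \<omega> p (ev Xs p)) \<in> C"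
    using form_C[OF w Xs] by (cases "int (length Xs) = k") (auto simp: deg_part_apply)
qed (auto simp: deg_part_apply form_outside form_head)

text \<open>The parity involution. Commuting or anticommuting with it expresses even or odd degree
  without splitting an operator such as \<open>sec_op x\<close> into its components of degree 1 and
  -1.\<close>

definition tau :: "'a form \<Rightarrow> 'a form"
  where "tau \<omega> = (\<lambda>p vs. (-1) ^ length vs * \<omega> p vs)"

lemma tau_apply: "tau \<omega> p vs = (-1) ^ length vs * \<omega> p vs" by (simp add: tau_def)

lemma tau_form [simp]: "\<omega> \<in> \<Omega> \<Longrightarrow> tau \<omega> \<in> \<Omega>"
proof (rule formI)
  assume w: "\<omega> \<in> \<Omega>"
  fix p us v w' ws
  show "tau \<omega> p (us @ v # w' # ws) = - tau \<omega> p (us @ w' # v # ws)"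
    using form_swap[OF w, of p us v w' ws] by (simp add: tau_apply)
  fix Xs assume Xs: "set Xs \<subseteq> VF"
  show "(\<lambda>p. tau \<omega> p (ev Xs p)) \<in> C"
    using form_C[OF w Xs] by (simp add: tau_apply)
qed (auto simp: tau_apply form_outside form_head algebra_simps)

lemma tau_add [simp]: "tau (\<omega> + \<eta>) = tau \<omega> + tau \<eta>"
  and tau_fun_op [simp]: "tau (fun_op f \<omega>) = fun_op f (tau \<omega>)"
  and tau_diff [simp]: "tau (\<omega> - \<eta>) = tau \<omega> - tau \<eta>"
  and tau_uminus [simp]: "tau (- \<omega>) = - tau \<omega>"
  and ins_tau: "ins X (tau \<omega>) = - tau (ins X \<omega>)"
  by (auto simp: fun_eq_iff tau_apply ins_apply algebra_simps fapply fun_op_apply)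

lemma tau_wd:
  assumes a: "\<alpha> \<in> CF" and w: "\<omega> \<in> \<Omega>"
  shows "wd \<alpha> (tau \<omega>) = - tau (wd \<alpha> \<omega>)"
proof -
  let ?S = "\<lambda>\<omega>. wd \<alpha> (tau \<omega>) + tau (wd \<alpha> \<omega>)"
  have "?S \<omega> = 0"
    by (rule operator_zero[where S = ?S and c = 1]) (use assms in \<open>auto simp: ins_wd ins_tau tau_apply fapply\<close>)
  then show ?thesis by (simp add: eq_neg_iff_add_eq_0)
qed

lemma tau_Lie:
  assumes X: "X \<in> VF" and w: "\<omega> \<in> \<Omega>"
  shows "Lie X (tau \<omega>) = tau (Lie X \<omega>)"
proof -
  let ?S = "\<lambda>\<omega>. Lie X (tau \<omega>) - tau (Lie X \<omega>)"
  have "?S \<omega> = 0"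
    by (rule operator_zero[where S = ?S and c = "-1"]) (use assms in \<open>auto simp: ins_Lie ins_tau tau_apply fapply\<close>)
  then show ?thesis by simp
qed

lemma tau_dd:
  assumes w: "\<omega> \<in> \<Omega>"
  shows "dd (tau \<omega>) = - tau (dd \<omega>)"
proof -
  let ?S = "\<lambda>\<omega>. dd (tau \<omega>) + tau (dd \<omega>)"
  have "?S \<omega> = 0"
    by (rule operator_zero[where S = ?S and c = "1"]) (use assms in \<open>auto simp: ins_dd ins_tau tau_Lie tau_apply fapply\<close>)
  then show ?thesis by (simp add: eq_neg_iff_add_eq_0)
qed

lemma ins_deg_part: "ins X (deg_part k \<omega>) = deg_part (k - 1) (ins X \<omega>)"
  by (auto simp: fun_eq_iff ins_apply deg_part_apply fapply)

lemma LV_deg_part: "X \<in> VF \<Longrightarrow> LV X Ys (deg_part k \<omega>) p = (if int (length Ys) = k then LV X Ys \<omega> p else 0)"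
proof (induction Ys arbitrary: k \<omega>)
  case Nil
  then show ?case using T_const[OF VF_T] by (simp add: deg_part_apply)
next
  case (Cons Y Ys)
  have "LV X Ys (deg_part (k - 1) (ins Y \<omega>)) p = (if int (length Ys) = k - 1 then LV X Ys (ins Y \<omega>) p else 0)"
    by (rule Cons.IH) (rule Cons.prems)
  then show "LV X (Y # Ys) (deg_part k \<omega>) p = (if int (length (Y # Ys)) = k then LV X (Y # Ys) \<omega> p else 0)"
    by (simp add: ins_deg_part deg_part_apply)
qed

lemma dv_deg_part: "set Xs \<subseteq> VF \<Longrightarrow> dv Xs (deg_part k \<omega>) p = (if int (length Xs) = k + 1 then dv Xs \<omega> p else 0)"
proof (induction Xs arbitrary: k \<omega>)
  case (Cons X Xs)
  have "dv Xs (deg_part (k - 1) (ins X \<omega>)) p = (if int (length Xs) = k - 1 + 1 then dv Xs (ins X \<omega>) p else 0)"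
    by (rule Cons.IH) (use Cons.prems in auto)
  then show "dv (X # Xs) (deg_part k \<omega>) p = (if int (length (X # Xs)) = k + 1 then dv (X # Xs) \<omega> p else 0)"
    using Cons.prems by (simp add: ins_deg_part LV_deg_part)
qed simp

lemma dd_deg_part: "\<omega> \<in> \<Omega> \<Longrightarrow> dd (deg_part k \<omega>) = deg_part (k + 1) (dd \<omega>)"
  by (rule form_eqI) (auto simp: dd_ev dv_deg_part deg_part_apply)

subsection \<open>Operators of even or odd degree\<close>

text \<open>The number \<open>s\<close> is 1 for even and -1 for odd operators. Only the behaviour
  on genuine forms is constrained, because a \<open>form_op\<close> is defined on arbitrary
  functions as well.\<close>

definition oper :: "real \<Rightarrow> 'a form_op \<Rightarrow> bool"
  where "oper s F \<longleftrightarrow> (\<forall>\<omega>\<in>\<Omega>. F \<omega> \<in> \<Omega>) \<and> (\<forall>\<omega>\<in>\<Omega>. \<forall>\<eta>\<in>\<Omega>. F (\<omega> + \<eta>) = F \<omega> + F \<eta>) \<and>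
     (\<forall>\<omega>\<in>\<Omega>. F (tau \<omega>) = s *\<^sub>R tau (F \<omega>))"

lemma operI:
  "(\<And>\<omega>. \<omega> \<in> \<Omega> \<Longrightarrow> F \<omega> \<in> \<Omega>) \<Longrightarrow> (\<And>\<omega> \<eta>. \<omega> \<in> \<Omega> \<Longrightarrow> \<eta> \<in> \<Omega> \<Longrightarrow> F (\<omega> + \<eta>) = F \<omega> + F \<eta>) \<Longrightarrow>
   (\<And>\<omega>. \<omega> \<in> \<Omega> \<Longrightarrow> F (tau \<omega>) = s *\<^sub>R tau (F \<omega>)) \<Longrightarrow> oper s F"
  by (simp add: oper_def)

lemma oper_form: "oper s F \<Longrightarrow> \<omega> \<in> \<Omega> \<Longrightarrow> F \<omega> \<in> \<Omega>"
  and oper_add: "oper s F \<Longrightarrow> \<omega> \<in> \<Omega> \<Longrightarrow> \<eta> \<in> \<Omega> \<Longrightarrow> F (\<omega> + \<eta>) = F \<omega> + F \<eta>"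
  and oper_tau: "oper s F \<Longrightarrow> \<omega> \<in> \<Omega> \<Longrightarrow> F (tau \<omega>) = s *\<^sub>R tau (F \<omega>)"
  by (simp_all add: oper_def)

lemma oper_cong: "oper s F \<Longrightarrow> (\<And>\<omega>. \<omega> \<in> \<Omega> \<Longrightarrow> G \<omega> = F \<omega>) \<Longrightarrow> oper s G"
  by (simp add: oper_def)

lemma oper_zero: "oper s F \<Longrightarrow> F 0 = 0"
  using oper_add[of s F 0 0] by simp

lemma oper_uminus: "oper s F \<Longrightarrow> \<omega> \<in> \<Omega> \<Longrightarrow> F (- \<omega>) = - F \<omega>"
  using oper_add[of s F \<omega> "- \<omega>"] oper_zero[of s F] by (simp add: eq_neg_iff_add_eq_0 add.commute)

lemma oper_sum: "oper s F \<Longrightarrow> (\<And>i. i \<in> I \<Longrightarrow> \<omega> i \<in> \<Omega>) \<Longrightarrow> F (\<Sum>i\<in>I. \<omega> i) = (\<Sum>i\<in>I. F (\<omega> i))"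
  by (induction I rule: infinite_finite_induct) (auto simp: oper_zero oper_add forms_sum)

abbreviation "N \<equiv> mdim A"

lemma sum_deg_part:
  assumes w: "\<omega> \<in> \<Omega>" and le: "a \<le> 0" "int N \<le> b"
  shows "(\<Sum>j = a..b. deg_part j \<omega>) = \<omega>"
proof (intro ext)
  fix p vs
  show "(\<Sum>j = a..b. deg_part j \<omega>) p vs = \<omega> p vs"
    using form_top[OF w, of vs p] le by (auto simp: sum_apply deg_part_apply)
qed

lemma hom_comp_form: "oper s F \<Longrightarrow> \<omega> \<in> \<Omega> \<Longrightarrow> hom_comp deg_part n k F \<omega> \<in> \<Omega>"
  unfolding hom_comp_def by (intro forms_sum deg_part_form oper_form[of s F])

lemma deg_part_add [simp]: "deg_part k (\<omega> + \<eta>) = deg_part k \<omega> + deg_part k \<eta>"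
  and deg_part_0 [simp]: "deg_part k 0 = 0"
  and deg_part_fun_op [simp]: "deg_part k (fun_op f \<omega>) = fun_op f (deg_part k \<omega>)"
  by (auto simp: fun_eq_iff deg_part_apply fapply fun_op_apply)

lemma hom_comp_add: "oper s F \<Longrightarrow> \<omega> \<in> \<Omega> \<Longrightarrow> \<eta> \<in> \<Omega> \<Longrightarrow>
    hom_comp deg_part n k F (\<omega> + \<eta>) = hom_comp deg_part n k F \<omega> + hom_comp deg_part n k F \<eta>"
  unfolding hom_comp_def by (simp add: oper_add[of s F] sum.distrib)

lemma hom_comp_zero: "oper s F \<Longrightarrow> hom_comp deg_part n k F 0 = 0"
  unfolding hom_comp_def by (simp add: oper_zero)

lemma hom_comp_sum: "oper s F \<Longrightarrow> (\<And>i. i \<in> I \<Longrightarrow> \<omega> i \<in> \<Omega>) \<Longrightarrow>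
    hom_comp deg_part n k F (\<Sum>i\<in>I. \<omega> i) = (\<Sum>i\<in>I. hom_comp deg_part n k F (\<omega> i))"
  by (induction I rule: infinite_finite_induct) (auto simp: hom_comp_zero hom_comp_add forms_sum)

lemma sum_hom_comp:
  assumes F: "oper s F" and w: "\<omega> \<in> \<Omega>"
  shows "(\<Sum>k = - 2 * int N..2 * int N. hom_comp deg_part N k F \<omega>) = F \<omega>"
proof -
  have "(\<Sum>k = - 2 * int N..2 * int N. deg_part (j + k) \<eta>) = \<eta>"
    if "\<eta> \<in> \<Omega>" "j \<in> {- int N..int N}" for \<eta> j
  proof -
    \<comment> \<open>For \<open>j\<close> between -N and N the shifted window still contains 0..N,
      where all degrees of forms lie. This is what the bound 2N is for.\<close>
    have "(\<Sum>k = - 2 * int N..2 * int N. deg_part (j + k) \<eta>) = (\<Sum>k = j - 2 * int N..j + 2 * int N. deg_part k \<eta>)"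
      by (rule sum.reindex_bij_witness[of _ "\<lambda>k. k - j" "\<lambda>k. j + k"]) auto
    also have "\<dots> = \<eta>" using that by (intro sum_deg_part) auto
    finally show ?thesis .
  qed
  note * = this
  have "(\<Sum>j = - int N..int N. \<Sum>k = - 2 * int N..2 * int N. deg_part (j + k) (F (deg_part j \<omega>))) =
      (\<Sum>j = - int N..int N. F (deg_part j \<omega>))"
    by (intro sum.cong refl *) (use w in \<open>simp_all add: oper_form[OF F]\<close>)
  also have "\<dots> = F (\<Sum>j = - int N..int N. deg_part j \<omega>)" using w by (intro oper_sum[OF F, symmetric]) auto
  also have "\<dots> = F \<omega>" using sum_deg_part[OF w] by simp
  finally show ?thesis unfolding hom_comp_def by (subst sum.swap)
qed

lemma tau_deg_part: "tau (deg_part j \<omega>) = (if even j then deg_part j \<omega> else - deg_part j \<omega>)"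
  by (auto simp: fun_eq_iff tau_apply deg_part_apply fapply)

text \<open>On a homogeneous form the rule for \<open>tau\<close> fixes the parity of the degrees in
  which \<open>F\<close> takes values; a component of the wrong parity equals its own
  negative.\<close>

lemma hom_comp_parity:
  assumes F: "oper s F" and w: "\<omega> \<in> \<Omega>" and s: "s = 1 \<and> odd k \<or> s = -1 \<and> even k"
  shows "hom_comp deg_part n k F \<omega> = 0"
  unfolding hom_comp_def
proof (rule sum.neutral, rule ballI)
  fix j :: int
  let ?w = "deg_part j \<omega>"
  have e: "F (tau ?w) = s *\<^sub>R tau (F ?w)" by (rule oper_tau[OF F]) (use w in simp)
  have f: "F (tau ?w) = (if even j then F ?w else - F ?w)"
    using w by (simp add: tau_deg_part oper_uminus[OF F])
  show "deg_part (j + k) (F ?w) = 0"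
  proof (intro ext)
    fix p vs
    have "(if even j then F ?w p vs else - F ?w p vs) = s * ((-1) ^ length vs * F ?w p vs)"
      using e[unfolded f, THEN fun_cong[of _ _ p], THEN fun_cong[of _ _ vs]]
      by (cases "even j") (simp_all add: tau_apply fapply)
    moreover have "int (length vs) = j + k \<Longrightarrow> even (length vs) = (even j = even k)"
      by (metis even_add even_of_nat)
    ultimately show "deg_part (j + k) (F ?w) p vs = 0 p vs"
      using s by (auto simp: deg_part_apply fapply split: if_splits)
  qed
qed

text \<open>By \<open>hom_comp_parity\<close> only degrees that match the parities of
  \<open>F\<close> and \<open>G\<close> survive in the double sum. For those the sign
  \<open>(-1) powi (k * l)\<close> is constant, so it can be pulled out and the components added up
  again.\<close>

lemma op_comm_eq:
  assumes F: "oper s F" and G: "oper t G" and s: "s = 1 \<or> s = -1" and t: "t = 1 \<or> t = -1" and w: "\<omega> \<in> \<Omega>"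
  shows "op_comm A F G \<omega> = F (G \<omega>) - (if s = -1 \<and> t = -1 then -1 else 1) *\<^sub>R G (F \<omega>)"
proof -
  let ?\<sigma> = "if s = -1 \<and> t = -1 then -1 else 1 :: real"
  let ?I = "{- 2 * int N..2 * int N}"
  let ?F = "\<lambda>k. hom_comp deg_part N k F" and ?G = "\<lambda>k. hom_comp deg_part N k G"
  have Gw: "G \<omega> \<in> \<Omega>" and Fw: "F \<omega> \<in> \<Omega>" using F G w by (auto intro: oper_form)
  have sign: "((-1) powi (k * l)) *\<^sub>R ?G l (?F k \<omega>) = ?\<sigma> *\<^sub>R ?G l (?F k \<omega>)" for k l
  proof (cases "(s = 1 \<and> odd k \<or> s = -1 \<and> even k) \<or> (t = 1 \<and> odd l \<or> t = -1 \<and> even l)")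
    case True
    then have "?G l (?F k \<omega>) = 0"
      using hom_comp_parity[OF F w] hom_comp_zero[OF G] hom_comp_parity[OF G hom_comp_form[OF F w]] by metis
    then show ?thesis by simp
  next
    case False
    then show ?thesis using s t by (auto simp: minus_one_powi)
  qed
  have 1: "(\<Sum>k\<in>?I. \<Sum>l\<in>?I. ?F k (?G l \<omega>)) = F (G \<omega>)"
  proof -
    have "(\<Sum>k\<in>?I. \<Sum>l\<in>?I. ?F k (?G l \<omega>)) = (\<Sum>k\<in>?I. ?F k (\<Sum>l\<in>?I. ?G l \<omega>))"
      by (intro sum.cong refl hom_comp_sum[OF F, symmetric] hom_comp_form[OF G w])
    then show ?thesis unfolding sum_hom_comp[OF G w] sum_hom_comp[OF F Gw] .
  qed
  have 2: "(\<Sum>k\<in>?I. \<Sum>l\<in>?I. ?G l (?F k \<omega>)) = G (F \<omega>)"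
  proof -
    have "(\<Sum>l\<in>?I. \<Sum>k\<in>?I. ?G l (?F k \<omega>)) = (\<Sum>l\<in>?I. ?G l (\<Sum>k\<in>?I. ?F k \<omega>))"
      by (intro sum.cong refl hom_comp_sum[OF G, symmetric] hom_comp_form[OF F w])
    then show ?thesis unfolding sum_hom_comp[OF F w] sum_hom_comp[OF G Fw] by (subst sum.swap)
  qed
  have "op_comm A F G \<omega> = (\<Sum>k\<in>?I. \<Sum>l\<in>?I. ?F k (?G l \<omega>) - ?\<sigma> *\<^sub>R ?G l (?F k \<omega>))"
    unfolding op_comm_def graded_comm_def sign ..
  also have "\<dots> = (\<Sum>k\<in>?I. \<Sum>l\<in>?I. ?F k (?G l \<omega>)) - ?\<sigma> *\<^sub>R (\<Sum>k\<in>?I. \<Sum>l\<in>?I. ?G l (?F k \<omega>))"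
    by (simp only: sum_subtractf scaleR_right.sum)
  finally show ?thesis unfolding 1 2 .
qed

lemma op_comm_odd: "oper (-1) F \<Longrightarrow> oper (-1) G \<Longrightarrow> \<omega> \<in> \<Omega> \<Longrightarrow> op_comm A F G \<omega> = F (G \<omega>) + G (F \<omega>)"
  using op_comm_eq[of "-1" F "-1" G \<omega>] by simp

lemma op_comm_even: "oper 1 F \<Longrightarrow> oper t G \<Longrightarrow> t = 1 \<or> t = -1 \<Longrightarrow> \<omega> \<in> \<Omega> \<Longrightarrow> op_comm A F G \<omega> = F (G \<omega>) - G (F \<omega>)"
  using op_comm_eq[of 1 F t G \<omega>] by simp

lemma oper_plus: "oper s F \<Longrightarrow> oper s G \<Longrightarrow> oper s (\<lambda>\<omega>. F \<omega> + G \<omega>)"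
  by (rule operI) (auto simp: oper_form oper_add oper_tau scaleR_add_right)

lemma oper_ins: "X \<in> VF \<Longrightarrow> oper (-1) (ins X)"
  by (rule operI) (auto simp: ins_tau)

lemma oper_wd: "\<alpha> \<in> CF \<Longrightarrow> oper (-1) (wd \<alpha>)"
  by (rule operI) (auto simp: tau_wd)

lemma oper_Lie: "X \<in> VF \<Longrightarrow> oper 1 (Lie X)"
  by (rule operI) (auto simp: tau_Lie)

lemma oper_dd: "oper (-1) dd"
  by (rule operI) (auto simp: tau_dd)

lemma oper_de_rham: "oper (-1) (de_rham A)"
  by (rule oper_cong[OF oper_dd]) (rule de_rham_dd)

lemma oper_dmul: "\<alpha> \<in> CF \<Longrightarrow> oper 1 (dmul \<alpha>)"
  by (rule operI) (auto simp: dmul_def tau_dd tau_wd)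

lemma oper_fun_op: "f \<in> C \<Longrightarrow> oper 1 (fun_op f)"
  by (rule operI) auto

subsection \<open>Sections of the generalized tangent bundle\<close>

abbreviation "TS \<equiv> ttm_sections A"

definition vp :: "('a \<Rightarrow> 'a ttvec) \<Rightarrow> 'a \<Rightarrow> 'a tvec" where "vp x = (\<lambda>p. fst (x p))"
definition cp :: "('a \<Rightarrow> 'a ttvec) \<Rightarrow> 'a \<Rightarrow> 'a covec" where "cp x = (\<lambda>p. snd (x p))"

lemma TS_iff: "x \<in> TS \<longleftrightarrow> vp x \<in> VF \<and> cp x \<in> CF"
  unfolding ttm_sections_def ttm_section_def vp_def cp_def vector_fields_def CF_def C_iff mem_Collect_eq
  by (simp only: UNIV_I ball_UNIV)

lemma TS_vp [simp]: "x \<in> TS \<Longrightarrow> vp x \<in> VF" and TS_cp [simp]: "x \<in> TS \<Longrightarrow> cp x \<in> CF"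
  unfolding TS_iff by blast+

lemma vp_apply: "vp x p = fst (x p)" and cp_apply: "cp x p = snd (x p)"
  by (simp_all add: vp_def cp_def)

lemma TS_eqI: "vp x = vp y \<Longrightarrow> cp x = cp y \<Longrightarrow> x = y"
  by (auto simp: vp_def cp_def fun_eq_iff prod_eq_iff)

lemma TS_I: "X \<in> VF \<Longrightarrow> \<alpha> \<in> CF \<Longrightarrow> (\<lambda>p. (X p, \<alpha> p)) \<in> TS"
  unfolding TS_iff vp_def cp_def by simp

lemma sec_op_eq: "sec_op x = (\<lambda>\<omega>. ins (vp x) \<omega> + wd (cp x) \<omega>)"
  by (simp add: sec_op_def fun_eq_iff ins_def wd_def vp_def cp_def fapply)

lemma oper_sec_op: "x \<in> TS \<Longrightarrow> oper (-1) (sec_op x)"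
  unfolding sec_op_eq by (intro oper_plus oper_ins oper_wd TS_vp TS_cp)

definition dorf :: "('a \<Rightarrow> 'a ttvec) \<Rightarrow> ('a \<Rightarrow> 'a ttvec) \<Rightarrow> 'a \<Rightarrow> 'a ttvec"
  where "dorf x y = (\<lambda>p. (lie (vp x) (vp y) p, LieC (vp x) (cp y) p - dC (vp y) (cp x) p))"

lemma vp_dorf [simp]: "vp (dorf x y) = lie (vp x) (vp y)"
  and cp_dorf: "cp (dorf x y) = (\<lambda>p. LieC (vp x) (cp y) p - dC (vp y) (cp x) p)"
  by (simp_all add: dorf_def vp_def cp_def)

lemma dorf_TS [simp]: "x \<in> TS \<Longrightarrow> y \<in> TS \<Longrightarrow> dorf x y \<in> TS"
  unfolding TS_iff[of "dorf x y"] by (simp add: cp_dorf)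

lemma comm_sec_d:
  assumes x: "x \<in> TS" and w: "\<omega> \<in> \<Omega>"
  shows "op_comm A (sec_op x) (de_rham A) \<omega> = Lie (vp x) \<omega> + dmul (cp x) \<omega>"
proof -
  have "op_comm A (sec_op x) (de_rham A) \<omega> = sec_op x (de_rham A \<omega>) + de_rham A (sec_op x \<omega>)"
    by (rule op_comm_odd[OF oper_sec_op[OF x] oper_de_rham w])
  also have "\<dots> = Lie (vp x) \<omega> + dmul (cp x) \<omega>"
    using x w by (simp add: sec_op_eq de_rham_dd ins_dd dmul_def)
  finally show ?thesis .
qed

lemma oper_comm_sec_d: "x \<in> TS \<Longrightarrow> oper 1 (op_comm A (sec_op x) (de_rham A))"
  by (rule oper_cong[OF oper_plus[OF oper_Lie oper_dmul]]) (auto simp: comm_sec_d)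

lemma comm_comm_sec_d:
  assumes x: "x \<in> TS" and y: "y \<in> TS" and w: "\<omega> \<in> \<Omega>"
  shows "op_comm A (op_comm A (sec_op x) (de_rham A)) (sec_op y) \<omega> = sec_op (dorf x y) \<omega>"
proof -
  let ?D = "op_comm A (sec_op x) (de_rham A)"
  have "op_comm A ?D (sec_op y) \<omega> = ?D (sec_op y \<omega>) - sec_op y (?D \<omega>)"
    by (rule op_comm_even[OF oper_comm_sec_d[OF x] oper_sec_op[OF y] _ w]) simp
  also have "\<dots> = Lie (vp x) (sec_op y \<omega>) + dmul (cp x) (sec_op y \<omega>) - sec_op y (Lie (vp x) \<omega> + dmul (cp x) \<omega>)"
    using x w by (simp only: comm_sec_d oper_form[OF oper_sec_op[OF y]])
  also have "\<dots> = sec_op (dorf x y) \<omega>"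
    using x y w
    by (simp add: sec_op_eq cp_dorf wd_diff_left ins_Lie Lie_wd ins_dmul dmul_wd)
  finally show ?thesis .
qed

lemma one_form0_Cons: "one_form0 p (v # vs) = 0"
  by (simp add: one_form0_def)

text \<open>The covector is read off from the action on the constant function 1, the vector from the
  action on differentials of functions. This gives uniqueness in the description of
  \<open>dorfman\<close>.\<close>

lemma sec_op_inj:
  assumes z: "z \<in> TS" "z' \<in> TS" and eq: "\<And>\<omega>. \<omega> \<in> \<Omega> \<Longrightarrow> sec_op z \<omega> = sec_op z' \<omega>"
  shows "z = z'"
proof (rule TS_eqI)
  show "cp z = cp z'"
  proof (intro ext)
    fix p v
    have "sec_op z one_form0 p [v] = sec_op z' one_form0 p [v]" using eq by simp
    then show "cp z p v = cp z' p v" by (simp add: sec_op_eq ins_apply fapply one_form0_Cons)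
  qed
  show "vp z = vp z'"
  proof
    fix p
    show "vp z p = vp z' p"
    proof (rule T_eqI[of _ p])
      fix f assume f: "f \<in> C"
      have "sec_op z (wd (dfun f) one_form0) p [] = sec_op z' (wd (dfun f) one_form0) p []" using f by (subst eq) simp_all
      then show "vp z p f = vp z' p f" using z by (simp add: sec_op_eq ins_apply fapply dfun_T)
    qed (use z in auto)
  qed
qed

lemma dorfman_dorf: "x \<in> TS \<Longrightarrow> y \<in> TS \<Longrightarrow> dorfman A x y = dorf x y"
  unfolding dorfman_def
proof (rule the_equality)
  assume xy: "x \<in> TS" "y \<in> TS"
  show *: "dorf x y \<in> TS \<and> (\<forall>\<omega>\<in>\<Omega>. sec_op (dorf x y) \<omega> = op_comm A (op_comm A (sec_op x) (de_rham A)) (sec_op y) \<omega>)"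
    using xy comm_comm_sec_d by simp
  fix z assume z: "z \<in> TS \<and> (\<forall>\<omega>\<in>\<Omega>. sec_op z \<omega> = op_comm A (op_comm A (sec_op x) (de_rham A)) (sec_op y) \<omega>)"
  show "z = dorf x y"
    by (rule sec_op_inj) (use z * in auto)
qed

end

section \<open>Linear algebra of a generalized almost product structure\<close>

lemma independent_family_coeff:
  fixes e :: "nat \<Rightarrow> 'v::real_vector"
  assumes inj: "inj_on e {..<n}" and ind: "independent (e ` {..<n})"
    and zero: "(\<Sum>j<n. c j *\<^sub>R e j) = 0" and j: "j < n"
  shows "c j = 0"
proof -
  let ?g = "the_inv_into {..<n} e"
  have "(\<Sum>v\<in>e ` {..<n}. c (?g v) *\<^sub>R v) = (\<Sum>j<n. c (?g (e j)) *\<^sub>R e j)"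
    by (rule sum.reindex[OF inj, unfolded o_def])
  also have "\<dots> = (\<Sum>j<n. c j *\<^sub>R e j)" by (intro sum.cong) (simp_all add: the_inv_into_f_f[OF inj])
  finally have "c (?g (e j)) = 0"
    using independentD[OF ind, of "e ` {..<n}" "\<lambda>v. c (?g v)" "e j"] zero j by auto
  moreover have "?g (e j) = j" by (rule the_inv_into_f_f[OF inj]) (use j in simp)
  ultimately show ?thesis by (simp only:)
qed

lemma independent_familyI:
  fixes e :: "nat \<Rightarrow> 'v::real_vector"
  assumes z: "\<And>c j. (\<Sum>j<n. c j *\<^sub>R e j) = 0 \<Longrightarrow> j < n \<Longrightarrow> c j = 0"
  shows "inj_on e {..<n}" "independent (e ` {..<n})"
proof -
  show inj: "inj_on e {..<n}"
  proof (rule inj_onI, rule ccontr)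
    fix i j assume ij: "i \<in> {..<n}" "j \<in> {..<n}" "e i = e j" "i \<noteq> j"
    let ?c = "\<lambda>k. (if k = i then 1 else 0) - (if k = j then 1 else 0 :: real)"
    have "(\<Sum>k<n. ?c k *\<^sub>R e k) = (\<Sum>k<n. (if k = i then e k else 0) - (if k = j then e k else 0))"
      by (intro sum.cong) auto
    also have "\<dots> = 0" using ij by (simp add: sum_subtractf)
    finally show False using z[of ?c i] ij by simp
  qed
  show "independent (e ` {..<n})"
  proof (rule independent_if_scalars_zero)
    fix f v assume s: "(\<Sum>v\<in>e ` {..<n}. f v *\<^sub>R v) = 0" and v: "v \<in> e ` {..<n}"
    from v obtain j where j: "j < n" "v = e j" by blast
    have "(\<Sum>j<n. f (e j) *\<^sub>R e j) = 0" using s sum.reindex[OF inj, of "\<lambda>v. f v *\<^sub>R v"] by (simp add: o_def)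
    then show "f v = 0" using z[of "\<lambda>j. f (e j)" j] j by simp
  qed simp
qed

text \<open>Elimination of one equation and one unknown at a time. It supplies the dimension count
  in \<open>kernel_lagrangian\<close>.\<close>

lemma underdetermined_system:
  fixes a :: "'i \<Rightarrow> 'j \<Rightarrow> real"
  assumes "finite I" "finite J" "card I < card J"
  shows "\<exists>c. (\<exists>j\<in>J. c j \<noteq> 0) \<and> (\<forall>i\<in>I. (\<Sum>j\<in>J. a i j * c j) = 0)"
  using assms
proof (induction I arbitrary: J a rule: finite_induct)
  case empty
  then obtain j where "j \<in> J" by (metis card_gt_0_iff ex_in_conv card.empty)
  then show ?case by (intro exI[of _ "\<lambda>_. 1"]) auto
next
  case (insert i I)
  show ?case
  proof (cases "\<forall>j\<in>J. a i j = 0")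
    case True
    have "card I < card J" using insert by simp
    then obtain c where "\<exists>j\<in>J. c j \<noteq> 0" "\<forall>i\<in>I. (\<Sum>j\<in>J. a i j * c j) = 0"
      using insert.IH[OF insert.prems(1)] by blast
    then show ?thesis using True by (intro exI[of _ c]) auto
  next
    case False
    then obtain j0 where j0: "j0 \<in> J" "a i j0 \<noteq> 0" by blast
    let ?J = "J - {j0}"
    have J: "finite ?J" "card I < card ?J" using insert j0 by auto
    obtain c where c: "\<exists>j\<in>?J. c j \<noteq> 0"
      "\<forall>k\<in>I. (\<Sum>j\<in>?J. (a k j - a k j0 * a i j / a i j0) * c j) = 0"
      using insert.IH[OF J, of "\<lambda>k j. a k j - a k j0 * a i j / a i j0"] by blast
    define s where "s = (\<Sum>j\<in>?J. a i j * c j)"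
    \<comment> \<open>The value at \<open>j0\<close> is chosen to satisfy equation \<open>i\<close>;
      the reduced system then says that the remaining equations hold as well.\<close>
    define c' where "c' = c(j0 := - s / a i j0)"
    have sum: "(\<Sum>j\<in>J. a k j * c' j) = a k j0 * (- s / a i j0) + (\<Sum>j\<in>?J. a k j * c j)" for k
    proof -
      have "(\<Sum>j\<in>J. a k j * c' j) = a k j0 * c' j0 + (\<Sum>j\<in>?J. a k j * c' j)"
        by (rule sum.remove[OF insert.prems(1) j0(1)])
      also have "(\<Sum>j\<in>?J. a k j * c' j) = (\<Sum>j\<in>?J. a k j * c j)" by (rule sum.cong) (auto simp: c'_def)
      finally show ?thesis by (simp add: c'_def)
    qed
    have "(\<Sum>j\<in>J. a i j * c' j) = 0" unfolding sum using j0 by (simp add: s_def)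
    moreover have "(\<Sum>j\<in>J. a k j * c' j) = 0" if "k \<in> I" for k
    proof -
      have "(\<Sum>j\<in>?J. (a k j - a k j0 * a i j / a i j0) * c j) = (\<Sum>j\<in>?J. a k j * c j) - a k j0 / a i j0 * s"
        unfolding s_def sum_distrib_left sum_subtractf[symmetric] by (rule sum.cong) (auto simp: algebra_simps)
      then show ?thesis unfolding sum using c(2) that by simp
    qed
    moreover have "\<exists>j\<in>J. c' j \<noteq> 0" using c(1) by (auto simp: c'_def)
    ultimately show ?thesis by blast
  qed
qed

context smooth_mfd
begin

text \<open>A division-free form of Cramer's rule: the elimination yields a common denominator \<open>D\<close>
  which does not vanish at the given point.\<close>

lemma smooth_linear_solver:
  fixes n :: nat and M :: "nat \<Rightarrow> nat \<Rightarrow> 'a \<Rightarrow> real"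
  assumes "\<And>i j. i < n \<Longrightarrow> j < n \<Longrightarrow> M i j \<in> C"
    and "\<And>c. (\<And>i. i < n \<Longrightarrow> (\<Sum>j<n. M i j p * c j) = 0) \<Longrightarrow> (\<And>j. j < n \<Longrightarrow> c j = 0)"
  shows "\<exists>D\<in>C. D p \<noteq> 0 \<and> (\<forall>b. (\<forall>i<n. b i \<in> C) \<longrightarrow> (\<exists>g. (\<forall>i<n. g i \<in> C) \<and>
    (\<forall>q c. (\<forall>i<n. (\<Sum>j<n. M i j q * c j) = b i q) \<longrightarrow> (\<forall>i<n. D q * c i = g i q))))"
  using assms
proof (induction n arbitrary: M)
  case 0
  show ?case by (intro bexI[of _ "\<lambda>_. 1"]) auto
next
  case (Suc n)
  have "\<exists>i<Suc n. M i n p \<noteq> 0"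
  proof (rule ccontr)
    assume "\<not> (\<exists>i<Suc n. M i n p \<noteq> 0)"
    then have "(\<Sum>j<Suc n. M i j p * (if j = n then 1 else 0)) = 0" if "i < Suc n" for i
      using that by simp
    from Suc.prems(2)[of "\<lambda>j. if j = n then 1 else 0", OF this, of n] show False by simp
  qed
  then obtain i0 where i0: "i0 < Suc n" "M i0 n p \<noteq> 0" by blast
  \<comment> \<open>A transposition that puts the pivot row \<open>i0\<close> last, so that the
    reduced system occupies the rows below \<open>n\<close>.\<close>
  define \<sigma> where "\<sigma> i = (if i = i0 then n else if i = n then i0 else i)" for i
  have \<sigma>: "\<sigma> i < Suc n" if "i < Suc n" for i using that i0 by (auto simp: \<sigma>_def)
  have \<sigma>\<sigma>: "\<sigma> (\<sigma> i) = i" for i by (simp add: \<sigma>_def)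
  have \<sigma>n: "\<sigma> n = i0" by (simp add: \<sigma>_def)
  define m where "m = M i0 n"
  \<comment> \<open>The last unknown is eliminated by cross multiplication with the pivot
    \<open>m\<close>, so the entries stay smooth even where \<open>m\<close> vanishes.\<close>
  define M' where "M' i j q = m q * M (\<sigma> i) j q - M (\<sigma> i) n q * M i0 j q" for i j q
  have MC: "M (\<sigma> i) j \<in> C" if "i < Suc n" "j < Suc n" for i j using Suc.prems(1) \<sigma> that by blast
  have mC: "m \<in> C" and M0C: "\<And>j. j < Suc n \<Longrightarrow> M i0 j \<in> C" using Suc.prems(1) i0 by (auto simp: m_def)
  have M'C: "M' i j \<in> C" if "i < n" "j < n" for i j
  proof -
    have "(\<lambda>q. m q * M (\<sigma> i) j q - M (\<sigma> i) n q * M i0 j q) \<in> C"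
      using MC[of i j] MC[of i n] mC M0C[of j] that by (intro C_diff C_mult) auto
    then show ?thesis by (simp add: M'_def[abs_def])
  qed
  have inj: "c j = 0" if c: "\<And>i. i < n \<Longrightarrow> (\<Sum>j<n. M' i j p * c j) = 0" and j: "j < n" for c j
  proof -
    define s where "s = (\<Sum>j<n. M i0 j p * c j)"
    define c' where "c' = c(n := - s / m p)"
    have sum: "(\<Sum>j<Suc n. M k j p * c' j) = (\<Sum>j<n. M k j p * c j) - M k n p * s / m p" for k
      by (simp add: c'_def)
    have "(\<Sum>j<Suc n. M k j p * c' j) = 0" if k: "k < Suc n" for k
    proof (cases "k = i0")
      case True
      then show ?thesis unfolding sum using i0 by (simp add: s_def m_def)
    next
      case False
      then have "\<sigma> k < n" using k i0 by (auto simp: \<sigma>_def)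
      from c[OF this] have "m p * (\<Sum>j<n. M k j p * c j) - M k n p * s = 0"
        unfolding M'_def \<sigma>\<sigma> s_def sum_distrib_left sum_subtractf[symmetric]
        by (simp add: algebra_simps)
      then show ?thesis unfolding sum using i0 by (simp add: m_def field_simps)
    qed
    from Suc.prems(2)[of c', OF this, of j] show ?thesis using j by (simp add: c'_def)
  qed
  obtain D where D: "D \<in> C" "D p \<noteq> 0" and sol: "\<And>b. (\<forall>i<n. b i \<in> C) \<Longrightarrow> (\<exists>g. (\<forall>i<n. g i \<in> C) \<and>
    (\<forall>q c. (\<forall>i<n. (\<Sum>j<n. M' i j q * c j) = b i q) \<longrightarrow> (\<forall>i<n. D q * c i = g i q)))"
  proof -
    have "\<exists>D\<in>C. D p \<noteq> 0 \<and> (\<forall>b. (\<forall>i<n. b i \<in> C) \<longrightarrow> (\<exists>g. (\<forall>i<n. g i \<in> C) \<and>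
      (\<forall>q c. (\<forall>i<n. (\<Sum>j<n. M' i j q * c j) = b i q) \<longrightarrow> (\<forall>i<n. D q * c i = g i q))))"
      by (rule Suc.IH) (rule M'C inj, assumption+)+
    then show ?thesis using that by blast
  qed
  show ?case
  proof (intro bexI[of _ "\<lambda>q. D q * m q"] conjI allI impI)
    show "(\<lambda>q. D q * m q) \<in> C" using D mC by simp
    show "D p * m p \<noteq> 0" using D i0 by (simp add: m_def)
    fix b assume b: "\<forall>i<Suc n. b i \<in> C"
    define b' where "b' i q = m q * b (\<sigma> i) q - M (\<sigma> i) n q * b i0 q" for i q
    have "b' i \<in> C" if "i < n" for i
    proof -
      have "(\<lambda>q. m q * b (\<sigma> i) q - M (\<sigma> i) n q * b i0 q) \<in> C"
        using MC[of i n] mC b \<sigma>[of i] i0 that by (intro C_diff C_mult) auto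
      then show ?thesis by (simp add: b'_def[abs_def])
    qed
    then obtain g where g: "\<forall>i<n. g i \<in> C"
      "\<And>q c. (\<forall>i<n. (\<Sum>j<n. M' i j q * c j) = b' i q) \<Longrightarrow> (\<forall>i<n. D q * c i = g i q)"
      using sol[of b'] by blast
    \<comment> \<open>Back substitution: for the last unknown the factor \<open>m\<close> of the
      denominator is absorbed by the pivot equation, for the others it is simply multiplied
      on.\<close>
    define g' where "g' i = (if i = n then (\<lambda>q. D q * b i0 q - (\<Sum>j<n. M i0 j q * g j q)) else (\<lambda>q. m q * g i q))" for i
    have "g' i \<in> C" if "i < Suc n" for i
      using that g(1) mC D b i0 M0C unfolding g'_def by (auto intro!: C_diff C_mult C_sum)
    moreover have "D q * m q * c i = g' i q" if c: "\<forall>i<Suc n. (\<Sum>j<Suc n. M i j q * c j) = b i q" and i: "i < Suc n" for q c i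
    proof -
      have c0: "(\<Sum>j<n. M i0 j q * c j) + m q * c n = b i0 q" using c i0 by (simp add: m_def)
      have "(\<Sum>j<n. M' k j q * c j) = b' k q" if k: "k < n" for k
      proof -
        have "(\<Sum>j<n. M (\<sigma> k) j q * c j) + M (\<sigma> k) n q * c n = b (\<sigma> k) q" using c \<sigma>[of k] k by simp
        then have "b' k q = m q * (\<Sum>j<n. M (\<sigma> k) j q * c j) - M (\<sigma> k) n q * (\<Sum>j<n. M i0 j q * c j)"
          unfolding b'_def c0[symmetric] by (simp add: algebra_simps flip: \<open>_ = b (\<sigma> k) q\<close>)
        then show ?thesis
          unfolding M'_def sum_distrib_left sum_subtractf[symmetric] by (simp add: algebra_simps)
      qed
      then have gc: "D q * c j = g j q" if "j < n" for j using g(2) that by blast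
      show ?thesis
      proof (cases "i = n")
        case False
        then show ?thesis using gc[of i] i by (simp add: g'_def)
      next
        case True
        have "(\<Sum>j<n. M i0 j q * g j q) = (\<Sum>j<n. M i0 j q * (D q * c j))"
          by (rule sum.cong) (auto simp: gc)
        also have "\<dots> = D q * (\<Sum>j<n. M i0 j q * c j)" by (simp add: sum_distrib_left mult_ac)
        finally have "g' n q = D q * (m q * c n)" using c0 by (simp add: g'_def algebra_simps flip: c0)
        then show ?thesis using True by simp
      qed
    qed
    ultimately show "\<exists>g. (\<forall>i<Suc n. g i \<in> C) \<and>
        (\<forall>q c. (\<forall>i<Suc n. (\<Sum>j<Suc n. M i j q * c j) = b i q) \<longrightarrow> (\<forall>i<Suc n. D q * m q * c i = g i q))"
      by (intro exI[of _ g']) blast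
  qed
qed

lemma inverse_extend:
  assumes "D \<in> C" "D p \<noteq> 0"
  obtains g W where "g \<in> C" "open W" "p \<in> W" "\<And>q. q \<in> W \<Longrightarrow> g q * D q = 1"
proof -
  have "continuous_on UNIV D" using sfo_continuous[of UNIV D] assms by (simp add: C_iff)
  then have U: "open (D -` (- {0}))" by (intro open_vimage) auto
  have "smooth_fun_on A (D -` (- {0})) (\<lambda>q. inverse (D q))"
    by (rule sfo_inverse[OF U sfo_mono[of UNIV D]]) (use assms in \<open>auto simp: C_iff\<close>)
  from sfo_extend[OF U _ this, of p] obtain g W where "g \<in> C" "open W" "p \<in> W" "W \<subseteq> D -` (- {0})"
    "\<And>q. q \<in> W \<Longrightarrow> inverse (D q) = g q"
    using assms by auto
  then show ?thesis using that[of g W] by (metis ComplD left_inverse singletonI subsetD vimage_eq)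
qed

section \<open>The pairing and global sections of the generalized tangent bundle\<close>

abbreviation "TT p \<equiv> T p \<times> T' p"

lemma subspace_TT: "subspace (TT p)"
  by (rule subspace_Times[OF subspace_T subspace_T'])

lemma pairing_sym: "pairing x y = pairing y x" by (simp add: pairing_def)

lemma pairing_lin: "x \<in> TT p \<Longrightarrow> x' \<in> TT p \<Longrightarrow> y \<in> TT p \<Longrightarrow>
    pairing (a *\<^sub>R x + b *\<^sub>R x') y = a * pairing x y + b * pairing x' y"
  by (auto simp: pairing_def fapply T'_lin algebra_simps)

lemma pairing_add: "x \<in> TT p \<Longrightarrow> x' \<in> TT p \<Longrightarrow> y \<in> TT p \<Longrightarrow> pairing (x + x') y = pairing x y + pairing x' y"
  using pairing_lin[of x p x' y 1 1] by simp

lemma pairing_diff: "x \<in> TT p \<Longrightarrow> x' \<in> TT p \<Longrightarrow> y \<in> TT p \<Longrightarrow> pairing (x - x') y = pairing x y - pairing x' y"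
  using pairing_lin[of x p x' y 1 "-1"] by simp

lemma pairing_scale: "x \<in> TT p \<Longrightarrow> y \<in> TT p \<Longrightarrow> pairing (c *\<^sub>R x) y = c * pairing x y"
  using pairing_lin[of x p x y c 0] by simp

lemma pairing_sum: "(\<And>i. i \<in> I \<Longrightarrow> x i \<in> TT p) \<Longrightarrow> y \<in> TT p \<Longrightarrow>
    pairing (\<Sum>i\<in>I. c i *\<^sub>R x i) y = (\<Sum>i\<in>I. c i * pairing (x i) y)"
proof (induction I rule: infinite_finite_induct)
  case (insert i I)
  have "(\<Sum>i\<in>I. c i *\<^sub>R x i) \<in> TT p"
    using insert.prems(1) by (intro subspace_sum[OF subspace_TT] subspace_scale[OF subspace_TT]) auto
  then have "pairing (c i *\<^sub>R x i + 1 *\<^sub>R (\<Sum>i\<in>I. c i *\<^sub>R x i)) y = c i * pairing (x i) y + 1 * pairing (\<Sum>i\<in>I. c i *\<^sub>R x i) y"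
    using insert.prems by (intro pairing_lin[where p = p]) auto
  then show ?case using insert by simp
qed (auto simp: pairing_def zero_prod_def T'_0 fapply)

lemma pairing_0: "y \<in> TT p \<Longrightarrow> pairing 0 y = 0"
  using pairing_scale[of 0 p y 0] subspace_0[OF subspace_TT] by simp

lemma pairing_span:
  assumes "S \<subseteq> TT p" "w \<in> TT p" "\<And>y. y \<in> S \<Longrightarrow> pairing y w = 0" "y \<in> span S"
  shows "pairing y w = 0"
proof -
  have "subspace {y \<in> TT p. pairing y w = 0}"
    unfolding subspace_def using subspace_TT[of p] assms(2)
    by (auto simp: pairing_add[where p = p] pairing_scale[where p = p] subspace_def simp del: mem_Times_iff simp: pairing_0[where p = p])
  moreover have "S \<subseteq> {y \<in> TT p. pairing y w = 0}" using assms by blast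
  ultimately have "span S \<subseteq> {y \<in> TT p. pairing y w = 0}" by (rule span_minimal[rotated])
  then show ?thesis using assms(4) by blast
qed

lemma pairing_C: "x \<in> TS \<Longrightarrow> y \<in> TS \<Longrightarrow> (\<lambda>p. pairing (x p) (y p)) \<in> C"
  using CF_C[OF TS_cp TS_vp, of x y] CF_C[OF TS_cp TS_vp, of y x]
  unfolding pairing_def vp_def cp_def by (intro C_mult C_add C_const)

lemma TS_TT [simp]: "x \<in> TS \<Longrightarrow> x p \<in> TT p"
  using VF_T[OF TS_vp, of x p] CF_T'[OF TS_cp, of x p] by (simp add: vp_def cp_def mem_Times_iff)

lemma TS_add [simp]: "x \<in> TS \<Longrightarrow> y \<in> TS \<Longrightarrow> (\<lambda>p. x p + y p) \<in> TS"
  using VF_add[OF TS_vp TS_vp, of x y] CF_add[OF TS_cp TS_cp, of x y] unfolding TS_iff vp_def cp_def by simp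

lemma TS_diff [simp]: "x \<in> TS \<Longrightarrow> y \<in> TS \<Longrightarrow> (\<lambda>p. x p - y p) \<in> TS"
  using VF_diff[OF TS_vp TS_vp, of x y] CF_minus[OF TS_cp TS_cp, of x y] unfolding TS_iff vp_def cp_def by simp

lemma TS_fmult [simp]: "f \<in> C \<Longrightarrow> x \<in> TS \<Longrightarrow> (\<lambda>p. f p *\<^sub>R x p) \<in> TS"
  using VF_fmult[OF _ TS_vp, of f x] CF_fmult[OF _ TS_cp, of f x] unfolding TS_iff vp_def cp_def by simp

lemma TS_0 [simp]: "(\<lambda>p. 0) \<in> TS"
  unfolding TS_iff vp_def cp_def by simp

lemma TS_sum: "(\<And>i. i \<in> I \<Longrightarrow> x i \<in> TS) \<Longrightarrow> (\<lambda>p. \<Sum>i\<in>I. x i p) \<in> TS"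
  by (induction I rule: infinite_finite_induct) auto

lemma C_localI: "(\<And>p. \<exists>W g. open W \<and> p \<in> W \<and> g \<in> C \<and> (\<forall>q\<in>W. f q = g q)) \<Longrightarrow> f \<in> C"
  unfolding C_iff by (rule sfoI) (auto simp: C_iff)

lemma TS_localI:
  assumes "\<And>p. \<exists>W y. open W \<and> p \<in> W \<and> y \<in> TS \<and> (\<forall>q\<in>W. x q = y q)"
  shows "x \<in> TS"
  unfolding TS_iff
proof
  have "x p \<in> TT p" for p using assms[of p] TS_TT by metis
  then have TTx: "fst (x p) \<in> T p" "snd (x p) \<in> T' p" for p by (auto simp: mem_Times_iff)
  show "vp x \<in> VF"
  proof (rule VFI)
    show "vp x p \<in> T p" for p using TTx by (simp add: vp_def)
    fix f assume f: "f \<in> C"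
    show "(\<lambda>p. vp x p f) \<in> C"
    proof (rule C_localI)
      fix p
      obtain W y where "open W" "p \<in> W" "y \<in> TS" "\<forall>q\<in>W. x q = y q" using assms by blast
      then show "\<exists>W g. open W \<and> p \<in> W \<and> g \<in> C \<and> (\<forall>q\<in>W. vp x q f = g q)"
        using f VF_C[OF TS_vp, of y f] by (intro exI[of _ W] exI[of _ "\<lambda>q. vp y q f"]) (auto simp: vp_def)
    qed
  qed
  show "cp x \<in> CF"
  proof (rule CFI)
    show "cp x p \<in> T' p" for p using TTx by (simp add: cp_def)
    fix X assume X: "X \<in> VF"
    show "(\<lambda>p. cp x p (X p)) \<in> C"
    proof (rule C_localI)
      fix p
      obtain W y where "open W" "p \<in> W" "y \<in> TS" "\<forall>q\<in>W. x q = y q" using assms by blast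
      then show "\<exists>W g. open W \<and> p \<in> W \<and> g \<in> C \<and> (\<forall>q\<in>W. cp x q (X q) = g q)"
        using X CF_C[OF TS_cp, of y X] by (intro exI[of _ W] exI[of _ "\<lambda>q. cp y q (X q)"]) (auto simp: cp_def)
    qed
  qed
qed

lemma ttm_section_TT: "ttm_section A U x \<Longrightarrow> q \<in> U \<Longrightarrow> x q \<in> TT q"
  by (simp add: ttm_section_def tm_section_def mem_Times_iff)

text \<open>One cutoff is used for the whole finite family, so that a local frame is extended on a
  common neighbourhood.\<close>

lemma ttm_section_extend:
  assumes U: "open U" "p \<in> U" and x: "\<And>i. i < (n::nat) \<Longrightarrow> ttm_section A U (x i)"
  obtains y W where "open W" "p \<in> W" "W \<subseteq> U" "\<And>i. i < n \<Longrightarrow> y i \<in> TS" "\<And>i q. q \<in> W \<Longrightarrow> y i q = x i q"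
proof -
  obtain ch W K where ch: "ch \<in> C" "open W" "p \<in> W" "W \<subseteq> U" "\<And>q. q \<in> W \<Longrightarrow> ch q = 1"
    "closed K" "K \<subseteq> U" "\<And>q. q \<notin> K \<Longrightarrow> ch q = 0"
    by (rule bump[OF U]) blast
  have off: "ch q = 0" if "q \<notin> U" for q using ch(7,8) that by blast
  have "(\<lambda>q. ch q *\<^sub>R x i q) \<in> TS" if i: "i < n" for i
    unfolding TS_iff
  proof
    have tt: "fst (x i q) \<in> T q" "snd (x i q) \<in> T' q" if "q \<in> U" for q
      using ttm_section_TT[OF x[OF i] that] by (auto simp: mem_Times_iff)
    show "vp (\<lambda>q. ch q *\<^sub>R x i q) \<in> VF"
      unfolding vp_def
    proof (rule VFI)
      show "fst (ch q *\<^sub>R x i q) \<in> T q" for q using tt[of q] off[of q] by (cases "q \<in> U") auto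
      fix f assume "f \<in> C"
      then have "smooth_fun_on A U (\<lambda>q. fst (x i q) f)" using x[OF i] by (simp add: ttm_section_def tm_section_def)
      from cutoff_smooth[OF ch(1) U(1) ch(6,7,8) this] show "(\<lambda>q. fst (ch q *\<^sub>R x i q) f) \<in> C" by (simp add: fapply)
    qed
    show "cp (\<lambda>q. ch q *\<^sub>R x i q) \<in> CF"
      unfolding cp_def
    proof (rule CFI)
      show "snd (ch q *\<^sub>R x i q) \<in> T' q" for q using tt[of q] off[of q] by (cases "q \<in> U") auto
      fix X assume "X \<in> VF"
      then have "smooth_fun_on A U (\<lambda>q. snd (x i q) (X q))" using x[OF i] by (simp add: ttm_section_def)
      from cutoff_smooth[OF ch(1) U(1) ch(6,7,8) this] show "(\<lambda>q. snd (ch q *\<^sub>R x i q) (X q)) \<in> C" by (simp add: fapply)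
    qed
  qed
  then show ?thesis using that[of W "\<lambda>i q. ch q *\<^sub>R x i q"] ch by simp
qed

text \<open>A covector at \<open>p\<close> is the differential there of a combination of coordinate
  functions with constant coefficients.\<close>

lemma cf_ext:
  assumes a: "\<alpha> \<in> T' p"
  obtains \<beta> where "\<beta> \<in> CF" "\<beta> p = \<alpha>"
proof -
  obtain W E \<xi> where W: "open W" "p \<in> W" "\<And>b. E b \<in> VF" "\<And>b. \<xi> b \<in> C"
    "\<And>q b c. q \<in> W \<Longrightarrow> b \<in> \<B> \<Longrightarrow> c \<in> \<B> \<Longrightarrow> E b q (\<xi> c) = (if b = c then 1 else 0)"
    "\<And>q v. q \<in> W \<Longrightarrow> v \<in> T q \<Longrightarrow> v = (\<Sum>b\<in>\<B>. v (\<xi> b) *\<^sub>R E b q)"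
    by (rule frame_exists[of p]) blast
  let ?f = "\<lambda>q. \<Sum>b\<in>\<B>. \<alpha> (E b p) * \<xi> b q"
  have f: "?f \<in> C" using W(4) by (intro C_sum C_mult C_const)
  have "dfun ?f p = \<alpha>"
  proof (rule T'_eqI[of _ p])
    fix v assume v: "v \<in> T p"
    have "\<alpha> v = \<alpha> (\<Sum>b\<in>\<B>. v (\<xi> b) *\<^sub>R E b p)" using W(6)[OF W(2) v] by simp
    also have "\<dots> = (\<Sum>b\<in>\<B>. v (\<xi> b) * \<alpha> (E b p))"
      using W(3) by (simp add: T'_sum[OF a] T'_scale[OF a])
    also have "\<dots> = dfun ?f p v"
      using W(4) v by (simp add: dfun_T T_sum[OF v] T_cmult[OF v]) (simp add: mult.commute)
    finally show "dfun ?f p v = \<alpha> v" by simp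
  qed (use f a in auto)
  then show ?thesis using that[of "dfun ?f"] f by simp
qed

lemma ts_ext:
  assumes "z \<in> TT p"
  obtains x where "x \<in> TS" "x p = z"
proof -
  obtain X where X: "X \<in> VF" "X p = fst z" by (rule vf_ext[of "fst z" p]) (use assms in auto)
  obtain \<alpha> where \<alpha>: "\<alpha> \<in> CF" "\<alpha> p = snd z" by (rule cf_ext[of "snd z" p]) (use assms in auto)
  show ?thesis by (rule that[OF TS_I[OF X(1) \<alpha>(1)]]) (simp add: X \<alpha>)
qed

end

section \<open>Fibres of the split structure\<close>

locale gap = smooth_mfd A for A :: "('a::{t2_space, second_countable_topology}, 'e::real_inner) atlas" +
  fixes E :: "'a \<Rightarrow> 'a ttvec set"
  assumes generalized_almost_product: "generalized_almost_product A E"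
begin

definition rk :: nat
  where "rk = (SOME r. split_structure A r E \<and> (\<forall>p. dim (fst ` E p) = r))"

lemma rk: "split_structure A rk E" "dim (fst ` E p) = rk"
proof -
  have "split_structure A rk E \<and> (\<forall>p. dim (fst ` E p) = rk)"
    unfolding rk_def by (rule someI_ex) (use generalized_almost_product in \<open>simp add: generalized_almost_product_def\<close>)
  then show "split_structure A rk E" "dim (fst ` E p) = rk" by auto
qed

lemma E_subbundle: "subbundle (ttm_section A) (2 * rk) E"
  and E_nondeg: "nondegenerate_on pairing (E p)"
  and E_signature: "has_signature pairing (E p) rk rk"
  using rk(1) by (auto simp: split_structure_def)

lemma E_frame:
  obtains W e where "open W" "p \<in> W" "\<And>i. i < 2 * rk \<Longrightarrow> e i \<in> TS" "frame_on W (2 * rk) e E"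
proof -
  obtain U e where U: "open U" "p \<in> U" "\<And>i. i < 2 * rk \<Longrightarrow> ttm_section A U (e i)" "frame_on U (2 * rk) e E"
    using E_subbundle unfolding subbundle_def by blast
  obtain y W where W: "open W" "p \<in> W" "W \<subseteq> U" "\<And>i. i < 2 * rk \<Longrightarrow> y i \<in> TS" "\<And>i q. q \<in> W \<Longrightarrow> y i q = e i q"
    by (rule ttm_section_extend[OF U(1,2), of "2 * rk" e, OF U(3)]) blast+
  have "frame_on W (2 * rk) y E"
    unfolding frame_on_def
  proof
    fix q assume q: "q \<in> W"
    then have eq: "(\<lambda>i. y i q) = (\<lambda>i. e i q)" using W(5) by auto
    show "inj_on (\<lambda>i. y i q) {..<2 * rk} \<and> independent ((\<lambda>i. y i q) ` {..<2 * rk}) \<and>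
        span ((\<lambda>i. y i q) ` {..<2 * rk}) = E q"
      unfolding eq using U(4) q W(3) unfolding frame_on_def by blast
  qed
  then show ?thesis using that W by blast
qed

lemma subspace_E: "subspace (E p)"
  using E_signature[of p] unfolding has_signature_def by (metis subspace_span)

lemma E_TT: "E p \<subseteq> TT p"
proof -
  obtain W e where W: "open W" "p \<in> W" "\<And>i. i < 2 * rk \<Longrightarrow> e i \<in> TS" "frame_on W (2 * rk) e E"
    by (rule E_frame[of p]) blast
  have "(\<lambda>i. e i p) ` {..<2 * rk} \<subseteq> TT p" using W(3) TS_TT by blast
  then have "span ((\<lambda>i. e i p) ` {..<2 * rk}) \<subseteq> TT p" by (rule span_minimal[OF _ subspace_TT])
  then show ?thesis using W(2,4) unfolding frame_on_def by metis
qed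

lemma E_T [simp]: "x \<in> E p \<Longrightarrow> fst x \<in> T p" and E_T' [simp]: "x \<in> E p \<Longrightarrow> snd x \<in> T' p"
  using E_TT[of p] by (auto simp: mem_Times_iff)

lemma E_basis: "\<exists>S. finite S \<and> independent S \<and> card S = 2 * rk \<and> span S = E p"
proof -
  obtain W e where W: "open W" "p \<in> W" "\<And>i. i < 2 * rk \<Longrightarrow> e i \<in> TS" "frame_on W (2 * rk) e E"
    by (rule E_frame[of p]) blast
  then show ?thesis
    by (intro exI[of _ "(\<lambda>i. e i p) ` {..<2 * rk}"]) (auto simp: frame_on_def card_image)
qed

abbreviation "Eo \<equiv> orth A E"

lemma orth_iff: "y \<in> Eo p \<longleftrightarrow> y \<in> TT p \<and> (\<forall>x\<in>E p. pairing x y = 0)"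
  by (simp add: orth_def)

lemma subspace_orth: "subspace (Eo p)"
  unfolding subspace_def
proof (intro conjI ballI allI)
  have E: "x \<in> E p \<Longrightarrow> x \<in> TT p" for x using E_TT by blast
  show "0 \<in> Eo p"
    unfolding orth_iff using subspace_0[OF subspace_TT] E by (auto simp: pairing_sym[of _ 0] pairing_0[where p = p])
  show "x + y \<in> Eo p" if "x \<in> Eo p" "y \<in> Eo p" for x y
    unfolding orth_iff
  proof (intro conjI ballI)
    show "x + y \<in> TT p" using that subspace_add[OF subspace_TT] unfolding orth_iff by blast
    fix z assume z: "z \<in> E p"
    have "pairing z (x + y) = pairing (x + y) z" by (rule pairing_sym)
    also have "\<dots> = pairing x z + pairing y z" by (rule pairing_add[where p = p]) (use that E[OF z] in \<open>auto simp only: orth_iff\<close>)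
    also have "\<dots> = 0" using that z unfolding orth_iff pairing_sym[of _ z] by simp
    finally show "pairing z (x + y) = 0" .
  qed
  show "c *\<^sub>R x \<in> Eo p" if "x \<in> Eo p" for c x
    unfolding orth_iff
  proof (intro conjI ballI)
    show "c *\<^sub>R x \<in> TT p" using that subspace_scale[OF subspace_TT] unfolding orth_iff by blast
    fix z assume z: "z \<in> E p"
    have "pairing z (c *\<^sub>R x) = pairing (c *\<^sub>R x) z" by (rule pairing_sym)
    also have "\<dots> = c * pairing x z" by (rule pairing_scale[where p = p]) (use that E[OF z] in \<open>auto simp only: orth_iff\<close>)
    also have "\<dots> = 0" using that z unfolding orth_iff pairing_sym[of _ z] by simp
    finally show "pairing z (c *\<^sub>R x) = 0" .
  qed
qed

lemma E_orth_zero: "x \<in> E p \<Longrightarrow> x \<in> Eo p \<Longrightarrow> x = 0"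
  using E_nondeg[of p] unfolding nondegenerate_on_def orth_iff by (metis pairing_sym)

lemma E_decompose:
  assumes z: "z \<in> TT p"
  shows "\<exists>x. x \<in> E p \<and> z - x \<in> Eo p"
proof -
  obtain B D where BD: "finite B" "finite D" "B \<inter> D = {}" "span (B \<union> D) = E p"
    "\<forall>x\<in>B. pairing x x = 1" "\<forall>x\<in>D. pairing x x = -1"
    "\<forall>x\<in>B \<union> D. \<forall>y\<in>B \<union> D. x \<noteq> y \<longrightarrow> pairing x y = 0"
    using E_signature[of p] unfolding has_signature_def by (elim exE conjE) (rule that)
  \<comment> \<open>The number \<open>pairing b b\<close> is 1 or -1 and hence its own inverse, so
    it serves as the divisor in the Fourier coefficient of \<open>z\<close>.\<close>
  define k where "k b = pairing b b * pairing z b" for b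
  define x where "x = (\<Sum>b\<in>B \<union> D. k b *\<^sub>R b)"
  have x: "x \<in> E p" unfolding x_def BD(4)[symmetric] by (intro span_sum span_scale span_base)
  have BT: "B \<union> D \<subseteq> TT p" using E_TT[of p] BD(4) span_superset by blast
  have "pairing y (z - x) = 0" if y: "y \<in> B \<union> D" for y
  proof -
    have "pairing x y = (\<Sum>b\<in>B \<union> D. k b * pairing b y)"
      unfolding x_def using BT y by (intro pairing_sum[where p = p]) auto
    also have "\<dots> = (\<Sum>b\<in>B \<union> D. if b = y then k y * pairing y y else 0)"
      using BD(7) y by (intro sum.cong) auto
    also have "\<dots> = k y * pairing y y" using y BD(1,2) by simp
    also have "\<dots> = pairing z y" using BD(5,6) y by (auto simp: k_def)
    finally have "pairing x y = pairing z y" .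
    then show ?thesis
    proof -
      have "pairing (z - x) y = pairing z y - pairing x y"
        by (rule pairing_diff[where p = p]) (use z x y BT E_TT[of p] in blast)+
      then show ?thesis using \<open>pairing x y = pairing z y\<close> pairing_sym[of y "z - x"] by linarith
    qed
  qed
  note perp = this
  have zx: "z - x \<in> TT p" using z x E_TT[of p] subspace_diff[OF subspace_TT] by blast
  have "pairing y (z - x) = 0" if "y \<in> E p" for y
    by (rule pairing_span[OF BT zx perp]) (use that BD(4) in simp_all)
  then have "z - x \<in> Eo p" unfolding orth_iff using zx by (intro conjI ballI)
  then show ?thesis using x by (intro exI[of _ x] conjI)
qed

section \<open>The orthogonal projection onto E\<close>

definition pr :: "'a \<Rightarrow> 'a ttvec \<Rightarrow> 'a ttvec"
  where "pr p z = (THE x. x \<in> E p \<and> z - x \<in> Eo p)"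

lemma proj_E: "proj A E z = (\<lambda>p. pr p (z p))"
  by (simp add: proj_def pr_def)

lemma pr_unique:
  assumes "x \<in> E p" "z - x \<in> Eo p" "y \<in> E p" "z - y \<in> Eo p"
  shows "x = y"
proof -
  have "(z - y) - (z - x) \<in> Eo p" by (rule subspace_diff[OF subspace_orth assms(4,2)])
  moreover have "x - y \<in> E p" by (rule subspace_diff[OF subspace_E assms(1,3)])
  ultimately have "x - y = 0" by (intro E_orth_zero[of _ p]) auto
  then show ?thesis by simp
qed

lemma pr_eqI: "x \<in> E p \<Longrightarrow> z - x \<in> Eo p \<Longrightarrow> pr p z = x"
  unfolding pr_def by (rule the_equality) (auto intro: pr_unique)

lemma pr:
  assumes "z \<in> TT p"
  shows pr_E [simp]: "pr p z \<in> E p" and pr_orth [simp]: "z - pr p z \<in> Eo p"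
proof -
  obtain x where x: "x \<in> E p" "z - x \<in> Eo p" using E_decompose[OF assms] by blast
  then show "pr p z \<in> E p" "z - pr p z \<in> Eo p" using pr_eqI[OF x] by auto
qed

lemma pr_id: "x \<in> E p \<Longrightarrow> pr p x = x"
  by (rule pr_eqI) (auto intro: subspace_0[OF subspace_orth])

lemma pr_lin:
  assumes "z \<in> TT p" "w \<in> TT p"
  shows "pr p (a *\<^sub>R z + b *\<^sub>R w) = a *\<^sub>R pr p z + b *\<^sub>R pr p w"
proof (rule pr_eqI)
  show "a *\<^sub>R pr p z + b *\<^sub>R pr p w \<in> E p"
    using assms by (intro subspace_add[OF subspace_E] subspace_scale[OF subspace_E]) auto
  have "a *\<^sub>R (z - pr p z) + b *\<^sub>R (w - pr p w) \<in> Eo p"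
    using assms by (intro subspace_add[OF subspace_orth] subspace_scale[OF subspace_orth]) auto
  then show "a *\<^sub>R z + b *\<^sub>R w - (a *\<^sub>R pr p z + b *\<^sub>R pr p w) \<in> Eo p" by (simp add: algebra_simps)
qed

lemma pr_add: "z \<in> TT p \<Longrightarrow> w \<in> TT p \<Longrightarrow> pr p (z + w) = pr p z + pr p w"
  using pr_lin[of z p w 1 1] by simp

lemma pairing_pr: "z \<in> TT p \<Longrightarrow> y \<in> E p \<Longrightarrow> pairing (pr p z) y = pairing z y"
proof -
  assume z: "z \<in> TT p" and y: "y \<in> E p"
  have "pairing y (z - pr p z) = 0" using pr_orth[OF z] y unfolding orth_iff by blast
  moreover have "pairing (z - pr p z) y = pairing z y - pairing (pr p z) y"
    by (rule pairing_diff[where p = p]) (use z y E_TT[of p] pr_E[OF z] in blast)+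
  ultimately show ?thesis using pairing_sym[of y "z - pr p z"] by linarith
qed

lemma E_eqI: "x \<in> E p \<Longrightarrow> x' \<in> E p \<Longrightarrow> (\<And>y. y \<in> E p \<Longrightarrow> pairing x y = pairing x' y) \<Longrightarrow> x = x'"
proof -
  assume a: "x \<in> E p" "x' \<in> E p" "\<And>y. y \<in> E p \<Longrightarrow> pairing x y = pairing x' y"
  have d: "x - x' \<in> E p" using a by (intro subspace_diff[OF subspace_E])
  have "pairing (x - x') y = 0" if "y \<in> E p" for y
    using pairing_diff[of x p x' y] a that E_TT[of p] by auto
  then have "x - x' = 0" using E_nondeg[of p] d unfolding nondegenerate_on_def by blast
  then show ?thesis by simp
qed

lemma E_finite_independent:
  assumes "independent S" "S \<subseteq> E p"
  shows "finite S" "card S \<le> 2 * rk"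
proof -
  obtain S0 where "finite S0" "card S0 = 2 * rk" "span S0 = E p" using E_basis by blast
  then show "finite S" "card S \<le> 2 * rk" using independent_span_bound[of S0 S] assms by auto
qed

text \<open>Rank and nullity: \<open>S\<close> and lifts of a basis of the image together span
  \<open>E p\<close>, whose dimension is twice that of the image.\<close>

lemma kernel_dim:
  assumes "independent S" "S \<subseteq> E p" "span S = {z \<in> E p. fst z = 0}"
  shows "rk \<le> card S"
proof -
  obtain S0 where S0: "finite S0" "independent S0" "card S0 = 2 * rk" "span S0 = E p" using E_basis by blast
  obtain BF where BF: "BF \<subseteq> fst ` E p" "independent BF" "fst ` E p \<subseteq> span BF" "card BF = rk"
    by (rule basis_exists[of "fst ` E p"]) (rule that, simp_all add: rk(2))
  have "fst ` E p \<subseteq> span (fst ` S0)"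
    unfolding S0(4)[symmetric] using linear_span_image[OF linear_fst, of S0] by simp
  then have finBF: "finite BF" using independent_span_bound[of "fst ` S0" BF] S0(1) BF by auto
  have "\<forall>f\<in>BF. \<exists>z\<in>E p. fst z = f" using BF(1) by blast
  then obtain l where l: "\<And>f. f \<in> BF \<Longrightarrow> l f \<in> E p \<and> fst (l f) = f" by metis
  have "S0 \<subseteq> span (S \<union> l ` BF)"
  proof
    fix z assume "z \<in> S0"
    then have z: "z \<in> E p" using S0(4) span_base by metis
    then have "fst z \<in> span BF" using BF(3) by blast
    then obtain u where u: "fst z = (\<Sum>f\<in>BF. u f *\<^sub>R f)" using finBF by (auto simp: span_finite)
    let ?y = "\<Sum>f\<in>BF. u f *\<^sub>R l f"
    have y: "?y \<in> E p" using l by (intro subspace_sum[OF subspace_E] subspace_scale[OF subspace_E]) auto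
    have "fst ?y = fst z" unfolding u fst_sum using l by (intro sum.cong) auto
    then have "z - ?y \<in> span S" unfolding assms(3) using subspace_diff[OF subspace_E z y] by simp
    then have "z - ?y \<in> span (S \<union> l ` BF)" using span_mono[of S "S \<union> l ` BF"] by blast
    moreover have "?y \<in> span (S \<union> l ` BF)" by (intro span_sum span_scale span_base) auto
    ultimately have "(z - ?y) + ?y \<in> span (S \<union> l ` BF)" by (rule span_add)
    then show "z \<in> span (S \<union> l ` BF)" by simp
  qed
  moreover have finS: "finite S" by (rule E_finite_independent[OF assms(1,2)])
  ultimately have "card S0 \<le> card (S \<union> l ` BF)"
    using independent_span_bound[of "S \<union> l ` BF" S0] S0(2) finBF by auto
  also have "\<dots> \<le> card S + card (l ` BF)" by (rule card_Un_le)
  also have "\<dots> \<le> card S + rk" using card_image_le[OF finBF, of l] BF(4) by simp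
  finally show ?thesis using S0(3) by simp
qed

text \<open>The kernel of the projection \<open>E \<rightarrow> TM\<close> is isotropic of half the rank, hence Lagrangian.\<close>

lemma kernel_lagrangian:
  assumes x: "x \<in> E p" and ann: "\<And>\<alpha>. (0, \<alpha>) \<in> E p \<Longrightarrow> \<alpha> (fst x) = 0"
  shows "fst x = 0"
proof (rule ccontr)
  assume nz: "fst x \<noteq> 0"
  let ?K = "{z \<in> E p. fst z = 0}"
  have subK: "subspace ?K" using subspace_E[of p] by (auto simp: subspace_def)
  obtain S where S: "S \<subseteq> ?K" "independent S" "?K \<subseteq> span S" by (rule basis_exists[of ?K]) (rule that)
  have spanS: "span S = ?K" using S span_minimal[OF S(1) subK] by blast
  have SE: "S \<subseteq> E p" using S(1) by blast
  have finS: "finite S" by (rule E_finite_independent[OF S(2) SE])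
  have rkS: "rk \<le> card S" by (rule kernel_dim[OF S(2) SE spanS])
  have "x \<notin> span S" using nz spanS by simp
  then have indx: "independent (insert x S)" and xS: "x \<notin> S" using S(2) independent_insert[of x S] span_base by auto
  obtain B where B: "insert x S \<subseteq> B" "B \<subseteq> E p" "independent B" "E p \<subseteq> span B"
    using maximal_independent_subset_extend[of "insert x S" "E p"] indx SE x by auto
  have finB: "finite B" and cardB: "card B \<le> 2 * rk" using E_finite_independent[OF B(3,2)] by auto
  have "card (B - insert x S) = card B - card (insert x S)" using B(1) finS by (intro card_Diff_subset) auto
  moreover have "card (insert x S) \<le> card B" by (rule card_mono[OF finB B(1)])
  \<comment> \<open>At most 2 rk - card S - 1 basis vectors lie outside \<open>insert x S\<close>.
    There are fewer conditions than coefficients, so a nonzero \<open>w\<close> in the kernel is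
    orthogonal to these vectors. It is orthogonal to \<open>S\<close> by isotropy and to
    \<open>x\<close> by assumption, which contradicts non-degeneracy.\<close>
  ultimately have "card (B - insert x S) < card S" using cardB rkS finS xS by auto
  from underdetermined_system[OF _ finS this, of "\<lambda>d k. pairing k d"]
  obtain c where c: "\<exists>k\<in>S. c k \<noteq> 0" "\<forall>d\<in>B - insert x S. (\<Sum>k\<in>S. pairing k d * c k) = 0" using finB by auto
  define w where "w = (\<Sum>k\<in>S. c k *\<^sub>R k)"
  have "w \<noteq> 0" using c(1) independentD[OF S(2) finS order_refl, of c] unfolding w_def by blast
  have wK: "w \<in> ?K" unfolding w_def spanS[symmetric] by (intro span_sum span_scale span_base)
  have w0: "fst w = 0" and wE: "w \<in> E p" using wK by auto
  have "pairing d w = 0" if d: "d \<in> B" for d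
  proof (cases "d \<in> insert x S")
    case True
    then consider "d = x" | "d \<in> S" by blast
    then show ?thesis
    proof cases
      case 1
      have "(0, snd w) \<in> E p" using wE w0 by (metis prod.collapse)
      then show ?thesis using 1 ann x w0 by (simp add: pairing_def T'_0[OF E_T'])
    next
      case 2
      then have "fst d = 0" "d \<in> E p" using S(1) by auto
      then show ?thesis using w0 wE by (simp add: pairing_def T'_0[OF E_T'])
    qed
  next
    case False
    have "pairing w d = (\<Sum>k\<in>S. c k * pairing k d)"
      unfolding w_def using SE B(2) d E_TT[of p] by (intro pairing_sum[where p = p]) auto
    also have "\<dots> = 0" using c(2) False d by (simp add: mult.commute)
    finally show ?thesis by (simp add: pairing_sym)
  qed
  note dw = this
  have perp: "pairing y w = 0" if "y \<in> E p" for y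
  proof (rule pairing_span[where p = p and S = B])
    show "B \<subseteq> TT p" "w \<in> TT p" using B(2) E_TT[of p] wE by blast+
    show "y \<in> span B" using B(4) that by blast
  qed (rule dw)
  have "\<forall>y\<in>E p. pairing w y = 0" using perp by (simp add: pairing_sym[of w])
  then have "w = 0" using E_nondeg[of p] wE unfolding nondegenerate_on_def by simp
  with \<open>w \<noteq> 0\<close> show False by simp
qed

end

section \<open>The splitting of the tangent bundle\<close>

context gap
begin

text \<open>For a non-tangent \<open>v\<close> the value is \<open>v\<close> itself, so its two
  parts are \<open>v\<close> and 0. Forms vanish on lists containing either, hence components and
  pullbacks of forms keep the normalisation outside the tangent space.\<close>

definition Pm :: "'a \<Rightarrow> 'a tvec \<Rightarrow> 'a tvec"
  where "Pm p v = (if v \<in> T p then fst (pr p (v, 0)) else v)"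

abbreviation "F p \<equiv> fst ` E p"

lemma vec_TT [simp]: "v \<in> T p \<Longrightarrow> (v, 0) \<in> TT p" and cov_TT [simp]: "\<alpha> \<in> T' p \<Longrightarrow> (0, \<alpha>) \<in> TT p"
  by auto

lemma Pm_F: "v \<in> T p \<Longrightarrow> Pm p v \<in> F p"
  unfolding Pm_def using pr_E[OF vec_TT, of v p] by simp

lemma F_T: "v \<in> F p \<Longrightarrow> v \<in> T p"
  by (elim imageE) (simp only: E_T)

lemma Pm_T [simp]: "v \<in> T p \<Longrightarrow> Pm p v \<in> T p"
  by (rule F_T[OF Pm_F])

lemma Pm_out: "v \<notin> T p \<Longrightarrow> Pm p v = v"
  by (simp add: Pm_def)

lemma Pm_lin: "v \<in> T p \<Longrightarrow> w \<in> T p \<Longrightarrow> Pm p (a *\<^sub>R v + b *\<^sub>R w) = a *\<^sub>R Pm p v + b *\<^sub>R Pm p w"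
  using pr_lin[of "(v, 0)" p "(w, 0)" a b] by (simp add: Pm_def)

lemma Pm_add: "v \<in> T p \<Longrightarrow> w \<in> T p \<Longrightarrow> Pm p (v + w) = Pm p v + Pm p w"
  using Pm_lin[of v p w 1 1] by simp

lemma Pm_scale: "v \<in> T p \<Longrightarrow> Pm p (c *\<^sub>R v) = c *\<^sub>R Pm p v"
  using Pm_lin[of v p v c 0] by simp

lemma Pm_0 [simp]: "Pm p 0 = 0"
  using Pm_scale[of 0 p 0] by simp

lemma Pm_diff: "v \<in> T p \<Longrightarrow> w \<in> T p \<Longrightarrow> Pm p (v - w) = Pm p v - Pm p w"
  using Pm_lin[of v p w 1 "-1"] by simp

lemma Pm_sum: "(\<And>i. i \<in> I \<Longrightarrow> v i \<in> T p) \<Longrightarrow> Pm p (\<Sum>i\<in>I. c i *\<^sub>R v i) = (\<Sum>i\<in>I. c i *\<^sub>R Pm p (v i))"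
  by (induction I rule: infinite_finite_induct) (auto simp: Pm_add Pm_scale T_sum_vec)

text \<open>The vector \<open>(v, 0) - pr p (v, 0)\<close> is orthogonal to \<open>E p\<close>, and
  its pairing with \<open>(0, \<alpha>)\<close> sees only its tangent part.\<close>

lemma kernel_Pm: "(0, \<alpha>) \<in> E p \<Longrightarrow> v \<in> T p \<Longrightarrow> \<alpha> (Pm p v) = \<alpha> v"
proof -
  assume a: "(0, \<alpha>) \<in> E p" and v: "v \<in> T p"
  have "\<alpha> \<in> T' p" using E_T'[OF a] by simp
  moreover have "pairing (0, \<alpha>) ((v, 0) - pr p (v, 0)) = 0"
    using pr_orth[OF vec_TT[OF v]] a unfolding orth_iff by blast
  ultimately show ?thesis
    using v T'_0[OF T'_uminus[OF E_T'[OF pr_E[OF vec_TT[OF v]]]]] Pm_T[OF v]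
    by (simp add: pairing_def Pm_def T'_diff)
qed

lemma orth_covector: "(0, \<beta>) \<in> Eo p \<longleftrightarrow> \<beta> \<in> T' p \<and> (\<forall>v\<in>F p. \<beta> v = 0)"
proof -
  have "pairing x (0, \<beta>) = 2 * \<beta> (fst x)" if "x \<in> E p" for x
    using T'_0[OF E_T'[OF that]] by (simp add: pairing_def)
  then show ?thesis unfolding orth_iff by auto
qed

lemma orth_Pm: "(0, \<beta>) \<in> Eo p \<Longrightarrow> v \<in> T p \<Longrightarrow> \<beta> (Pm p v) = 0"
  using Pm_F[of v p] unfolding orth_covector by blast

text \<open>The Lagrangian property in the form used below: covectors of the kernel separate the
  points of \<open>F p\<close>. Together with \<open>kernel_Pm\<close> it yields
  \<open>Pm_id\<close> and \<open>Pm_orth\<close>.\<close>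

lemma F_zero: "v \<in> F p \<Longrightarrow> (\<And>\<alpha>. (0, \<alpha>) \<in> E p \<Longrightarrow> \<alpha> v = 0) \<Longrightarrow> v = 0"
  using kernel_lagrangian by blast

lemma subspace_F: "subspace (F p)"
  by (rule linear_subspace_image[OF linear_fst subspace_E])

lemma Pm_id: "v \<in> F p \<Longrightarrow> Pm p v = v"
proof -
  assume v: "v \<in> F p"
  have vT: "v \<in> T p" by (rule F_T[OF v])
  have "Pm p v - v = 0"
  proof (rule F_zero)
    show "Pm p v - v \<in> F p" by (rule subspace_diff[OF subspace_F Pm_F[OF vT] v])
    show "\<alpha> (Pm p v - v) = 0" if "(0, \<alpha>) \<in> E p" for \<alpha>
      using kernel_Pm[OF that vT] E_T'[OF that] vT by (simp add: T'_diff)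
  qed
  then show ?thesis by simp
qed

lemma Pm_idem [simp]: "Pm p (Pm p v) = Pm p v"
  using Pm_id[OF Pm_F] by (cases "v \<in> T p") (auto simp: Pm_out)

lemma Pm_orth: "y \<in> Eo p \<Longrightarrow> Pm p (fst y) = 0"
proof (rule F_zero)
  assume y: "y \<in> Eo p"
  then have yT: "fst y \<in> T p" "snd y \<in> T' p" unfolding orth_iff by auto
  show "Pm p (fst y) \<in> F p" by (rule Pm_F[OF yT(1)])
  fix \<alpha> assume a: "(0, \<alpha>) \<in> E p"
  have "pairing (0, \<alpha>) y = 0" using y a unfolding orth_iff by blast
  then show "\<alpha> (Pm p (fst y)) = 0"
    using kernel_Pm[OF a yT(1)] T'_0[OF yT(2)] by (simp add: pairing_def)
qed

text \<open>By \<open>Pm_orth\<close> the orthogonal part of \<open>z\<close> contributes nothing.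
  Projecting a bracket onto E therefore acts on its anchor by \<open>Pm\<close>, whatever the
  covector part is.\<close>

lemma fst_pr: "z \<in> TT p \<Longrightarrow> fst (pr p z) = Pm p (fst z)"
proof -
  assume z: "z \<in> TT p"
  have "fst z = fst (pr p z) + fst (z - pr p z)" by simp
  then have "Pm p (fst z) = Pm p (fst (pr p z) + fst (z - pr p z))" by simp
  also have "\<dots> = Pm p (fst (pr p z)) + Pm p (fst (z - pr p z))"
    using z pr_E[OF z] by (intro Pm_add) auto
  also have "Pm p (fst (z - pr p z)) = 0" by (rule Pm_orth[OF pr_orth[OF z]])
  also have "Pm p (fst (pr p z)) = fst (pr p z)" using pr_E[OF z] by (intro Pm_id) auto
  finally show ?thesis by simp
qed

text \<open>By \<open>fst_pr\<close> the projection of \<open>(0, \<alpha>)\<close> is again a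
  covector. Evaluating it and its complement on the image of \<open>Pm\<close> identifies it with
  the pullback of \<open>\<alpha>\<close> along \<open>Pm\<close>.\<close>

lemma covector_split:
  assumes a: "\<alpha> \<in> T' p"
  shows covector_E: "(0, \<lambda>v. \<alpha> (Pm p v)) \<in> E p"
    and covector_orth: "(0, \<lambda>v. \<alpha> (v - Pm p v)) \<in> Eo p"
proof -
  define \<alpha>1 where "\<alpha>1 = snd (pr p (0, \<alpha>))"
  have pE: "pr p (0, \<alpha>) \<in> E p" and po: "(0, \<alpha>) - pr p (0, \<alpha>) \<in> Eo p" using a by auto
  have f0: "fst (pr p (0, \<alpha>)) = 0" using fst_pr[OF cov_TT[OF a]] by simp
  then have e: "pr p (0, \<alpha>) = (0, \<alpha>1)" unfolding \<alpha>1_def by (metis prod.collapse)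
  have K: "(0, \<alpha>1) \<in> E p" using pE e by simp
  have O: "(0, \<alpha> - \<alpha>1) \<in> Eo p" using po e by simp
  have T1: "\<alpha>1 \<in> T' p" using E_T'[OF K] by simp
  have "\<alpha> (Pm p v) = \<alpha>1 v" for v
  proof (cases "v \<in> T p")
    case True
    have "(\<alpha> - \<alpha>1) (Pm p v) = 0" by (rule orth_Pm[OF O True])
    then show ?thesis using kernel_Pm[OF K True] by (simp add: fapply)
  next
    case False
    then show ?thesis using T'_outside[OF a] T'_outside[OF T1] by (simp add: Pm_out)
  qed
  note * = this
  then have "(\<lambda>v. \<alpha> (Pm p v)) = \<alpha>1" by auto
  then show "(0, \<lambda>v. \<alpha> (Pm p v)) \<in> E p" using K by simp
  have "\<alpha> (v - Pm p v) = (\<alpha> - \<alpha>1) v" for v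
  proof (cases "v \<in> T p")
    case True
    then show ?thesis using * by (simp add: fapply T'_diff[OF a])
  next
    case False
    then show ?thesis using T'_outside[OF a] T'_outside[OF T1] T'_0[OF a] by (simp add: fapply Pm_out)
  qed
  then have "(\<lambda>v. \<alpha> (v - Pm p v)) = \<alpha> - \<alpha>1" by auto
  then show "(0, \<lambda>v. \<alpha> (v - Pm p v)) \<in> Eo p" using O by simp
qed

text \<open>The coefficients solve the Gram system of the frame, whose matrix is invertible at
  \<open>p\<close> by non-degeneracy. The neighbourhood is fixed by the frame, before the section
  \<open>z\<close> is given.\<close>

lemma frame_coefficients:
  assumes W: "open W" "p \<in> W" and e: "\<And>i. i < 2 * rk \<Longrightarrow> e i \<in> TS" "frame_on W (2 * rk) e E"
  obtains W' where "open W'" "p \<in> W'" "W' \<subseteq> W"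
    "\<And>z. z \<in> TS \<Longrightarrow> \<exists>c. (\<forall>i<2 * rk. c i \<in> C) \<and> (\<forall>q\<in>W'. pr q (z q) = (\<Sum>i<2 * rk. c i q *\<^sub>R e i q))"
proof -
  let ?n = "2 * rk"
  have fr: "inj_on (\<lambda>i. e i q) {..<?n}" "independent ((\<lambda>i. e i q) ` {..<?n})" "span ((\<lambda>i. e i q) ` {..<?n}) = E q" if "q \<in> W" for q
    using e(2) that unfolding frame_on_def by auto
  have eE: "e i q \<in> E q" if "i < ?n" "q \<in> W" for i q
    using fr(3)[OF that(2)] span_base[of "e i q" "(\<lambda>i. e i q) ` {..<?n}"] that(1) by auto
  define M where "M i j q = pairing (e i q) (e j q)" for i j q
  have MC: "M i j \<in> C" if "i < ?n" "j < ?n" for i j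
    using pairing_C[OF e(1)[OF that(1)] e(1)[OF that(2)]] by (simp add: M_def[abs_def])
  have Mc: "(\<Sum>j<?n. M i j q * c j) = pairing (\<Sum>j<?n. c j *\<^sub>R e j q) (e i q)" if "i < ?n" for i q c
  proof -
    have "pairing (\<Sum>j<?n. c j *\<^sub>R e j q) (e i q) = (\<Sum>j<?n. c j * pairing (e j q) (e i q))"
      using e(1) that by (intro pairing_sum[where p = q]) (auto simp del: mem_Times_iff)
    then show ?thesis unfolding M_def by (simp add: mult.commute pairing_sym)
  qed
  have inj: "c j = 0" if c: "\<And>i. i < ?n \<Longrightarrow> (\<Sum>j<?n. M i j p * c j) = 0" and j: "j < ?n" for c j
  proof -
    let ?w = "\<Sum>j<?n. c j *\<^sub>R e j p"
    have wE: "?w \<in> E p" using eE W(2) by (intro subspace_sum[OF subspace_E] subspace_scale[OF subspace_E]) auto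
    have "pairing y ?w = 0" if y: "y \<in> E p" for y
    proof (rule pairing_span[where p = p and S = "(\<lambda>i. e i p) ` {..<?n}"])
      show "(\<lambda>i. e i p) ` {..<?n} \<subseteq> TT p" using e(1) TS_TT by blast
      show "?w \<in> TT p" using wE E_TT by blast
      show "y \<in> span ((\<lambda>i. e i p) ` {..<?n})" using fr(3)[OF W(2)] y by simp
      fix y assume "y \<in> (\<lambda>i. e i p) ` {..<?n}"
      then obtain i where i: "i < ?n" "y = e i p" by blast
      then show "pairing y ?w = 0" using c[OF i(1)] Mc[OF i(1)] by (simp add: pairing_sym)
    qed
    then have "\<forall>y\<in>E p. pairing ?w y = 0" by (simp add: pairing_sym[of ?w])
    then have w0: "?w = 0" using E_nondeg[of p] wE unfolding nondegenerate_on_def by blast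
    show ?thesis by (rule independent_family_coeff[OF fr(1,2)[OF W(2)] w0 j])
  qed
  have "\<exists>D\<in>C. D p \<noteq> 0 \<and> (\<forall>b. (\<forall>i<?n. b i \<in> C) \<longrightarrow> (\<exists>g. (\<forall>i<?n. g i \<in> C) \<and>
    (\<forall>q c. (\<forall>i<?n. (\<Sum>j<?n. M i j q * c j) = b i q) \<longrightarrow> (\<forall>i<?n. D q * c i = g i q))))"
    by (rule smooth_linear_solver) (rule MC inj, assumption+)+
  then obtain D where D: "D \<in> C" "D p \<noteq> 0" and sol: "\<And>b. (\<forall>i<?n. b i \<in> C) \<Longrightarrow> (\<exists>g. (\<forall>i<?n. g i \<in> C) \<and>
    (\<forall>q c. (\<forall>i<?n. (\<Sum>j<?n. M i j q * c j) = b i q) \<longrightarrow> (\<forall>i<?n. D q * c i = g i q)))"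
    by blast
  obtain h V where h: "h \<in> C" "open V" "p \<in> V" "\<And>q. q \<in> V \<Longrightarrow> h q * D q = 1"
    by (rule inverse_extend[OF D]) blast
  show ?thesis
  proof (rule that[of "W \<inter> V"])
    show "open (W \<inter> V)" "p \<in> W \<inter> V" "W \<inter> V \<subseteq> W" using W h by auto
    fix z assume z: "z \<in> TS"
    have "\<forall>i<?n. (\<lambda>q. pairing (z q) (e i q)) \<in> C" using pairing_C[OF z e(1)] by blast
    from sol[OF this] obtain g where g: "\<forall>i<?n. g i \<in> C" "\<And>q c. (\<forall>i<?n. (\<Sum>j<?n. M i j q * c j) = pairing (z q) (e i q)) \<Longrightarrow>
        (\<forall>i<?n. D q * c i = g i q)"
      by blast
    have "pr q (z q) = (\<Sum>i<?n. (h q * g i q) *\<^sub>R e i q)" if q: "q \<in> W \<inter> V" for q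
    proof -
      have qW: "q \<in> W" and qV: "q \<in> V" using q by auto
      have "pr q (z q) \<in> span ((\<lambda>i. e i q) ` {..<?n})" using pr_E[OF TS_TT[OF z]] fr(3)[OF qW] by simp
      then obtain u where "pr q (z q) = (\<Sum>v\<in>(\<lambda>i. e i q) ` {..<?n}. u v *\<^sub>R v)" by (auto simp: span_finite)
      also have "\<dots> = (\<Sum>i<?n. u (e i q) *\<^sub>R e i q)"
        by (rule sum.reindex[OF fr(1)[OF qW], unfolded o_def])
      finally have u: "pr q (z q) = (\<Sum>i<?n. u (e i q) *\<^sub>R e i q)" .
      have "(\<Sum>j<?n. M i j q * u (e j q)) = pairing (z q) (e i q)" if i: "i < ?n" for i
        unfolding Mc[OF i] u[symmetric] by (rule pairing_pr[OF TS_TT[OF z] eE[OF i qW]])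
      then have "D q * u (e i q) = g i q" if "i < ?n" for i using g(2)[of q "\<lambda>j. u (e j q)"] that by blast
      then have "h q * g i q = u (e i q)" if "i < ?n" for i
        using h(4)[OF qV] that by (metis mult.assoc mult_1)
      then show ?thesis unfolding u by (intro sum.cong) auto
    qed
    then show "\<exists>c. (\<forall>i<?n. c i \<in> C) \<and> (\<forall>q\<in>W \<inter> V. pr q (z q) = (\<Sum>i<?n. c i q *\<^sub>R e i q))"
      using g(1) h(1) by (intro exI[of _ "\<lambda>i q. h q * g i q"]) auto
  qed
qed

lemma proj_TS [simp]:
  assumes z: "z \<in> TS"
  shows "proj A E z \<in> TS"
  unfolding proj_E
proof (rule TS_localI)
  fix p
  obtain W e where W: "open W" "p \<in> W" "\<And>i. i < 2 * rk \<Longrightarrow> e i \<in> TS" "frame_on W (2 * rk) e E"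
    by (rule E_frame[of p]) blast
  obtain W' where W': "open W'" "p \<in> W'"
    "\<exists>c. (\<forall>i<2 * rk. c i \<in> C) \<and> (\<forall>q\<in>W'. pr q (z q) = (\<Sum>i<2 * rk. c i q *\<^sub>R e i q))"
  proof (rule frame_coefficients[OF W])
    fix W' assume W': "open W'" "p \<in> W'" and
      c: "\<And>z. z \<in> TS \<Longrightarrow> \<exists>c. (\<forall>i<2 * rk. c i \<in> C) \<and> (\<forall>q\<in>W'. pr q (z q) = (\<Sum>i<2 * rk. c i q *\<^sub>R e i q))"
    show thesis by (rule that[OF W' c[OF z]])
  qed
  then obtain c where c: "\<forall>i<2 * rk. c i \<in> C" "\<forall>q\<in>W'. pr q (z q) = (\<Sum>i<2 * rk. c i q *\<^sub>R e i q)" by blast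
  have "(\<lambda>q. \<Sum>i<2 * rk. c i q *\<^sub>R e i q) \<in> TS" using c(1) W(3) by (intro TS_sum TS_fmult) auto
  then show "\<exists>W y. open W \<and> p \<in> W \<and> y \<in> TS \<and> (\<forall>q\<in>W. pr q (z q) = y q)" using W' c(2) by blast
qed

section \<open>Projected and reflected vector fields\<close>

definition PF :: "('a \<Rightarrow> 'a tvec) \<Rightarrow> 'a \<Rightarrow> 'a tvec" where "PF X = (\<lambda>p. Pm p (X p))"
definition QF :: "('a \<Rightarrow> 'a tvec) \<Rightarrow> 'a \<Rightarrow> 'a tvec" where "QF X = (\<lambda>p. X p - Pm p (X p))"
definition RF :: "('a \<Rightarrow> 'a tvec) \<Rightarrow> 'a \<Rightarrow> 'a tvec" where "RF X = (\<lambda>p. X p - 2 *\<^sub>R Pm p (X p))"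

lemma vp_proj: "z \<in> TS \<Longrightarrow> vp (proj A E z) = PF (vp z)"
  by (auto simp: vp_def PF_def proj_E fst_pr)

lemma PF_VF [simp]: "X \<in> VF \<Longrightarrow> PF X \<in> VF"
proof -
  assume X: "X \<in> VF"
  have z: "(\<lambda>p. (X p, 0)) \<in> TS" using TS_I[OF X CF_0] by simp
  have "vp (proj A E (\<lambda>p. (X p, 0))) = PF X" unfolding vp_proj[OF z] by (simp add: vp_def)
  then show ?thesis using TS_vp[OF proj_TS[OF z]] by simp
qed

lemma QF_VF [simp]: "X \<in> VF \<Longrightarrow> QF X \<in> VF"
  using VF_diff[of X "PF X"] PF_VF[of X] unfolding QF_def PF_def by simp

lemma RF_VF [simp]: "X \<in> VF \<Longrightarrow> RF X \<in> VF"
  using VF_diff[OF _ VF_scale[OF PF_VF], of X X 2] unfolding RF_def PF_def by simp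

lemma PF_PF [simp]: "PF (PF X) = PF X" and QF_PF [simp]: "QF (PF X) = (\<lambda>p. 0)"
  by (auto simp: PF_def QF_def)

lemma PF_QF [simp]: "X \<in> VF \<Longrightarrow> PF (QF X) = (\<lambda>p. 0)"
  and QF_QF [simp]: "X \<in> VF \<Longrightarrow> QF (QF X) = QF X"
  by (auto simp: PF_def QF_def Pm_diff)

lemma PF_add_QF: "(\<lambda>p. PF X p + QF X p) = X"
  by (simp add: PF_def QF_def)

lemma RF_eq: "RF X = (\<lambda>p. QF X p - PF X p)"
  by (auto simp: RF_def QF_def PF_def scaleR_2)

lemma ins_split: "X \<in> VF \<Longrightarrow> \<omega> \<in> \<Omega> \<Longrightarrow> ins X \<omega> = ins (PF X) \<omega> + ins (QF X) \<omega>"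
  using ins_add_left[of \<omega> "PF X" "QF X"] unfolding PF_add_QF by simp

lemma ins_zero_field: "\<omega> \<in> \<Omega> \<Longrightarrow> ins (\<lambda>p. 0) \<omega> = 0"
  by (auto simp: ins_def fun_eq_iff fapply)

lemma ins_RF: "X \<in> VF \<Longrightarrow> \<omega> \<in> \<Omega> \<Longrightarrow> ins (RF X) \<omega> = ins (QF X) \<omega> - ins (PF X) \<omega>"
  unfolding RF_eq by (simp add: ins_diff_left)

subsection \<open>The components of the bigrading\<close>

end

text \<open>The component of \<open>F\<close>-degree \<open>a\<close> of a multilinear function, where \<open>P\<close> is the projection
  onto the first summand: the first argument is split by \<open>P\<close> and its complement.\<close>

primrec Pcomp :: "('v \<Rightarrow> 'v) \<Rightarrow> 'v list \<Rightarrow> int \<Rightarrow> ('v::real_vector list \<Rightarrow> real) \<Rightarrow> real"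
  where
    "Pcomp P [] a \<eta> = (if a = 0 then \<eta> [] else 0)"
  | "Pcomp P (v # vs) a \<eta> = Pcomp P vs (a - 1) (\<lambda>ws. \<eta> (P v # ws)) + Pcomp P vs a (\<lambda>ws. \<eta> ((v - P v) # ws))"

lemma Pcomp_lin: "Pcomp P vs a (\<lambda>ws. s * \<eta> ws + t * \<eta>' ws) = s * Pcomp P vs a \<eta> + t * Pcomp P vs a \<eta>'"
  by (induction vs arbitrary: a \<eta> \<eta>') (auto simp: algebra_simps)

lemma Pcomp_add: "Pcomp P vs a (\<lambda>ws. \<eta> ws + \<eta>' ws) = Pcomp P vs a \<eta> + Pcomp P vs a \<eta>'"
  using Pcomp_lin[of P vs a 1 \<eta> 1 \<eta>'] by simp

lemma Pcomp_scale: "Pcomp P vs a (\<lambda>ws. s * \<eta> ws) = s * Pcomp P vs a \<eta>"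
  using Pcomp_lin[of P vs a s \<eta> 0 \<eta>] by simp

lemma Pcomp_uminus: "Pcomp P vs a (\<lambda>ws. - \<eta> ws) = - Pcomp P vs a \<eta>"
  using Pcomp_scale[of P vs a "-1" \<eta>] by simp

lemma Pcomp_zero: "Pcomp P vs a (\<lambda>ws. 0) = 0"
  using Pcomp_scale[of P vs a 0 "\<lambda>_. 0"] by simp

lemma Pcomp_range: "a < 0 \<or> a > int (length vs) \<Longrightarrow> Pcomp P vs a \<eta> = 0"
  by (induction vs arbitrary: a \<eta>) auto

context gap
begin

text \<open>Only the first degree \<open>a\<close> is recorded. The component of bidegree (a,b) is
  obtained by also taking the part of total degree a + b.\<close>

definition comp :: "int \<Rightarrow> 'a form \<Rightarrow> 'a form"
  where "comp a \<omega> = (\<lambda>p vs. Pcomp (Pm p) vs a (\<omega> p))"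

lemma comp_Nil [simp]: "comp a \<omega> p [] = (if a = 0 then \<omega> p [] else 0)"
  by (simp add: comp_def)

lemma ins_comp: "ins Y (comp a \<omega>) = comp (a - 1) (ins (PF Y) \<omega>) + comp a (ins (QF Y) \<omega>)"
  by (auto simp: fun_eq_iff ins_def comp_def fapply PF_def QF_def)

lemma comp_add [simp]: "comp a (\<omega> + \<eta>) = comp a \<omega> + comp a \<eta>"
  and comp_0 [simp]: "comp a 0 = 0"
  and comp_scaleR [simp]: "comp a (c *\<^sub>R \<omega>) = c *\<^sub>R comp a \<omega>"
  by (auto simp: fun_eq_iff comp_def fapply Pcomp_add Pcomp_zero Pcomp_scale plus_fun_def scaleR_fun_def zero_fun_def)

lemma comp_uminus [simp]: "comp a (- \<omega>) = - comp a \<omega>" using comp_scaleR[of a "-1" \<omega>] by simp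
lemma comp_diff [simp]: "comp a (\<omega> - \<eta>) = comp a \<omega> - comp a \<eta>" using comp_add[of a \<omega> "- \<eta>"] by simp

lemma comp_range: "a < 0 \<or> a > int (length vs) \<Longrightarrow> comp a \<omega> p vs = 0"
  unfolding comp_def by (rule Pcomp_range)

lemma comp_form [simp]:
  assumes w: "\<omega> \<in> \<Omega>"
  shows "comp a \<omega> \<in> \<Omega>"
proof (rule formI)
  fix p :: 'a and vs us ws :: "'a tvec list" and v w s t
  have Z: "\<omega> p (us @ 0 # ws) = 0" for us ws using form_slot[OF w, of 0 p 0 us 0 0 ws] by simp
  show "comp a \<omega> p vs = 0" if "\<not> set vs \<subseteq> T p"
  proof -
    have "Pcomp (Pm p) vs a \<eta> = 0"
      if "\<And>vs. \<not> set vs \<subseteq> T p \<Longrightarrow> \<eta> vs = 0" "\<And>us ws. \<eta> (us @ 0 # ws) = 0" "\<not> set vs \<subseteq> T p" for \<eta> a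
      using that
    proof (induction vs arbitrary: \<eta> a)
      case (Cons u vs)
      show ?case
      proof (cases "u \<in> T p")
        case True
        have 1: "Pcomp (Pm p) vs b (\<lambda>ws. \<eta> (u' # ws)) = 0" if "u' \<in> T p" for u' b
        proof (rule Cons.IH)
          show "\<eta> (u' # us @ 0 # ws) = 0" for us ws using Cons.prems(2)[of "u' # us" ws] by simp
        qed (use Cons.prems True that in auto)
        show ?thesis using 1[of "Pm p u"] 1[of "u - Pm p u"] True by simp
      next
        case False
        have "\<eta> (u # ws) = 0" "\<eta> (0 # ws) = 0" for ws using Cons.prems(1)[of "u # ws"] Cons.prems(2)[of "[]" ws] False by auto
        then show ?thesis using False by (simp add: Pm_out Pcomp_zero)
      qed
    qed simp
    then show ?thesis unfolding comp_def using that form_outside[OF w] Z by blast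
  qed
  show "comp a \<omega> p ((s *\<^sub>R v + t *\<^sub>R w) # ws) = s * comp a \<omega> p (v # ws) + t * comp a \<omega> p (w # ws)"
    if vw: "v \<in> T p" "w \<in> T p"
  proof -
    have "(\<lambda>ws. \<omega> p (Pm p (s *\<^sub>R v + t *\<^sub>R w) # ws)) = (\<lambda>ws. s * \<omega> p (Pm p v # ws) + t * \<omega> p (Pm p w # ws))"
      using vw by (simp add: Pm_lin form_head[OF w])
    moreover have "(s *\<^sub>R v + t *\<^sub>R w) - Pm p (s *\<^sub>R v + t *\<^sub>R w) = s *\<^sub>R (v - Pm p v) + t *\<^sub>R (w - Pm p w)"
      using vw by (simp add: Pm_lin algebra_simps)
    then have "(\<lambda>ws. \<omega> p (((s *\<^sub>R v + t *\<^sub>R w) - Pm p (s *\<^sub>R v + t *\<^sub>R w)) # ws)) =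
        (\<lambda>ws. s * \<omega> p ((v - Pm p v) # ws) + t * \<omega> p ((w - Pm p w) # ws))"
      using vw by (simp add: form_head[OF w])
    ultimately show ?thesis unfolding comp_def Pcomp.simps by (simp only: Pcomp_lin) (simp add: algebra_simps)
  qed
  show "comp a \<omega> p (us @ v # w # ws) = - comp a \<omega> p (us @ w # v # ws)"
  proof -
    have "Pcomp (Pm p) (us @ v # w # ws) a \<eta> = - Pcomp (Pm p) (us @ w # v # ws) a \<eta>"
      if "\<And>us v w ws. \<eta> (us @ v # w # ws) = - \<eta> (us @ w # v # ws)" for \<eta> a
      using that
    proof (induction us arbitrary: \<eta> a)
      case Nil
      have s: "(\<lambda>ws. \<eta> (x # y # ws)) = (\<lambda>ws. - \<eta> (y # x # ws))" for x y
      proof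
        show "\<eta> (x # y # ws) = - \<eta> (y # x # ws)" for ws using Nil[of "[]" x y ws] by (simp only: append_Nil)
      qed
      show ?case
        unfolding append_Nil Pcomp.simps
        unfolding s[of "Pm p v" "Pm p w"] s[of "Pm p v" "w - Pm p w"] s[of "v - Pm p v" "Pm p w"] s[of "v - Pm p v" "w - Pm p w"]
          Pcomp_uminus by simp
    next
      case (Cons u us)
      have *: "Pcomp (Pm p) (us @ v # w # ws) b (\<lambda>ws. \<eta> (u' # ws)) = - Pcomp (Pm p) (us @ w # v # ws) b (\<lambda>ws. \<eta> (u' # ws))" for b u'
      proof (rule Cons.IH)
        show "\<eta> (u' # us' @ v # w # ws) = - \<eta> (u' # us' @ w # v # ws)" for us' v w ws
          using Cons.prems[of "u' # us'" v w ws] by (simp only: append_Cons)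
      qed
      show ?case unfolding append_Cons Pcomp.simps * by simp
    qed
    from this[of "\<omega> p", OF form_swap[OF w]] show ?thesis unfolding comp_def .
  qed
next
  fix Xs assume "set Xs \<subseteq> VF"
  then show "(\<lambda>p. comp a \<omega> p (ev Xs p)) \<in> C"
    using w
  proof (induction Xs arbitrary: \<omega> a)
    case Nil
    then show ?case by (cases "a = 0") auto
  next
    case (Cons X Xs)
    have "(\<lambda>p. comp (a - 1) (ins (PF X) \<omega>) p (ev Xs p)) \<in> C" "(\<lambda>p. comp a (ins (QF X) \<omega>) p (ev Xs p)) \<in> C"
      by (rule Cons.IH; use Cons.prems in simp)+
    then have "(\<lambda>p. comp (a - 1) (ins (PF X) \<omega>) p (ev Xs p) + comp a (ins (QF X) \<omega>) p (ev Xs p)) \<in> C" by (rule C_add)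
    moreover have "comp a \<omega> p (ev (X # Xs) p) = comp (a - 1) (ins (PF X) \<omega>) p (ev Xs p) + comp a (ins (QF X) \<omega>) p (ev Xs p)" for p
      using ins_comp[of X a \<omega>] by (simp add: fun_eq_iff ins_apply fapply)
    ultimately show "(\<lambda>p. comp a \<omega> p (ev (X # Xs) p)) \<in> C" by simp
  qed
qed

lemma ins_PF_comp: "X \<in> VF \<Longrightarrow> \<omega> \<in> \<Omega> \<Longrightarrow> ins (PF X) (comp a \<omega>) = comp (a - 1) (ins (PF X) \<omega>)"
  by (simp add: ins_comp ins_zero_field)

lemma ins_QF_comp: "X \<in> VF \<Longrightarrow> \<omega> \<in> \<Omega> \<Longrightarrow> ins (QF X) (comp a \<omega>) = comp a (ins (QF X) \<omega>)"
  by (simp add: ins_comp ins_zero_field)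

lemma comp_Cons: "comp a \<omega> p (X p # ev Xs p) = comp (a - 1) (ins (PF X) \<omega>) p (ev Xs p) + comp a (ins (QF X) \<omega>) p (ev Xs p)"
  using ins_comp[of X a \<omega>] by (simp add: fun_eq_iff ins_apply fapply)

lemma sum_comp:
  assumes w: "\<omega> \<in> \<Omega>" and le: "lo \<le> 0" "int N \<le> hi"
  shows "(\<Sum>a = lo..hi. comp a \<omega>) = \<omega>"
proof (rule form_eqI)
  show "(\<Sum>a = lo..hi. comp a \<omega>) \<in> \<Omega>" using w by (intro forms_sum) simp
  show "\<omega> \<in> \<Omega>" by (rule w)
  fix Xs p assume Xs: "set Xs \<subseteq> VF"
  \<comment> \<open>The bounds are generalised because contraction with \<open>PF X\<close> shifts
    the window by one; the list becomes shorter at the same time, so the window remains large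
    enough.\<close>
  have *: "(\<Sum>a = lo..hi. comp a \<omega> p (ev Xs p)) = \<omega> p (ev Xs p)"
    if "\<omega> \<in> \<Omega>" "set Xs \<subseteq> VF" "lo \<le> 0" "int (length Xs) \<le> hi" for \<omega> lo hi
    using that
  proof (induction Xs arbitrary: \<omega> lo hi)
    case Nil
    then show ?case by simp
  next
    case (Cons X Xs)
    have 1: "(\<Sum>a = lo - 1..hi - 1. comp a (ins (PF X) \<omega>) p (ev Xs p)) = ins (PF X) \<omega> p (ev Xs p)"
      by (rule Cons.IH) (use Cons.prems in auto)
    have 2: "(\<Sum>a = lo..hi. comp a (ins (QF X) \<omega>) p (ev Xs p)) = ins (QF X) \<omega> p (ev Xs p)"
      by (rule Cons.IH) (use Cons.prems in auto)
    have 3: "(\<Sum>a = lo..hi. comp (a - 1) (ins (PF X) \<omega>) p (ev Xs p)) = (\<Sum>a = lo - 1..hi - 1. comp a (ins (PF X) \<omega>) p (ev Xs p))"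
      by (rule sum.reindex_bij_witness[of _ "\<lambda>a. a + 1" "\<lambda>a. a - 1"]) auto
    have "ins X \<omega> p (ev Xs p) = ins (PF X) \<omega> p (ev Xs p) + ins (QF X) \<omega> p (ev Xs p)"
      using ins_split[of X \<omega>] Cons.prems by (simp add: fapply)
    then show "(\<Sum>a = lo..hi. comp a \<omega> p (ev (X # Xs) p)) = \<omega> p (ev (X # Xs) p)"
      by (simp add: comp_Cons sum.distrib 1 2 3) (simp add: ins_apply)
  qed
  show "(\<Sum>a = lo..hi. comp a \<omega>) p (ev Xs p) = \<omega> p (ev Xs p)"
  proof (cases "length Xs \<le> N")
    case True
    then show ?thesis using *[OF w Xs le(1), of hi] le(2) by (simp add: sum_apply)
  next
    case False
    then show ?thesis using form_top[OF w, of "ev Xs p" p] form_top[OF comp_form[OF w], of "ev Xs p" _ p] by (simp add: sum_apply)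
  qed
qed

lemma comp_comp: "\<omega> \<in> \<Omega> \<Longrightarrow> comp a (comp b \<omega>) = (if a = b then comp a \<omega> else 0)"
proof (rule form_eqI)
  fix Xs p assume w: "\<omega> \<in> \<Omega>" and Xs: "set Xs \<subseteq> VF"
  have "comp a (comp b \<omega>) p (ev Xs p) = (if a = b then comp a \<omega> p (ev Xs p) else 0)"
    using w Xs
  proof (induction Xs arbitrary: \<omega> a b)
    case (Cons X Xs)
    have 1: "comp (a - 1) (comp (b - 1) (ins (PF X) \<omega>)) p (ev Xs p) = (if a - 1 = b - 1 then comp (a - 1) (ins (PF X) \<omega>) p (ev Xs p) else 0)"
      by (rule Cons.IH) (use Cons.prems in auto)
    have 2: "comp a (comp b (ins (QF X) \<omega>)) p (ev Xs p) = (if a = b then comp a (ins (QF X) \<omega>) p (ev Xs p) else 0)"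
      by (rule Cons.IH) (use Cons.prems in auto)
    show "comp a (comp b \<omega>) p (ev (X # Xs) p) = (if a = b then comp a \<omega> p (ev (X # Xs) p) else 0)"
      using Cons.prems 1 2 by (simp add: comp_Cons ins_PF_comp ins_QF_comp)
  qed simp
  then show "comp a (comp b \<omega>) p (ev Xs p) = (if a = b then comp a \<omega> else 0) p (ev Xs p)" by (simp add: fapply)
qed auto

lemma comp_deg_part: "comp a (deg_part k \<omega>) = deg_part k (comp a \<omega>)"
proof -
  have "Pcomp P vs a (\<lambda>ws. if int (length ws) = k then \<eta> ws else 0) = (if int (length vs) = k then Pcomp P vs a \<eta> else 0)" for P :: "'a tvec \<Rightarrow> 'a tvec" and vs a k \<eta>
  proof (induction vs arbitrary: a k \<eta>)
    case (Cons v vs)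
    have "(\<lambda>ws. if int (length (u # ws)) = k then \<eta> (u # ws) else 0) = (\<lambda>ws. if int (length ws) = k - 1 then \<eta> (u # ws) else 0)" for u
      by auto
    then show ?case using Cons.IH[of _ "k - 1"] by simp
  qed simp
  then show ?thesis by (auto simp: fun_eq_iff comp_def deg_part_apply[abs_def])
qed

lemma comp_deg_zero: "\<omega> \<in> \<Omega> \<Longrightarrow> \<not> (0 \<le> a \<and> 0 \<le> b \<and> a + b \<le> int N) \<Longrightarrow> comp a (deg_part (a + b) \<omega>) = 0"
proof (intro ext)
  fix p vs assume w: "\<omega> \<in> \<Omega>" and ab: "\<not> (0 \<le> a \<and> 0 \<le> b \<and> a + b \<le> int N)"
  show "comp a (deg_part (a + b) \<omega>) p vs = 0 p vs"
  proof (cases "int (length vs) = a + b")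
    case True
    then show ?thesis using ab comp_range[of a vs \<omega> p] form_top[OF comp_form[OF w, of a], of vs p]
      by (auto simp: comp_deg_part deg_part_apply fapply)
  next
    case False
    then show ?thesis by (simp add: comp_deg_part deg_part_apply fapply)
  qed
qed

text \<open>Moving \<open>Lie X\<close> past a contraction leaves a contraction with a bracket,
  which lowers the first degree by 0 or 1. Measured against the degree that contraction with
  \<open>PF Y\<close> or \<open>QF Y\<close> removes, this permits only the shifts -1, 0 and
  1.\<close>

lemma comp_Lie:
  assumes X: "X \<in> VF" and w: "\<omega> \<in> \<Omega>" and s: "s \<notin> {-1, 0, 1}"
  shows "comp (a + s) (Lie X (comp a \<omega>)) = 0"
proof (rule ins_coinduct[where P = "\<lambda>\<eta>. \<exists>a. \<exists>\<omega>\<in>\<Omega>. \<eta> = comp (a + s) (Lie X (comp a \<omega>))"])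
  fix \<eta> assume "\<exists>a. \<exists>\<omega>\<in>\<Omega>. \<eta> = comp (a + s) (Lie X (comp a \<omega>))"
  then obtain a \<omega> where w: "\<omega> \<in> \<Omega>" and \<eta>: "\<eta> = comp (a + s) (Lie X (comp a \<omega>))" by blast
  show "\<eta> \<in> \<Omega> \<and> (\<forall>p. \<eta> p [] = 0) \<and> (\<forall>Y\<in>VF. \<exists>\<eta>1 \<eta>2.
      (\<exists>a. \<exists>\<omega>\<in>\<Omega>. \<eta>1 = comp (a + s) (Lie X (comp a \<omega>))) \<and> (\<exists>a. \<exists>\<omega>\<in>\<Omega>. \<eta>2 = comp (a + s) (Lie X (comp a \<omega>))) \<and>
      ins Y \<eta> = \<eta>1 + \<eta>2)"
  proof (intro conjI allI ballI)
    show "\<eta> \<in> \<Omega>" using \<eta> w X by simp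
    show "\<eta> p [] = 0" for p using \<eta> w X s T_const[OF VF_T[OF X]] by auto
    fix Y assume Y: "Y \<in> VF"
    have 0: "comp c (ins Z (comp a \<omega>)) = 0" if "Z \<in> VF" "c \<noteq> a - 1" "c \<noteq> a" for Z c
      using that w by (simp add: ins_comp comp_comp)
    have "ins Y \<eta> = comp (a + s - 1) (ins (PF Y) (Lie X (comp a \<omega>))) + comp (a + s) (ins (QF Y) (Lie X (comp a \<omega>)))"
      unfolding \<eta> by (rule ins_comp)
    also have "comp (a + s - 1) (ins (PF Y) (Lie X (comp a \<omega>))) = comp ((a - 1) + s) (Lie X (comp (a - 1) (ins (PF Y) \<omega>)))"
      using X Y w s 0[of "lie X (PF Y)" "a + s - 1"] by (simp add: ins_Lie ins_PF_comp algebra_simps)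
    also have "comp (a + s) (ins (QF Y) (Lie X (comp a \<omega>))) = comp (a + s) (Lie X (comp a (ins (QF Y) \<omega>)))"
      using X Y w s 0[of "lie X (QF Y)" "a + s"] by (simp add: ins_Lie ins_QF_comp)
    finally show "\<exists>\<eta>1 \<eta>2. (\<exists>a. \<exists>\<omega>\<in>\<Omega>. \<eta>1 = comp (a + s) (Lie X (comp a \<omega>))) \<and> (\<exists>a. \<exists>\<omega>\<in>\<Omega>. \<eta>2 = comp (a + s) (Lie X (comp a \<omega>))) \<and>
      ins Y \<eta> = \<eta>1 + \<eta>2"
      using Y w forms_ins[OF PF_VF[OF Y] w] forms_ins[OF QF_VF[OF Y] w] by blast
  qed
qed (use w in blast)

text \<open>The source of the four bidegrees of d. By \<iota>_Y d = L_Y - d \<iota>_Y the shifts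
  come from \<open>comp_Lie\<close>: 0, 1, 2 for \<open>PF Y\<close>, because that contraction
  itself lowers the degree, and -1, 0, 1 for \<open>QF Y\<close>.\<close>

lemma comp_dd:
  assumes w: "\<omega> \<in> \<Omega>" and s: "s \<notin> {-1, 0, 1, 2}"
  shows "comp (a + s) (dd (comp a \<omega>)) = 0"
proof (rule ins_coinduct[where P = "\<lambda>\<eta>. \<exists>a. \<exists>\<omega>\<in>\<Omega>. \<eta> = comp (a + s) (dd (comp a \<omega>))"])
  fix \<eta> assume "\<exists>a. \<exists>\<omega>\<in>\<Omega>. \<eta> = comp (a + s) (dd (comp a \<omega>))"
  then obtain a \<omega> where w: "\<omega> \<in> \<Omega>" and \<eta>: "\<eta> = comp (a + s) (dd (comp a \<omega>))" by blast
  show "\<eta> \<in> \<Omega> \<and> (\<forall>p. \<eta> p [] = 0) \<and> (\<forall>Y\<in>VF. \<exists>\<eta>1 \<eta>2.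
      (\<exists>a. \<exists>\<omega>\<in>\<Omega>. \<eta>1 = comp (a + s) (dd (comp a \<omega>))) \<and> (\<exists>a. \<exists>\<omega>\<in>\<Omega>. \<eta>2 = comp (a + s) (dd (comp a \<omega>))) \<and>
      ins Y \<eta> = \<eta>1 + \<eta>2)"
  proof (intro conjI allI ballI)
    show "\<eta> \<in> \<Omega>" using \<eta> w by simp
    show "\<eta> p [] = 0" for p using \<eta> w by simp
    fix Y assume Y: "Y \<in> VF"
    have P: "comp (a + (s - 1)) (Lie (PF Y) (comp a \<omega>)) = 0" by (rule comp_Lie) (use Y w s in auto)
    have Q: "comp (a + s) (Lie (QF Y) (comp a \<omega>)) = 0" by (rule comp_Lie) (use Y w s in auto)
    have "ins Y \<eta> = comp (a + s - 1) (ins (PF Y) (dd (comp a \<omega>))) + comp (a + s) (ins (QF Y) (dd (comp a \<omega>)))"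
      unfolding \<eta> by (rule ins_comp)
    also have "comp (a + s - 1) (ins (PF Y) (dd (comp a \<omega>))) = comp ((a - 1) + s) (dd (comp (a - 1) (- ins (PF Y) \<omega>)))"
      using Y w P by (simp add: ins_dd ins_PF_comp algebra_simps)
    also have "comp (a + s) (ins (QF Y) (dd (comp a \<omega>))) = comp (a + s) (dd (comp a (- ins (QF Y) \<omega>)))"
      using Y w Q by (simp add: ins_dd ins_QF_comp)
    finally show "\<exists>\<eta>1 \<eta>2. (\<exists>a. \<exists>\<omega>\<in>\<Omega>. \<eta>1 = comp (a + s) (dd (comp a \<omega>))) \<and> (\<exists>a. \<exists>\<omega>\<in>\<Omega>. \<eta>2 = comp (a + s) (dd (comp a \<omega>))) \<and>
      ins Y \<eta> = \<eta>1 + \<eta>2"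
      using Y w forms_uminus[OF forms_ins[OF PF_VF[OF Y] w]] forms_uminus[OF forms_ins[OF QF_VF[OF Y] w]] by blast
  qed
qed (use w in blast)

section \<open>The reflection and the pullback along it\<close>

definition Rm :: "'a \<Rightarrow> 'a tvec \<Rightarrow> 'a tvec" where "Rm p v = v - 2 *\<^sub>R Pm p v"

definition eps :: "'a form \<Rightarrow> 'a form"
  where "eps \<omega> = (\<lambda>p vs. \<omega> p (map (Rm p) vs))"

lemma RF_Rm: "RF X p = Rm p (X p)" by (simp add: RF_def Rm_def)

lemma eps_ev: "eps \<omega> p (ev Xs p) = \<omega> p (ev (map RF Xs) p)"
  by (simp add: eps_def ev_def RF_Rm o_def)

lemma Rm_T_iff: "Rm p v \<in> T p \<longleftrightarrow> v \<in> T p"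
proof (cases "v \<in> T p")
  case False
  have "Rm p v = - v" using False by (simp add: Rm_def Pm_out scaleR_2)
  then show ?thesis using T_neg[of "- v" p] False by auto
qed (simp add: Rm_def)

lemma eps_form [simp]: "\<omega> \<in> \<Omega> \<Longrightarrow> eps \<omega> \<in> \<Omega>"
proof (rule formI)
  assume w: "\<omega> \<in> \<Omega>"
  fix p :: 'a and vs us ws :: "'a tvec list" and v w' s t
  show "eps \<omega> p vs = 0" if "\<not> set vs \<subseteq> T p"
  proof -
    have "\<not> set (map (Rm p) vs) \<subseteq> T p" using that Rm_T_iff by auto
    then show ?thesis unfolding eps_def by (rule form_outside[OF w])
  qed
  show "eps \<omega> p ((s *\<^sub>R v + t *\<^sub>R w') # ws) = s * eps \<omega> p (v # ws) + t * eps \<omega> p (w' # ws)" if vw: "v \<in> T p" "w' \<in> T p"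
  proof -
    have "Rm p (s *\<^sub>R v + t *\<^sub>R w') = s *\<^sub>R Rm p v + t *\<^sub>R Rm p w'" using vw by (simp add: Rm_def Pm_lin algebra_simps)
    then show ?thesis using vw by (simp add: eps_def form_head[OF w] Rm_T_iff)
  qed
  show "eps \<omega> p (us @ v # w' # ws) = - eps \<omega> p (us @ w' # v # ws)"
    unfolding eps_def map_append list.map by (rule form_swap[OF w])
  show "(\<lambda>p. eps \<omega> p (ev Xs p)) \<in> C" if "set Xs \<subseteq> VF" for Xs
    unfolding eps_ev using that by (intro form_C[OF w]) auto
qed

lemma eps_add [simp]: "eps (\<omega> + \<eta>) = eps \<omega> + eps \<eta>"
  and eps_0 [simp]: "eps 0 = 0"
  and eps_fun_op [simp]: "eps (fun_op f \<omega>) = fun_op f (eps \<omega>)"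
  and eps_scaleR [simp]: "eps (c *\<^sub>R \<omega>) = c *\<^sub>R eps \<omega>"
  and eps_uminus [simp]: "eps (- \<omega>) = - eps \<omega>"
  and eps_diff [simp]: "eps (\<omega> - \<eta>) = eps \<omega> - eps \<eta>"
  by (auto simp: fun_eq_iff eps_def fapply fun_op_apply)

lemma ins_eps: "ins X (eps \<omega>) = eps (ins (RF X) \<omega>)"
  by (simp add: fun_eq_iff ins_def eps_def RF_Rm)

lemma RF_RF [simp]: "X \<in> VF \<Longrightarrow> RF (RF X) = X"
proof
  fix p assume X: "X \<in> VF"
  have "Pm p (1 *\<^sub>R X p + (-2) *\<^sub>R Pm p (X p)) = 1 *\<^sub>R Pm p (X p) + (-2) *\<^sub>R Pm p (Pm p (X p))"
    using X by (intro Pm_lin) auto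
  then have "Pm p (X p - 2 *\<^sub>R Pm p (X p)) = - Pm p (X p)" by (simp add: fun_eq_iff fapply)
  then show "RF (RF X) p = X p" by (simp only: RF_def) (simp add: fun_eq_iff fapply)
qed

lemma eps_eps [simp]: "\<omega> \<in> \<Omega> \<Longrightarrow> eps (eps \<omega>) = \<omega>"
proof (rule form_eqI)
  fix Xs p assume w: "\<omega> \<in> \<Omega>" and Xs: "set Xs \<subseteq> VF"
  have "map (\<lambda>X. RF (RF X)) Xs = Xs" by (rule map_idI) (use Xs in auto)
  then have "map RF (map RF Xs) = Xs" by (simp only: map_map o_def)
  then show "eps (eps \<omega>) p (ev Xs p) = \<omega> p (ev Xs p)" by (simp only: eps_ev)
qed auto

lemma eps_comp: "\<omega> \<in> \<Omega> \<Longrightarrow> eps (comp a \<omega>) = (if even a then 1 else -1) *\<^sub>R comp a \<omega>"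
proof (rule form_eqI)
  fix Xs p assume w: "\<omega> \<in> \<Omega>" and Xs: "set Xs \<subseteq> VF"
  have "eps (comp a \<omega>) p (ev Xs p) = (if even a then 1 else -1) * comp a \<omega> p (ev Xs p)"
    using w Xs
  proof (induction Xs arbitrary: \<omega> a)
    case Nil
    then show ?case by (simp add: eps_def)
  next
    case (Cons X Xs)
    have 1: "eps (comp (a - 1) (ins (PF X) \<omega>)) p (ev Xs p) = (if even (a - 1) then 1 else -1) * comp (a - 1) (ins (PF X) \<omega>) p (ev Xs p)"
      by (rule Cons.IH) (use Cons.prems in auto)
    have 2: "eps (comp a (ins (QF X) \<omega>)) p (ev Xs p) = (if even a then 1 else -1) * comp a (ins (QF X) \<omega>) p (ev Xs p)"
      by (rule Cons.IH) (use Cons.prems in auto)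
    have "eps (comp a \<omega>) p (ev (X # Xs) p) = ins X (eps (comp a \<omega>)) p (ev Xs p)" by (simp add: ins_apply)
    also have "ins X (eps (comp a \<omega>)) = eps (comp a (ins (QF X) \<omega>)) - eps (comp (a - 1) (ins (PF X) \<omega>))"
      using Cons.prems by (simp add: ins_eps ins_RF ins_PF_comp ins_QF_comp)
    finally show "eps (comp a \<omega>) p (ev (X # Xs) p) = (if even a then 1 else -1) * comp a \<omega> p (ev (X # Xs) p)"
      by (cases "even a") (simp_all add: fapply 1 2 comp_Cons algebra_simps)
  qed
  then show "eps (comp a \<omega>) p (ev Xs p) = ((if even a then 1 else -1) *\<^sub>R comp a \<omega>) p (ev Xs p)" by (simp add: fapply)
qed auto

end

section \<open>Components of wedge products of covectors\<close>

lemma wedge_list_Nil: "wedge_list [] vs = (if vs = [] then 1 else 0)"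
  and wedge_list_Cons: "wedge_list (\<alpha> # \<alpha>s) = wedge_left \<alpha> (wedge_list \<alpha>s)"
  by (simp_all add: wedge_list_def)

lemma wedge_left_support:
  "(\<And>ws. int (length ws) \<noteq> k \<Longrightarrow> \<eta> ws = 0) \<Longrightarrow> int (length vs) \<noteq> k + 1 \<Longrightarrow> wedge_left \<alpha> \<eta> vs = 0"
proof (induction vs arbitrary: k \<eta>)
  case (Cons v vs)
  have "wedge_left \<alpha> (\<lambda>ws. \<eta> (v # ws)) vs = 0"
  proof (rule Cons.IH)
    show "\<eta> (v # ws) = 0" if "int (length ws) \<noteq> k - 1" for ws
      using Cons.prems(1)[of "v # ws"] that by simp
  qed (use Cons.prems in simp)
  then show ?case using Cons.prems by (simp add: wedge_left_Cons)
qed simp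

lemma wedge_list_support: "length vs \<noteq> length \<alpha>s \<Longrightarrow> wedge_list \<alpha>s vs = 0"
proof (induction \<alpha>s arbitrary: vs)
  case Nil
  then show ?case by (simp add: wedge_list_Nil)
next
  case (Cons \<alpha> \<alpha>s)
  show ?case unfolding wedge_list_Cons
    by (rule wedge_left_support[where k = "int (length \<alpha>s)"]) (use Cons in auto)
qed

lemma wedge_left_zero: "wedge_left \<alpha> (\<lambda>ws. 0) vs = 0"
  using wedge_left_lin[of \<alpha> 0 "\<lambda>_. 0" 0 "\<lambda>_. 0" vs] by simp

text \<open>The covector vanishes on the complementary part of every vector, so in each surviving
  term the argument it receives has been projected by \<open>P\<close>. This uses up one unit of
  \<open>a\<close>.\<close>

lemma Pcomp_wedge_left_P:
  assumes "\<And>v. \<alpha> (P v) = \<alpha> v" "\<And>v. \<alpha> (v - P v) = 0"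
  shows "Pcomp P vs a (wedge_left \<alpha> \<eta>) = wedge_left \<alpha> (\<lambda>ws. Pcomp P ws (a - 1) \<eta>) vs"
proof (induction vs arbitrary: a \<eta>)
  case (Cons v vs)
  have 1: "(\<lambda>ws. wedge_left \<alpha> \<eta> (P v # ws)) = (\<lambda>ws. \<alpha> v * \<eta> ws + (-1) * wedge_left \<alpha> (\<lambda>u. \<eta> (P v # u)) ws)"
    by (simp add: wedge_left_Cons assms)
  have 2: "(\<lambda>ws. wedge_left \<alpha> \<eta> ((v - P v) # ws)) = (\<lambda>ws. 0 * \<eta> ws + (-1) * wedge_left \<alpha> (\<lambda>u. \<eta> ((v - P v) # u)) ws)"
    by (simp add: wedge_left_Cons assms)
  have 3: "(\<lambda>ws. Pcomp P (v # ws) (a - 1) \<eta>) = (\<lambda>ws. 1 * Pcomp P ws (a - 1 - 1) (\<lambda>u. \<eta> (P v # u)) + 1 * Pcomp P ws (a - 1) (\<lambda>u. \<eta> ((v - P v) # u)))"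
    by simp
  have IH: "Pcomp P vs b (\<lambda>ws. wedge_left \<alpha> \<eta> ws) = wedge_left \<alpha> (\<lambda>ws. Pcomp P ws (b - 1) \<eta>) vs" for b \<eta>
    using Cons.IH by simp
  show ?case
    unfolding Pcomp.simps(2)[of P v vs] 1 2 wedge_left_Cons[of _ _ v] 3 unfolding Pcomp_lin IH wedge_left_lin by simp
qed simp

lemma Pcomp_wedge_left_Q:
  assumes "\<And>v. \<alpha> (P v) = 0" "\<And>v. \<alpha> (v - P v) = \<alpha> v"
  shows "Pcomp P vs a (wedge_left \<alpha> \<eta>) = wedge_left \<alpha> (\<lambda>ws. Pcomp P ws a \<eta>) vs"
proof (induction vs arbitrary: a \<eta>)
  case (Cons v vs)
  have 1: "(\<lambda>ws. wedge_left \<alpha> \<eta> (P v # ws)) = (\<lambda>ws. 0 * \<eta> ws + (-1) * wedge_left \<alpha> (\<lambda>u. \<eta> (P v # u)) ws)"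
    by (simp add: wedge_left_Cons assms)
  have 2: "(\<lambda>ws. wedge_left \<alpha> \<eta> ((v - P v) # ws)) = (\<lambda>ws. \<alpha> v * \<eta> ws + (-1) * wedge_left \<alpha> (\<lambda>u. \<eta> ((v - P v) # u)) ws)"
    by (simp add: wedge_left_Cons assms)
  have 3: "(\<lambda>ws. Pcomp P (v # ws) a \<eta>) = (\<lambda>ws. 1 * Pcomp P ws (a - 1) (\<lambda>u. \<eta> (P v # u)) + 1 * Pcomp P ws a (\<lambda>u. \<eta> ((v - P v) # u)))"
    by simp
  have IH: "Pcomp P vs b (\<lambda>ws. wedge_left \<alpha> \<eta> ws) = wedge_left \<alpha> (\<lambda>ws. Pcomp P ws b \<eta>) vs" for b \<eta>
    using Cons.IH by simp
  show ?case
    unfolding Pcomp.simps(2)[of P v vs] 1 2 wedge_left_Cons[of _ _ v] 3 unfolding Pcomp_lin IH wedge_left_lin by simp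
qed simp

lemma Pcomp_wedge_list:
  assumes "\<And>\<alpha> v. \<alpha> \<in> set \<alpha>s \<Longrightarrow> \<alpha> (P v) = \<alpha> v \<and> \<alpha> (v - P v) = 0"
    and "\<And>\<beta> v. \<beta> \<in> set \<beta>s \<Longrightarrow> \<beta> (P v) = 0 \<and> \<beta> (v - P v) = \<beta> v"
  shows "Pcomp P vs c (wedge_list (\<alpha>s @ \<beta>s)) = (if c = int (length \<alpha>s) then wedge_list (\<alpha>s @ \<beta>s) vs else 0)"
  using assms(1)
proof (induction \<alpha>s arbitrary: c vs)
  case Nil
  have "Pcomp P vs c (wedge_list \<beta>s) = (if c = 0 then wedge_list \<beta>s vs else 0)"
    using assms(2)
  proof (induction \<beta>s arbitrary: c vs)
    case Nil
    show ?case
    proof (cases vs)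
      case (Cons v ws)
      then show ?thesis by (simp add: wedge_list_Nil Pcomp_zero)
    qed (simp add: wedge_list_Nil)
  next
    case (Cons \<beta> \<beta>s)
    have "Pcomp P vs c (wedge_list (\<beta> # \<beta>s)) = wedge_left \<beta> (\<lambda>ws. Pcomp P ws c (wedge_list \<beta>s)) vs"
      unfolding wedge_list_Cons by (rule Pcomp_wedge_left_Q) (use Cons.prems in auto)
    also have "\<dots> = wedge_left \<beta> (\<lambda>ws. if c = 0 then wedge_list \<beta>s ws else 0) vs"
      using Cons by simp
    finally show ?case by (cases "c = 0") (simp_all add: wedge_left_zero wedge_list_Cons)
  qed
  then show ?case by simp
next
  case (Cons \<alpha> \<alpha>s)
  have "Pcomp P vs c (wedge_list (\<alpha> # \<alpha>s @ \<beta>s)) = wedge_left \<alpha> (\<lambda>ws. Pcomp P ws (c - 1) (wedge_list (\<alpha>s @ \<beta>s))) vs"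
    unfolding wedge_list_Cons by (rule Pcomp_wedge_left_P) (use Cons.prems in auto)
  also have "\<dots> = wedge_left \<alpha> (\<lambda>ws. if c - 1 = int (length \<alpha>s) then wedge_list (\<alpha>s @ \<beta>s) ws else 0) vs"
    using Cons by simp
  finally show ?case by (cases "c - 1 = int (length \<alpha>s)") (auto simp add: wedge_left_zero wedge_list_Cons)
qed

lemma linear_wedge_left: "linear (wedge_left \<alpha>)"
proof (rule linearI)
  show "wedge_left \<alpha> (\<eta> + \<eta>') = wedge_left \<alpha> \<eta> + wedge_left \<alpha> \<eta>'" for \<eta> \<eta>'
    using wedge_left_lin[of \<alpha> 1 \<eta> 1 \<eta>'] by (simp add: fun_eq_iff fapply plus_fun_def)
  show "wedge_left \<alpha> (c *\<^sub>R \<eta>) = c *\<^sub>R wedge_left \<alpha> \<eta>" for c \<eta>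
    using wedge_left_lin[of \<alpha> c \<eta> 0 \<eta>] by (simp add: fun_eq_iff fapply scaleR_fun_def)
qed

text \<open>The derivation that extends \<open>pj\<close> to multilinear functions. For
  \<open>pj = Pm p\<close> it is the number operator of the first degree.\<close>

primrec slot_sum :: "('v \<Rightarrow> 'v) \<Rightarrow> 'v list \<Rightarrow> ('v list \<Rightarrow> real) \<Rightarrow> real"
  where
    "slot_sum pj [] \<eta> = 0"
  | "slot_sum pj (v # vs) \<eta> = \<eta> (pj v # vs) + slot_sum pj vs (\<lambda>ws. \<eta> (v # ws))"

lemma slot_sum_add: "slot_sum pj vs (\<lambda>ws. \<eta> ws + \<eta>' ws) = slot_sum pj vs \<eta> + slot_sum pj vs \<eta>'"
  by (induction vs arbitrary: \<eta> \<eta>') auto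

context gap
begin

definition WL :: "'a \<Rightarrow> int \<Rightarrow> int \<Rightarrow> ('a tvec list \<Rightarrow> real) set"
  where "WL p a b = {wedge_list (\<alpha>s @ \<beta>s) | \<alpha>s \<beta>s.
    int (length \<alpha>s) = a \<and> (\<forall>\<alpha>\<in>set \<alpha>s. \<alpha> \<in> T' p \<and> (0, \<alpha>) \<in> E p) \<and>
    int (length \<beta>s) = b \<and> (\<forall>\<beta>\<in>set \<beta>s. \<beta> \<in> T' p \<and> (0, \<beta>) \<in> Eo p)}"

lemma bigraded_iff: "\<omega> \<in> bigraded_forms A E a b \<longleftrightarrow> \<omega> \<in> \<Omega> \<and> (\<forall>p. \<omega> p \<in> span (WL p a b))"
  by (simp add: bigraded_forms_def WL_def)

lemma kernel_covector:
  assumes "(0, \<alpha>) \<in> E p"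
  shows "\<alpha> (Pm p v) = \<alpha> v \<and> \<alpha> (v - Pm p v) = 0"
proof -
  have a: "\<alpha> \<in> T' p" using E_T'[OF assms] by simp
  show ?thesis
    using kernel_Pm[OF assms, of v] T'_diff[OF a, of v "Pm p v"] T'_0[OF a] by (cases "v \<in> T p") (auto simp: Pm_out)
qed

lemma annihilator_covector:
  assumes "(0, \<beta>) \<in> Eo p"
  shows "\<beta> (Pm p v) = 0 \<and> \<beta> (v - Pm p v) = \<beta> v"
proof -
  have b: "\<beta> \<in> T' p" using assms unfolding orth_covector by simp
  show ?thesis
    using orth_Pm[OF assms, of v] T'_diff[OF b, of v "Pm p v"] T'_0[OF b] T'_outside[OF b, of v]
    by (cases "v \<in> T p") (auto simp: Pm_out)
qed

lemma bigraded_pointwise: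
  assumes "\<eta> \<in> span (WL p a b)"
  shows "Pcomp (Pm p) vs a \<eta> = \<eta> vs" "int (length vs) \<noteq> a + b \<Longrightarrow> \<eta> vs = 0"
proof -
  let ?S = "{\<eta>. (\<forall>vs. Pcomp (Pm p) vs a \<eta> = \<eta> vs) \<and> (\<forall>vs. int (length vs) \<noteq> a + b \<longrightarrow> \<eta> vs = 0)}"
  have "subspace ?S"
    unfolding subspace_def
    by (auto simp: fapply plus_fun_def scaleR_fun_def zero_fun_def Pcomp_add Pcomp_scale Pcomp_zero)
  moreover have "WL p a b \<subseteq> ?S"
  proof
    fix \<eta> assume "\<eta> \<in> WL p a b"
    then obtain \<alpha>s \<beta>s where e: "\<eta> = wedge_list (\<alpha>s @ \<beta>s)" "int (length \<alpha>s) = a" "int (length \<beta>s) = b"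
      and a: "\<forall>\<alpha>\<in>set \<alpha>s. \<alpha> \<in> T' p \<and> (0, \<alpha>) \<in> E p" and b: "\<forall>\<beta>\<in>set \<beta>s. \<beta> \<in> T' p \<and> (0, \<beta>) \<in> Eo p"
      unfolding WL_def by blast
    have "Pcomp (Pm p) vs a \<eta> = \<eta> vs" for vs
    proof -
      have "Pcomp (Pm p) vs a (wedge_list (\<alpha>s @ \<beta>s)) = (if a = int (length \<alpha>s) then wedge_list (\<alpha>s @ \<beta>s) vs else 0)"
      proof (rule Pcomp_wedge_list)
        show "\<alpha> (Pm p v) = \<alpha> v \<and> \<alpha> (v - Pm p v) = 0" if "\<alpha> \<in> set \<alpha>s" for \<alpha> v
          by (rule kernel_covector) (use a that in blast)
        show "\<beta> (Pm p v) = 0 \<and> \<beta> (v - Pm p v) = \<beta> v" if "\<beta> \<in> set \<beta>s" for \<beta> v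
          by (rule annihilator_covector) (use b that in blast)
      qed
      then show ?thesis using e by simp
    qed
    moreover have "\<eta> vs = 0" if "int (length vs) \<noteq> a + b" for vs
      using e that by (intro wedge_list_support[of vs "\<alpha>s @ \<beta>s", folded e(1)]) auto
    ultimately show "\<eta> \<in> ?S" by blast
  qed
  ultimately have "span (WL p a b) \<subseteq> ?S" by (rule span_minimal[rotated])
  then show "Pcomp (Pm p) vs a \<eta> = \<eta> vs" "int (length vs) \<noteq> a + b \<Longrightarrow> \<eta> vs = 0" using assms by blast+
qed

lemma bigraded_comp: "\<omega> \<in> bigraded_forms A E a b \<Longrightarrow> comp a \<omega> = \<omega>"
  unfolding bigraded_iff comp_def using bigraded_pointwise(1) by (intro ext) blast

lemma bigraded_deg:
  assumes "\<omega> \<in> bigraded_forms A E a b"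
  shows "deg_part k \<omega> = (if k = a + b then \<omega> else 0)"
proof (intro ext)
  fix p vs
  have "\<omega> p \<in> span (WL p a b)" using assms unfolding bigraded_iff by blast
  from bigraded_pointwise(2)[OF this, of vs]
  show "deg_part k \<omega> p vs = (if k = a + b then \<omega> else 0) p vs" by (auto simp: deg_part_apply fapply)
qed

lemma bigraded_component:
  "\<omega> \<in> bigraded_forms A E i j \<Longrightarrow> comp a (deg_part (a + b) \<omega>) = (if a = i \<and> b = j then \<omega> else 0)"
proof -
  assume w: "\<omega> \<in> bigraded_forms A E i j"
  have wf: "\<omega> \<in> \<Omega>" using w unfolding bigraded_iff by blast
  have "comp a \<omega> = (if a = i then \<omega> else 0)"
  proof (cases "a = i")
    case False
    have "comp a (comp i \<omega>) = 0" using comp_comp[OF wf, of a i] False by simp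
    then show ?thesis using False unfolding bigraded_comp[OF w] by simp
  qed (simp add: bigraded_comp[OF w])
  then show ?thesis using bigraded_comp[OF w] by (auto simp: bigraded_deg[OF w])
qed

lemma bigraded_zero: "0 \<in> bigraded_forms A E a b"
  unfolding bigraded_iff by (simp add: fapply span_zero)

subsection \<open>Euler's formula for the bidegree\<close>

text \<open>Contracting with a frame vector and wedging with its dual covector, summed over the
  frame, is a derivation; peeling off the first argument shows that it is
  \<open>slot_sum\<close>.\<close>

lemma euler_sum:
  assumes T: "\<And>v. v \<in> T p \<Longrightarrow> pj v \<in> T p"
    and lin: "\<And>c (I :: 'e set) v. (\<And>i. i \<in> I \<Longrightarrow> v i \<in> T p) \<Longrightarrow> pj (\<Sum>i\<in>I. c i *\<^sub>R v i) = (\<Sum>i\<in>I. c i *\<^sub>R pj (v i))"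
    and idem: "\<And>v. v \<in> T p \<Longrightarrow> pj (pj v) = pj v"
    and E: "\<And>b. E' b \<in> T p" "\<And>v. v \<in> T p \<Longrightarrow> v = (\<Sum>b\<in>\<B>. v (\<xi> b) *\<^sub>R E' b)"
    and w: "\<omega> \<in> \<Omega>" and Xs: "set Xs \<subseteq> VF"
  shows "(\<Sum>b\<in>\<B>. wedge_left (\<lambda>v. dfun (\<xi> b) p (pj v)) (\<lambda>ws. \<omega> p (pj (E' b) # ws)) (ev Xs p)) = slot_sum pj (ev Xs p) (\<omega> p)"
  using w Xs
proof (induction Xs arbitrary: \<omega>)
  case (Cons X Xs)
  have X: "X p \<in> T p" using Cons.prems by simp
  \<comment> \<open>Idempotence supplies a \<open>pj\<close> to the coefficients and another to the
    frame vectors, as the left side of the claim requires.\<close>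
  have "pj (X p) = pj (\<Sum>b\<in>\<B>. pj (X p) (\<xi> b) *\<^sub>R E' b)" using E(2)[OF T[OF X]] idem[OF X] by simp
  also have "\<dots> = (\<Sum>b\<in>\<B>. pj (X p) (\<xi> b) *\<^sub>R pj (E' b))" by (rule lin) (rule E(1))
  finally have "\<omega> p (pj (X p) # ev Xs p) = \<omega> p ([] @ (\<Sum>b\<in>\<B>. pj (X p) (\<xi> b) *\<^sub>R pj (E' b)) # ev Xs p)" by simp
  also have "\<dots> = (\<Sum>b\<in>\<B>. pj (X p) (\<xi> b) * \<omega> p ([] @ pj (E' b) # ev Xs p))"
    by (rule form_slot_sum[OF Cons.prems(1) finite_\<B>]) (rule T[OF E(1)])
  finally have 1: "\<omega> p (pj (X p) # ev Xs p) = (\<Sum>b\<in>\<B>. dfun (\<xi> b) p (pj (X p)) * \<omega> p (pj (E' b) # ev Xs p))"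
    by (simp add: dfun_T T[OF X])
  have IH: "(\<Sum>b\<in>\<B>. wedge_left (\<lambda>v. dfun (\<xi> b) p (pj v)) (\<lambda>ws. ins X \<omega> p (pj (E' b) # ws)) (ev Xs p)) = slot_sum pj (ev Xs p) (ins X \<omega> p)"
    by (rule Cons.IH) (use Cons.prems in auto)
  have 2: "(\<lambda>ws. \<omega> p (u # X p # ws)) = (\<lambda>ws. (-1) * ins X \<omega> p (u # ws))" for u
  proof
    show "\<omega> p (u # X p # ws) = (-1) * ins X \<omega> p (u # ws)" for ws
      using form_swap_head[OF Cons.prems(1), of p u "X p" ws] by (simp add: ins_apply)
  qed
  have "(\<Sum>b\<in>\<B>. wedge_left (\<lambda>v. dfun (\<xi> b) p (pj v)) (\<lambda>ws. \<omega> p (pj (E' b) # ws)) (X p # ev Xs p)) =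
    \<omega> p (pj (X p) # ev Xs p) + slot_sum pj (ev Xs p) (ins X \<omega> p)"
    unfolding 1 IH[symmetric] wedge_left_Cons 2 wedge_left_scale by (simp add: sum.distrib)
  then show "(\<Sum>b\<in>\<B>. wedge_left (\<lambda>v. dfun (\<xi> b) p (pj v)) (\<lambda>ws. \<omega> p (pj (E' b) # ws)) (ev (X # Xs) p)) = slot_sum pj (ev (X # Xs) p) (\<omega> p)"
    by (simp add: ins_def)
qed simp

text \<open>The first slot contributes exactly the part of \<open>comp a\<close> carried by
  \<open>PF X\<close>, which raises its factor from a - 1 to a; the part carried by
  \<open>QF X\<close> already has the factor a.\<close>

lemma slot_sum_comp: "\<omega> \<in> \<Omega> \<Longrightarrow> set Xs \<subseteq> VF \<Longrightarrow> slot_sum (Pm p) (ev Xs p) (comp a \<omega> p) = real_of_int a * comp a \<omega> p (ev Xs p)"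
proof (induction Xs arbitrary: \<omega> a)
  case (Cons X Xs)
  have X: "X \<in> VF" using Cons.prems by simp
  have 1: "slot_sum (Pm p) (ev Xs p) (comp (a - 1) (ins (PF X) \<omega>) p) = real_of_int (a - 1) * comp (a - 1) (ins (PF X) \<omega>) p (ev Xs p)"
    by (rule Cons.IH) (use Cons.prems in auto)
  have 2: "slot_sum (Pm p) (ev Xs p) (comp a (ins (QF X) \<omega>) p) = real_of_int a * comp a (ins (QF X) \<omega>) p (ev Xs p)"
    by (rule Cons.IH) (use Cons.prems in auto)
  have 3: "(\<lambda>ws. comp a \<omega> p (X p # ws)) = (\<lambda>ws. comp (a - 1) (ins (PF X) \<omega>) p ws + comp a (ins (QF X) \<omega>) p ws)"
    using ins_comp[of X a \<omega>] by (simp add: fun_eq_iff ins_apply fapply)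
  have 4: "comp a \<omega> p (Pm p (X p) # ev Xs p) = comp (a - 1) (ins (PF X) \<omega>) p (ev Xs p)"
    using ins_PF_comp[OF X Cons.prems(1), of a] by (simp add: fun_eq_iff ins_apply PF_def)
  show "slot_sum (Pm p) (ev (X # Xs) p) (comp a \<omega> p) = real_of_int a * comp a \<omega> p (ev (X # Xs) p)"
    unfolding ev_simps slot_sum.simps 3 4 slot_sum_add 1 2 by (simp add: comp_Cons algebra_simps)
qed simp

lemma slot_sum_complement: "\<omega> \<in> \<Omega> \<Longrightarrow> set Xs \<subseteq> VF \<Longrightarrow>
  slot_sum (\<lambda>v. v - Pm p v) (ev Xs p) (\<omega> p) = real (length Xs) * \<omega> p (ev Xs p) - slot_sum (Pm p) (ev Xs p) (\<omega> p)"
proof (induction Xs arbitrary: \<omega>)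
  case (Cons X Xs)
  have "slot_sum (\<lambda>v. v - Pm p v) (ev Xs p) (ins X \<omega> p) = real (length Xs) * ins X \<omega> p (ev Xs p) - slot_sum (Pm p) (ev Xs p) (ins X \<omega> p)"
    by (rule Cons.IH) (use Cons.prems in auto)
  then show "slot_sum (\<lambda>v. v - Pm p v) (ev (X # Xs) p) (\<omega> p) = real (length (X # Xs)) * \<omega> p (ev (X # Xs) p) - slot_sum (Pm p) (ev (X # Xs) p) (\<omega> p)"
    using Cons.prems by (simp add: ins_def form_diff algebra_simps)
qed simp

lemma wedge_left_WL_P:
  assumes "(0, \<alpha>) \<in> E p" "\<eta> \<in> span (WL p a b)"
  shows "wedge_left \<alpha> \<eta> \<in> span (WL p (a + 1) b)"
proof -
  have "wedge_left \<alpha> ` WL p a b \<subseteq> WL p (a + 1) b"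
  proof
    fix \<theta> assume "\<theta> \<in> wedge_left \<alpha> ` WL p a b"
    then obtain \<alpha>s \<beta>s where e: "\<theta> = wedge_left \<alpha> (wedge_list (\<alpha>s @ \<beta>s))" "int (length \<alpha>s) = a" "int (length \<beta>s) = b"
      and a: "\<forall>\<alpha>\<in>set \<alpha>s. \<alpha> \<in> T' p \<and> (0, \<alpha>) \<in> E p" and b: "\<forall>\<beta>\<in>set \<beta>s. \<beta> \<in> T' p \<and> (0, \<beta>) \<in> Eo p"
      unfolding WL_def by blast
    show "\<theta> \<in> WL p (a + 1) b"
      unfolding WL_def using e a b assms(1) E_T'[OF assms(1)]
      by (intro CollectI exI[of _ "\<alpha> # \<alpha>s"] exI[of _ \<beta>s]) (auto simp: wedge_list_Cons)
  qed
  then have "span (wedge_left \<alpha> ` WL p a b) \<subseteq> span (WL p (a + 1) b)" by (rule span_mono)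
  then show ?thesis using assms(2) linear_span_image[OF linear_wedge_left, of \<alpha> "WL p a b"] by blast
qed

text \<open>The generators list the covectors of E before those of the complement, so a covector of
  the complement can be put in front only when the first degree is 0.\<close>

lemma wedge_left_WL_Q:
  assumes "(0, \<beta>) \<in> Eo p" "\<eta> \<in> span (WL p 0 b)"
  shows "wedge_left \<beta> \<eta> \<in> span (WL p 0 (b + 1))"
proof -
  have "wedge_left \<beta> ` WL p 0 b \<subseteq> WL p 0 (b + 1)"
  proof
    fix \<theta> assume "\<theta> \<in> wedge_left \<beta> ` WL p 0 b"
    then obtain \<beta>s where e: "\<theta> = wedge_left \<beta> (wedge_list \<beta>s)" "int (length \<beta>s) = b"
      and b: "\<forall>\<beta>\<in>set \<beta>s. \<beta> \<in> T' p \<and> (0, \<beta>) \<in> Eo p"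
      unfolding WL_def by auto
    show "\<theta> \<in> WL p 0 (b + 1)"
      unfolding WL_def using e b assms(1)
      by (intro CollectI exI[of _ "[]"] exI[of _ "\<beta> # \<beta>s"]) (auto simp: wedge_list_Cons orth_covector)
  qed
  then have "span (wedge_left \<beta> ` WL p 0 b) \<subseteq> span (WL p 0 (b + 1))" by (rule span_mono)
  then show ?thesis using assms(2) linear_span_image[OF linear_wedge_left, of \<beta> "WL p 0 b"] by blast
qed

lemma T_form_eqI:
  assumes "\<omega> \<in> \<Omega>" "\<eta> \<in> \<Omega>" "\<And>Xs. set Xs \<subseteq> VF \<Longrightarrow> \<omega> p (ev Xs p) = \<eta> p (ev Xs p)"
  shows "\<omega> p = \<eta> p"
proof
  fix vs
  show "\<omega> p vs = \<eta> p vs"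
  proof (cases "set vs \<subseteq> T p")
    case True
    then obtain Xs where "set Xs \<subseteq> VF" "ev Xs p = vs" using vfs_ext unfolding ev_def by metis
    then show ?thesis using assms(3) by blast
  next
    case False
    then show ?thesis using form_outside assms(1,2) by metis
  qed
qed

text \<open>Euler's formula, divided by the degree, writes a component as a sum of wedges of
  covectors with components of lower degree. The case \<open>a = 0\<close> is settled by induction
  on \<open>b\<close>; then \<open>a\<close> increases, in accordance with the order of factors in
  the generators.\<close>

lemma component_in_span:
  assumes "\<omega> \<in> \<Omega>" "comp (int a) \<omega> = \<omega>" "deg_part (int a + int b) \<omega> = \<omega>"
  shows "\<omega> p \<in> span (WL p (int a) (int b))"
proof -
  obtain W E' \<xi> where W: "open W" "p \<in> W" "\<And>b. E' b \<in> VF" "\<And>b. \<xi> b \<in> C"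
    "\<And>q b c. q \<in> W \<Longrightarrow> b \<in> \<B> \<Longrightarrow> c \<in> \<B> \<Longrightarrow> E' b q (\<xi> c) = (if b = c then 1 else 0)"
    "\<And>q v. q \<in> W \<Longrightarrow> v \<in> T q \<Longrightarrow> v = (\<Sum>b\<in>\<B>. v (\<xi> b) *\<^sub>R E' b q)"
    by (rule frame_exists[of p]) blast
  define \<alpha>P where "\<alpha>P b = (\<lambda>q v. dfun (\<xi> b) q (Pm q v))" for b
  define \<alpha>Q where "\<alpha>Q b = (\<lambda>q v. dfun (\<xi> b) q (v - Pm q v))" for b
  have dT: "dfun (\<xi> b) q \<in> T' q" for b q using W(4) by simp
  have PE: "(0, \<alpha>P b q) \<in> E q" for b q unfolding \<alpha>P_def by (rule covector_E[OF dT])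
  have QO: "(0, \<alpha>Q b q) \<in> Eo q" for b q unfolding \<alpha>Q_def by (rule covector_orth[OF dT])
  have PCF: "\<alpha>P b \<in> CF" for b
  proof (rule CFI)
    show "\<alpha>P b q \<in> T' q" for q using E_T'[OF PE[of b q]] by simp
    show "(\<lambda>q. \<alpha>P b q (X q)) \<in> C" if "X \<in> VF" for X
      using CF_C[OF dfun_CF[OF W(4)[of b]] PF_VF[OF that]] by (simp add: \<alpha>P_def PF_def)
  qed
  have QCF: "\<alpha>Q b \<in> CF" for b
  proof (rule CFI)
    show "\<alpha>Q b q \<in> T' q" for q using QO[of b q] unfolding orth_covector by blast
    show "(\<lambda>q. \<alpha>Q b q (X q)) \<in> C" if "X \<in> VF" for X
      using CF_C[OF dfun_CF[OF W(4)[of b]] QF_VF[OF that]] by (simp add: \<alpha>Q_def QF_def)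
  qed
  have EulerP: "(\<Sum>b\<in>\<B>. wd (\<alpha>P b) (ins (PF (E' b)) \<omega>)) p = real_of_int a *\<^sub>R \<omega> p" if w: "\<omega> \<in> \<Omega>" "comp a \<omega> = \<omega>" for \<omega> a
  proof -
    have "(\<Sum>b\<in>\<B>. wd (\<alpha>P b) (ins (PF (E' b)) \<omega>)) p = (real_of_int a *\<^sub>R \<omega>) p"
    proof (rule T_form_eqI)
      show "(\<Sum>b\<in>\<B>. wd (\<alpha>P b) (ins (PF (E' b)) \<omega>)) \<in> \<Omega>" using w W(3) PCF by (intro forms_sum) simp
      show "real_of_int a *\<^sub>R \<omega> \<in> \<Omega>" using w by simp
      fix Xs assume Xs: "set Xs \<subseteq> VF"
      have "(\<Sum>b\<in>\<B>. wd (\<alpha>P b) (ins (PF (E' b)) \<omega>)) p (ev Xs p) =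
          (\<Sum>b\<in>\<B>. wedge_left (\<lambda>v. dfun (\<xi> b) p (Pm p v)) (\<lambda>ws. \<omega> p (Pm p (E' b p) # ws)) (ev Xs p))"
        by (simp add: sum_apply wd_def ins_def PF_def \<alpha>P_def)
      also have "\<dots> = slot_sum (Pm p) (ev Xs p) (\<omega> p)"
        by (rule euler_sum) (use W w Xs in \<open>auto simp: Pm_sum\<close>)
      also have "\<dots> = real_of_int a * \<omega> p (ev Xs p)" using slot_sum_comp[OF w(1) Xs, of p a] w(2) by simp
      finally show "(\<Sum>b\<in>\<B>. wd (\<alpha>P b) (ins (PF (E' b)) \<omega>)) p (ev Xs p) = (real_of_int a *\<^sub>R \<omega>) p (ev Xs p)"
        by (simp add: fapply)
    qed
    then show ?thesis by (simp add: fapply)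
  qed
  have EulerQ: "(\<Sum>b\<in>\<B>. wd (\<alpha>Q b) (ins (QF (E' b)) \<omega>)) p = real k *\<^sub>R \<omega> p" if w: "\<omega> \<in> \<Omega>" "comp 0 \<omega> = \<omega>" "deg_part (int k) \<omega> = \<omega>" for \<omega> k
  proof -
    have "(\<Sum>b\<in>\<B>. wd (\<alpha>Q b) (ins (QF (E' b)) \<omega>)) p = (real k *\<^sub>R \<omega>) p"
    proof (rule T_form_eqI)
      show "(\<Sum>b\<in>\<B>. wd (\<alpha>Q b) (ins (QF (E' b)) \<omega>)) \<in> \<Omega>" using w W(3) QCF by (intro forms_sum) simp
      show "real k *\<^sub>R \<omega> \<in> \<Omega>" using w by simp
      fix Xs assume Xs: "set Xs \<subseteq> VF"
      have "(\<Sum>b\<in>\<B>. wd (\<alpha>Q b) (ins (QF (E' b)) \<omega>)) p (ev Xs p) =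
          (\<Sum>b\<in>\<B>. wedge_left (\<lambda>v. dfun (\<xi> b) p (v - Pm p v)) (\<lambda>ws. \<omega> p ((E' b p - Pm p (E' b p)) # ws)) (ev Xs p))"
        by (simp add: sum_apply wd_def ins_def QF_def \<alpha>Q_def)
      also have "\<dots> = slot_sum (\<lambda>v. v - Pm p v) (ev Xs p) (\<omega> p)"
        by (rule euler_sum) (use W w Xs in \<open>auto simp: Pm_sum Pm_diff sum_subtractf algebra_simps\<close>)
      also have "\<dots> = real (length Xs) * \<omega> p (ev Xs p)"
        using slot_sum_complement[OF w(1) Xs, of p] slot_sum_comp[OF w(1) Xs, of p 0] w(2) by simp
      also have "\<dots> = real k * \<omega> p (ev Xs p)"
      proof (cases "length Xs = k")
        case False
        then have "deg_part (int k) \<omega> p (ev Xs p) = 0" by (simp add: deg_part_apply)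
        then show ?thesis using w(3) by simp
      qed simp
      finally show "(\<Sum>b\<in>\<B>. wd (\<alpha>Q b) (ins (QF (E' b)) \<omega>)) p (ev Xs p) = (real k *\<^sub>R \<omega>) p (ev Xs p)"
        by (simp add: fapply)
    qed
    then show ?thesis by (simp add: fapply)
  qed
  have zero: "\<omega> p \<in> span (WL p 0 (int b))" if "\<omega> \<in> \<Omega>" "comp 0 \<omega> = \<omega>" "deg_part (int b) \<omega> = \<omega>" for \<omega> b
    using that
  proof (induction b arbitrary: \<omega>)
    case 0
    have "\<omega> p vs = (\<omega> p [] *\<^sub>R wedge_list ([] @ [])) vs" for vs
    proof (cases vs)
      case (Cons u us)
      have "deg_part (int 0) \<omega> p vs = 0" using Cons by (simp add: deg_part_apply)
      then have "\<omega> p vs = 0" using 0(3) by (simp only:)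
      then show ?thesis using Cons by (simp add: fapply wedge_list_Nil)
    qed (simp add: fapply wedge_list_Nil)
    then have "\<omega> p = \<omega> p [] *\<^sub>R wedge_list ([] @ [])" by blast
    moreover have "wedge_list ([] @ []) \<in> WL p 0 0" unfolding WL_def by (intro CollectI exI[of _ "[]"]) simp
    ultimately show "\<omega> p \<in> span (WL p 0 (int 0))" using span_scale[OF span_base] by (metis of_nat_0)
  next
    case (Suc b)
    have "wd (\<alpha>Q c) (ins (QF (E' c)) \<omega>) p \<in> span (WL p 0 (int b + 1))" for c
      unfolding wd_def
    proof (rule wedge_left_WL_Q[OF QO])
      show "ins (QF (E' c)) \<omega> p \<in> span (WL p 0 (int b))"
      proof (rule Suc.IH)
        show "ins (QF (E' c)) \<omega> \<in> \<Omega>" using Suc.prems W(3) by simp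
        show "comp 0 (ins (QF (E' c)) \<omega>) = ins (QF (E' c)) \<omega>" 
          by (rule ins_QF_comp[OF W(3) Suc.prems(1), of c 0, unfolded Suc.prems(2), symmetric])
        show "deg_part (int b) (ins (QF (E' c)) \<omega>) = ins (QF (E' c)) \<omega>"
          using ins_deg_part[of "QF (E' c)" "int (Suc b)" \<omega>, unfolded Suc.prems(3), symmetric] by (simp only: of_nat_Suc add_diff_cancel_left')
      qed
    qed
    then have "(\<Sum>c\<in>\<B>. wd (\<alpha>Q c) (ins (QF (E' c)) \<omega>)) p \<in> span (WL p 0 (int b + 1))"
      unfolding sum_apply[of _ _ p] by (intro span_sum)
    \<comment> \<open>Division by the degree, which is nonzero in the successor case.\<close>
    then have "(1 / real (Suc b)) *\<^sub>R (real (Suc b) *\<^sub>R \<omega> p) \<in> span (WL p 0 (int b + 1))"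
      unfolding EulerQ[OF Suc.prems] by (rule span_scale)
    then show "\<omega> p \<in> span (WL p 0 (int (Suc b)))" by (simp add: add.commute del: of_nat_Suc) (simp add: add.commute)
  qed
  show ?thesis
    using assms
  proof (induction a arbitrary: \<omega>)
    case 0
    then show "\<omega> p \<in> span (WL p (int 0) (int b))" using zero[of \<omega> b] by simp
  next
    case (Suc a)
    have "wd (\<alpha>P c) (ins (PF (E' c)) \<omega>) p \<in> span (WL p (int a + 1) (int b))" for c
      unfolding wd_def
    proof (rule wedge_left_WL_P[OF PE])
      show "ins (PF (E' c)) \<omega> p \<in> span (WL p (int a) (int b))"
      proof (rule Suc.IH)
        show "ins (PF (E' c)) \<omega> \<in> \<Omega>" using Suc.prems W(3) by simp
        show "comp (int a) (ins (PF (E' c)) \<omega>) = ins (PF (E' c)) \<omega>" 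
          using ins_PF_comp[OF W(3) Suc.prems(1), of c "int (Suc a)", unfolded Suc.prems(2), symmetric] by (simp only: of_nat_Suc add_diff_cancel_left')
        show "deg_part (int a + int b) (ins (PF (E' c)) \<omega>) = ins (PF (E' c)) \<omega>"
          using ins_deg_part[of "PF (E' c)" "int (Suc a) + int b" \<omega>, unfolded Suc.prems(3), symmetric] by (simp only: of_nat_Suc add_diff_cancel_left' add.assoc)
      qed
    qed
    then have "(\<Sum>c\<in>\<B>. wd (\<alpha>P c) (ins (PF (E' c)) \<omega>)) p \<in> span (WL p (int a + 1) (int b))"
      unfolding sum_apply[of _ _ p] by (intro span_sum)
    then have "(1 / real_of_int (int (Suc a))) *\<^sub>R (real_of_int (int (Suc a)) *\<^sub>R \<omega> p) \<in> span (WL p (int a + 1) (int b))"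
      unfolding EulerP[OF Suc.prems(1,2)] by (rule span_scale)
    then show "\<omega> p \<in> span (WL p (int (Suc a)) (int b))" by (simp add: add.commute del: of_nat_Suc) (simp add: add.commute)
  qed
qed

section \<open>Bidegree components of forms and of the differential\<close>

lemma component_bigraded: "\<omega> \<in> \<Omega> \<Longrightarrow> comp a (deg_part (a + b) \<omega>) \<in> bigraded_forms A E a b"
proof (cases "0 \<le> a \<and> 0 \<le> b")
  case True
  assume w: "\<omega> \<in> \<Omega>"
  let ?w = "comp a (deg_part (a + b) \<omega>)"
  have "?w p \<in> span (WL p (int (nat a)) (int (nat b)))" for p
  proof (rule component_in_span)
    show "comp (int (nat a)) ?w = ?w" using True w by (simp add: comp_comp)
    show "deg_part (int (nat a) + int (nat b)) ?w = ?w"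
      using True by (auto simp: comp_deg_part fun_eq_iff deg_part_apply)
  qed (use w in simp)
  then show ?thesis using True w unfolding bigraded_iff by simp
next
  case False
  assume w: "\<omega> \<in> \<Omega>"
  have "comp a (deg_part (a + b) \<omega>) = 0" by (rule comp_deg_zero[OF w]) (use False in auto)
  then show ?thesis using bigraded_zero by simp
qed

lemma sum_comp_deg:
  assumes w: "\<omega> \<in> \<Omega>" and i: "0 \<le> i"
  shows "(\<Sum>j = 0..int N. comp i (deg_part (i + j) \<omega>)) = comp i \<omega>"
proof (intro ext)
  fix p vs
  have "(\<Sum>j = 0..int N. comp i (deg_part (i + j) \<omega>)) p vs = (\<Sum>j = 0..int N. if j = int (length vs) - i then comp i \<omega> p vs else 0)"
    unfolding sum_apply by (rule sum.cong) (auto simp: comp_deg_part deg_part_apply)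
  also have "\<dots> = (if int (length vs) - i \<in> {0..int N} then comp i \<omega> p vs else 0)" by simp
  also have "\<dots> = comp i \<omega> p vs"
    using comp_range[of i vs \<omega> p] form_top[OF comp_form[OF w, of i], of vs p] i by auto
  finally show "(\<Sum>j = 0..int N. comp i (deg_part (i + j) \<omega>)) p vs = comp i \<omega> p vs" .
qed

lemma comp_sum: "comp a (\<Sum>i\<in>I. \<omega> i) = (\<Sum>i\<in>I. comp a (\<omega> i))"
  by (induction I rule: infinite_finite_induct) auto

lemma deg_part_sum: "deg_part a (\<Sum>i\<in>I. \<omega> i) = (\<Sum>i\<in>I. deg_part a (\<omega> i))"
  by (induction I rule: infinite_finite_induct) auto

text \<open>Applying \<open>comp a\<close> and \<open>deg_part (a + b)\<close> to any decomposition
  isolates its entry with index (a,b), so the definite description is satisfied by one value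
  only.\<close>

lemma form_bicomp_eq: 
  assumes w: "\<omega> \<in> \<Omega>"
  shows "form_bicomp A E a b \<omega> = comp a (deg_part (a + b) \<omega>)"
  unfolding form_bicomp_def
proof (rule the_equality)
  let ?c = "\<lambda>i j. comp i (deg_part (i + j) \<omega>)"
  have "(\<Sum>i = 0..int N. \<Sum>j = 0..int N. ?c i j) = (\<Sum>i = 0..int N. comp i \<omega>)"
    by (rule sum.cong[OF refl]) (rule sum_comp_deg[OF w], simp)
  also have "\<dots> = \<omega>" by (rule sum_comp[OF w]) auto
  finally have s: "\<omega> = (\<Sum>i = 0..int N. \<Sum>j = 0..int N. ?c i j)" ..
  show "\<exists>c. (\<forall>i j. c i j \<in> bigraded_forms A E i j) \<and> \<omega> = (\<Sum>i = 0..int N. \<Sum>j = 0..int N. c i j) \<and> ?c a b = c a b"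
    using component_bigraded[OF w] s by (intro exI[of _ ?c] conjI allI) auto
  fix \<eta> assume "\<exists>c. (\<forall>i j. c i j \<in> bigraded_forms A E i j) \<and> \<omega> = (\<Sum>i = 0..int N. \<Sum>j = 0..int N. c i j) \<and> \<eta> = c a b"
  then obtain c where c: "\<And>i j. c i j \<in> bigraded_forms A E i j" "\<omega> = (\<Sum>i = 0..int N. \<Sum>j = 0..int N. c i j)" "\<eta> = c a b"
    by blast
  show "\<eta> = comp a (deg_part (a + b) \<omega>)"
  proof (cases "0 \<le> a \<and> 0 \<le> b \<and> a + b \<le> int N")
    case True
    have "comp a (deg_part (a + b) \<omega>) = (\<Sum>i = 0..int N. \<Sum>j = 0..int N. comp a (deg_part (a + b) (c i j)))"
      unfolding c(2) deg_part_sum comp_sum ..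
    also have "\<dots> = (\<Sum>i = 0..int N. \<Sum>j = 0..int N. if a = i \<and> b = j then c i j else 0)"
      by (simp only: bigraded_component[OF c(1)])
    also have "\<dots> = (\<Sum>i = 0..int N. if a = i then c i b else 0)"
      using True by (intro sum.cong refl) auto
    also have "\<dots> = c a b" using True by simp
    finally show ?thesis using c(3) by simp
  next
    \<comment> \<open>An entry with such indices need not occur in the sum, but the space of forms
      of this bidegree is zero.\<close>
    case False
    have "c a b \<in> \<Omega>" using c(1)[of a b] unfolding bigraded_iff by blast
    then have "comp a (deg_part (a + b) (c a b)) = 0" by (rule comp_deg_zero[OF _ False])
    then have "c a b = 0" using bigraded_component[OF c(1)[of a b], of a b] by simp
    then show ?thesis using c(3) comp_deg_zero[OF w False] by simp
  qed
qed

definition delta :: "'a form \<Rightarrow> 'a form"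
  where "delta \<omega> = (1 / 2) *\<^sub>R (dd \<omega> - eps (dd (eps \<omega>)))"

text \<open>Since \<open>dd\<close> raises the total degree by exactly 1 = a + b, the second index
  follows from the first. The sum over \<open>j\<close> recombines the parts of different degree to
  \<open>comp i \<omega>\<close>.\<close>

lemma op_bicomp_dd:
  assumes w: "\<omega> \<in> \<Omega>" and ab: "a + b = 1"
  shows "op_bicomp A E a b (de_rham A) \<omega> = (\<Sum>i = 0..int N. comp (i + a) (dd (comp i \<omega>)))"
proof -
  have "form_bicomp A E (i + a) (j + b) (de_rham A (form_bicomp A E i j \<omega>)) = comp (i + a) (dd (comp i (deg_part (i + j) \<omega>)))" for i j
  proof -
    let ?w = "comp i (deg_part (i + j) \<omega>)"
    have 1: "?w = deg_part (i + j) (comp i \<omega>)" by (rule comp_deg_part)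
    have "deg_part (i + j + 1) (dd ?w) = dd ?w"
      unfolding 1 dd_deg_part[OF comp_form[OF w]] by (auto simp: fun_eq_iff deg_part_apply)
    moreover have "i + a + (j + b) = i + j + 1" using ab by simp
    ultimately show ?thesis using w by (simp only: form_bicomp_eq[OF w] de_rham_dd comp_form deg_part_form form_bicomp_eq dd_form)
  qed
  then have "op_bicomp A E a b (de_rham A) \<omega> = (\<Sum>i = 0..int N. \<Sum>j = 0..int N. comp (i + a) (dd (comp i (deg_part (i + j) \<omega>))))"
    by (simp add: op_bicomp_def)
  also have "\<dots> = (\<Sum>i = 0..int N. comp (i + a) (dd (comp i \<omega>)))"
  proof (rule sum.cong[OF refl])
    fix i assume i: "i \<in> {0..int N}"
    have "(\<Sum>j = 0..int N. comp (i + a) (dd (comp i (deg_part (i + j) \<omega>)))) = comp (i + a) (dd (\<Sum>j = 0..int N. comp i (deg_part (i + j) \<omega>)))"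
      using w oper_sum[OF oper_dd, of "{0..int N}" "\<lambda>j. comp i (deg_part (i + j) \<omega>)"] by (simp add: comp_sum)
    also have "\<dots> = comp (i + a) (dd (comp i \<omega>))" using sum_comp_deg[OF w, of i] i by simp
    finally show "(\<Sum>j = 0..int N. comp (i + a) (dd (comp i (deg_part (i + j) \<omega>)))) = comp (i + a) (dd (comp i \<omega>))" .
  qed
  finally show ?thesis .
qed

lemma delta_comp:
  assumes w: "\<omega> \<in> \<Omega>" and i: "0 \<le> i" "i \<le> int N"
  shows "delta (comp i \<omega>) = comp (i + 1) (dd (comp i \<omega>)) + comp (i - 1) (dd (comp i \<omega>))"
proof -
  let ?\<eta> = "dd (comp i \<omega>)"
  have e: "?\<eta> \<in> \<Omega>" using w by simp
  \<comment> \<open>The range is widened so that it contains all of i - 1, ..., i + 2 for every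
    \<open>i\<close> between 0 and N.\<close>
  have "?\<eta> = (\<Sum>b = -1..int N + 2. comp b ?\<eta>)" using sum_comp[OF e, of "-1" "int N + 2"] by simp
  also have "\<dots> = (\<Sum>b\<in>{i - 1, i, i + 1, i + 2}. comp b ?\<eta>)"
  proof (rule sum.mono_neutral_right)
    show "\<forall>b\<in>{-1..int N + 2} - {i - 1, i, i + 1, i + 2}. comp b ?\<eta> = 0"
    proof
      fix b assume b: "b \<in> {-1..int N + 2} - {i - 1, i, i + 1, i + 2}"
      have "comp (i + (b - i)) ?\<eta> = 0" by (rule comp_dd[OF w]) (use b in auto)
      then show "comp b ?\<eta> = 0" by simp
    qed
  qed (use i in auto)
  finally have s: "?\<eta> = comp (i - 1) ?\<eta> + comp i ?\<eta> + comp (i + 1) ?\<eta> + comp (i + 2) ?\<eta>" by (simp add: add.assoc)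
  let ?s = "if even i then 1 else -1 :: real"
  have "eps (dd (eps (comp i \<omega>))) = ?s *\<^sub>R eps ?\<eta>" using w by (simp add: eps_comp)
  also have "eps ?\<eta> = eps (comp (i - 1) ?\<eta> + comp i ?\<eta> + comp (i + 1) ?\<eta> + comp (i + 2) ?\<eta>)" using s by simp
  also have "?s *\<^sub>R \<dots> = - comp (i - 1) ?\<eta> + comp i ?\<eta> - comp (i + 1) ?\<eta> + comp (i + 2) ?\<eta>"
    using e by (cases "even i") (simp_all add: eps_comp)
  finally have 2: "eps (dd (eps (comp i \<omega>))) = - comp (i - 1) ?\<eta> + comp i ?\<eta> - comp (i + 1) ?\<eta> + comp (i + 2) ?\<eta>" .
  have "?\<eta> - eps (dd (eps (comp i \<omega>))) = 2 *\<^sub>R (comp (i + 1) ?\<eta> + comp (i - 1) ?\<eta>)"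
    unfolding 2 using s by (simp add: scaleR_2 algebra_simps)
  then show ?thesis unfolding delta_def by simp
qed

lemma delta_add: "\<omega> \<in> \<Omega> \<Longrightarrow> \<eta> \<in> \<Omega> \<Longrightarrow> delta (\<omega> + \<eta>) = delta \<omega> + delta \<eta>"
  by (simp add: delta_def scaleR_add_right[symmetric])

lemma delta_sum:
  assumes "\<And>i. i \<in> I \<Longrightarrow> \<omega> i \<in> \<Omega>"
  shows "delta (\<Sum>i\<in>I. \<omega> i) = (\<Sum>i\<in>I. delta (\<omega> i))"
  using assms
proof (induction I rule: infinite_finite_induct)
  case (insert i I)
  have "delta (\<omega> i + (\<Sum>i\<in>I. \<omega> i)) = delta (\<omega> i) + delta (\<Sum>i\<in>I. \<omega> i)"
    using insert.prems by (intro delta_add forms_sum) auto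
  then show ?case using insert by simp
qed (auto simp: delta_def)

lemma d_split_delta: 
  assumes w: "\<omega> \<in> \<Omega>"
  shows "d_split A E \<omega> = delta \<omega>"
proof -
  have "d_split A E \<omega> = op_bicomp A E 1 0 (de_rham A) \<omega> + op_bicomp A E (-1) 2 (de_rham A) \<omega>"
    by (simp add: d_split_def fapply)
  also have "\<dots> = (\<Sum>i = 0..int N. comp (i + 1) (dd (comp i \<omega>)) + comp (i + (-1)) (dd (comp i \<omega>)))"
    using op_bicomp_dd[OF w, of 1 0] op_bicomp_dd[OF w, of "-1" 2] by (simp add: sum.distrib)
  also have "\<dots> = (\<Sum>i = 0..int N. delta (comp i \<omega>))"
    by (rule sum.cong) (auto simp: delta_comp[OF w])
  also have "\<dots> = delta (\<Sum>i = 0..int N. comp i \<omega>)" using w by (intro delta_sum[symmetric]) simp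
  also have "\<dots> = delta \<omega>" using sum_comp[OF w, of 0 "int N"] by simp
  finally show ?thesis .
qed

end

section \<open>The Leibnizator\<close>

lemma wedge_left_map: "wedge_left \<alpha> \<eta> (map R vs) = wedge_left (\<lambda>v. \<alpha> (R v)) (\<lambda>ws. \<eta> (map R ws)) vs"
  by (induction vs arbitrary: \<eta>) (auto simp: wedge_left_Cons)

context gap
begin

section \<open>Cartan calculus of the split differential\<close>

definition aR :: "('a \<Rightarrow> 'a covec) \<Rightarrow> 'a \<Rightarrow> 'a covec" where "aR \<alpha> = (\<lambda>p v. \<alpha> p (Rm p v))"

lemma Rm_lin: "v \<in> T p \<Longrightarrow> w \<in> T p \<Longrightarrow> Rm p (a *\<^sub>R v + b *\<^sub>R w) = a *\<^sub>R Rm p v + b *\<^sub>R Rm p w"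
  by (simp add: Rm_def Pm_lin algebra_simps)

lemma aR_CF [simp]: "\<alpha> \<in> CF \<Longrightarrow> aR \<alpha> \<in> CF"
proof (rule CFI)
  assume a: "\<alpha> \<in> CF"
  show "aR \<alpha> p \<in> T' p" for p
    by (rule T'I) (use a in \<open>simp_all add: aR_def Rm_lin T'_lin[OF CF_T'] T'_outside[OF CF_T'] Rm_T_iff\<close>)
  show "(\<lambda>p. aR \<alpha> p (X p)) \<in> C" if "X \<in> VF" for X
    using CF_C[OF a RF_VF[OF that]] by (simp add: aR_def RF_Rm)
qed

lemma aR_aR [simp]: "\<alpha> \<in> CF \<Longrightarrow> aR (aR \<alpha>) = \<alpha>"
proof (rule CF_eqI)
  fix X p assume a: "\<alpha> \<in> CF" and X: "X \<in> VF"
  have "Rm p (Rm p (X p)) = X p" using fun_cong[OF RF_RF[OF X], of p] by (simp add: RF_Rm)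
  then show "aR (aR \<alpha>) p (X p) = \<alpha> p (X p)" by (simp add: aR_def)
qed auto

lemma eps_wd: "eps (wd \<alpha> \<omega>) = wd (aR \<alpha>) (eps \<omega>)"
  by (simp add: fun_eq_iff eps_def wd_def wedge_left_map aR_def)

lemma eps_tau: "eps (tau \<omega>) = tau (eps \<omega>)"
  by (simp add: fun_eq_iff eps_def tau_apply)

lemma delta_form [simp]: "\<omega> \<in> \<Omega> \<Longrightarrow> delta \<omega> \<in> \<Omega>"
  by (simp add: delta_def)

lemma tau_scaleR [simp]: "tau (c *\<^sub>R \<omega>) = c *\<^sub>R tau \<omega>"
  by (simp add: fun_eq_iff tau_apply fapply)

lemma oper_delta: "oper (-1) delta"
proof (rule operI)
  fix \<omega> assume w: "\<omega> \<in> \<Omega>"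
  then have e: "eps (dd (eps (tau \<omega>))) = - tau (eps (dd (eps \<omega>)))" by (simp add: eps_tau tau_dd)
  show "delta (tau \<omega>) = (-1) *\<^sub>R tau (delta \<omega>)"
    unfolding delta_def e tau_scaleR tau_diff tau_dd[OF w] by (simp add: algebra_simps)
qed (simp_all add: delta_add)

lemma oper_d_split: "oper (-1) (d_split A E)"
  by (rule oper_cong[OF oper_delta]) (rule d_split_delta)

lemma ins_eps_P:
  assumes "X \<in> VF" "PF X = X" "\<omega> \<in> \<Omega>"
  shows "ins X (eps \<omega>) = - eps (ins X \<omega>)"
proof -
  have "Pm p (X p) = X p" for p using fun_cong[OF assms(2), of p] by (simp add: PF_def)
  then have "RF X = (\<lambda>p. - X p)" by (simp add: RF_def scaleR_2)
  then show ?thesis using assms by (simp add: ins_eps ins_minus_left)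
qed

definition Lam :: "('a \<Rightarrow> 'a tvec) \<Rightarrow> 'a form \<Rightarrow> 'a form"
  where "Lam X \<omega> = (1 / 2) *\<^sub>R (Lie X \<omega> + eps (Lie X (eps \<omega>)))"

text \<open>The commutator of a covector with the split differential, the counterpart of
  \<open>Lam\<close>. It is linear over functions by \<open>Tht_fun\<close>, so it contributes
  nothing when the commutator acts on a function.\<close>

definition Tht :: "('a \<Rightarrow> 'a covec) \<Rightarrow> 'a form \<Rightarrow> 'a form"
  where "Tht \<alpha> \<omega> = (1 / 2) *\<^sub>R (dmul \<alpha> \<omega> - eps (dmul (aR \<alpha>) (eps \<omega>)))"

lemma comm_ins_delta:
  assumes X: "X \<in> VF" "PF X = X" and w: "\<omega> \<in> \<Omega>"
  shows "ins X (delta \<omega>) + delta (ins X \<omega>) = Lam X \<omega>"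
proof -
  have e: "ins X (eps \<theta>) = - eps (ins X \<theta>)" if "\<theta> \<in> \<Omega>" for \<theta> by (rule ins_eps_P[OF X that])
  have "ins X (delta \<omega>) + delta (ins X \<omega>) =
      (1 / 2) *\<^sub>R ((ins X (dd \<omega>) - ins X (eps (dd (eps \<omega>)))) + (dd (ins X \<omega>) - eps (dd (eps (ins X \<omega>)))))"
    by (simp only: delta_def ins_scaleR ins_diff scaleR_add_right)
  also have "(ins X (dd \<omega>) - ins X (eps (dd (eps \<omega>)))) + (dd (ins X \<omega>) - eps (dd (eps (ins X \<omega>)))) = Lie X \<omega> + eps (Lie X (eps \<omega>))"
    using X(1) w by (simp add: e ins_dd)
  finally show ?thesis unfolding Lam_def .
qed

lemma comm_wd_delta:
  assumes a: "\<alpha> \<in> CF" and w: "\<omega> \<in> \<Omega>"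
  shows "wd \<alpha> (delta \<omega>) + delta (wd \<alpha> \<omega>) = Tht \<alpha> \<omega>"
proof -
  have e: "wd \<alpha> (eps \<theta>) = eps (wd (aR \<alpha>) \<theta>)" for \<theta> using a by (simp add: eps_wd)
  have "wd \<alpha> (delta \<omega>) + delta (wd \<alpha> \<omega>) =
      (1 / 2) *\<^sub>R ((wd \<alpha> (dd \<omega>) - wd \<alpha> (eps (dd (eps \<omega>)))) + (dd (wd \<alpha> \<omega>) - eps (dd (eps (wd \<alpha> \<omega>)))))"
    by (simp only: delta_def wd_scaleR wd_diff scaleR_add_right)
  also have "(wd \<alpha> (dd \<omega>) - wd \<alpha> (eps (dd (eps \<omega>)))) + (dd (wd \<alpha> \<omega>) - eps (dd (eps (wd \<alpha> \<omega>)))) = dmul \<alpha> \<omega> - eps (dmul (aR \<alpha>) (eps \<omega>))"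
    unfolding e eps_wd[of \<alpha> \<omega>] using w by (simp add: dmul_def)
  finally show ?thesis unfolding Tht_def .
qed

lemma half_sum: "(1 / 2) *\<^sub>R x + (1 / 2) *\<^sub>R x = (x :: 'v::real_vector)"
  by (simp add: scaleR_left_distrib[symmetric])

lemma Lam_fun: "X \<in> VF \<Longrightarrow> \<omega> \<in> \<Omega> \<Longrightarrow> f \<in> C \<Longrightarrow> Lam X (fun_op f \<omega>) = fun_op f (Lam X \<omega>) + fun_op (\<lambda>p. X p f) \<omega>"
proof -
  assume a: "X \<in> VF" "\<omega> \<in> \<Omega>" "f \<in> C"
  let ?u = "fun_op (\<lambda>p. X p f) \<omega>"
  have 1: "Lam X (fun_op f \<omega>) = (1 / 2) *\<^sub>R ((?u + fun_op f (Lie X \<omega>)) + (?u + fun_op f (eps (Lie X (eps \<omega>)))))"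
    using a by (simp add: Lam_def Lie_fun)
  have "fun_op f (Lam X \<omega>) + ?u = (1 / 2) *\<^sub>R (fun_op f (Lie X \<omega>) + fun_op f (eps (Lie X (eps \<omega>)))) + ((1 / 2) *\<^sub>R ?u + (1 / 2) *\<^sub>R ?u)"
    unfolding half_sum by (simp add: Lam_def)
  then show ?thesis unfolding 1 by (simp only: scaleR_add_right ac_simps)
qed

lemma Tht_fun: "\<alpha> \<in> CF \<Longrightarrow> \<omega> \<in> \<Omega> \<Longrightarrow> f \<in> C \<Longrightarrow> Tht \<alpha> (fun_op f \<omega>) = fun_op f (Tht \<alpha> \<omega>)"
  by (simp add: Tht_def dmul_fun)

lemma oper_Lam: "X \<in> VF \<Longrightarrow> oper 1 (Lam X)"
  by (rule operI) (auto simp: Lam_def eps_tau tau_Lie fun_eq_iff fapply tau_apply algebra_simps)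

lemma oper_Tht: "\<alpha> \<in> CF \<Longrightarrow> oper 1 (Tht \<alpha>)"
  by (rule operI) (auto simp: Tht_def eps_tau oper_tau[OF oper_dmul] fun_eq_iff fapply tau_apply algebra_simps)

text \<open>Contraction with a field of F anticommutes with \<open>eps\<close>, while the bracket
  need not lie in F. Averaging therefore produces half of the difference between [X,Y] and its
  reflection, and this is P[X,Y].\<close>

lemma Lam_ins:
  assumes X: "X \<in> VF" and Y: "Y \<in> VF" "PF Y = Y" and w: "\<omega> \<in> \<Omega>"
  shows "Lam X (ins Y \<omega>) - ins Y (Lam X \<omega>) = ins (PF (lie X Y)) \<omega>"
proof -
  let ?Z = "lie X Y"
  have e: "ins Y (eps \<theta>) = - eps (ins Y \<theta>)" if "\<theta> \<in> \<Omega>" for \<theta> by (rule ins_eps_P[OF Y that])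
  have e': "eps (ins Y \<omega>) = - ins Y (eps \<omega>)" using e[OF w] by simp
  have 1: "Lam X (ins Y \<omega>) = (1 / 2) *\<^sub>R (Lie X (ins Y \<omega>) - eps (Lie X (ins Y (eps \<omega>))))"
    unfolding Lam_def e' using X Y w by simp
  have 2: "ins Y (Lam X \<omega>) = (1 / 2) *\<^sub>R (Lie X (ins Y \<omega>) - ins ?Z \<omega> - (eps (Lie X (ins Y (eps \<omega>))) - eps (ins ?Z (eps \<omega>))))"
    unfolding Lam_def ins_scaleR ins_add using e[of "Lie X (eps \<omega>)"] X Y w by (simp add: ins_Lie)
  have 3: "eps (ins ?Z (eps \<omega>)) = ins (RF ?Z) \<omega>" using X Y w by (simp add: ins_eps)
  have "Lam X (ins Y \<omega>) - ins Y (Lam X \<omega>) = (1 / 2) *\<^sub>R (ins ?Z \<omega> - ins (RF ?Z) \<omega>)"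
    unfolding 1 2 3 scaleR_diff_right[symmetric] by simp
  also have "ins ?Z \<omega> - ins (RF ?Z) \<omega> = ins (PF ?Z) \<omega> + ins (PF ?Z) \<omega>"
    using ins_split[OF VF_lie[OF X Y(1)] w] ins_RF[OF VF_lie[OF X Y(1)] w] by simp
  finally show ?thesis by (simp only: scaleR_add_right half_sum)
qed

lemma Lam_wd:
  assumes X: "X \<in> VF" and b: "\<beta> \<in> CF" and w: "\<omega> \<in> \<Omega>"
  shows "Lam X (wd \<beta> \<omega>) - wd \<beta> (Lam X \<omega>) = (1 / 2) *\<^sub>R (wd (LieC X \<beta>) \<omega> + wd (aR (LieC X (aR \<beta>))) \<omega>)"
proof -
  have 1: "Lam X (wd \<beta> \<omega>) = (1 / 2) *\<^sub>R (wd (LieC X \<beta>) \<omega> + wd \<beta> (Lie X \<omega>) + (wd (aR (LieC X (aR \<beta>))) \<omega> + wd \<beta> (eps (Lie X (eps \<omega>)))))"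
    unfolding Lam_def eps_wd[of \<beta>] using X b w by (simp add: Lie_wd eps_wd)
  have 2: "wd \<beta> (Lam X \<omega>) = (1 / 2) *\<^sub>R (wd \<beta> (Lie X \<omega>) + wd \<beta> (eps (Lie X (eps \<omega>))))"
    by (simp add: Lam_def)
  show ?thesis unfolding 1 2 scaleR_diff_right[symmetric] by simp
qed

lemma Tht_ins:
  assumes a: "\<alpha> \<in> CF" and Y: "Y \<in> VF" "PF Y = Y" and w: "\<omega> \<in> \<Omega>"
  shows "Tht \<alpha> (ins Y \<omega>) - ins Y (Tht \<alpha> \<omega>) = - ((1 / 2) *\<^sub>R (wd (dC Y \<alpha>) \<omega> + wd (aR (dC Y (aR \<alpha>))) \<omega>))"
proof -
  have e: "ins Y (eps \<theta>) = - eps (ins Y \<theta>)" if "\<theta> \<in> \<Omega>" for \<theta> by (rule ins_eps_P[OF Y that])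
  have e': "eps (ins Y \<omega>) = - ins Y (eps \<omega>)" using e[OF w] by simp
  have d: "dmul (aR \<alpha>) (- \<theta>) = - dmul (aR \<alpha>) \<theta>" if "\<theta> \<in> \<Omega>" for \<theta>
    using dmul_scaleR[OF aR_CF[OF a] that, of "-1"] by simp
  have 1: "Tht \<alpha> (ins Y \<omega>) = (1 / 2) *\<^sub>R (dmul \<alpha> (ins Y \<omega>) + eps (dmul (aR \<alpha>) (ins Y (eps \<omega>))))"
    unfolding Tht_def e' using a Y w by (simp add: d)
  have 2: "ins Y (Tht \<alpha> \<omega>) = (1 / 2) *\<^sub>R (dmul \<alpha> (ins Y \<omega>) + wd (dC Y \<alpha>) \<omega> + (eps (dmul (aR \<alpha>) (ins Y (eps \<omega>))) + wd (aR (dC Y (aR \<alpha>))) \<omega>))"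
    unfolding Tht_def ins_scaleR ins_diff using e[of "dmul (aR \<alpha>) (eps \<omega>)"] a Y w by (simp add: ins_dmul eps_wd)
  show ?thesis unfolding 1 2 scaleR_diff_right[symmetric] scaleR_minus_right[symmetric] by simp
qed

lemma Tht_wd:
  assumes a: "\<alpha> \<in> CF" and b: "\<beta> \<in> CF" and w: "\<omega> \<in> \<Omega>"
  shows "Tht \<alpha> (wd \<beta> \<omega>) = wd \<beta> (Tht \<alpha> \<omega>)"
proof -
  have "eps (dmul (aR \<alpha>) (eps (wd \<beta> \<omega>))) = wd \<beta> (eps (dmul (aR \<alpha>) (eps \<omega>)))"
    unfolding eps_wd[of \<beta>] using a b w by (simp add: dmul_wd eps_wd)
  then show ?thesis using a b w by (simp add: Tht_def dmul_wd)
qed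

text \<open>The derived bracket formed with the split differential, as a section. Its vector part
  lies in F, which allows the commutator calculus to be applied to it once more in the
  Leibnizator.\<close>

definition dz :: "('a \<Rightarrow> 'a ttvec) \<Rightarrow> ('a \<Rightarrow> 'a ttvec) \<Rightarrow> 'a \<Rightarrow> 'a ttvec"
  where "dz x y = (\<lambda>p. (PF (lie (vp x) (vp y)) p,
    (1 / 2) *\<^sub>R (LieC (vp x) (cp y) p + aR (LieC (vp x) (aR (cp y))) p - (dC (vp y) (cp x) p + aR (dC (vp y) (aR (cp x))) p))))"

lemma wd_scale_left: "wd (\<lambda>p. c *\<^sub>R \<alpha> p) \<omega> = c *\<^sub>R wd \<alpha> \<omega>"
  using wd_fmult_left[of "\<lambda>_. c" \<alpha> \<omega>] by (simp add: fun_op_const)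

lemma dz_TS: "x \<in> TS \<Longrightarrow> y \<in> TS \<Longrightarrow> dz x y \<in> TS"
  unfolding dz_def by (rule TS_I) simp_all

lemma vp_dz: "vp (dz x y) = PF (lie (vp x) (vp y))"
  and cp_dz: "cp (dz x y) = (\<lambda>p. (1 / 2) *\<^sub>R (LieC (vp x) (cp y) p + aR (LieC (vp x) (aR (cp y))) p - (dC (vp y) (cp x) p + aR (dC (vp y) (aR (cp x))) p)))"
  by (simp_all add: dz_def vp_def cp_def)

text \<open>An operator is only determined by its values on forms, so the lemmas below are stated up
  to agreement on forms.\<close>

lemma comm_delta:
  assumes x: "x \<in> TS" "PF (vp x) = vp x" and \<phi>: "\<And>\<omega>. \<omega> \<in> \<Omega> \<Longrightarrow> \<phi> \<omega> = sec_op x \<omega>" and w: "\<omega> \<in> \<Omega>"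
  shows "op_comm A \<phi> (d_split A E) \<omega> = Lam (vp x) \<omega> + Tht (cp x) \<omega>"
proof -
  have "op_comm A \<phi> (d_split A E) \<omega> = \<phi> (d_split A E \<omega>) + d_split A E (\<phi> \<omega>)"
    by (rule op_comm_odd[OF oper_cong[OF oper_sec_op[OF x(1)] \<phi>] oper_d_split w])
  also have "\<dots> = sec_op x (delta \<omega>) + delta (sec_op x \<omega>)"
    using w x by (simp only: \<phi> d_split_delta delta_form oper_form[OF oper_sec_op])
  also have "\<dots> = (ins (vp x) (delta \<omega>) + delta (ins (vp x) \<omega>)) + (wd (cp x) (delta \<omega>) + delta (wd (cp x) \<omega>))"
    using w x by (simp add: sec_op_eq delta_add)
  also have "\<dots> = Lam (vp x) \<omega> + Tht (cp x) \<omega>"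
    using w x by (simp add: comm_ins_delta comm_wd_delta)
  finally show ?thesis .
qed

lemma oper_comm_delta:
  assumes x: "x \<in> TS" "PF (vp x) = vp x" and \<phi>: "\<And>\<omega>. \<omega> \<in> \<Omega> \<Longrightarrow> \<phi> \<omega> = sec_op x \<omega>"
  shows "oper 1 (op_comm A \<phi> (d_split A E))"
proof (rule oper_cong)
  show "oper 1 (\<lambda>\<omega>. Lam (vp x) \<omega> + Tht (cp x) \<omega>)" using x by (intro oper_plus oper_Lam oper_Tht) auto
qed (rule comm_delta[OF x \<phi>])

lemma comm_comm_delta:
  assumes x: "x \<in> TS" "PF (vp x) = vp x" and y: "y \<in> TS" "PF (vp y) = vp y" and w: "\<omega> \<in> \<Omega>"
  shows "op_comm A (op_comm A (sec_op x) (d_split A E)) (sec_op y) \<omega> = sec_op (dz x y) \<omega>"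
proof -
  let ?D = "op_comm A (sec_op x) (d_split A E)"
  let ?X = "vp x" and ?Y = "vp y" and ?a = "cp x" and ?b = "cp y"
  have "op_comm A ?D (sec_op y) \<omega> = ?D (sec_op y \<omega>) - sec_op y (?D \<omega>)"
    by (rule op_comm_even[OF oper_comm_delta[OF x refl] oper_sec_op[OF y(1)] _ w]) simp
  also have "\<dots> = Lam ?X (sec_op y \<omega>) + Tht ?a (sec_op y \<omega>) - sec_op y (Lam ?X \<omega> + Tht ?a \<omega>)"
    using w by (simp only: comm_delta[OF x refl] oper_form[OF oper_sec_op[OF y(1)]])
  also have "Lam ?X (sec_op y \<omega>) = Lam ?X (ins ?Y \<omega>) + Lam ?X (wd ?b \<omega>)"
    using x y w oper_add[OF oper_Lam[OF TS_vp[OF x(1)]]] by (simp add: sec_op_eq)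
  also have "Tht ?a (sec_op y \<omega>) = Tht ?a (ins ?Y \<omega>) + Tht ?a (wd ?b \<omega>)"
    using x y w oper_add[OF oper_Tht[OF TS_cp[OF x(1)]]] by (simp add: sec_op_eq)
  also have "sec_op y (Lam ?X \<omega> + Tht ?a \<omega>) = ins ?Y (Lam ?X \<omega>) + wd ?b (Lam ?X \<omega>) + (ins ?Y (Tht ?a \<omega>) + wd ?b (Tht ?a \<omega>))"
    by (simp add: sec_op_eq)
  also have "Lam ?X (ins ?Y \<omega>) + Lam ?X (wd ?b \<omega>) + (Tht ?a (ins ?Y \<omega>) + Tht ?a (wd ?b \<omega>)) -
      (ins ?Y (Lam ?X \<omega>) + wd ?b (Lam ?X \<omega>) + (ins ?Y (Tht ?a \<omega>) + wd ?b (Tht ?a \<omega>))) =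
      (Lam ?X (ins ?Y \<omega>) - ins ?Y (Lam ?X \<omega>)) + (Lam ?X (wd ?b \<omega>) - wd ?b (Lam ?X \<omega>)) +
      ((Tht ?a (ins ?Y \<omega>) - ins ?Y (Tht ?a \<omega>)) + (Tht ?a (wd ?b \<omega>) - wd ?b (Tht ?a \<omega>)))"
    by (simp add: algebra_simps)
  also have "\<dots> = sec_op (dz x y) \<omega>"
    using x y w
    by (simp add: Lam_ins Lam_wd Tht_ins Tht_wd sec_op_eq vp_dz cp_dz wd_scale_left wd_diff_left wd_add_left scaleR_diff_right scaleR_add_right)
  finally show ?thesis .
qed

text \<open>Agreement is required on forms only, because the commutators are known only there.
  Iterated operators are compared through this relation instead of equality.\<close>

definition is_mult :: "'a form_op \<Rightarrow> ('a \<Rightarrow> real) \<Rightarrow> bool"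
  where "is_mult \<phi> g \<longleftrightarrow> (\<forall>\<omega>\<in>\<Omega>. \<phi> \<omega> = fun_op g \<omega>)"

text \<open>\<open>Lam\<close> obeys the Leibniz rule and \<open>Tht\<close> is linear over
  functions, so commuting with multiplication by \<open>g\<close> leaves multiplication by a
  derivative of \<open>g\<close>.\<close>

lemma L_op_mult:
  assumes x: "x \<in> TS" "PF (vp x) = vp x" and \<psi>: "\<And>\<omega>. \<omega> \<in> \<Omega> \<Longrightarrow> \<psi> \<omega> = sec_op x \<omega>"
    and \<phi>: "is_mult \<phi> g" and g: "g \<in> C"
  shows "is_mult (L_op A (d_split A E) \<psi> \<phi>) (\<lambda>p. vp x p g)"
  unfolding is_mult_def
proof
  fix \<omega> assume w: "\<omega> \<in> \<Omega>"
  let ?D = "op_comm A \<psi> (d_split A E)"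
  have p: "\<phi> \<omega> = fun_op g \<omega>" if "\<omega> \<in> \<Omega>" for \<omega> using \<phi> that by (simp add: is_mult_def)
  have o: "oper 1 \<phi>" by (rule oper_cong[OF oper_fun_op[OF g]]) (rule p)
  have "L_op A (d_split A E) \<psi> \<phi> \<omega> = ?D (\<phi> \<omega>) - \<phi> (?D \<omega>)"
    unfolding L_op_def by (rule op_comm_even[OF oper_comm_delta[OF x \<psi>] o _ w]) simp_all
  also have "\<dots> = ?D (fun_op g \<omega>) - fun_op g (?D \<omega>)"
    using w by (simp only: p oper_form[OF oper_comm_delta[OF x \<psi>]])
  also have "\<dots> = Lam (vp x) (fun_op g \<omega>) + Tht (cp x) (fun_op g \<omega>) - fun_op g (Lam (vp x) \<omega> + Tht (cp x) \<omega>)"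
    using w g by (simp only: comm_delta[OF x \<psi>] forms_fun_op)
  also have "\<dots> = fun_op (\<lambda>p. vp x p g) \<omega>"
    using w g x by (simp add: Lam_fun Tht_fun)
  finally show "L_op A (d_split A E) \<psi> \<phi> \<omega> = fun_op (\<lambda>p. vp x p g) \<omega>" .
qed

lemma hom_comp_mult:
  assumes "is_mult \<phi> g"
  shows "is_mult (hom_comp deg_part N j \<phi>) (if j = 0 then g else (\<lambda>_. 0))"
  unfolding is_mult_def
proof
  fix \<omega> assume w: "\<omega> \<in> \<Omega>"
  have "hom_comp deg_part N j \<phi> \<omega> = (\<Sum>i = - int N..int N. deg_part (i + j) (fun_op g (deg_part i \<omega>)))"
    unfolding hom_comp_def using assms w by (simp add: is_mult_def)
  also have "\<dots> = (\<Sum>i = - int N..int N. if j = 0 then fun_op g (deg_part i \<omega>) else 0)"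
    by (rule sum.cong) (auto simp: fun_eq_iff deg_part_apply fapply fun_op_apply)
  also have "\<dots> = fun_op (if j = 0 then g else (\<lambda>_. 0)) \<omega>"
  proof (cases "j = 0")
    case True
    have "(\<Sum>i = - int N..int N. fun_op g (deg_part i \<omega>)) = fun_op g (\<Sum>i = - int N..int N. deg_part i \<omega>)"
      by (simp add: fun_eq_iff sum_apply fun_op_apply sum_distrib_left)
    then show ?thesis using True sum_deg_part[OF w] by simp
  next
    case False
    then show ?thesis by (simp add: fun_eq_iff fun_op_apply fapply)
  qed
  finally show "hom_comp deg_part N j \<phi> \<omega> = fun_op (if j = 0 then g else (\<lambda>_. 0)) \<omega>" .
qed

text \<open>Multiplication by a function is homogeneous of degree 0, and \<open>S\<close> maps such
  operators to such operators, so only the component of degree 0 of \<open>S\<close> is visible on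
  them. The condition \<open>a0\<close> takes care of the vanishing components of
  \<open>\<phi>\<close>.\<close>

lemma hom_comp_der:
  assumes S: "\<And>\<phi> g. is_mult \<phi> g \<Longrightarrow> g \<in> C \<Longrightarrow> is_mult (S \<phi>) (a g)" and a0: "a (\<lambda>_. 0) = (\<lambda>_. 0)"
    and \<phi>: "is_mult \<phi> g" and g: "g \<in> C"
  shows "is_mult (hom_comp (hom_comp deg_part N) N k S \<phi>) (if k = 0 then a g else (\<lambda>_. 0))"
  unfolding is_mult_def
proof
  fix \<omega> assume w: "\<omega> \<in> \<Omega>"
  have "hom_comp deg_part N (j + k) (S (hom_comp deg_part N j \<phi>)) \<omega> = (if j = 0 then (if k = 0 then fun_op (a g) \<omega> else 0) else 0)" for j
  proof -
    let ?h = "if j = 0 then g else (\<lambda>_. 0)"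
    have "is_mult (S (hom_comp deg_part N j \<phi>)) (a ?h)"
      by (rule S[OF hom_comp_mult[OF \<phi>]]) (use g in simp)
    from hom_comp_mult[OF this, of "j + k"] w
    have "hom_comp deg_part N (j + k) (S (hom_comp deg_part N j \<phi>)) \<omega> = fun_op (if j + k = 0 then a ?h else (\<lambda>_. 0)) \<omega>"
      by (simp add: is_mult_def)
    then show ?thesis using a0 by (auto simp: fun_eq_iff fun_op_apply fapply)
  qed
  then have "hom_comp (hom_comp deg_part N) N k S \<phi> \<omega> = (\<Sum>j = - int N..int N. if j = 0 then (if k = 0 then fun_op (a g) \<omega> else 0) else 0)"
    unfolding hom_comp_def[of "hom_comp deg_part N"] sum_apply[of _ _ \<omega>] by (rule sum.cong[OF refl])
  also have "\<dots> = (if k = 0 then fun_op (a g) \<omega> else 0)" by simp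
  also have "\<dots> = fun_op (if k = 0 then a g else (\<lambda>_. 0)) \<omega>" by (simp add: fun_eq_iff fun_op_apply fapply)
  finally show "hom_comp (hom_comp deg_part N) N k S \<phi> \<omega> = fun_op (if k = 0 then a g else (\<lambda>_. 0)) \<omega>" .
qed

text \<open>All terms except k = l = 0 drop out, and there the sign is 1. On multiplication
  operators the graded commutator of derivations is thus the ordinary commutator.\<close>

lemma der_comm_mult:
  assumes S: "\<And>\<phi> g. is_mult \<phi> g \<Longrightarrow> g \<in> C \<Longrightarrow> is_mult (S \<phi>) (a g)" and a0: "a (\<lambda>_. 0) = (\<lambda>_. 0)" and aC: "\<And>g. g \<in> C \<Longrightarrow> a g \<in> C"
    and R: "\<And>\<phi> g. is_mult \<phi> g \<Longrightarrow> g \<in> C \<Longrightarrow> is_mult (R \<phi>) (b g)" and b0: "b (\<lambda>_. 0) = (\<lambda>_. 0)" and bC: "\<And>g. g \<in> C \<Longrightarrow> b g \<in> C"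
    and \<phi>: "is_mult \<phi> g" and g: "g \<in> C" and w: "\<omega> \<in> \<Omega>"
  shows "der_comm A S R \<phi> \<omega> = fun_op (a (b g)) \<omega> - fun_op (b (a g)) \<omega>"
proof -
  let ?H = "\<lambda>k S. hom_comp (hom_comp deg_part N) N k S"
  let ?I = "{- 2 * int N..2 * int N}"
  have z: "fun_op (\<lambda>_. 0) \<omega> = 0" by (simp add: fun_eq_iff fun_op_apply fapply)
  have FG: "?H k S (?H l R \<phi>) \<omega> = (if k = 0 then if l = 0 then fun_op (a (b g)) \<omega> else 0 else 0)" for k l
  proof -
    have "is_mult (?H k S (?H l R \<phi>)) (if k = 0 then a (if l = 0 then b g else (\<lambda>_. 0)) else (\<lambda>_. 0))"
    proof (rule hom_comp_der[where S = S and a = a, OF S a0])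
      show "is_mult (?H l R \<phi>) (if l = 0 then b g else (\<lambda>_. 0))"
        by (rule hom_comp_der[where S = R and a = b, OF R b0 \<phi> g])
    qed (use bC g in simp_all)
    then show ?thesis using w a0 z by (auto simp: is_mult_def)
  qed
  have GF: "?H l R (?H k S \<phi>) \<omega> = (if k = 0 then if l = 0 then fun_op (b (a g)) \<omega> else 0 else 0)" for k l
  proof -
    have "is_mult (?H l R (?H k S \<phi>)) (if l = 0 then b (if k = 0 then a g else (\<lambda>_. 0)) else (\<lambda>_. 0))"
    proof (rule hom_comp_der[where S = R and a = b, OF R b0])
      show "is_mult (?H k S \<phi>) (if k = 0 then a g else (\<lambda>_. 0))"
        by (rule hom_comp_der[where S = S and a = a, OF S a0 \<phi> g])
    qed (use aC g in simp_all)
    then show ?thesis using w b0 z by (auto simp: is_mult_def)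
  qed
  have "der_comm A S R \<phi> \<omega> = (\<Sum>k\<in>?I. \<Sum>l\<in>?I. ?H k S (?H l R \<phi>) \<omega> - ((-1) powi (k * l)) *\<^sub>R ?H l R (?H k S \<phi>) \<omega>)"
    unfolding der_comm_def graded_comm_def sum_apply[of _ _ \<omega>]
    by (intro sum.cong refl) (simp only: minus_apply scaleR_fun_apply)
  also have "\<dots> = (\<Sum>k\<in>?I. \<Sum>l\<in>?I. if k = 0 then if l = 0 then fun_op (a (b g)) \<omega> - fun_op (b (a g)) \<omega> else 0 else 0)"
    unfolding FG GF by (intro sum.cong refl) simp
  also have "\<dots> = (\<Sum>k\<in>?I. if k = 0 then fun_op (a (b g)) \<omega> - fun_op (b (a g)) \<omega> else 0)"
    by (intro sum.cong refl) simp
  also have "\<dots> = fun_op (a (b g)) \<omega> - fun_op (b (a g)) \<omega>" by simp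
  finally show ?thesis .
qed

lemma leibnizator_value:
  assumes x: "x \<in> TS" "PF (vp x) = vp x" and y: "y \<in> TS" "PF (vp y) = vp y" and f: "f \<in> C" and w: "\<omega> \<in> \<Omega>"
  shows "leibnizator A (d_split A E) (sec_op x) (sec_op y) (fun_op f) \<omega> =
    fun_op (\<lambda>p. lie (vp x) (vp y) p f - Pm p (lie (vp x) (vp y) p) f) \<omega>"
proof -
  let ?L = "L_op A (d_split A E)"
  have m: "is_mult (fun_op f) f" by (simp add: is_mult_def)
  have 1: "der_comm A (?L (sec_op x)) (?L (sec_op y)) (fun_op f) \<omega> =
      fun_op (\<lambda>p. vp x p (\<lambda>q. vp y q f)) \<omega> - fun_op (\<lambda>p. vp y p (\<lambda>q. vp x q f)) \<omega>"
  proof (rule der_comm_mult[where a = "\<lambda>g p. vp x p g" and b = "\<lambda>g p. vp y p g"])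
    show "is_mult (?L (sec_op x) \<phi>) (\<lambda>p. vp x p g)" if "is_mult \<phi> g" "g \<in> C" for \<phi> g
      by (rule L_op_mult[OF x refl that])
    show "is_mult (?L (sec_op y) \<phi>) (\<lambda>p. vp y p g)" if "is_mult \<phi> g" "g \<in> C" for \<phi> g
      by (rule L_op_mult[OF y refl that])
    show "(\<lambda>p. vp x p (\<lambda>_. 0)) = (\<lambda>_. 0)" "(\<lambda>p. vp y p (\<lambda>_. 0)) = (\<lambda>_. 0)"
      using T_const[OF VF_T[OF TS_vp[OF x(1)]]] T_const[OF VF_T[OF TS_vp[OF y(1)]]] by auto
    show "(\<lambda>p. vp x p g) \<in> C" "(\<lambda>p. vp y p g) \<in> C" if "g \<in> C" for g using x y that by simp_all
  qed (rule m f w)+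
  have dzP: "PF (vp (dz x y)) = vp (dz x y)" by (simp add: vp_dz)
  have "is_mult (?L (op_comm A (op_comm A (sec_op x) (d_split A E)) (sec_op y)) (fun_op f)) (\<lambda>p. vp (dz x y) p f)"
    by (rule L_op_mult[OF dz_TS[OF x(1) y(1)] dzP comm_comm_delta[OF x y] m f])
  then have 2: "?L (op_comm A (op_comm A (sec_op x) (d_split A E)) (sec_op y)) (fun_op f) \<omega> = fun_op (\<lambda>p. vp (dz x y) p f) \<omega>"
    using w by (simp add: is_mult_def)
  have "leibnizator A (d_split A E) (sec_op x) (sec_op y) (fun_op f) \<omega> =
      der_comm A (?L (sec_op x)) (?L (sec_op y)) (fun_op f) \<omega> - ?L (op_comm A (op_comm A (sec_op x) (d_split A E)) (sec_op y)) (fun_op f) \<omega>"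
    by (simp add: leibnizator_def fapply)
  also have "\<dots> = fun_op (\<lambda>p. lie (vp x) (vp y) p f - Pm p (lie (vp x) (vp y) p) f) \<omega>"
    unfolding 1 2 using f by (simp add: fun_eq_iff fapply fun_op_apply vp_dz PF_def lie_apply algebra_simps)
  finally show ?thesis .
qed

end

section \<open>Involutivity\<close>

context gap
begin

abbreviation "\<Gamma> \<equiv> sections A E"

lemma sections_TS [simp]: "x \<in> \<Gamma> \<Longrightarrow> x \<in> TS" and sections_E [simp]: "x \<in> \<Gamma> \<Longrightarrow> x p \<in> E p"
  by (simp_all add: sections_def)

lemma sectionsI: "x \<in> TS \<Longrightarrow> (\<And>p. x p \<in> E p) \<Longrightarrow> x \<in> \<Gamma>"
  unfolding sections_def by blast

lemma sections_F [simp]: "x \<in> \<Gamma> \<Longrightarrow> vp x p \<in> F p"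
  unfolding vp_def by (rule imageI) simp

lemma sections_PF [simp]: "x \<in> \<Gamma> \<Longrightarrow> PF (vp x) = vp x"
  unfolding PF_def using Pm_id[OF sections_F] by blast

lemma proj_sections [simp]: "z \<in> TS \<Longrightarrow> proj A E z \<in> \<Gamma>"
proof (rule sectionsI)
  show "proj A E z p \<in> E p" if "z \<in> TS" for p unfolding proj_E by (rule pr_E[OF TS_TT[OF that]])
qed simp

lemma sections_extend:
  assumes u: "u \<in> E p"
  obtains s where "s \<in> \<Gamma>" "s p = u"
proof -
  have "u \<in> TT p" using u E_TT by blast
  from ts_ext[OF this] obtain x where x: "x \<in> TS" "x p = u" by blast
  have "proj A E x p = u" using x u by (simp add: proj_E pr_id)
  with x(1) show thesis using that[of "proj A E x"] by simp
qed

text \<open>Projecting \<open>(X, 0)\<close> onto E keeps the vector part, because \<open>Pm\<close>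
  fixes the vectors of F.\<close>

lemma lift_field:
  assumes X: "X \<in> VF" and F: "\<And>p. X p \<in> F p"
  obtains x where "x \<in> \<Gamma>" "vp x = X"
proof -
  let ?z = "\<lambda>p. (X p, 0 :: 'a covec)"
  have z: "?z \<in> TS" by (rule TS_I[OF X CF_0])
  have "vp ?z = X" by (simp add: vp_def)
  then have "vp (proj A E ?z) = X" using vp_proj[OF z] F by (simp add: PF_def Pm_id)
  then show thesis using that[of "proj A E ?z"] z by simp
qed

section \<open>The image of the anchor as a subbundle\<close>

lemma F_basis: "\<exists>B. finite B \<and> independent B \<and> card B = rk \<and> B \<subseteq> F p \<and> span B = F p"
proof -
  obtain S where S: "finite S" "independent S" "card S = 2 * rk" "span S = E p" using E_basis by blast
  obtain B where B: "B \<subseteq> F p" "independent B" "F p \<subseteq> span B" "card B = dim (F p)" using basis_exists by blast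
  have "linear (fst :: 'a ttvec \<Rightarrow> 'a tvec)" by (rule linearI) simp_all
  then have "span (fst ` S) = F p" using linear_span_image[of fst S] S(4) by simp
  then have "finite B" using independent_span_bound[of "fst ` S" B] S(1) B by auto
  moreover have "span B = F p" using B(1,3) span_minimal[OF B(1) subspace_F] by blast
  ultimately show ?thesis using B rk(2) by auto
qed

lemma F_spanning:
  assumes "independent S" "S \<subseteq> F p" "card S = rk" "finite S"
  shows "span S = F p"
proof (rule ccontr)
  assume ne: "span S \<noteq> F p"
  have "span S \<subseteq> F p" by (rule span_minimal[OF assms(2) subspace_F])
  with ne obtain v where v: "v \<in> F p" "v \<notin> span S" by blast
  obtain B where B: "finite B" "card B = rk" "span B = F p" using F_basis[of p] by (elim exE conjE)
  have "independent (insert v S)" using v(2) assms(1) by (simp add: independent_insertI)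
  moreover have "insert v S \<subseteq> span B" using v(1) assms(2) B(3) by blast
  ultimately have "card (insert v S) \<le> rk" using independent_span_bound[OF B(1), of "insert v S"] B(2) by simp
  moreover have "v \<notin> S" using v(2) span_base by blast
  ultimately show False using assms(3,4) by simp
qed

lemma VF_tm_section: "X \<in> VF \<Longrightarrow> tm_section A U X"
  unfolding tm_section_def using VF_T VF_C C_iff sfo_mono[of UNIV _ U] by blast

text \<open>A basis at \<open>p\<close> is extended to fields, which are projected into F.
  Independence near \<open>p\<close> is tested by covector fields dual to the basis at
  \<open>p\<close>; spanning then follows from the constant rank.\<close>

lemma F_subbundle: "subbundle (tm_section A) rk F"
  unfolding subbundle_def
proof
  fix p
  obtain B where B: "finite B" "independent B" "card B = rk" "B \<subseteq> F p" "span B = F p" using F_basis[of p] by (elim exE conjE)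
  obtain f where f: "bij_betw f {..<rk} B" using ex_bij_betw_nat_finite[OF B(1)] unfolding B(3) atLeast0LessThan by (elim exE)
  have fF: "f i \<in> F p" if "i < rk" for i using bij_betwE[OF f] that B(4) by auto
  have fT: "f i \<in> T p" if "i < rk" for i using fF[OF that] by (rule F_T)
  have "\<exists>X. X \<in> VF \<and> (\<forall>q. X q \<in> F q) \<and> X p = f i" if "i < rk" for i
  proof -
    note i = that
    obtain Y where Y: "Y \<in> VF" "Y p = f i" by (rule vf_ext[OF fT[OF i]])
    have "PF Y p = f i" using Y(2) Pm_id[OF fF[OF i]] by (simp add: PF_def)
    moreover have "PF Y q \<in> F q" for q unfolding PF_def by (rule Pm_F) (use Y in simp)
    ultimately show ?thesis using PF_VF[OF Y(1)] by blast
  qed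
  then obtain X where X: "\<And>i. i < rk \<Longrightarrow> X i \<in> VF" "\<And>i q. i < rk \<Longrightarrow> X i q \<in> F q" "\<And>i. i < rk \<Longrightarrow> X i p = f i"
    by metis
  have "\<exists>\<beta>. \<beta> \<in> CF \<and> (\<forall>j<rk. \<beta> p (f j) = (if j = i then 1 else 0))" if i: "i < rk" for i
  proof -
    obtain g where g: "linear g" "\<And>v. v \<in> B \<Longrightarrow> g v = (if v = f i then 1 else 0 :: real)"
      using linear_independent_extend[OF B(2), of "\<lambda>v. if v = f i then 1 else 0"] by blast
    have "(\<lambda>v. if v \<in> T p then g v else 0) \<in> T' p"
      by (rule T'I) (simp_all add: linear_add[OF g(1)] linear_scale[OF g(1)])
    then obtain \<beta> where b: "\<beta> \<in> CF" "\<beta> p = (\<lambda>v. if v \<in> T p then g v else 0)" by (rule cf_ext)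
    have "\<beta> p (f j) = (if j = i then 1 else 0)" if "j < rk" for j
      using that i b(2) fT g(2) bij_betwE[OF f] bij_betw_imp_inj_on[OF f] by (auto simp: inj_on_eq_iff)
    with b(1) show ?thesis by blast
  qed
  then obtain \<beta> where b: "\<And>i. i < rk \<Longrightarrow> \<beta> i \<in> CF"
    "\<And>i j. i < rk \<Longrightarrow> j < rk \<Longrightarrow> \<beta> i p (f j) = (if j = i then 1 else 0)" by metis
  let ?M = "\<lambda>i j q. \<beta> i q (X j q)"
  have M: "(\<Sum>j<rk. ?M i j q * c j) = \<beta> i q (\<Sum>j<rk. c j *\<^sub>R X j q)" if "i < rk" for i q c
  proof -
    have "\<beta> i q (\<Sum>j<rk. c j *\<^sub>R X j q) = (\<Sum>j<rk. \<beta> i q (c j *\<^sub>R X j q))"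
      by (rule T'_sum[where p = q]) (use that X(1) b(1) in auto)
    also have "\<dots> = (\<Sum>j<rk. ?M i j q * c j)"
      by (intro sum.cong refl) (use that X(1) b(1) in \<open>simp add: T'_scale[where p = q]\<close>)
    finally show ?thesis by simp
  qed
  have "\<exists>D\<in>C. D p \<noteq> 0 \<and> (\<forall>b. (\<forall>i<rk. b i \<in> C) \<longrightarrow> (\<exists>g. (\<forall>i<rk. g i \<in> C) \<and>
    (\<forall>q c. (\<forall>i<rk. (\<Sum>j<rk. ?M i j q * c j) = b i q) \<longrightarrow> (\<forall>i<rk. D q * c i = g i q))))"
  proof (rule smooth_linear_solver)
    fix c j assume c: "\<And>i. i < rk \<Longrightarrow> (\<Sum>j<rk. ?M i j p * c j) = 0" and j: "j < rk"
    have "(\<Sum>k<rk. ?M j k p * c k) = (\<Sum>k<rk. if k = j then c k else 0)"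
      by (intro sum.cong) (use j b(2) X(3) in auto)
    then show "c j = 0" using c[OF j] j by simp
  qed (use X(1) b(1) in simp)
  then obtain D where D: "D \<in> C" "D p \<noteq> 0" "\<forall>b. (\<forall>i<rk. b i \<in> C) \<longrightarrow> (\<exists>g. (\<forall>i<rk. g i \<in> C) \<and>
    (\<forall>q c. (\<forall>i<rk. (\<Sum>j<rk. ?M i j q * c j) = b i q) \<longrightarrow> (\<forall>i<rk. D q * c i = g i q)))" by blast
  \<comment> \<open>The system is taken with right-hand side 0. Comparison with its zero solution
    shows that the resulting \<open>g\<close> vanishes.\<close>
  from D(3)[rule_format, of "\<lambda>_ _. 0"] obtain g
    where g: "\<And>q c i. (\<And>i. i < rk \<Longrightarrow> (\<Sum>j<rk. ?M i j q * c j) = 0) \<Longrightarrow> i < rk \<Longrightarrow> D q * c i = g i q" by auto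
  have g0: "g i q = 0" if "i < rk" for i q using g[of q "\<lambda>_. 0" i] that by simp
  obtain h W where W: "open W" "p \<in> W" "\<And>q. q \<in> W \<Longrightarrow> h q * D q = 1" by (rule inverse_extend[OF D(1,2)]) blast
  have "frame_on W rk X F"
    unfolding frame_on_def
  proof (intro ballI conjI)
    fix q assume q: "q \<in> W"
    have z: "c j = 0" if c: "(\<Sum>j<rk. c j *\<^sub>R X j q) = 0" and j: "j < rk" for c j
    proof -
      have "(\<Sum>j<rk. ?M i j q * c j) = 0" if i: "i < rk" for i
        unfolding M[OF i] c by (rule T'_0[where p = q]) (use i b(1) in simp)
      then have "D q * c j = 0" using g[of q c j] g0[OF j] j by simp
      moreover have "D q \<noteq> 0" using W(3)[OF q] by auto
      ultimately show ?thesis by simp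
    qed
    show i: "inj_on (\<lambda>i. X i q) {..<rk}" by (rule independent_familyI(1)) (rule z)
    show n: "independent ((\<lambda>i. X i q) ` {..<rk})" by (rule independent_familyI(2)) (rule z)
    show "span ((\<lambda>i. X i q) ` {..<rk}) = F q"
      by (rule F_spanning[OF n]) (use X(2) card_image[OF i] in auto)
  qed
  then show "\<exists>U e. open U \<and> p \<in> U \<and> (\<forall>i<rk. tm_section A U (e i)) \<and> frame_on U rk e F"
    using W(1,2) X(1) VF_tm_section by blast
qed

definition lie_closed :: bool
  where "lie_closed \<longleftrightarrow> (\<forall>x\<in>\<Gamma>. \<forall>y\<in>\<Gamma>. PF (lie (vp x) (vp y)) = lie (vp x) (vp y))"

lemma involutive_iff: "involutive_subbundle A F \<longleftrightarrow> lie_closed"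
proof
  assume i: "involutive_subbundle A F"
  show lie_closed
    unfolding lie_closed_def
  proof (intro ballI)
    fix x y assume xy: "x \<in> \<Gamma>" "y \<in> \<Gamma>"
    have "\<forall>p. lie (vp x) (vp y) p \<in> F p"
      using i xy sections_F[OF xy(1)] sections_F[OF xy(2)] TS_vp[OF sections_TS] unfolding involutive_subbundle_def by blast
    then show "PF (lie (vp x) (vp y)) = lie (vp x) (vp y)" by (simp add: PF_def Pm_id)
  qed
next
  assume l: lie_closed
  show "involutive_subbundle A F"
    unfolding involutive_subbundle_def
  proof (intro conjI ballI impI allI)
    show "\<exists>k. subbundle (tm_section A) k F" using F_subbundle by blast
    fix X Y p assume X: "X \<in> VF" and Y: "Y \<in> VF" and XY: "(\<forall>p. X p \<in> F p) \<and> (\<forall>p. Y p \<in> F p)"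
    obtain x where x: "x \<in> \<Gamma>" "vp x = X" using lift_field[OF X] XY by blast
    obtain y where y: "y \<in> \<Gamma>" "vp y = Y" using lift_field[OF Y] XY by blast
    have "lie X Y p = Pm p (lie X Y p)"
      using l x y unfolding lie_closed_def by (metis PF_def)
    moreover have "Pm p (lie X Y p) \<in> F p" by (rule Pm_F) (use X Y in simp)
    ultimately show "lie X Y p \<in> F p" by simp
  qed
qed

lemma leibnizator_iff:
  "(\<forall>x\<in>\<Gamma>. \<forall>y\<in>\<Gamma>. \<forall>f\<in>C. \<forall>\<omega>\<in>\<Omega>. leibnizator A (d_split A E) (sec_op x) (sec_op y) (fun_op f) \<omega> = 0) \<longleftrightarrow> lie_closed"
proof -
  let ?Z = "\<lambda>x y. lie (vp x) (vp y)"
  have val: "leibnizator A (d_split A E) (sec_op x) (sec_op y) (fun_op f) \<omega> = fun_op (\<lambda>p. ?Z x y p f - Pm p (?Z x y p) f) \<omega>"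
    if "x \<in> \<Gamma>" "y \<in> \<Gamma>" "f \<in> C" "\<omega> \<in> \<Omega>" for x y f \<omega>
    by (rule leibnizator_value) (use that in simp_all)
  show ?thesis
  proof
    assume *: "\<forall>x\<in>\<Gamma>. \<forall>y\<in>\<Gamma>. \<forall>f\<in>C. \<forall>\<omega>\<in>\<Omega>. leibnizator A (d_split A E) (sec_op x) (sec_op y) (fun_op f) \<omega> = 0"
    show lie_closed
      unfolding lie_closed_def PF_def
    proof (intro ballI ext)
      fix x y p assume xy: "x \<in> \<Gamma>" "y \<in> \<Gamma>"
      have "Pm p (?Z x y p) = ?Z x y p"
      proof (rule T_eqI[of _ p])
        fix f assume f: "f \<in> C"
        \<comment> \<open>The unit form, evaluated on the empty list, reads off the function by
          which the Leibnizator multiplies.\<close>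
        have "leibnizator A (d_split A E) (sec_op x) (sec_op y) (fun_op f) one_form0 = 0"
          using * xy f one_form0 by blast
        then have "fun_op (\<lambda>p. ?Z x y p f - Pm p (?Z x y p) f) one_form0 p [] = 0"
          using val[OF xy f one_form0] by (simp add: fapply)
        then show "Pm p (?Z x y p) f = ?Z x y p f" by (simp add: fun_op_apply one_form0_def)
      qed (use xy in simp_all)
      then show "Pm p (?Z x y p) f = ?Z x y p f" for f by simp
    qed
  next
    assume l: lie_closed
    show "\<forall>x\<in>\<Gamma>. \<forall>y\<in>\<Gamma>. \<forall>f\<in>C. \<forall>\<omega>\<in>\<Omega>. leibnizator A (d_split A E) (sec_op x) (sec_op y) (fun_op f) \<omega> = 0"
    proof (intro ballI)
      fix x y f \<omega> assume a: "x \<in> \<Gamma>" "y \<in> \<Gamma>" "f \<in> C" "\<omega> \<in> \<Omega>"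
      have "Pm p (?Z x y p) = ?Z x y p" for p
        using l a(1,2) unfolding lie_closed_def PF_def by (metis (no_types))
      then show "leibnizator A (d_split A E) (sec_op x) (sec_op y) (fun_op f) \<omega> = 0"
        unfolding val[OF a] by (simp add: fun_eq_iff fun_op_apply fapply)
    qed
  qed
qed

lemma TT_nondeg:
  assumes d: "d \<in> TT p" and z: "\<And>w. w \<in> TT p \<Longrightarrow> pairing d w = 0"
  shows "d = 0"
proof -
  have "fst d = 0"
  proof (rule T_eqI[of _ p])
    fix f assume f: "f \<in> C"
    show "fst d f = 0 f" using z[of "(0, dfun f p)"] d f by (auto simp: pairing_def dfun_T T'_0[where p = p] fapply)
  qed (use d in auto)
  moreover have "snd d = 0"
  proof (rule T'_eqI[of _ p])
    fix v assume v: "v \<in> T p"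
    show "snd d v = 0 v" using z[of "(v, 0)"] v by (simp add: pairing_def fapply)
  qed (use d in auto)
  ultimately show ?thesis by (simp add: prod_eq_iff)
qed

text \<open>The definition refers to the double complement, which contains E. The difference of two
  candidates is orthogonal to the E part and to the complementary part of every \<open>w\<close>, so
  it vanishes by non-degeneracy of the full pairing.\<close>

lemma proj_orth: "z \<in> TS \<Longrightarrow> proj A Eo z p = z p - pr p (z p)"
  unfolding proj_def
proof (rule the_equality)
  assume "z \<in> TS"
  then have zT: "z p \<in> TT p" by (rule TS_TT)
  have EE: "x \<in> orth A Eo p" if "x \<in> E p" for x
    unfolding orth_def[of A Eo] using that E_TT[of p] orth_iff[of _ p] by (auto simp: pairing_sym[of _ x])
  show *: "z p - pr p (z p) \<in> Eo p \<and> z p - (z p - pr p (z p)) \<in> orth A Eo p"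
    using EE[OF pr_E[OF zT]] pr_orth[OF zT] by simp
  fix x assume x: "x \<in> Eo p \<and> z p - x \<in> orth A Eo p"
  let ?d = "z p - pr p (z p) - x"
  have dE: "?d \<in> Eo p" using * x subspace_diff[OF subspace_orth] by blast
  have xT: "x \<in> TT p" using x orth_iff by blast
  have "pairing ?d w = 0" if w: "w \<in> TT p" for w
  proof -
    have dT: "?d \<in> TT p" by (rule conjunct1[OF iffD1[OF orth_iff dE]])
    have p: "pr p w \<in> TT p" "w - pr p w \<in> TT p" "pr p (z p) \<in> TT p"
      using pr_E[OF w] pr_orth[OF w] pr_E[OF zT] E_TT orth_iff by blast+
    have 1: "pairing (pr p w) ?d = 0" using conjunct2[OF iffD1[OF orth_iff dE]] pr_E[OF w] by blast
    have zx: "z p - x \<in> TT p" by (rule subspace_diff[OF subspace_TT zT xT])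
    have eq: "?d = (z p - x) - pr p (z p)" by simp
    have "pairing (w - pr p w) (z p - x) = 0"
      using x pr_orth[OF w] unfolding orth_def[of A Eo] by blast
    moreover have "pairing (pr p (z p)) (w - pr p w) = 0"
      by (rule bspec[OF conjunct2[OF iffD1[OF orth_iff pr_orth[OF w]]] pr_E[OF zT]])
    moreover have "pairing ?d (w - pr p w) = pairing (z p - x) (w - pr p w) - pairing (pr p (z p)) (w - pr p w)"
      unfolding eq by (rule pairing_diff[OF zx p(3) p(2)])
    ultimately have 2: "pairing (w - pr p w) ?d = 0" by (simp add: pairing_sym[of "w - pr p w"])
    have "pairing (pr p w + (w - pr p w)) ?d = 0" unfolding pairing_add[OF p(1,2) dT] using 1 2 by simp
    then show ?thesis by (simp add: pairing_sym[of _ ?d])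
  qed
  then have "?d = 0" by (rule TT_nondeg[OF conjunct1[OF iffD1[OF orth_iff dE]]])
  then show "x = z p - pr p (z p)" by simp
qed

text \<open>By \<open>fst_pr\<close> the vector part of the component in the complement is [X,Y] -
  P[X,Y].\<close>

lemma one_forms_iff: "(\<forall>x\<in>\<Gamma>. \<forall>y\<in>\<Gamma>. proj A Eo (dorfman A x y) \<in> one_forms A) \<longleftrightarrow> lie_closed"
proof -
  have "proj A Eo (dorfman A x y) \<in> one_forms A \<longleftrightarrow> PF (lie (vp x) (vp y)) = lie (vp x) (vp y)"
    if xy: "x \<in> \<Gamma>" "y \<in> \<Gamma>" for x y
  proof -
    let ?z = "dorf x y"
    have z: "?z \<in> TS" using xy by simp
    have d: "dorfman A x y = ?z" by (rule dorfman_dorf) (use xy in simp_all)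
    have e: "proj A Eo ?z = (\<lambda>p. ?z p - proj A E ?z p)" by (rule ext) (simp add: proj_orth[OF z] proj_E)
    have "fst (?z p - proj A E ?z p) = 0 \<longleftrightarrow> Pm p (lie (vp x) (vp y) p) = lie (vp x) (vp y) p" for p
      using fst_pr[OF TS_TT[OF z]] by (auto simp: proj_E dorf_def)
    moreover have "(\<lambda>p. ?z p - proj A E ?z p) \<in> TS" using z by simp
    ultimately show ?thesis unfolding d e one_forms_def PF_def fun_eq_iff[of _ "lie (vp x) (vp y)"] by simp
  qed
  then show ?thesis unfolding lie_closed_def by blast
qed

end

section \<open>The Courant algebroid\<close>

context smooth_mfd
begin

text \<open>Evaluated on a test field, the bracket involves only derivatives of functions and Lie
  brackets, so its identities become calculations for the simplifier.\<close>

lemma dorf_apply: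
  assumes x: "x \<in> TS" and y: "y \<in> TS" and W: "W \<in> VF"
  shows "cp (dorf x y) p (W p) = vp x p (\<lambda>q. cp y q (W q)) - cp y p (lie (vp x) W p) -
    (vp y p (\<lambda>q. cp x q (W q)) - W p (\<lambda>q. cp x q (vp y q)) - cp x p (lie (vp y) W p))"
  using assms by (simp add: cp_dorf fapply LieC_apply dC_apply)

lemma vp_simps [simp]: "vp (\<lambda>p. x p + y p) = (\<lambda>p. vp x p + vp y p)" "vp (\<lambda>p. x p - y p) = (\<lambda>p. vp x p - vp y p)"
    "vp (\<lambda>p. f p *\<^sub>R x p) = (\<lambda>p. f p *\<^sub>R vp x p)"
  and cp_simps [simp]: "cp (\<lambda>p. x p + y p) = (\<lambda>p. cp x p + cp y p)" "cp (\<lambda>p. x p - y p) = (\<lambda>p. cp x p - cp y p)"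
    "cp (\<lambda>p. f p *\<^sub>R x p) = (\<lambda>p. f p *\<^sub>R cp x p)"
  by (simp_all add: vp_def cp_def)

lemma vp_add: "x \<in> TS \<Longrightarrow> f \<in> C \<Longrightarrow> g \<in> C \<Longrightarrow> vp x p (\<lambda>q. f q + g q) = vp x p f + vp x p g"
  and vp_diff: "x \<in> TS \<Longrightarrow> f \<in> C \<Longrightarrow> g \<in> C \<Longrightarrow> vp x p (\<lambda>q. f q - g q) = vp x p f - vp x p g"
  and vp_cmult: "x \<in> TS \<Longrightarrow> f \<in> C \<Longrightarrow> vp x p (\<lambda>q. c * f q) = c * vp x p f"
  and vp_mult: "x \<in> TS \<Longrightarrow> f \<in> C \<Longrightarrow> g \<in> C \<Longrightarrow> vp x p (\<lambda>q. f q * g q) = f p * vp x p g + g p * vp x p f"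
  and vp_const: "x \<in> TS \<Longrightarrow> vp x p (\<lambda>q. c) = 0"
  by (rule T_add T_diff T_cmult T_mult T_const, rule VF_T, rule TS_vp, assumption+)+

lemma cp_add: "x \<in> TS \<Longrightarrow> v \<in> T p \<Longrightarrow> w \<in> T p \<Longrightarrow> cp x p (v + w) = cp x p v + cp x p w"
  and cp_diff: "x \<in> TS \<Longrightarrow> v \<in> T p \<Longrightarrow> w \<in> T p \<Longrightarrow> cp x p (v - w) = cp x p v - cp x p w"
  and cp_scale: "x \<in> TS \<Longrightarrow> v \<in> T p \<Longrightarrow> cp x p (c *\<^sub>R v) = c * cp x p v"
  by (rule T'_add T'_diff T'_scale, rule CF_T', rule TS_cp, assumption+)+

text \<open>The test fields are written as vector parts \<open>vp w\<close> of sections, so that the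
  rules for \<open>vp\<close> also apply to derivatives along them.\<close>

lemma section_eqI:
  assumes z: "z \<in> TS" "z' \<in> TS" "\<And>p. vp z p = vp z' p" "\<And>w p. w \<in> TS \<Longrightarrow> cp z p (vp w p) = cp z' p (vp w p)"
  shows "z = z'"
proof (rule TS_eqI)
  show "vp z = vp z'" using z(3) by (rule ext)
  show "cp z = cp z'"
  proof (rule CF_eqI)
    fix X p assume X: "X \<in> VF"
    show "cp z p (X p) = cp z' p (X p)"
      using z(4)[OF TS_I[OF X CF_0], of p] by (simp add: vp_def)
  qed (use z in simp_all)
qed

lemma dorf_add_right: "x \<in> TS \<Longrightarrow> y \<in> TS \<Longrightarrow> z \<in> TS \<Longrightarrow> dorf x (\<lambda>p. y p + z p) = (\<lambda>p. dorf x y p + dorf x z p)"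
  by (rule section_eqI) (simp_all add: dorf_apply lie_add_right lie_add_left fapply vp_add cp_add)

lemma dorf_add_left: "x \<in> TS \<Longrightarrow> y \<in> TS \<Longrightarrow> z \<in> TS \<Longrightarrow> dorf (\<lambda>p. y p + z p) x = (\<lambda>p. dorf y x p + dorf z x p)"
  by (rule section_eqI) (simp_all add: dorf_apply lie_add_right lie_add_left fapply vp_add cp_add)

lemma dorf_fmult_right:
  assumes x: "x \<in> TS" and y: "y \<in> TS" and f: "f \<in> C"
  shows "dorf x (\<lambda>p. f p *\<^sub>R y p) = (\<lambda>p. f p *\<^sub>R dorf x y p + vp x p f *\<^sub>R y p)"
  by (rule section_eqI)
    (use assms in \<open>simp_all add: dorf_apply lie_fmult_right lie_fmult_left fapply vp_mult cp_scale cp_diff algebra_simps\<close>)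

lemma dorf_scale_right: "x \<in> TS \<Longrightarrow> y \<in> TS \<Longrightarrow> dorf x (\<lambda>p. c *\<^sub>R y p) = (\<lambda>p. c *\<^sub>R dorf x y p)"
  using dorf_fmult_right[of x y "\<lambda>_. c"] by (simp add: vp_const)

lemma dorf_scale_left: "x \<in> TS \<Longrightarrow> y \<in> TS \<Longrightarrow> dorf (\<lambda>p. c *\<^sub>R y p) x = (\<lambda>p. c *\<^sub>R dorf y x p)"
  by (rule section_eqI) (simp_all add: dorf_apply lie_scale_left fapply vp_cmult cp_scale algebra_simps)

lemma dorf_jacobi:
  assumes x: "x \<in> TS" and y: "y \<in> TS" and z: "z \<in> TS"
  shows "dorf x (dorf y z) = (\<lambda>p. dorf (dorf x y) z p + dorf y (dorf x z) p)"
proof (rule section_eqI)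
  fix w p assume w: "w \<in> TS"
  \<comment> \<open>Orients the Jacobi identity of vector fields: brackets nested on the left become
    brackets nested on the right, and both sides reach a common form.\<close>
  have J: "lie (lie X Y) Z p = lie X (lie Y Z) p - lie Y (lie X Z) p" if "X \<in> VF" "Y \<in> VF" "Z \<in> VF" for X Y Z p
    using lie_jacobi[OF that] by simp
  show "cp (dorf x (dorf y z)) p (vp w p) = cp (\<lambda>p. dorf (dorf x y) z p + dorf y (dorf x z) p) p (vp w p)"
    using x y z w by (simp add: dorf_apply fapply J lie_apply vp_add vp_diff cp_diff)
next
  show "vp (dorf x (dorf y z)) p = vp (\<lambda>p. dorf (dorf x y) z p + dorf y (dorf x z) p) p" for p
    using lie_jacobi[of "vp x" "vp y" "vp z" p] x y z by simp
qed (use assms in simp_all)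

lemma dorf_metric:
  assumes x: "x \<in> TS" and y: "y \<in> TS" and z: "z \<in> TS"
  shows "vp x p (\<lambda>q. pairing (y q) (z q)) = pairing (dorf x y p) (z p) + pairing (y p) (dorf x z p)"
proof -
  have e: "pairing (u q) (w q) = 2 * (cp u q (vp w q) + cp w q (vp u q))" for u w :: "'a \<Rightarrow> 'a ttvec" and q
    by (simp add: pairing_def vp_def cp_def)
  have "vp x p (\<lambda>q. 2 * (cp y q (vp z q) + cp z q (vp y q))) =
      2 * (vp x p (\<lambda>q. cp y q (vp z q)) + vp x p (\<lambda>q. cp z q (vp y q)))"
    using x y z by (simp only: vp_cmult vp_add TS_vp TS_cp C_add CF_C)
  moreover have "cp x p (lie (vp z) (vp y) p) = - cp x p (lie (vp y) (vp z) p)"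
    unfolding lie_anti[of "vp z"] using x y z by (intro T'_neg[OF CF_T']) simp_all
  ultimately show ?thesis
    unfolding e using x y z by (simp add: dorf_apply)
qed

lemma dorf_self:
  assumes x: "x \<in> TS"
  shows "vp (dorf x x) p = 0" "cp (dorf x x) = dfun (\<lambda>q. cp x q (vp x q))"
proof -
  show "vp (dorf x x) p = 0" by (simp add: lie_def fun_eq_iff fapply)
  show "cp (dorf x x) = dfun (\<lambda>q. cp x q (vp x q))"
    by (rule CF_eqI) (use x in \<open>simp_all add: dorf_apply\<close>)
qed

end

context gap
begin

definition Br :: "('a \<Rightarrow> 'a ttvec) \<Rightarrow> ('a \<Rightarrow> 'a ttvec) \<Rightarrow> 'a \<Rightarrow> 'a ttvec"
  where "Br x y = proj A E (dorf x y)"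

lemma dorfman_Br: "x \<in> \<Gamma> \<Longrightarrow> y \<in> \<Gamma> \<Longrightarrow> proj A E (dorfman A x y) = Br x y"
  unfolding Br_def by (subst dorfman_dorf) simp_all

lemma Br_sections [simp]: "x \<in> \<Gamma> \<Longrightarrow> y \<in> \<Gamma> \<Longrightarrow> Br x y \<in> \<Gamma>"
  unfolding Br_def by simp

lemma Br_pr: "Br x y p = pr p (dorf x y p)" by (simp add: Br_def proj_E)

lemma vp_Br: "x \<in> \<Gamma> \<Longrightarrow> y \<in> \<Gamma> \<Longrightarrow> vp (Br x y) = PF (lie (vp x) (vp y))"
  unfolding Br_def by (subst vp_proj) simp_all

lemma sections_lin:
  assumes "x \<in> \<Gamma>" "y \<in> \<Gamma>"
  shows "a *\<^sub>R x + b *\<^sub>R y \<in> \<Gamma>"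
proof -
  have e: "a *\<^sub>R x + b *\<^sub>R y = (\<lambda>p. a *\<^sub>R x p + b *\<^sub>R y p)" by (simp add: fun_eq_iff fapply)
  show ?thesis unfolding e
  proof (rule sectionsI)
    show "a *\<^sub>R x p + b *\<^sub>R y p \<in> E p" for p
      by (rule subspace_add[OF subspace_E subspace_scale[OF subspace_E] subspace_scale[OF subspace_E]]) (use assms in simp_all)
  qed (use assms in simp)
qed

lemma sections_fmult: "f \<in> C \<Longrightarrow> x \<in> \<Gamma> \<Longrightarrow> (\<lambda>p. f p *\<^sub>R x p) \<in> \<Gamma>"
  by (rule sectionsI) (simp_all add: subspace_scale[OF subspace_E])

lemma dorf_pr_lin:
  assumes "dorf u v = (\<lambda>p. a p *\<^sub>R w p + b p *\<^sub>R w' p)" "w \<in> TS" "w' \<in> TS"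
  shows "Br u v = (\<lambda>p. a p *\<^sub>R pr p (w p) + b p *\<^sub>R pr p (w' p))"
  by (rule ext) (simp only: Br_pr assms(1) pr_lin[OF TS_TT[OF assms(2)] TS_TT[OF assms(3)]])

lemma Br_lin:
  assumes x: "x \<in> \<Gamma>" and y: "y \<in> \<Gamma>" and z: "z \<in> \<Gamma>"
  shows "Br (a *\<^sub>R x + b *\<^sub>R y) z = a *\<^sub>R Br x z + b *\<^sub>R Br y z"
    and "Br z (a *\<^sub>R x + b *\<^sub>R y) = a *\<^sub>R Br z x + b *\<^sub>R Br z y"
proof -
  have e: "a *\<^sub>R x + b *\<^sub>R y = (\<lambda>p. a *\<^sub>R x p + b *\<^sub>R y p)" for x y :: "'a \<Rightarrow> 'a ttvec"
    by (simp add: fun_eq_iff fapply)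
  have 1: "dorf (\<lambda>p. a *\<^sub>R x p + b *\<^sub>R y p) z = (\<lambda>p. a *\<^sub>R dorf x z p + b *\<^sub>R dorf y z p)"
    using x y z by (simp add: dorf_add_left dorf_scale_left)
  have 2: "dorf z (\<lambda>p. a *\<^sub>R x p + b *\<^sub>R y p) = (\<lambda>p. a *\<^sub>R dorf z x p + b *\<^sub>R dorf z y p)"
    using x y z by (simp add: dorf_add_right dorf_scale_right)
  show "Br (a *\<^sub>R x + b *\<^sub>R y) z = a *\<^sub>R Br x z + b *\<^sub>R Br y z"
    unfolding e by (subst dorf_pr_lin[OF 1]) (use x y z in \<open>simp_all add: Br_pr\<close>)
  show "Br z (a *\<^sub>R x + b *\<^sub>R y) = a *\<^sub>R Br z x + b *\<^sub>R Br z y"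
    unfolding e by (subst dorf_pr_lin[OF 2]) (use x y z in \<open>simp_all add: Br_pr\<close>)
qed

lemma Br_fmult:
  assumes x: "x \<in> \<Gamma>" and y: "y \<in> \<Gamma>" and f: "f \<in> C"
  shows "Br x (\<lambda>p. f p *\<^sub>R y p) = (\<lambda>p. f p *\<^sub>R Br x y p + vp x p f *\<^sub>R y p)"
proof -
  have "pr p (y p) = y p" for p by (rule pr_id) (use y in simp)
  then show ?thesis
    using dorf_pr_lin[OF dorf_fmult_right[OF sections_TS[OF x] sections_TS[OF y] f]] x y by (simp add: Br_pr)
qed

text \<open>Projection onto E does not change pairings with elements of E, so the identity passes
  from the Dorfman bracket to the projected one.\<close>

lemma Br_metric:
  assumes x: "x \<in> \<Gamma>" and y: "y \<in> \<Gamma>" and z: "z \<in> \<Gamma>"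
  shows "vp x p (\<lambda>q. pairing (y q) (z q)) = pairing (Br x y p) (z p) + pairing (y p) (Br x z p)"
proof -
  have e: "pairing (Br x u p) (w p) = pairing (dorf x u p) (w p)" if "u \<in> \<Gamma>" "w \<in> \<Gamma>" for u w
    unfolding Br_pr by (rule pairing_pr[OF TS_TT sections_E]) (use x that in simp_all)
  have "pairing (y p) (Br x z p) = pairing (y p) (dorf x z p)"
    using e[OF z y] by (simp only: pairing_sym[of "y p"])
  then show ?thesis using dorf_metric[of x y z p] e[OF y z] x y z by simp
qed

text \<open>Uniqueness holds because every vector of \<open>E p\<close> is the value of a section
  and the pairing is non-degenerate on \<open>E p\<close>.\<close>

lemma courant_D_eqI:
  assumes z: "z \<in> \<Gamma>" "\<And>y p. y \<in> \<Gamma> \<Longrightarrow> pairing (z p) (y p) = fst (y p) f"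
  shows "courant_D \<Gamma> (\<lambda>_. pairing) (\<lambda>_. fst) f = z"
  unfolding courant_D_def
proof (rule the_equality)
  show "z \<in> \<Gamma> \<and> (\<forall>y\<in>\<Gamma>. \<forall>p. pairing (z p) (y p) = fst (y p) f)" using assms by blast
  fix w assume w: "w \<in> \<Gamma> \<and> (\<forall>y\<in>\<Gamma>. \<forall>p. pairing (w p) (y p) = fst (y p) f)"
  show "w = z"
  proof
    fix p
    show "w p = z p"
    proof (rule E_eqI)
      fix u assume "u \<in> E p"
      then obtain s where "s \<in> \<Gamma>" "s p = u" by (rule sections_extend)
      then show "pairing (w p) u = pairing (z p) u" using w z(2) by auto
    qed (use w z in simp_all)
  qed
qed

lemma Br_self:
  assumes x: "x \<in> \<Gamma>"
  shows "Br x x = (1 / 2) *\<^sub>R courant_D \<Gamma> (\<lambda>_. pairing) (\<lambda>_. fst) (\<lambda>q. pairing (x q) (x q))"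
proof -
  let ?f = "\<lambda>q. cp x q (vp x q)"
  have fC: "?f \<in> C" using x by simp
  have "courant_D \<Gamma> (\<lambda>_. pairing) (\<lambda>_. fst) (\<lambda>q. pairing (x q) (x q)) = (\<lambda>p. 2 *\<^sub>R Br x x p)"
  proof (rule courant_D_eqI)
    show "(\<lambda>p. 2 *\<^sub>R Br x x p) \<in> \<Gamma>" by (rule sections_fmult) (use x in simp_all)
    fix y p assume y: "y \<in> \<Gamma>"
    have d: "dorf x x p \<in> TT p" by (rule TS_TT) (use x in simp)
    have "pairing (2 *\<^sub>R Br x x p) (y p) = 2 * pairing (dorf x x p) (y p)"
      unfolding Br_pr using pairing_scale[OF subsetD[OF E_TT pr_E[OF d]] subsetD[OF E_TT sections_E[OF y]], of 2]
        pairing_pr[OF d sections_E[OF y]] by simp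
    \<comment> \<open>One factor 2 is the scaling of the bracket and one belongs to
      \<open>pairing\<close>. Since \<open>pairing (x q) (x q)\<close> is 4 times the value of the
      covector part of \<open>x\<close> on its vector part, the constants match the factor 1/2 of
      the axiom.\<close>
    also have "\<dots> = 4 * vp y p ?f"
      using dorf_self[OF sections_TS[OF x]] x y T'_0[OF CF_T', of "cp y" p]
      by (simp add: pairing_def fun_eq_iff[of "cp (dorf x x)"] cp_apply[symmetric] vp_apply[symmetric] del: vp_dorf)
    also have "\<dots> = vp y p (\<lambda>q. 4 * ?f q)"
      using T_cmult[OF VF_T[OF TS_vp[OF sections_TS[OF y]]] fC, of p 4] by simp
    also have "(\<lambda>q. 4 * ?f q) = (\<lambda>q. pairing (x q) (x q))" by (simp add: pairing_def vp_def cp_def)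
    finally show "pairing (2 *\<^sub>R Br x x p) (y p) = fst (y p) (\<lambda>q. pairing (x q) (x q))" by (simp add: vp_def)
  qed
  then show ?thesis by (simp add: fun_eq_iff fapply)
qed

text \<open>Under \<open>lie_closed\<close> the sections of \<open>T\<^sup>*M \<inter> E\<^sup>\<bottom>\<close> bracket \<open>E\<close> into \<open>E\<^sup>\<bottom>\<close>, which is why
  projecting the inner brackets does no harm in the Jacobi identity.\<close>

lemma orth_dorf:
  assumes l: lie_closed and z: "z \<in> \<Gamma>" and w: "w \<in> TS" "\<And>p. w p \<in> Eo p" "\<And>p. vp w p = 0"
  shows "pr p (dorf z w p) = 0" "pr p (dorf w z p) = 0"
proof -
  have zT: "z \<in> TS" using z by simp
  have w0: "vp w = (\<lambda>p. 0)" using w(3) by (rule ext)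
  have c: "cp w p v = 0" if "v \<in> F p" for v p
  proof -
    have "w p = (0, cp w p)" using w(3)[of p] by (simp add: vp_def cp_def prod_eq_iff)
    then have "(0, cp w p) \<in> Eo p" using w(2)[of p] by simp
    from conjunct2[OF iffD1[OF orth_covector this]] that show ?thesis by blast
  qed
  have lie0: "lie X (\<lambda>p. 0) = (\<lambda>p. 0)" "lie (\<lambda>p. 0) X = (\<lambda>p. 0)" if "X \<in> VF" for X
    using T_const[OF VF_T[OF that], of _ 0] by (simp_all add: lie_def fun_eq_iff fapply)
  have key: "cp (dorf z w) p v = 0 \<and> cp (dorf w z) p v = 0" if v: "v \<in> F p" for v
  proof -
    obtain u where u: "u \<in> E p" "v = fst u" using v by blast
    obtain s where s: "s \<in> \<Gamma>" "s p = u" using u(1) by (rule sections_extend)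
    have v': "v = vp s p" using s(2) u(2) by (simp add: vp_def)
    \<comment> \<open>Involutivity enters here: the bracket of two fields of F stays in F, where the
      covector part of \<open>w\<close> vanishes.\<close>
    have L: "cp w p (lie (vp z) (vp s) p) = 0"
    proof (rule c)
      have "lie (vp z) (vp s) p = Pm p (lie (vp z) (vp s) p)"
        using l z s(1) unfolding lie_closed_def by (metis PF_def)
      moreover have "Pm p (lie (vp z) (vp s) p) \<in> F p" by (rule Pm_F) (use z s in simp)
      ultimately show "lie (vp z) (vp s) p \<in> F p" by (simp only:)
    qed
    have s0: "(\<lambda>q. cp w q (vp s q)) = (\<lambda>q. 0)" and z0: "(\<lambda>q. cp w q (vp z q)) = (\<lambda>q. 0)"
      using c sections_F[OF s(1)] sections_F[OF z] by auto
    have sT: "vp s \<in> VF" using s(1) by simp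
    have k: "X p (\<lambda>q. 0) = 0" if "X \<in> VF" for X using T_const[OF VF_T[OF that]] by simp
    show ?thesis
      unfolding v' dorf_apply[OF zT w(1) sT] dorf_apply[OF w(1) zT sT] w0 s0 z0 L
      using lie0[OF sT] k[OF sT] k[OF TS_vp[OF zT]] T'_0[OF CF_T'[OF TS_cp[OF zT]]] by (simp add: fapply)
  qed
  have in_orth: "u p \<in> Eo p" if u: "vp u p = 0" "cp u p \<in> T' p" "\<And>v. v \<in> F p \<Longrightarrow> cp u p v = 0" for u
  proof -
    have e: "u p = (0, cp u p)" using u(1) by (simp add: vp_def cp_def prod_eq_iff)
    show ?thesis unfolding e orth_covector using u(2,3) by blast
  qed
  have "dorf z w p \<in> Eo p"
    by (rule in_orth) (use key zT w(1) in \<open>simp_all add: w0 lie0\<close>)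
  then show "pr p (dorf z w p) = 0" by (intro pr_eqI subspace_0[OF subspace_E]) simp
  have "dorf w z p \<in> Eo p"
    by (rule in_orth) (use key zT w(1) in \<open>simp_all add: w0 lie0\<close>)
  then show "pr p (dorf w z p) = 0" by (intro pr_eqI subspace_0[OF subspace_E]) simp
qed

lemma Br_jacobi:
  assumes l: lie_closed and x: "x \<in> \<Gamma>" and y: "y \<in> \<Gamma>" and z: "z \<in> \<Gamma>"
  shows "Br x (Br y z) = Br (Br x y) z + Br y (Br x z)"
proof -
  \<comment> \<open>The part of the bracket lost by projection. Under \<open>lie_closed\<close> it
    has no vector part, so \<open>orth_dorf\<close> removes it from either argument of an outer
    bracket.\<close>
  define R where "R x y = (\<lambda>p. dorf x y p - Br x y p)" for x y
  have R: "R x y \<in> TS" "\<And>p. R x y p \<in> Eo p" "\<And>p. vp (R x y) p = 0" "dorf x y = (\<lambda>p. Br x y p + R x y p)"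
    if "x \<in> \<Gamma>" "y \<in> \<Gamma>" for x y
  proof -
    show "R x y \<in> TS" unfolding R_def by (rule TS_diff) (use that in simp_all)
    show "R x y p \<in> Eo p" for p unfolding R_def Br_pr by (rule pr_orth[OF TS_TT]) (use that in simp)
    show "vp (R x y) p = 0" for p
      using l that vp_Br[OF that] unfolding lie_closed_def R_def by simp
    show "dorf x y = (\<lambda>p. Br x y p + R x y p)" by (simp add: R_def)
  qed
  have right: "pr p (dorf u (dorf v w) p) = Br u (Br v w) p" if "u \<in> \<Gamma>" "v \<in> \<Gamma>" "w \<in> \<Gamma>" for u v w p
  proof -
    have "dorf u (dorf v w) = (\<lambda>p. dorf u (Br v w) p + dorf u (R v w) p)"
      unfolding R(4)[OF that(2,3)] by (rule dorf_add_right) (use that R(1) in simp_all)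
    then have "pr p (dorf u (dorf v w) p) = pr p (dorf u (Br v w) p) + pr p (dorf u (R v w) p)"
      using pr_add[OF TS_TT[of "dorf u (Br v w)" p] TS_TT[of "dorf u (R v w)" p]] that R(1) by simp
    then show ?thesis using orth_dorf(1)[OF l that(1) R(1-3)[OF that(2,3)]] by (simp add: Br_pr)
  qed
  have left: "pr p (dorf (dorf u v) w p) = Br (Br u v) w p" if "u \<in> \<Gamma>" "v \<in> \<Gamma>" "w \<in> \<Gamma>" for u v w p
  proof -
    have "dorf (dorf u v) w = (\<lambda>p. dorf (Br u v) w p + dorf (R u v) w p)"
      unfolding R(4)[OF that(1,2)] by (rule dorf_add_left) (use that R(1) in simp_all)
    then have "pr p (dorf (dorf u v) w p) = pr p (dorf (Br u v) w p) + pr p (dorf (R u v) w p)"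
      using pr_add[OF TS_TT[of "dorf (Br u v) w" p] TS_TT[of "dorf (R u v) w" p]] that R(1) by simp
    then show ?thesis using orth_dorf(2)[OF l that(3) R(1-3)[OF that(1,2)]] by (simp add: Br_pr)
  qed
  show ?thesis
  proof
    fix p
    have "pr p (dorf x (dorf y z) p) = pr p (dorf (dorf x y) z p + dorf y (dorf x z) p)"
      using dorf_jacobi[of x y z] x y z by simp
    also have "\<dots> = pr p (dorf (dorf x y) z p) + pr p (dorf y (dorf x z) p)"
      by (rule pr_add[OF TS_TT TS_TT]) (use x y z in simp_all)
    finally show "Br x (Br y z) p = (Br (Br x y) z + Br y (Br x z)) p"
      unfolding right[OF x y z] left[OF x y z] right[OF y x z] by (simp only: plus_fun_apply)
  qed
qed

end

context gap
begin

section \<open>The vector bundle structure of E\<close>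

lemma ttm_section_subset:
  assumes "ttm_section A U x" "W \<subseteq> U"
  shows "ttm_section A W x"
proof -
  have m: "smooth_fun_on A W f" if "smooth_fun_on A U f" for f by (rule sfo_mono[OF that assms(2)])
  show ?thesis using assms(1) m subsetD[OF assms(2)] unfolding ttm_section_def tm_section_def by blast
qed

lemma TS_ttm_section: "x \<in> TS \<Longrightarrow> ttm_section A U x"
  by (rule ttm_section_subset[of UNIV]) (simp_all add: ttm_sections_def)

lemma local_coefficients:
  assumes U: "open U" "p \<in> U" and e: "\<And>i. i < 2 * rk \<Longrightarrow> ttm_section A U (e i)" "frame_on U (2 * rk) e E"
    and s: "ttm_section A U s" "\<And>q. q \<in> U \<Longrightarrow> s q \<in> E q"
  shows "\<exists>W d. open W \<and> p \<in> W \<and> W \<subseteq> U \<and> (\<forall>i<2 * rk. d i \<in> C) \<and> (\<forall>q\<in>W. s q = (\<Sum>i<2 * rk. d i q *\<^sub>R e i q))"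
proof -
  \<comment> \<open>The section is appended to the frame as entry \<open>2 * rk\<close>, so that a
    single extension provides both on a common neighbourhood.\<close>
  let ?x = "\<lambda>i. if i < 2 * rk then e i else s"
  have x: "ttm_section A U (?x i)" if "i < Suc (2 * rk)" for i using e(1) s(1) by simp
  obtain y W1 where y: "open W1" "p \<in> W1" "W1 \<subseteq> U" "\<And>i. i < Suc (2 * rk) \<Longrightarrow> y i \<in> TS" "\<And>i q. q \<in> W1 \<Longrightarrow> y i q = ?x i q"
    by (rule ttm_section_extend[OF U x]) blast+
  have fr: "frame_on W1 (2 * rk) y E"
    unfolding frame_on_def
  proof
    fix q assume q: "q \<in> W1"
    have "y i q = e i q" if "i \<in> {..<2 * rk}" for i using y(5)[OF q] that by simp
    then have "(\<lambda>i. y i q) ` {..<2 * rk} = (\<lambda>i. e i q) ` {..<2 * rk}"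
      "inj_on (\<lambda>i. y i q) {..<2 * rk} = inj_on (\<lambda>i. e i q) {..<2 * rk}"
      by (auto intro!: inj_on_cong)
    then show "inj_on (\<lambda>i. y i q) {..<2 * rk} \<and> independent ((\<lambda>i. y i q) ` {..<2 * rk}) \<and> span ((\<lambda>i. y i q) ` {..<2 * rk}) = E q"
      using e(2) y(3) q unfolding frame_on_def by auto
  qed
  obtain W3 where W3: "open W3" "p \<in> W3" "W3 \<subseteq> W1"
    "\<And>z. z \<in> TS \<Longrightarrow> \<exists>c. (\<forall>i<2 * rk. c i \<in> C) \<and> (\<forall>q\<in>W3. pr q (z q) = (\<Sum>i<2 * rk. c i q *\<^sub>R y i q))"
    by (rule frame_coefficients[OF y(1,2) y(4) fr]) auto
  obtain d where d: "\<forall>i<2 * rk. d i \<in> C" "\<forall>q\<in>W3. pr q (y (2 * rk) q) = (\<Sum>i<2 * rk. d i q *\<^sub>R y i q)"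
    using W3(4)[OF y(4)[of "2 * rk"]] by auto
  have "s q = (\<Sum>i<2 * rk. d i q *\<^sub>R e i q)" if q: "q \<in> W3" for q
  proof -
    have "pr q (s q) = s q" by (rule pr_id) (use s(2) y(3) W3(3) q in blast)
    moreover have "y (2 * rk) q = s q" using y(5) W3(3) q by auto
    moreover have "y i q = e i q" if "i < 2 * rk" for i using y(5) W3(3) q that by auto
    ultimately show ?thesis using d(2) q by auto
  qed
  then show ?thesis
    using y(3) W3(1-3) d(1) by (intro exI[of _ W3] exI[of _ d]) auto
qed

lemma smooth_coefficients:
  assumes U: "open U" and e: "\<And>i. i < 2 * rk \<Longrightarrow> ttm_section A U (e i)" "frame_on U (2 * rk) e E"
    and s: "ttm_section A U s" "\<And>q. q \<in> U \<Longrightarrow> s q \<in> E q"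
  shows "smooth_combination A U (2 * rk) e s"
proof -
  have loc: "\<exists>W d. open W \<and> p \<in> W \<and> W \<subseteq> U \<and> (\<forall>i<2 * rk. d i \<in> C) \<and> (\<forall>q\<in>W. s q = (\<Sum>i<2 * rk. d i q *\<^sub>R e i q))"
    if "p \<in> U" for p by (rule local_coefficients[OF U that e s])
  \<comment> \<open>A pointwise choice of coefficients. Uniqueness forces them to agree with the
    smooth local ones, so they are smooth.\<close>
  define c where "c i q = (SOME c. s q = (\<Sum>i<2 * rk. c i *\<^sub>R e i q)) i" for i q
  have c: "s q = (\<Sum>i<2 * rk. c i q *\<^sub>R e i q)" if q: "q \<in> U" for q
  proof -
    obtain d W where "q \<in> W" "\<forall>q\<in>W. s q = (\<Sum>i<2 * rk. d i q *\<^sub>R e i q)" using loc[OF q] by blast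
    then have "\<exists>c. s q = (\<Sum>i<2 * rk. c i *\<^sub>R e i q)" by (intro exI[of _ "\<lambda>i. d i q"]) simp
    from someI_ex[OF this] show ?thesis unfolding c_def .
  qed
  have uniq: "c i q = d i" if "q \<in> U" "s q = (\<Sum>i<2 * rk. d i *\<^sub>R e i q)" "i < 2 * rk" for i q d
  proof -
    have "(\<Sum>i<2 * rk. (c i q - d i) *\<^sub>R e i q) = 0"
      using c[OF that(1)] that(2) by (simp add: scaleR_diff_left sum_subtractf)
    then have "c i q - d i = 0"
      by (rule independent_family_coeff[rotated 2]) (use e(2) that in \<open>auto simp: frame_on_def\<close>)
    then show ?thesis by simp
  qed
  have "smooth_fun_on A U (c i)" if i: "i < 2 * rk" for i
  proof (rule sfoI[OF U])
    fix p assume "p \<in> U"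
    from loc[OF this] obtain W d where W: "open W" "p \<in> W" "W \<subseteq> U" "\<forall>i<2 * rk. d i \<in> C"
      "\<forall>q\<in>W. s q = (\<Sum>i<2 * rk. d i q *\<^sub>R e i q)" by blast
    have "\<forall>q\<in>W. c i q = d i q"
    proof
      fix q assume q: "q \<in> W"
      show "c i q = d i q" by (rule uniq[of q "\<lambda>i. d i q", OF subsetD[OF W(3) q] _ i]) (use W(5) q in blast)
    qed
    with W i show "\<exists>W g. open W \<and> p \<in> W \<and> g \<in> C \<and> (\<forall>q\<in>W. c i q = g q)" by blast
  qed
  with c show ?thesis unfolding smooth_combination_def by blast
qed

lemma combination_section:
  assumes U: "open U" "p \<in> U" and e: "\<And>i. i < 2 * rk \<Longrightarrow> ttm_section A U (e i)"
    and s: "smooth_combination A U (2 * rk) e s"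
  shows "\<exists>W y. open W \<and> p \<in> W \<and> y \<in> TS \<and> (\<forall>q\<in>W. s q = y q)"
proof -
  obtain c where c: "\<And>i. i < 2 * rk \<Longrightarrow> smooth_fun_on A U (c i)" "\<And>q. q \<in> U \<Longrightarrow> s q = (\<Sum>i<2 * rk. c i q *\<^sub>R e i q)"
    using s unfolding smooth_combination_def by blast
  obtain y W1 where y: "open W1" "p \<in> W1" "W1 \<subseteq> U" "\<And>i. i < 2 * rk \<Longrightarrow> y i \<in> TS" "\<And>i q. q \<in> W1 \<Longrightarrow> y i q = e i q"
    by (rule ttm_section_extend[OF U e]) blast+
  obtain ch W K where b: "ch \<in> C" "open W" "p \<in> W" "W \<subseteq> U" "\<And>q. q \<in> W \<Longrightarrow> ch q = 1"
    "closed K" "K \<subseteq> U" "\<And>q. q \<notin> K \<Longrightarrow> ch q = 0" by (rule bump[OF U]) blast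
  have "(\<lambda>q. ch q * c i q) \<in> C" if "i < 2 * rk" for i
    by (rule cutoff_smooth[OF b(1) U(1) b(6-8) c(1)[OF that]])
  then have "(\<lambda>q. \<Sum>i<2 * rk. (ch q * c i q) *\<^sub>R y i q) \<in> TS"
    by (intro TS_sum TS_fmult) (use y(4) in simp_all)
  moreover have "\<forall>q\<in>W \<inter> W1. s q = (\<Sum>i<2 * rk. (ch q * c i q) *\<^sub>R y i q)"
    using b(4,5) c(2) y(5) by auto
  moreover have "open (W \<inter> W1)" "p \<in> W \<inter> W1" using b y by auto
  ultimately show ?thesis by blast
qed

text \<open>The distinguished frames are all local smooth frames of E. Both the transition functions
  and the coefficients of sections are smooth by \<open>smooth_coefficients\<close>; conversely
  \<open>combination_section\<close> shows that smooth coefficients give a smooth section.\<close>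

lemma E_vector_bundle: "vector_bundle A E \<Gamma>"
proof -
  let ?k = "2 * rk"
  let ?\<F> = "{(U, e). open U \<and> (\<forall>i<?k. ttm_section A U (e i)) \<and> frame_on U ?k e E}"
  have fE: "f i q \<in> E q" if "frame_on V ?k f E" "q \<in> V" "i < ?k" for f V i q
    using that span_base[of "f i q" "(\<lambda>i. f i q) ` {..<?k}"] unfolding frame_on_def by auto
  have sub: "frame_on (U \<inter> V) ?k e E" if "frame_on U ?k e E" for U V e
    using that unfolding frame_on_def by blast
  have cover: "\<exists>U e. (U, e) \<in> ?\<F> \<and> p \<in> U" for p
    using E_subbundle unfolding subbundle_def by blast
  have trans: "smooth_combination A (U \<inter> V) ?k e (f i)" if "(U, e) \<in> ?\<F>" "(V, f) \<in> ?\<F>" "i < ?k" for U e V f i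
  proof (rule smooth_coefficients)
    show "ttm_section A (U \<inter> V) (e j)" if "j < ?k" for j
      by (rule ttm_section_subset[of U]) (use that \<open>(U, e) \<in> ?\<F>\<close> in auto)
    show "ttm_section A (U \<inter> V) (f i)"
      by (rule ttm_section_subset[of V]) (use that in auto)
    show "f i q \<in> E q" if "q \<in> U \<inter> V" for q
      by (rule fE[of V]) (use that \<open>(V, f) \<in> ?\<F>\<close> \<open>i < ?k\<close> in auto)
  qed (use that sub in auto)
  have sec: "s \<in> \<Gamma> \<longleftrightarrow> (\<forall>p. s p \<in> E p) \<and> (\<forall>(U, e)\<in>?\<F>. smooth_combination A U ?k e s)" for s
  proof
    assume s: "s \<in> \<Gamma>"
    have "smooth_combination A U ?k e s" if "(U, e) \<in> ?\<F>" for U e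
      by (rule smooth_coefficients) (use that TS_ttm_section[OF sections_TS[OF s]] s in auto)
    then show "(\<forall>p. s p \<in> E p) \<and> (\<forall>(U, e)\<in>?\<F>. smooth_combination A U ?k e s)" using s by auto
  next
    assume s: "(\<forall>p. s p \<in> E p) \<and> (\<forall>(U, e)\<in>?\<F>. smooth_combination A U ?k e s)"
    have "s \<in> TS"
    proof (rule TS_localI)
      fix p
      obtain U e where Ue: "(U, e) \<in> ?\<F>" "p \<in> U" using cover by blast
      show "\<exists>W y. open W \<and> p \<in> W \<and> y \<in> TS \<and> (\<forall>q\<in>W. s q = y q)"
        by (rule combination_section[of U p e]) (use Ue s in auto)
    qed
    with s show "s \<in> \<Gamma>" by (intro sectionsI) auto
  qed
  show ?thesis
    unfolding vector_bundle_def
  proof (intro exI[of _ ?k] exI[of _ ?\<F>] conjI)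
    show "(\<Union>(U, e)\<in>?\<F>. U) = UNIV" using cover by blast
    show "\<forall>(U, e)\<in>?\<F>. open U \<and> frame_on U ?k e E" by blast
    show "\<forall>(U, e)\<in>?\<F>. \<forall>(V, f)\<in>?\<F>. \<forall>i<?k. smooth_combination A (U \<inter> V) ?k e (f i)" using trans by blast
    show "\<Gamma> = {s. (\<forall>p. s p \<in> E p) \<and> (\<forall>(U, e)\<in>?\<F>. smooth_combination A U ?k e s)}" using sec by blast
  qed
qed

text \<open>The axiom on anchors is \<open>lie_closed\<close> itself, by \<open>vp_Br\<close>.
  Conversely, involutivity enters through this axiom and through the Jacobi identity, while the
  remaining algebraic rules are inherited from the Dorfman bracket by projection.\<close>

lemma courant_algebroid_iff:
  "courant_algebroid A E \<Gamma> (\<lambda>x y. proj A E (dorfman A x y)) (\<lambda>_. pairing) (\<lambda>_. fst) \<longleftrightarrow> lie_closed"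
  (is "?C \<longleftrightarrow> _")
proof
  assume C: ?C
  have anchor: "\<forall>x\<in>\<Gamma>. \<forall>y\<in>\<Gamma>. (\<lambda>p. fst (proj A E (dorfman A x y) p)) = lie (\<lambda>p. fst (x p)) (\<lambda>p. fst (y p))"
    using C unfolding courant_algebroid_def by (elim conjE)
  show lie_closed
    unfolding lie_closed_def
  proof (intro ballI)
    fix x y assume xy: "x \<in> \<Gamma>" "y \<in> \<Gamma>"
    have "vp (Br x y) = lie (vp x) (vp y)"
      using anchor[rule_format, OF xy] unfolding dorfman_Br[OF xy] vp_def .
    then show "PF (lie (vp x) (vp y)) = lie (vp x) (vp y)" using vp_Br[OF xy] by simp
  qed
next
  assume l: lie_closed
  let ?br = "\<lambda>x y. proj A E (dorfman A x y)"
  note Br = dorfman_Br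
  show ?C
    unfolding courant_algebroid_def
  proof (intro conjI allI ballI)
    show "vector_bundle A E \<Gamma>" by (rule E_vector_bundle)
    show "nondegenerate_on pairing (E p)" for p by (rule E_nondeg)
    show "pairing x y = pairing y x" for x y by (rule pairing_sym)
    show "pairing (a *\<^sub>R x + b *\<^sub>R y) z = a * pairing x z + b * pairing y z"
      if "x \<in> E p" "y \<in> E p" "z \<in> E p" for p x y z a b
      by (rule pairing_lin[OF subsetD[OF E_TT that(1)] subsetD[OF E_TT that(2)] subsetD[OF E_TT that(3)]])
    show "(\<lambda>p. pairing (x p) (y p)) \<in> C" if "x \<in> \<Gamma>" "y \<in> \<Gamma>" for x y
      by (rule pairing_C) (use that in simp_all)
    show "fst (a *\<^sub>R x + b *\<^sub>R y) = a *\<^sub>R fst x + b *\<^sub>R fst y" for a b and x y :: "'a ttvec" by simp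
    show "(\<lambda>p. fst (x p)) \<in> VF" if "x \<in> \<Gamma>" for x
      using TS_vp[OF sections_TS[OF that]] unfolding vp_def .
    show "?br x y \<in> \<Gamma>" if "x \<in> \<Gamma>" "y \<in> \<Gamma>" for x y
      unfolding Br[OF that] by (rule Br_sections[OF that])
    show "?br (a *\<^sub>R x + b *\<^sub>R y) z = a *\<^sub>R ?br x z + b *\<^sub>R ?br y z"
      if "x \<in> \<Gamma>" "y \<in> \<Gamma>" "z \<in> \<Gamma>" for x y z a b
      unfolding Br[OF that(1,3)] Br[OF that(2,3)] Br[OF sections_lin[OF that(1,2)] that(3)] by (rule Br_lin(1)[OF that])
    show "?br z (a *\<^sub>R x + b *\<^sub>R y) = a *\<^sub>R ?br z x + b *\<^sub>R ?br z y"
      if "x \<in> \<Gamma>" "y \<in> \<Gamma>" "z \<in> \<Gamma>" for x y z a b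
      unfolding Br[OF that(3,1)] Br[OF that(3,2)] Br[OF that(3) sections_lin[OF that(1,2)]] by (rule Br_lin(2)[OF that])
    show "?br x (?br y z) = ?br (?br x y) z + ?br y (?br x z)" if "x \<in> \<Gamma>" "y \<in> \<Gamma>" "z \<in> \<Gamma>" for x y z
      unfolding Br[OF that(2,3)] Br[OF that(1,2)] Br[OF that(1,3)] Br[OF that(1) Br_sections[OF that(2,3)]]
        Br[OF Br_sections[OF that(1,2)] that(3)] Br[OF that(2) Br_sections[OF that(1,3)]]
      by (rule Br_jacobi[OF l that])
    show "(\<lambda>p. fst (?br x y p)) = lie (\<lambda>p. fst (x p)) (\<lambda>p. fst (y p))" if "x \<in> \<Gamma>" "y \<in> \<Gamma>" for x y
    proof -
      have "vp (Br x y) = lie (vp x) (vp y)" using vp_Br[OF that] l that unfolding lie_closed_def by simp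
      then show ?thesis unfolding Br[OF that] vp_def .
    qed
    show "?br x (\<lambda>p. f p *\<^sub>R y p) = (\<lambda>p. f p *\<^sub>R ?br x y p + fst (x p) f *\<^sub>R y p)"
      if "x \<in> \<Gamma>" "y \<in> \<Gamma>" "f \<in> C" for x y f
      unfolding Br[OF that(1,2)] Br[OF that(1) sections_fmult[OF that(3,2)]] using Br_fmult[OF that] unfolding vp_def .
    show "fst (x p) (\<lambda>q. pairing (y q) (z q)) = pairing (?br x y p) (z p) + pairing (y p) (?br x z p)"
      if "x \<in> \<Gamma>" "y \<in> \<Gamma>" "z \<in> \<Gamma>" for x y z p
      unfolding Br[OF that(1,2)] Br[OF that(1,3)] using Br_metric[OF that] unfolding vp_def .
    show "?br x x = (1 / 2) *\<^sub>R courant_D \<Gamma> (\<lambda>_. pairing) (\<lambda>_. fst) (\<lambda>q. pairing (x q) (x q))" if "x \<in> \<Gamma>" for x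
      unfolding Br[OF that that] by (rule Br_self[OF that])
  qed
qed

end

theorem proposition41:
  fixes A :: "('a::{t2_space, second_countable_topology}, 'e::real_inner) atlas"
    and E :: "'a \<Rightarrow> 'a ttvec set"
  assumes "smooth_manifold A"
    and "connected (UNIV :: 'a set)"
    and "generalized_almost_product A E"
  shows
    "(involutive_subbundle A (\<lambda>p. fst ` E p) \<longleftrightarrow>
        (\<forall>x\<in>sections A E. \<forall>y\<in>sections A E. \<forall>f\<in>smooth_funs A. \<forall>\<omega>\<in>forms A.
           leibnizator A (d_split A E) (sec_op x) (sec_op y) (fun_op f) \<omega> = 0)) \<and>
     (involutive_subbundle A (\<lambda>p. fst ` E p) \<longleftrightarrow>
        (\<forall>x\<in>sections A E. \<forall>y\<in>sections A E.
           proj A (orth A E) (dorfman A x y) \<in> one_forms A)) \<and>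
     (involutive_subbundle A (\<lambda>p. fst ` E p) \<longleftrightarrow>
        courant_algebroid A E (sections A E) (\<lambda>x y. proj A E (dorfman A x y))
          (\<lambda>_. pairing) (\<lambda>_. fst))"
proof -
  interpret gap A E by unfold_locales (rule assms)+
  show ?thesis
    unfolding involutive_iff leibnizator_iff one_forms_iff courant_algebroid_iff by simp
qed

end
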